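(* Let $R$ be a ring, let $\mathcal{T}$ be a Fermat theory over $R$, and let $\mathcal{A}$ be a reduced cellular simplicial algebra over $\mathcal{T}$, with augmentation ideal $\overline{\mathcal{A}}$. Then (for every $r\ge1$) the $r$-th power $\overline{\mathcal{A}}^r$ is an $(r-1)$-connected simplicial abelian group.
   Context: **Fermat theories.** A Lawvere theory is a category with finite products whose objects are the finite powers of one generating object. For a commutative ring $R$, $\mathrm{Com}_R$ is the Lawvere theory of $R$-polynomial maps $\mathbb{A}^m_R\to\mathbb{A}^n_R$. A Fermat theory is a Lawvere theory $\mathcal{T}$ with a morphism $\iota:\mathrm{Com}_{\mathbb{Z}}\to\mathcal{T}$ such that for all objects $S,X$ and every $f:\iota(\mathbb{A}^1_{\mathbb{Z}})\times S\to X$ there is $g:\iota(\mathbb{A}^1_{\mathbb{Z}})\times\iota(\mathbb{A}^1_{\mathbb{Z}})\times S\to X$ with $f(l_1,s)-f(l_2,s)=(l_1-l_2)\cdot g(l_1,l_2,s)$ ($l_1,l_2$ images of the projections, ring operations images of those of $\mathrm{Com}_{\mathbb{Z}}$). It is over $R$ if $\iota$ factors through $\mathrm{Com}_{\mathbb{Z}}\to\mathrm{Com}_R$. A $\mathcal{T}$-algebra is a finite product preserving functor $\mathcal{T}\to\mathrm{Set}$; $T_0$ is the $\mathcal{T}$-algebra represented by the object indexed by $0$; $\mathbb{F}$ is the free functor from $R$-modules to $\mathcal{T}$-algebras, left adjoint to the forgetful functor. **Cellular simplicial algebras.** The category $\mathrm{s}\mathcal{T}\mathrm{Alg}$ of simplicial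 $\mathcal{T}$-algebras has a cofibrantly generated model structure with weak equivalences created by the forgetful functor to simplicial sets and generating cofibrations $\mathbb{F}(\overline{R}[\mathcal{S}^{k-1}])\hookrightarrow\mathbb{F}(\overline{R}[\mathcal{D}^k])$, where $\mathcal{S}^{k-1}=\Delta^{k-1}/\partial\Delta^{k-1}$, $\mathcal{D}^k=\Delta^k/\Lambda^k_0$, the inclusion is induced by the last face, $\overline{R}[-]$ is reduced simplicial chains and $\mathbb{F}$ is applied degreewise. A cellular object is one obtained as a transfinite composition of cobase changes of generating cofibrations. **Augmentation.** A cellular $\mathcal{A}$ is augmented over the constant simplicial algebra $T_0$, canonically with respect to its cellular structure: inductively along the cell attachments, using on $\mathbb{F}(\overline{R}[\mathcal{S}^{k-1}])$ and $\mathbb{F}(\overline{R}[\mathcal{D}^k])$ the augmentation obtained by applying $\mathbb{F}$ to the zero map of simplicial modules, and taking pushouts. The augmentation ideal $\overline{\mathcal{A}}$ is the kernel of this augmentation $\mathcal{A}\to T_0$; $\overline{\mathcal{A}}^r$ is its $r$-th power, taken degreewise. $\mathcal{A}$ is reduced if $\overline{\mathcal{A}}_0=0$.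
   Formalization: In the definition of a Fermat theory, g is required to be unique (the standard Dubuc–Kock definition); with mere existence the claim fails, e.g. for F_3-algebras with x^9 = x^3, a single 1-cell attached along zero, and r = 3. *)

theory Defs
  imports
    "HOL-Library.FuncSet"
    "HOL-Algebra.IntRing"
    "HOL-Algebra.Module"
    "HOL-Algebra.Ideal_Product"
    "HOL-Algebra.Indexed_Polynomials"
    "HOL-Algebra.Elementary_Groups"
begin

section \<open>Lawvere theories\<close>

text \<open>
  The objects of a Lawvere theory are the natural numbers, the object \<open>n\<close> being the \<open>n\<close>-th power
  of the generating object \<open>1\<close>; \<open>Prj T n i\<close> is the \<open>i\<close>-th projection of that power. The product of
  \<open>m\<close> and \<open>n\<close> is then \<open>m + n\<close>. \<open>Cmp T g f\<close> is "g after f".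
\<close>

record 't lawvere =
  Hom :: "nat \<Rightarrow> nat \<Rightarrow> 't set"
  Cmp :: "'t \<Rightarrow> 't \<Rightarrow> 't"
  Idn :: "nat \<Rightarrow> 't"
  Prj :: "nat \<Rightarrow> nat \<Rightarrow> 't"

locale lawvere_theory =
  fixes T :: "'t lawvere"
  assumes Idn_in: "Idn T n \<in> Hom T n n"
    and Cmp_in: "f \<in> Hom T l m \<Longrightarrow> g \<in> Hom T m n \<Longrightarrow> Cmp T g f \<in> Hom T l n"
    and Idn_left: "f \<in> Hom T m n \<Longrightarrow> Cmp T (Idn T n) f = f"
    and Idn_right: "f \<in> Hom T m n \<Longrightarrow> Cmp T f (Idn T m) = f"
    and Cmp_assoc: "f \<in> Hom T k l \<Longrightarrow> g \<in> Hom T l m \<Longrightarrow> h \<in> Hom T m n \<Longrightarrow>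
          Cmp T h (Cmp T g f) = Cmp T (Cmp T h g) f"
    and Prj_in: "i < n \<Longrightarrow> Prj T n i \<in> Hom T n 1"
    and Prj_1: "Prj T 1 0 = Idn T 1"
    and power: "(\<And>i. i < n \<Longrightarrow> fs i \<in> Hom T m 1) \<Longrightarrow>
          \<exists>!f. f \<in> Hom T m n \<and> (\<forall>i<n. Cmp T (Prj T n i) f = fs i)"

text \<open>
  A morphism of Lawvere theories is a functor that preserves the generating object and finite
  products. Since the hom-sets of a theory need not be disjoint, the action on arrows is indexed
  by source and target.
\<close>

locale lawvere_morphism =
  S: lawvere_theory S + T: lawvere_theory T for S :: "'s lawvere" and T :: "'t lawvere" +
  fixes \<phi> :: "nat \<Rightarrow> nat \<Rightarrow> 's \<Rightarrow> 't"
  assumes arr: "f \<in> Hom S m n \<Longrightarrow> \<phi> m n f \<in> Hom T m n"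
    and Idn: "\<phi> n n (Idn S n) = Idn T n"
    and Cmp: "f \<in> Hom S l m \<Longrightarrow> g \<in> Hom S m n \<Longrightarrow>
          \<phi> l n (Cmp S g f) = Cmp T (\<phi> m n g) (\<phi> l m f)"
    and Prj: "i < n \<Longrightarrow> \<phi> n 1 (Prj S n i) = Prj T n i"


section \<open>The theory of polynomial maps\<close>

text \<open>
  The polynomial ring over \<open>R\<close> in the variables \<open>X\<^sub>0, X\<^sub>1, \<dots>\<close>, with the library's representation of
  a polynomial as the function that sends a monomial (a multiset of variables) to its coefficient.
\<close>

definition mpoly_ring :: "('r, 'z) ring_scheme \<Rightarrow> (nat multiset \<Rightarrow> 'r) ring" where
  "mpoly_ring R =
    \<lparr> carrier = ring.indexed_pset R UNIV (carrier R),
      mult = (\<lambda>p q M. \<Oplus>\<^bsub>R\<^esub>A\<in>{A. A \<subseteq># M}. p A \<otimes>\<^bsub>R\<^esub> q (M - A)),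
      one = ring.indexed_const R \<one>\<^bsub>R\<^esub>,
      zero = ring.indexed_const R \<zero>\<^bsub>R\<^esub>,
      add = ring.indexed_padd R \<rparr>"

definition mpoly_subst ::
  "('r, 'z) ring_scheme \<Rightarrow> (nat multiset \<Rightarrow> 'r) list \<Rightarrow> (nat multiset \<Rightarrow> 'r) \<Rightarrow> (nat multiset \<Rightarrow> 'r)"
  where
  "mpoly_subst R qs p =
    (\<Oplus>\<^bsub>mpoly_ring R\<^esub>M\<in>{M. p M \<noteq> \<zero>\<^bsub>R\<^esub>}.
       ring.indexed_const R (p M) \<otimes>\<^bsub>mpoly_ring R\<^esub>
       (\<Otimes>\<^bsub>mpoly_ring R\<^esub>i\<in>set_mset M. (qs ! i) [^]\<^bsub>mpoly_ring R\<^esub> count M i))"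

definition Com :: "('r, 'z) ring_scheme \<Rightarrow> (nat multiset \<Rightarrow> 'r) list lawvere" where
  "Com R =
    \<lparr> Hom = (\<lambda>m n. {ps. length ps = n \<and> set ps \<subseteq> ring.indexed_pset R {..<m} (carrier R)}),
      Cmp = (\<lambda>g f. map (mpoly_subst R f) g),
      Idn = (\<lambda>n. map (ring.indexed_var R) [0..<n]),
      Prj = (\<lambda>n i. [ring.indexed_var R i]) \<rparr>"

text \<open>The canonical morphism from \<open>Com \<Z>\<close> to \<open>Com R\<close>, reducing integer coefficients to \<open>R\<close>.\<close>

definition Com_base ::
  "('r, 'z) ring_scheme \<Rightarrow> nat \<Rightarrow> nat \<Rightarrow> (nat multiset \<Rightarrow> int) list \<Rightarrow> (nat multiset \<Rightarrow> 'r) list"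
  where "Com_base R m n ps = map (\<lambda>p M. [p M] \<cdot>\<^bsub>R\<^esub> \<one>\<^bsub>R\<^esub>) ps"


section \<open>Algebras over a Lawvere theory\<close>

record ('t, 'a) talg =
  Ob :: "nat \<Rightarrow> 'a set"
  Act :: "nat \<Rightarrow> nat \<Rightarrow> 't \<Rightarrow> 'a \<Rightarrow> 'a"

locale talgebra = lawvere_theory T for T :: "'t lawvere" +
  fixes A :: "('t, 'a) talg"
  assumes Act_in: "f \<in> Hom T m n \<Longrightarrow> x \<in> Ob A m \<Longrightarrow> Act A m n f x \<in> Ob A n"
    and Act_Idn: "x \<in> Ob A n \<Longrightarrow> Act A n n (Idn T n) x = x"
    and Act_Cmp: "f \<in> Hom T l m \<Longrightarrow> g \<in> Hom T m n \<Longrightarrow> x \<in> Ob A l \<Longrightarrow>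
          Act A l n (Cmp T g f) x = Act A m n g (Act A l m f x)"
    and preserves_power: "(\<And>i. i < n \<Longrightarrow> xs i \<in> Ob A 1) \<Longrightarrow>
          \<exists>!x. x \<in> Ob A n \<and> (\<forall>i<n. Act A n 1 (Prj T n i) x = xs i)"

text \<open>
  Morphisms are natural transformations; the components are taken to be extensional functions, so
  that equality of morphisms is equality in the logic.
\<close>

definition talg_hom ::
  "'t lawvere \<Rightarrow> ('t, 'a) talg \<Rightarrow> ('t, 'b) talg \<Rightarrow> (nat \<Rightarrow> 'a \<Rightarrow> 'b) set" where
  "talg_hom T A B =
    {h. (\<forall>n. h n \<in> Ob A n \<rightarrow>\<^sub>E Ob B n) \<and>
        (\<forall>m n. \<forall>f\<in>Hom T m n. \<forall>x\<in>Ob A m. h n (Act A m n f x) = Act B m n f (h m x))}"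

definition talg_comp ::
  "('t, 'a) talg \<Rightarrow> (nat \<Rightarrow> 'b \<Rightarrow> 'c) \<Rightarrow> (nat \<Rightarrow> 'a \<Rightarrow> 'b) \<Rightarrow> nat \<Rightarrow> 'a \<Rightarrow> 'c" where
  "talg_comp A g h = (\<lambda>n. compose (Ob A n) (g n) (h n))"

definition represented :: "'t lawvere \<Rightarrow> nat \<Rightarrow> ('t, 't) talg" where
  "represented T k = \<lparr> Ob = Hom T k, Act = (\<lambda>m n f x. Cmp T f x) \<rparr>"

text \<open>The element of \<open>A(n) = A(1)\<^sup>n\<close> with given components, and the \<open>n\<close>-ary operation on \<open>A(1)\<close>
  given by an arrow \<open>f : n \<rightarrow> 1\<close>.\<close>

definition tuple :: "'t lawvere \<Rightarrow> ('t, 'a) talg \<Rightarrow> 'a list \<Rightarrow> 'a" where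
  "tuple T A xs = (THE x. x \<in> Ob A (length xs) \<and>
     (\<forall>i<length xs. Act A (length xs) 1 (Prj T (length xs) i) x = xs ! i))"

definition talg_op :: "'t lawvere \<Rightarrow> ('t, 'a) talg \<Rightarrow> 't \<Rightarrow> 'a list \<Rightarrow> 'a" where
  "talg_op T A f xs = Act A (length xs) 1 f (tuple T A xs)"

text \<open>
  The \<open>R\<close>-module underlying a \<open>T\<close>-algebra, for a morphism \<open>\<kappa>\<close> from \<open>Com R\<close> to \<open>T\<close>. The fields
  \<open>mult\<close> and \<open>one\<close>, which are irrelevant for a module, hold the multiplication and unit of the
  underlying commutative ring, so that the same record also serves as that ring.
\<close>

definition underlying ::
  "('r, 'z) ring_scheme \<Rightarrow> 't lawvere \<Rightarrow> (nat \<Rightarrow> nat \<Rightarrow> (nat multiset \<Rightarrow> 'r) list \<Rightarrow> 't) \<Rightarrow>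
   ('t, 'a) talg \<Rightarrow> ('r, 'a) module" where
  "underlying R T \<kappa> A =
    (let P = mpoly_ring R; V = ring.indexed_var R in
    \<lparr> carrier = Ob A 1,
      mult = (\<lambda>a b. talg_op T A (\<kappa> 2 1 [V 0 \<otimes>\<^bsub>P\<^esub> V 1]) [a, b]),
      one = talg_op T A (\<kappa> 0 1 [\<one>\<^bsub>P\<^esub>]) [],
      zero = talg_op T A (\<kappa> 0 1 [\<zero>\<^bsub>P\<^esub>]) [],
      add = (\<lambda>a b. talg_op T A (\<kappa> 2 1 [V 0 \<oplus>\<^bsub>P\<^esub> V 1]) [a, b]),
      smult = (\<lambda>r a. talg_op T A (\<kappa> 1 1 [ring.indexed_const R r \<otimes>\<^bsub>P\<^esub> V 0]) [a]) \<rparr>)"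


section \<open>Fermat theories\<close>

text \<open>
  For \<open>f : 1 \<times> m \<rightarrow> n\<close> and \<open>g : 1 \<times> 1 \<times> m \<rightarrow> n\<close>, the equation
  \<open>f(l\<^sub>1,s) - f(l\<^sub>2,s) = (l\<^sub>1 - l\<^sub>2) \<cdot> g(l\<^sub>1,l\<^sub>2,s)\<close> is stated in each component \<open>j < n\<close>, in the ring of arrows
  \<open>1 \<times> 1 \<times> m \<rightarrow> 1\<close>; this is the ring underlying the algebra represented by \<open>1 \<times> 1 \<times> m\<close>.

  As in the usual definition of Fermat theories (Dubuc--Kock), \<open>g\<close> is required to be unique. With
  mere existence every quotient theory of \<open>Com R\<close>, i.e. every variety of commutative \<open>R\<close>-algebras,
  would qualify.
\<close>

locale fermat_theory = lawvere_morphism "Com \<Z>" T \<iota> for T :: "'t lawvere" and \<iota> +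
  assumes fermat: "f \<in> Hom T (Suc m) n \<Longrightarrow>
    (let H = underlying \<Z> T \<iota> (represented T (Suc (Suc m)));
         l1 = Prj T (Suc (Suc m)) 0;
         l2 = Prj T (Suc (Suc m)) 1;
         s = map (Prj T (Suc (Suc m))) [2..<Suc (Suc m)];
         pair_s = (\<lambda>l. tuple T (represented T (Suc (Suc m))) (l # s))
     in \<exists>!g. g \<in> Hom T (Suc (Suc m)) n \<and>
          (\<forall>j<n. Cmp T (Prj T n j) (Cmp T f (pair_s l1)) \<ominus>\<^bsub>H\<^esub> Cmp T (Prj T n j) (Cmp T f (pair_s l2)) =
                 (l1 \<ominus>\<^bsub>H\<^esub> l2) \<otimes>\<^bsub>H\<^esub> Cmp T (Prj T n j) g))"

locale fermat_theory_over =
  R: cring R + fermat_theory T \<iota> + \<kappa>: lawvere_morphism "Com R" T \<kappa>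
  for R :: "('r, 'z) ring_scheme" and T :: "'t lawvere" and \<iota> and \<kappa> +
  assumes factorization: "p \<in> Hom (Com \<Z>) m n \<Longrightarrow> \<iota> m n p = \<kappa> m n (Com_base R m n p)"


section \<open>The free algebra functor\<close>

definition mod_hom ::
  "('r, 'z) ring_scheme \<Rightarrow> ('r, 'm) module \<Rightarrow> ('r, 'n) module \<Rightarrow> ('m \<Rightarrow> 'n) set" where
  "mod_hom R M N =
    {\<phi> \<in> carrier M \<rightarrow>\<^sub>E carrier N.
       (\<forall>x\<in>carrier M. \<forall>y\<in>carrier M. \<phi> (x \<oplus>\<^bsub>M\<^esub> y) = \<phi> x \<oplus>\<^bsub>N\<^esub> \<phi> y) \<and>
       (\<forall>r\<in>carrier R. \<forall>x\<in>carrier M. \<phi> (r \<odot>\<^bsub>M\<^esub> x) = r \<odot>\<^bsub>N\<^esub> \<phi> x)}"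

text \<open>
  A left adjoint of the forgetful functor, given by a universal arrow \<open>\<eta> M : M \<rightarrow> U (F M)\<close> for
  every module \<open>M\<close>. A universal property can only be tested on algebras whose elements lie in one
  fixed type. Every free algebra on \<open>M\<close> is generated by the image of \<open>M\<close>, hence isomorphic to an
  algebra with elements \<open>(t, [m\<^sub>1, \<dots>, m\<^sub>k])\<close>, \<open>t\<close> an arrow of \<open>T\<close>; and \<open>F M\<close> itself has elements in
  \<open>'f\<close>. The type \<open>'t \<times> ('m + 'f) list\<close> contains copies of both, so testing on it alone
  already determines \<open>F M\<close> and implies the universal property for algebras in every type.
  The test types in the definitions of pushouts and colimits below are chosen on the same principle.
\<close>

locale free_functor =
  fixes R :: "('r, 'z) ring_scheme" and T :: "'t lawvere" and \<kappa>
    and F :: "('r, 'm) module \<Rightarrow> ('t, 'f) talg"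
    and \<eta> :: "('r, 'm) module \<Rightarrow> 'm \<Rightarrow> 'f"
  assumes F_algebra: "module R M \<Longrightarrow> talgebra T (F M)"
    and unit: "module R M \<Longrightarrow> \<eta> M \<in> mod_hom R M (underlying R T \<kappa> (F M))"
    and universal: "module R M \<Longrightarrow> talgebra T (B :: ('t, 't \<times> ('m + 'f) list) talg) \<Longrightarrow>
          \<phi> \<in> mod_hom R M (underlying R T \<kappa> B) \<Longrightarrow>
          \<exists>!h. h \<in> talg_hom T (F M) B \<and> (\<forall>x\<in>carrier M. h 1 (\<eta> M x) = \<phi> x)"

text \<open>The adjoint transpose of \<open>\<phi> : M \<rightarrow> U B\<close>, and the action of \<open>F\<close> on linear maps.\<close>

definition free_lift ::
  "'t lawvere \<Rightarrow> (('r, 'm) module \<Rightarrow> ('t, 'f) talg) \<Rightarrow> (('r, 'm) module \<Rightarrow> 'm \<Rightarrow> 'f) \<Rightarrow>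
   ('r, 'm) module \<Rightarrow> ('t, 'b) talg \<Rightarrow> ('m \<Rightarrow> 'b) \<Rightarrow> nat \<Rightarrow> 'f \<Rightarrow> 'b" where
  "free_lift T F \<eta> M B \<phi> =
    (THE h. h \<in> talg_hom T (F M) B \<and> (\<forall>x\<in>carrier M. h 1 (\<eta> M x) = \<phi> x))"

definition free_map ::
  "'t lawvere \<Rightarrow> (('r, 'm) module \<Rightarrow> ('t, 'f) talg) \<Rightarrow> (('r, 'm) module \<Rightarrow> 'm \<Rightarrow> 'f) \<Rightarrow>
   ('r, 'm) module \<Rightarrow> ('r, 'm) module \<Rightarrow> ('m \<Rightarrow> 'm) \<Rightarrow> nat \<Rightarrow> 'f \<Rightarrow> 'f" where
  "free_map T F \<eta> M N \<phi> = free_lift T F \<eta> M (F N) (\<lambda>x. \<eta> N (\<phi> x))"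

text \<open>
  \<open>F\<close> applied to the zero map \<open>M \<rightarrow> 0\<close>, followed by the unique morphism from \<open>F 0\<close> to
  \<open>T\<^sub>0 = represented T 0\<close>, which is an isomorphism as both are initial.
\<close>

definition free_augmentation ::
  "('r, 'z) ring_scheme \<Rightarrow> 't lawvere \<Rightarrow> (nat \<Rightarrow> nat \<Rightarrow> (nat multiset \<Rightarrow> 'r) list \<Rightarrow> 't) \<Rightarrow>
   (('r, 'm) module \<Rightarrow> ('t, 'f) talg) \<Rightarrow> (('r, 'm) module \<Rightarrow> 'm \<Rightarrow> 'f) \<Rightarrow>
   ('r, 'm) module \<Rightarrow> nat \<Rightarrow> 'f \<Rightarrow> 't" where
  "free_augmentation R T \<kappa> F \<eta> M =
    (let Z = M\<lparr>carrier := {\<zero>\<^bsub>M\<^esub>}\<rparr>; T0 = represented T 0 in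
     talg_comp (F M)
       (free_lift T F \<eta> Z T0 (\<lambda>_. \<zero>\<^bsub>underlying R T \<kappa> T0\<^esub>))
       (free_map T F \<eta> M Z (\<lambda>_. \<zero>\<^bsub>M\<^esub>)))"


section \<open>Simplicial algebras\<close>

text \<open>Arrows \<open>[p] \<rightarrow> [q]\<close> of the simplex category.\<close>

definition delta :: "nat \<Rightarrow> nat \<Rightarrow> (nat \<Rightarrow> nat) set" where
  "delta p q = {\<theta> \<in> {..p} \<rightarrow>\<^sub>E {..q}. mono_on {..p} \<theta>}"

text \<open>For \<open>\<theta> : [p] \<rightarrow> [q]\<close>, the morphism \<open>Str A p q \<theta>\<close> goes from \<open>Deg A q\<close> to \<open>Deg A p\<close>.\<close>

record ('t, 'a) salg =
  Deg :: "nat \<Rightarrow> ('t, 'a) talg"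
  Str :: "nat \<Rightarrow> nat \<Rightarrow> (nat \<Rightarrow> nat) \<Rightarrow> nat \<Rightarrow> 'a \<Rightarrow> 'a"

locale salgebra =
  fixes T :: "'t lawvere" and A :: "('t, 'a) salg"
  assumes Deg: "talgebra T (Deg A p)"
    and Str_hom: "\<theta> \<in> delta p q \<Longrightarrow> Str A p q \<theta> \<in> talg_hom T (Deg A q) (Deg A p)"
    and Str_id: "x \<in> Ob (Deg A p) n \<Longrightarrow> Str A p p (restrict id {..p}) n x = x"
    and Str_comp: "\<theta> \<in> delta p q \<Longrightarrow> \<psi> \<in> delta q r \<Longrightarrow> x \<in> Ob (Deg A r) n \<Longrightarrow>
          Str A p r (compose {..p} \<psi> \<theta>) n x = Str A p q \<theta> n (Str A q r \<psi> n x)"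

definition salg_hom ::
  "'t lawvere \<Rightarrow> ('t, 'a) salg \<Rightarrow> ('t, 'b) salg \<Rightarrow> (nat \<Rightarrow> nat \<Rightarrow> 'a \<Rightarrow> 'b) set" where
  "salg_hom T A B =
    {h. (\<forall>p. h p \<in> talg_hom T (Deg A p) (Deg B p)) \<and>
        (\<forall>p q. \<forall>\<theta>\<in>delta p q. \<forall>n. \<forall>x\<in>Ob (Deg A q) n.
           h p n (Str A p q \<theta> n x) = Str B p q \<theta> n (h q n x))}"

definition salg_comp ::
  "('t, 'a) salg \<Rightarrow> (nat \<Rightarrow> nat \<Rightarrow> 'b \<Rightarrow> 'c) \<Rightarrow> (nat \<Rightarrow> nat \<Rightarrow> 'a \<Rightarrow> 'b) \<Rightarrow> nat \<Rightarrow> nat \<Rightarrow> 'a \<Rightarrow> 'c"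
  where "salg_comp A g h = (\<lambda>p. talg_comp (Deg A p) (g p) (h p))"

definition salg_id :: "('t, 'a) salg \<Rightarrow> nat \<Rightarrow> nat \<Rightarrow> 'a \<Rightarrow> 'a" where
  "salg_id A = (\<lambda>p n. restrict id (Ob (Deg A p) n))"

definition const_salg :: "('t, 'a) talg \<Rightarrow> ('t, 'a) salg" where
  "const_salg A = \<lparr> Deg = (\<lambda>p. A), Str = (\<lambda>p q \<theta> n. restrict id (Ob A n)) \<rparr>"


section \<open>Generating cofibrations\<close>

text \<open>The \<open>p\<close>-simplices of the standard simplex with the \<open>k\<close> vertices \<open>0, \<dots>, k - 1\<close>; it is empty
  for \<open>k = 0\<close>.\<close>

definition simplex :: "nat \<Rightarrow> nat \<Rightarrow> (nat \<Rightarrow> nat) set" where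
  "simplex k p = {x \<in> {..p} \<rightarrow>\<^sub>E {..<k}. mono_on {..p} x}"

text \<open>Pointed simplicial sets; \<open>Opr K p q \<theta>\<close> goes from \<open>Smp K q\<close> to \<open>Smp K p\<close>.\<close>

record 'x psset =
  Smp :: "nat \<Rightarrow> 'x set"
  Bas :: "nat \<Rightarrow> 'x"
  Opr :: "nat \<Rightarrow> nat \<Rightarrow> (nat \<Rightarrow> nat) \<Rightarrow> 'x \<Rightarrow> 'x"

text \<open>The quotient of \<open>simplex k\<close> by a subcomplex \<open>L\<close>, with \<open>None\<close> as the collapsed point; for empty
  \<open>L\<close> a disjoint base point is added.\<close>

definition simplex_quotient :: "nat \<Rightarrow> (nat \<Rightarrow> (nat \<Rightarrow> nat) set) \<Rightarrow> (nat \<Rightarrow> nat) option psset" where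
  "simplex_quotient k L =
    \<lparr> Smp = (\<lambda>p. insert None (Some ` (simplex k p - L p))),
      Bas = (\<lambda>p. None),
      Opr = (\<lambda>p q \<theta> y. case y of None \<Rightarrow> None
         | Some x \<Rightarrow> if compose {..p} x \<theta> \<in> L p then None else Some (compose {..p} x \<theta>)) \<rparr>"

text \<open>
  \<open>sphere k\<close> is \<open>\<S>\<^sup>k\<^sup>-\<^sup>1 = \<Delta>\<^sup>k\<^sup>-\<^sup>1/\<partial>\<Delta>\<^sup>k\<^sup>-\<^sup>1\<close> and \<open>disk k\<close> is \<open>\<D>\<^sup>k = \<Delta>\<^sup>k/\<Lambda>\<^sup>k\<^sub>0\<close>, for \<open>k \<ge> 0\<close>. For \<open>k = 0\<close> these are a
  point and the discrete two-point set, so that \<open>k = 0\<close> freely adjoins a generator in degree 0.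
  The horn \<open>\<Lambda>\<^sup>k\<^sub>0\<close> is the union of the faces containing the vertex 0, i.e. of all faces but the one
  opposite to 0. That remaining face induces the inclusion of \<open>sphere k\<close> into \<open>disk k\<close> (each of the
  other faces is collapsed in the quotient).
\<close>

definition sphere :: "nat \<Rightarrow> (nat \<Rightarrow> nat) option psset" where
  "sphere k = simplex_quotient k (\<lambda>p. {x \<in> simplex k p. x ` {..p} \<noteq> {..<k}})"

definition disk :: "nat \<Rightarrow> (nat \<Rightarrow> nat) option psset" where
  "disk k = simplex_quotient (Suc k) (\<lambda>p. {x \<in> simplex (Suc k) p. \<not> {1..k} \<subseteq> x ` {..p}})"

definition sphere_disk :: "nat \<Rightarrow> (nat \<Rightarrow> nat) option \<Rightarrow> (nat \<Rightarrow> nat) option" where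
  "sphere_disk p = map_option (\<lambda>x. compose {..p} Suc x)"

text \<open>
  Reduced chains \<open>R[K\<^sub>p] / R[*]\<close> in degree \<open>p\<close>: finitely supported functions on the simplices other
  than the base point. The fields \<open>mult\<close> and \<open>one\<close> play no role.
\<close>

definition reduced_chains :: "('r, 'z) ring_scheme \<Rightarrow> 'x psset \<Rightarrow> nat \<Rightarrow> ('r, 'x \<Rightarrow> 'r) module" where
  "reduced_chains R K p =
    \<lparr> carrier = {c. (\<forall>x. c x \<in> carrier R) \<and> finite {x. c x \<noteq> \<zero>\<^bsub>R\<^esub>} \<and>
                    {x. c x \<noteq> \<zero>\<^bsub>R\<^esub>} \<subseteq> Smp K p - {Bas K p}},
      mult = undefined,
      one = undefined,
      zero = (\<lambda>x. \<zero>\<^bsub>R\<^esub>),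
      add = (\<lambda>c d x. c x \<oplus>\<^bsub>R\<^esub> d x),
      smult = (\<lambda>r c x. r \<otimes>\<^bsub>R\<^esub> c x) \<rparr>"

text \<open>The linear map induced by a pointed map \<open>f\<close> from the \<open>q\<close>-simplices of \<open>K\<close> to the
  \<open>p\<close>-simplices of \<open>L\<close>.\<close>

definition chain_map ::
  "('r, 'z) ring_scheme \<Rightarrow> 'x psset \<Rightarrow> nat \<Rightarrow> 'y psset \<Rightarrow> nat \<Rightarrow> ('x \<Rightarrow> 'y) \<Rightarrow>
   ('x \<Rightarrow> 'r) \<Rightarrow> ('y \<Rightarrow> 'r)" where
  "chain_map R K q L p f =
    (\<lambda>c\<in>carrier (reduced_chains R K q). \<lambda>y.
       if y = Bas L p then \<zero>\<^bsub>R\<^esub> else (\<Oplus>\<^bsub>R\<^esub>x\<in>{x. c x \<noteq> \<zero>\<^bsub>R\<^esub> \<and> f x = y}. c x))"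

text \<open>\<open>F\<close> applied degreewise to the simplicial module of reduced chains.\<close>

definition free_salg ::
  "('r, 'z) ring_scheme \<Rightarrow> 't lawvere \<Rightarrow> (('r, 'x \<Rightarrow> 'r) module \<Rightarrow> ('t, 'f) talg) \<Rightarrow>
   (('r, 'x \<Rightarrow> 'r) module \<Rightarrow> ('x \<Rightarrow> 'r) \<Rightarrow> 'f) \<Rightarrow> 'x psset \<Rightarrow> ('t, 'f) salg" where
  "free_salg R T F \<eta> K =
    \<lparr> Deg = (\<lambda>p. F (reduced_chains R K p)),
      Str = (\<lambda>p q \<theta>. free_map T F \<eta> (reduced_chains R K q) (reduced_chains R K p)
                        (chain_map R K q K p (Opr K p q \<theta>))) \<rparr>"

definition generating_cofibration ::
  "('r, 'z) ring_scheme \<Rightarrow> 't lawvere \<Rightarrow>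
   (('r, (nat \<Rightarrow> nat) option \<Rightarrow> 'r) module \<Rightarrow> ('t, 'f) talg) \<Rightarrow>
   (('r, (nat \<Rightarrow> nat) option \<Rightarrow> 'r) module \<Rightarrow> ((nat \<Rightarrow> nat) option \<Rightarrow> 'r) \<Rightarrow> 'f) \<Rightarrow>
   nat \<Rightarrow> nat \<Rightarrow> nat \<Rightarrow> 'f \<Rightarrow> 'f" where
  "generating_cofibration R T F \<eta> k =
    (\<lambda>p. free_map T F \<eta> (reduced_chains R (sphere k) p) (reduced_chains R (disk k) p)
           (chain_map R (sphere k) p (disk k) p (sphere_disk p)))"


section \<open>Cellular simplicial algebras\<close>

text \<open>
  The square with \<open>i : S \<rightarrow> D\<close>, \<open>a : S \<rightarrow> B\<close>, \<open>j : B \<rightarrow> P\<close>, \<open>c : D \<rightarrow> P\<close> is a pushout. An actual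
  pushout is degreewise generated by the images of \<open>B\<close> and \<open>D\<close>, so that it is isomorphic to one in
  the test type, which also contains a copy of \<open>'a\<close>.
\<close>

definition is_pushout ::
  "'t lawvere \<Rightarrow> ('t, 'f) salg \<Rightarrow> ('t, 'f) salg \<Rightarrow> ('t, 'a) salg \<Rightarrow> ('t, 'a) salg \<Rightarrow>
   (nat \<Rightarrow> nat \<Rightarrow> 'f \<Rightarrow> 'f) \<Rightarrow> (nat \<Rightarrow> nat \<Rightarrow> 'f \<Rightarrow> 'a) \<Rightarrow>
   (nat \<Rightarrow> nat \<Rightarrow> 'a \<Rightarrow> 'a) \<Rightarrow> (nat \<Rightarrow> nat \<Rightarrow> 'f \<Rightarrow> 'a) \<Rightarrow> bool" where
  "is_pushout T S D B P i a j c \<longleftrightarrow>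
    i \<in> salg_hom T S D \<and> a \<in> salg_hom T S B \<and> j \<in> salg_hom T B P \<and> c \<in> salg_hom T D P \<and>
    salg_comp S j a = salg_comp S c i \<and>
    (\<forall>(Z :: ('t, 't \<times> ('a + 'f) list) salg) u v.
       salgebra T Z \<longrightarrow> u \<in> salg_hom T B Z \<longrightarrow> v \<in> salg_hom T D Z \<longrightarrow>
       salg_comp S u a = salg_comp S v i \<longrightarrow>
       (\<exists>!w. w \<in> salg_hom T P Z \<and> salg_comp B w j = u \<and> salg_comp D w c = v))"

text \<open>
  \<open>Y \<beta>\<close> is the colimit of the chain \<open>(Y \<gamma>)\<^sub>\<gamma>\<^sub><\<^sub>\<beta>\<close>. If there is no \<open>\<gamma> < \<beta>\<close>, this says that \<open>Y \<beta>\<close> is an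
  initial object.
\<close>

definition is_chain_colimit ::
  "'t lawvere \<Rightarrow> ('i::wellorder \<Rightarrow> ('t, 'a) salg) \<Rightarrow> ('i \<Rightarrow> 'i \<Rightarrow> nat \<Rightarrow> nat \<Rightarrow> 'a \<Rightarrow> 'a) \<Rightarrow> 'i \<Rightarrow> bool"
  where
  "is_chain_colimit T Y e \<beta> \<longleftrightarrow>
    (\<forall>(Z :: ('t, 't \<times> ('i \<times> 'a) list) salg) u.
       salgebra T Z \<longrightarrow> (\<forall>\<gamma><\<beta>. u \<gamma> \<in> salg_hom T (Y \<gamma>) Z) \<longrightarrow>
       (\<forall>\<delta><\<beta>. \<forall>\<gamma>\<le>\<delta>. salg_comp (Y \<gamma>) (u \<delta>) (e \<gamma> \<delta>) = u \<gamma>) \<longrightarrow>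
       (\<exists>!w. w \<in> salg_hom T (Y \<beta>) Z \<and> (\<forall>\<gamma><\<beta>. salg_comp (Y \<gamma>) w (e \<gamma> \<beta>) = u \<gamma>)))"

text \<open>
  A presentation of a simplicial algebra as a transfinite composition of cobase changes of generating
  cofibrations, starting at the initial object. The stages are indexed by the ordinals up to and
  including \<open>Last C\<close>, represented by an initial segment of a well-ordered type. The cell attached
  to the stage \<open>\<beta>\<close> has dimension \<open>Dim C \<beta>\<close>, attaching map \<open>Att C \<beta>\<close> and characteristic map
  \<open>Chr C \<beta>\<close>.
\<close>

record ('i, 't, 'a, 'f) cells =
  Last :: 'i
  Stage :: "'i \<Rightarrow> ('t, 'a) salg"
  Trans :: "'i \<Rightarrow> 'i \<Rightarrow> nat \<Rightarrow> nat \<Rightarrow> 'a \<Rightarrow> 'a"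
  Dim :: "'i \<Rightarrow> nat"
  Att :: "'i \<Rightarrow> nat \<Rightarrow> nat \<Rightarrow> 'f \<Rightarrow> 'a"
  Chr :: "'i \<Rightarrow> nat \<Rightarrow> nat \<Rightarrow> 'f \<Rightarrow> 'a"

definition next_stage :: "'i::wellorder \<Rightarrow> 'i" where
  "next_stage \<beta> = (LEAST \<gamma>. \<beta> < \<gamma>)"

locale cellular_structure =
  fixes R :: "('r, 'z) ring_scheme" and T :: "'t lawvere"
    and F :: "('r, (nat \<Rightarrow> nat) option \<Rightarrow> 'r) module \<Rightarrow> ('t, 'f) talg"
    and \<eta> :: "('r, (nat \<Rightarrow> nat) option \<Rightarrow> 'r) module \<Rightarrow> ((nat \<Rightarrow> nat) option \<Rightarrow> 'r) \<Rightarrow> 'f"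
    and C :: "('i::wellorder, 't, 'a, 'f) cells"
  assumes Stage: "\<beta> \<le> Last C \<Longrightarrow> salgebra T (Stage C \<beta>)"
    and Trans_hom: "\<gamma> \<le> \<delta> \<Longrightarrow> \<delta> \<le> Last C \<Longrightarrow>
          Trans C \<gamma> \<delta> \<in> salg_hom T (Stage C \<gamma>) (Stage C \<delta>)"
    and Trans_id: "\<beta> \<le> Last C \<Longrightarrow> Trans C \<beta> \<beta> = salg_id (Stage C \<beta>)"
    and Trans_comp: "\<beta> \<le> \<gamma> \<Longrightarrow> \<gamma> \<le> \<delta> \<Longrightarrow> \<delta> \<le> Last C \<Longrightarrow>
          Trans C \<beta> \<delta> = salg_comp (Stage C \<beta>) (Trans C \<gamma> \<delta>) (Trans C \<beta> \<gamma>)"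
    and successor: "\<beta> < Last C \<Longrightarrow>
          is_pushout T (free_salg R T F \<eta> (sphere (Dim C \<beta>))) (free_salg R T F \<eta> (disk (Dim C \<beta>)))
            (Stage C \<beta>) (Stage C (next_stage \<beta>))
            (generating_cofibration R T F \<eta> (Dim C \<beta>))
            (Att C \<beta>) (Trans C \<beta> (next_stage \<beta>)) (Chr C \<beta>)"
    and limit: "\<beta> \<le> Last C \<Longrightarrow> (\<nexists>\<gamma>. \<gamma> < \<beta> \<and> \<beta> = next_stage \<gamma>) \<Longrightarrow>
          is_chain_colimit T (Stage C) (Trans C) \<beta>"

abbreviation cellular_object :: "('i, 't, 'a, 'f) cells \<Rightarrow> ('t, 'a) salg" where
  "cellular_object C \<equiv> Stage C (Last C)"

text \<open>
  The canonical augmentations of the stages over the constant simplicial algebra \<open>T\<^sub>0\<close>. The conditions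
  determine \<open>\<epsilon>\<close> uniquely: at a successor, \<open>\<epsilon>\<close> is the map out of the pushout induced by the
  augmentation of the previous stage and that of the attached cell, which have to agree on
  the boundary of the cell; at a limit it is the map out of the colimit.
\<close>

locale canonical_augmentation = cellular_structure R T F \<eta> C
  for R :: "('r, 'z) ring_scheme" and T :: "'t lawvere"
    and F :: "('r, (nat \<Rightarrow> nat) option \<Rightarrow> 'r) module \<Rightarrow> ('t, 'f) talg"
    and \<eta> :: "('r, (nat \<Rightarrow> nat) option \<Rightarrow> 'r) module \<Rightarrow> ((nat \<Rightarrow> nat) option \<Rightarrow> 'r) \<Rightarrow> 'f"
    and C :: "('i::wellorder, 't, 'a, 'f) cells" +
  fixes \<kappa> :: "nat \<Rightarrow> nat \<Rightarrow> (nat multiset \<Rightarrow> 'r) list \<Rightarrow> 't"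
    and \<epsilon> :: "'i \<Rightarrow> nat \<Rightarrow> nat \<Rightarrow> 'a \<Rightarrow> 't"
  assumes aug_hom: "\<beta> \<le> Last C \<Longrightarrow>
          \<epsilon> \<beta> \<in> salg_hom T (Stage C \<beta>) (const_salg (represented T 0))"
    and aug_Trans: "\<gamma> \<le> \<delta> \<Longrightarrow> \<delta> \<le> Last C \<Longrightarrow>
          salg_comp (Stage C \<gamma>) (\<epsilon> \<delta>) (Trans C \<gamma> \<delta>) = \<epsilon> \<gamma>"
    and aug_Att: "\<beta> < Last C \<Longrightarrow>
          salg_comp (free_salg R T F \<eta> (sphere (Dim C \<beta>))) (\<epsilon> \<beta>) (Att C \<beta>) =
          (\<lambda>p. free_augmentation R T \<kappa> F \<eta> (reduced_chains R (sphere (Dim C \<beta>)) p))"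
    and aug_Chr: "\<beta> < Last C \<Longrightarrow>
          salg_comp (free_salg R T F \<eta> (disk (Dim C \<beta>))) (\<epsilon> (next_stage \<beta>)) (Chr C \<beta>) =
          (\<lambda>p. free_augmentation R T \<kappa> F \<eta> (reduced_chains R (disk (Dim C \<beta>)) p))"

text \<open>The kernel, in degree \<open>p\<close>, of an augmentation \<open>e\<close> of \<open>A\<close> over \<open>T\<^sub>0\<close>, an ideal of the ring
  underlying \<open>Deg A p\<close>.\<close>

definition augmentation_ideal ::
  "('r, 'z) ring_scheme \<Rightarrow> 't lawvere \<Rightarrow> (nat \<Rightarrow> nat \<Rightarrow> (nat multiset \<Rightarrow> 'r) list \<Rightarrow> 't) \<Rightarrow>
   ('t, 'a) salg \<Rightarrow> (nat \<Rightarrow> nat \<Rightarrow> 'a \<Rightarrow> 't) \<Rightarrow> nat \<Rightarrow> 'a set" where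
  "augmentation_ideal R T \<kappa> A e p =
    a_kernel (underlying R T \<kappa> (Deg A p)) (underlying R T \<kappa> (represented T 0)) (e p 1)"

definition reduced ::
  "('r, 'z) ring_scheme \<Rightarrow> 't lawvere \<Rightarrow> (nat \<Rightarrow> nat \<Rightarrow> (nat multiset \<Rightarrow> 'r) list \<Rightarrow> 't) \<Rightarrow>
   ('t, 'a) salg \<Rightarrow> (nat \<Rightarrow> nat \<Rightarrow> 'a \<Rightarrow> 't) \<Rightarrow> bool" where
  "reduced R T \<kappa> A e \<longleftrightarrow>
    augmentation_ideal R T \<kappa> A e 0 = {\<zero>\<^bsub>underlying R T \<kappa> (Deg A 0)\<^esub>}"


section \<open>Connectivity of simplicial abelian groups\<close>

record 'g sgroup =
  Grp :: "nat \<Rightarrow> 'g monoid"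
  GStr :: "nat \<Rightarrow> nat \<Rightarrow> (nat \<Rightarrow> nat) \<Rightarrow> 'g \<Rightarrow> 'g"

locale simplicial_abelian_group =
  fixes G :: "'g sgroup"
  assumes Grp: "comm_group (Grp G p)"
    and GStr_hom: "\<theta> \<in> delta p q \<Longrightarrow> GStr G p q \<theta> \<in> hom (Grp G q) (Grp G p)"
    and GStr_id: "x \<in> carrier (Grp G p) \<Longrightarrow> GStr G p p (restrict id {..p}) x = x"
    and GStr_comp: "\<theta> \<in> delta p q \<Longrightarrow> \<psi> \<in> delta q r \<Longrightarrow> x \<in> carrier (Grp G r) \<Longrightarrow>
          GStr G p r (compose {..p} \<psi> \<theta>) x = GStr G p q \<theta> (GStr G q r \<psi> x)"

text \<open>\<open>face G p i\<close> is the face map \<open>d\<^sub>i\<close> from degree \<open>p + 1\<close> to degree \<open>p\<close>.\<close>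

definition face :: "'g sgroup \<Rightarrow> nat \<Rightarrow> nat \<Rightarrow> 'g \<Rightarrow> 'g" where
  "face G p i = GStr G p (Suc p) (\<lambda>j\<in>{..p}. if j < i then j else Suc j)"

text \<open>The homotopy groups are the homology groups of the Moore complex, whose term in degree \<open>p\<close> is
  the intersection of the kernels of \<open>d\<^sub>1, \<dots>, d\<^sub>p\<close> and whose differential is \<open>d\<^sub>0\<close>.\<close>

fun moore :: "'g sgroup \<Rightarrow> nat \<Rightarrow> 'g set" where
  "moore G 0 = carrier (Grp G 0)"
| "moore G (Suc p) = {x \<in> carrier (Grp G (Suc p)). \<forall>i\<in>{1..Suc p}. face G p i x = \<one>\<^bsub>Grp G p\<^esub>}"

fun moore_cycles :: "'g sgroup \<Rightarrow> nat \<Rightarrow> 'g set" where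
  "moore_cycles G 0 = moore G 0"
| "moore_cycles G (Suc p) = {x \<in> moore G (Suc p). face G p 0 x = \<one>\<^bsub>Grp G p\<^esub>}"

definition homotopy_group :: "'g sgroup \<Rightarrow> nat \<Rightarrow> 'g set monoid" where
  "homotopy_group G p = (Grp G p)\<lparr>carrier := moore_cycles G p\<rparr> Mod (face G p 0 ` moore G (Suc p))"

definition connected_simplicial_abelian_group :: "nat \<Rightarrow> 'g sgroup \<Rightarrow> bool" where
  "connected_simplicial_abelian_group n G \<longleftrightarrow>
    simplicial_abelian_group G \<and> (\<forall>p\<le>n. trivial_group (homotopy_group G p))"

fun ideal_power :: "('a, 'z) ring_scheme \<Rightarrow> 'a set \<Rightarrow> nat \<Rightarrow> 'a set" where
  "ideal_power A I 0 = carrier A"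
| "ideal_power A I (Suc r) = ideal_prod A I (ideal_power A I r)"

text \<open>The simplicial abelian group given degreewise by the \<open>r\<close>-th power of the augmentation ideal.\<close>

definition augmentation_power ::
  "('r, 'z) ring_scheme \<Rightarrow> 't lawvere \<Rightarrow> (nat \<Rightarrow> nat \<Rightarrow> (nat multiset \<Rightarrow> 'r) list \<Rightarrow> 't) \<Rightarrow>
   ('t, 'a) salg \<Rightarrow> (nat \<Rightarrow> nat \<Rightarrow> 'a \<Rightarrow> 't) \<Rightarrow> nat \<Rightarrow> 'a sgroup" where
  "augmentation_power R T \<kappa> A e r =
    \<lparr> Grp = (\<lambda>p. let U = underlying R T \<kappa> (Deg A p) in
                \<lparr> carrier = ideal_power U (augmentation_ideal R T \<kappa> A e p) r,
                  mult = add U,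
                  one = \<zero>\<^bsub>U\<^esub> \<rparr>),
      GStr = (\<lambda>p q \<theta>. Str A p q \<theta> 1) \<rparr>"

end

theory Submission
 imports Defs
begin

text \<open>
 Let \<open>I\<close> be the augmentation ideal of \<open>A\<close>, and call a simplicial ring with an ideal good if for all \<open>m\<close>
 the homotopy of the \<open>m\<close>-th power of the ideal vanishes below degree \<open>m\<close>. The path object \<open>PA\<close>, with
 \<open>A (p + 1)\<close> in degree \<open>p\<close>, is good, because it contracts to \<open>A 0\<close>, whose ideal is 0 as \<open>A\<close> is reduced. The algebra \<open>A\<close>
 is obtained from \<open>PA\<close> by killing the free generators of \<open>A (p + 1)\<close> that are not degenerate under \<open>s\<^sub>0\<close>,
 corrected so that \<open>d\<^sub>0\<close> vanishes on them. Each cell contributes a sphere \<open>W\<close> of such generators, and the cells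
 are killed one at a time. By the Fermat property a generator \<open>\<xi>\<close> is no zero divisor, and \<open>f - e f\<close> is a
 multiple of \<open>\<xi>\<close>, where \<open>e\<close> substitutes 0 for \<open>\<xi>\<close>. Therefore the Koszul complex of alternating tensors on \<open>W\<close>
 with coefficients in the powers of the ideal resolves the power of the ideal in the quotient. Alternating tensors preserve
 connectivity, so killing \<open>W\<close> preserves goodness; so do limits, since an element involves finitely many generators.
\<close>

section \<open>Homotopy of simplicial abelian groups\<close>

text \<open>The bounds fit exactly. In the Koszul complex for exponent m, the term with words of
  length n has coefficients in the power m - n, whose homotopy vanishes below m - n. Each step along
  the exact complex gains one degree, so the quotient again vanishes below m. The start is safe: for
  m > 0 the m-th power has no homotopy at all on the path object, and exponent 0 asks for nothing.
  The obstacle is that operators do not permute the variables. A variable of a cell goes to a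
  variable of the same cell or to 0 only modulo variables of earlier cells, since d_0 of its
  generator lies on the boundary of the cell. This dictates the order of killing. Quotients are
  modelled by normal forms, the image of the substitution of 0, rather than by cosets. Existence of
  Fermat quotients gives division by a variable, uniqueness its regularity. Both are applied to
  explicit free generators of each degree of A. As the universal properties speak of one test type,
  independence is tested on algebras of arrows, through cofree simplicial algebras.\<close>

lemma (in comm_group) comm_group_subgroup:
 assumes "subgroup H G" shows "comm_group (G\<lparr>carrier := H\<rparr>)"
 using assms by (intro group.group_comm_groupI subgroup_imp_group) (auto intro: m_comm dest: subgroup.mem_carrier)

definition coface :: "nat => nat => nat => nat" where
 "coface p i = (\<lambda>j\<in>{..p}. if j < i then j else Suc j)"

definition codegeneracy :: "nat => nat => nat => nat" where
 "codegeneracy p i = (\<lambda>j\<in>{..Suc p}. if j \<le> i then j else j - 1)"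

lemma coface_in [simp]: "i \<le> Suc p ==> coface p i \<in> delta p (Suc p)"
 by (auto simp: delta_def coface_def mono_on_def)

lemma codegeneracy_in [simp]: "i \<le> p ==> codegeneracy p i \<in> delta (Suc p) p"
 by (auto simp: delta_def codegeneracy_def mono_on_def)

lemma delta_comp [simp]: "\<theta> \<in> delta p q ==> \<psi> \<in> delta q r ==> compose {..p} \<psi> \<theta> \<in> delta p r"
 by (auto simp: delta_def compose_def mono_on_def PiE_def Pi_def extensional_def)

lemma delta_id [simp]: "restrict id {..p} \<in> delta p p"
 by (auto simp: delta_def mono_on_def)

lemma face_coface: "face G p i = GStr G p (Suc p) (coface p i)"
 by (simp add: face_def coface_def)

definition degen :: "'g sgroup => nat => nat => 'g => 'g" where
 "degen G p i = GStr G (Suc p) p (codegeneracy p i)"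

context simplicial_abelian_group
begin

sublocale Gp: comm_group "Grp G p" for p
 by (rule Grp)

lemma GStr_closed [simp]: "\<theta> \<in> delta p q ==> x \<in> carrier (Grp G q) ==> GStr G p q \<theta> x \<in> carrier (Grp G p)"
 using GStr_hom by (auto simp: hom_def)

lemma GStr_mult: "\<theta> \<in> delta p q ==> x \<in> carrier (Grp G q) ==> y \<in> carrier (Grp G q) ==>
  GStr G p q \<theta> (x \<otimes>\<^bsub>Grp G q\<^esub> y) = GStr G p q \<theta> x \<otimes>\<^bsub>Grp G p\<^esub> GStr G p q \<theta> y"
 using GStr_hom by (auto simp: hom_def)

lemma GStr_group_hom: "\<theta> \<in> delta p q ==> group_hom (Grp G q) (Grp G p) (GStr G p q \<theta>)"
 by (simp add: group_hom_def group_hom_axioms_def GStr_hom)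

lemma GStr_one: "\<theta> \<in> delta p q ==> GStr G p q \<theta> \<one>\<^bsub>Grp G q\<^esub> = \<one>\<^bsub>Grp G p\<^esub>"
 by (rule group_hom.hom_one[OF GStr_group_hom])

lemma GStr_inv: "\<theta> \<in> delta p q ==> x \<in> carrier (Grp G q) ==>
  GStr G p q \<theta> (inv\<^bsub>Grp G q\<^esub> x) = inv\<^bsub>Grp G p\<^esub> GStr G p q \<theta> x"
 by (rule group_hom.hom_inv[OF GStr_group_hom])

lemma face_closed [simp]: "i \<le> Suc p ==> x \<in> carrier (Grp G (Suc p)) ==> face G p i x \<in> carrier (Grp G p)"
 by (simp add: face_coface)

lemma face_mult: "i \<le> Suc p ==> x \<in> carrier (Grp G (Suc p)) ==> y \<in> carrier (Grp G (Suc p)) ==>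
  face G p i (x \<otimes>\<^bsub>Grp G (Suc p)\<^esub> y) = face G p i x \<otimes>\<^bsub>Grp G p\<^esub> face G p i y"
 by (simp add: face_coface GStr_mult)

lemma face_one: "i \<le> Suc p ==> face G p i \<one>\<^bsub>Grp G (Suc p)\<^esub> = \<one>\<^bsub>Grp G p\<^esub>"
 by (simp add: face_coface GStr_one)

lemma face_inv: "i \<le> Suc p ==> x \<in> carrier (Grp G (Suc p)) ==>
  face G p i (inv\<^bsub>Grp G (Suc p)\<^esub> x) = inv\<^bsub>Grp G p\<^esub> face G p i x"
 by (simp add: face_coface GStr_inv)

lemma degen_closed [simp]: "i \<le> p ==> x \<in> carrier (Grp G p) ==> degen G p i x \<in> carrier (Grp G (Suc p))"
 by (simp add: degen_def)

lemma degen_one: "i \<le> p ==> degen G p i \<one>\<^bsub>Grp G p\<^esub> = \<one>\<^bsub>Grp G (Suc p)\<^esub>"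
 by (simp add: degen_def GStr_one)

lemma face_face:
 assumes "i < j" "j \<le> Suc (Suc p)" "x \<in> carrier (Grp G (Suc (Suc p)))"
 shows "face G p i (face G (Suc p) j x) = face G p (j - 1) (face G (Suc p) i x)"
proof -
 have "compose {..p} (coface (Suc p) j) (coface p i) = compose {..p} (coface (Suc p) i) (coface p (j - 1))"
  using assms(1) by (auto simp: compose_def coface_def restrict_def fun_eq_iff)
 then show ?thesis
  using assms GStr_comp[of "coface p i" p "Suc p" "coface (Suc p) j" "Suc (Suc p)" x]
   GStr_comp[of "coface p (j - 1)" p "Suc p" "coface (Suc p) i" "Suc (Suc p)" x]
  by (simp add: face_coface)
qed

lemma face_degen_less:
 assumes "i < j" "j \<le> Suc p" "x \<in> carrier (Grp G (Suc p))"
 shows "face G (Suc p) i (degen G (Suc p) j x) = degen G p (j - 1) (face G p i x)"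
proof -
 have "compose {..Suc p} (codegeneracy (Suc p) j) (coface (Suc p) i) = compose {..Suc p} (coface p i) (codegeneracy p (j - 1))"
  using assms(1,2) by (auto simp: compose_def coface_def codegeneracy_def restrict_def fun_eq_iff)
 then show ?thesis
  using assms GStr_comp[of "coface (Suc p) i" "Suc p" "Suc (Suc p)" "codegeneracy (Suc p) j" "Suc p" x]
   GStr_comp[of "codegeneracy p (j - 1)" "Suc p" p "coface p i" "Suc p" x]
  by (simp add: face_coface degen_def)
qed

lemma face_degen_greater:
 assumes "Suc j < i" "i \<le> Suc (Suc p)" "x \<in> carrier (Grp G (Suc p))"
 shows "face G (Suc p) i (degen G (Suc p) j x) = degen G p j (face G p (i - 1) x)"
proof -
 have "compose {..Suc p} (codegeneracy (Suc p) j) (coface (Suc p) i) = compose {..Suc p} (coface p (i - 1)) (codegeneracy p j)"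
  using assms(1,2) by (auto simp: compose_def coface_def codegeneracy_def restrict_def fun_eq_iff)
 then show ?thesis
  using assms GStr_comp[of "coface (Suc p) i" "Suc p" "Suc (Suc p)" "codegeneracy (Suc p) j" "Suc p" x]
   GStr_comp[of "codegeneracy p j" "Suc p" p "coface p (i - 1)" "Suc p" x]
  by (simp add: face_coface degen_def)
qed

lemma face_degen_eq:
 assumes "i = j \<or> i = Suc j" "j \<le> p" "x \<in> carrier (Grp G p)"
 shows "face G p i (degen G p j x) = x"
proof -
 have "compose {..p} (codegeneracy p j) (coface p i) = restrict id {..p}"
  using assms(1,2) by (auto simp: compose_def coface_def codegeneracy_def restrict_def fun_eq_iff)
 then show ?thesis
  using assms GStr_comp[of "coface p i" p "Suc p" "codegeneracy p j" p x] GStr_id[of x p]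
  by (auto simp: face_coface degen_def)
qed

lemma moore_carrier: "moore G p \<subseteq> carrier (Grp G p)"
 by (cases p) auto

text \<open>Removes the special role of face 0 and of degree 0 from the recursive definition. With
  all faces treated alike, cycles are handled by the simplicial identities.\<close>

lemma moore_cycles_iff:
 "z \<in> moore_cycles G n \<longleftrightarrow> z \<in> carrier (Grp G n) \<and> (\<forall>k i. n = Suc k \<longrightarrow> i \<le> n \<longrightarrow> face G k i z = \<one>\<^bsub>Grp G k\<^esub>)"
proof (cases n)
 case (Suc k)
 have "(\<forall>i\<in>{1..Suc k}. P i) \<and> P 0 \<longleftrightarrow> (\<forall>i. i \<le> Suc k \<longrightarrow> P i)" for P :: "nat => bool"
  by (metis One_nat_def Suc_leI atLeastAtMost_iff bot_nat_0.extremum not_gr_zero)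
 from this[of "\<lambda>i. face G k i z = \<one>\<^bsub>Grp G k\<^esub>"] show ?thesis
  by (simp add: Suc)
qed simp

declare moore_cycles.simps [simp del]

lemma moore_cycles_carrier: "z \<in> moore_cycles G n ==> z \<in> carrier (Grp G n)"
 unfolding moore_cycles_iff by blast

lemma face_degen_cycle:
 assumes "z \<in> moore_cycles G n" "i \<le> Suc n" "j \<le> n"
 shows "face G n i (degen G n j z) = (if i = j \<or> i = Suc j then z else \<one>\<^bsub>Grp G n\<^esub>)"
proof -
 have z: "z \<in> carrier (Grp G n)"
  using assms(1) by (rule moore_cycles_carrier)
 consider "i = j \<or> i = Suc j" | "i < j" | "Suc j < i"
  by linarith
 then show ?thesis
 proof cases
  case 2
  then obtain k where "n = Suc k"
   using assms(3) by (cases n) auto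
  then show ?thesis
   using 2 assms z face_degen_less[of i j k z] degen_one[of "j - 1" k] by (auto simp: moore_cycles_iff)
 next
  case 3
  then obtain k where "n = Suc k"
   using assms(2) by (cases n) auto
  then show ?thesis
   using 3 assms z face_degen_greater[of j i k z] degen_one[of j k] by (auto simp: moore_cycles_iff)
 qed (use face_degen_eq[OF _ assms(3) z] in auto)
qed

text \<open>For a cycle \<open>a\<close>, the degeneracy \<open>degen G n j a\<close> has faces
  \<open>j\<close> and \<open>Suc j\<close> equal to \<open>a\<close> and all others trivial. Its
  difference from \<open>y\<close> therefore has the nontrivial face at \<open>j\<close> instead of
  \<open>Suc j\<close>, and the induction ends at face 0, where \<open>y\<close> is a Moore
  chain.\<close>

lemma single_face_boundary:
 assumes "y \<in> carrier (Grp G (Suc n))" "j \<le> Suc n" "a \<in> moore_cycles G n" "face G n j y = a"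
  and "\<And>i. i \<le> Suc n ==> i \<noteq> j ==> face G n i y = \<one>\<^bsub>Grp G n\<^esub>"
 shows "\<exists>y\<in>moore G (Suc n). face G n 0 y = a"
 using assms
proof (induction j arbitrary: y)
 case 0
 then show ?case
  by auto
next
 case (Suc j)
 have a: "a \<in> carrier (Grp G n)"
  using Suc.prems moore_cycles_carrier by blast
 define y' where "y' = degen G n j a \<otimes>\<^bsub>Grp G (Suc n)\<^esub> inv\<^bsub>Grp G (Suc n)\<^esub> y"
 have d: "face G n i y' = face G n i (degen G n j a) \<otimes>\<^bsub>Grp G n\<^esub> inv\<^bsub>Grp G n\<^esub> face G n i y" if "i \<le> Suc n" for i
  using that Suc.prems a by (simp add: y'_def face_mult face_inv)
 show ?case
 proof (rule Suc.IH[of y'])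
  show "y' \<in> carrier (Grp G (Suc n))"
   using Suc.prems a by (simp add: y'_def)
  show "face G n j y' = a"
   using Suc.prems a by (simp add: d face_degen_cycle)
  show "face G n i y' = \<one>\<^bsub>Grp G n\<^esub>" if "i \<le> Suc n" "i \<noteq> j" for i
   using that Suc.prems a by (cases "i = Suc j") (auto simp: d face_degen_cycle)
 qed (use Suc.prems in auto)
qed

lemma moore_cycles_subgroup: "subgroup (moore_cycles G n) (Grp G n)"
proof (rule Gp.subgroupI)
 have "\<one>\<^bsub>Grp G n\<^esub> \<in> moore_cycles G n"
  by (auto simp: moore_cycles_iff face_one)
 then show "moore_cycles G n \<noteq> {}"
  by blast
qed (auto simp: moore_cycles_iff face_mult face_inv)

lemma boundary_subgroup: "subgroup (face G n 0 ` moore G (Suc n)) (Grp G n)"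
proof -
 have "subgroup (moore G (Suc n)) (Grp G (Suc n))"
 proof (rule Gp.subgroupI)
  have "\<one>\<^bsub>Grp G (Suc n)\<^esub> \<in> moore G (Suc n)"
   by (auto simp: face_one)
  then show "moore G (Suc n) \<noteq> {}"
   by blast
 qed (auto simp: face_mult face_inv)
 moreover have "group_hom (Grp G (Suc n)) (Grp G n) (face G n 0)"
  by (simp add: face_coface GStr_group_hom)
 ultimately show ?thesis
  by (rule group_hom.subgroup_img_is_subgroup[rotated])
qed

lemma boundary_cycle:
 assumes "y \<in> moore G (Suc n)" shows "face G n 0 y \<in> moore_cycles G n"
proof -
 have "face G k i (face G (Suc k) 0 y) = \<one>\<^bsub>Grp G k\<^esub>" if "n = Suc k" "i \<le> n" for k i
 proof -
  have "face G k i (face G (Suc k) 0 y) = face G k 0 (face G (Suc k) (Suc i) y)"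
   using face_face[of 0 "Suc i" k y] that assms by auto
  also have "\<dots> = \<one>\<^bsub>Grp G k\<^esub>"
   using that assms face_one by auto
  finally show ?thesis .
 qed
 moreover have "face G n 0 y \<in> carrier (Grp G n)"
  using assms by simp
 ultimately show ?thesis
  unfolding moore_cycles_iff by blast
qed

text \<open>Dividing by \<open>degen G n j b\<close> cancels the face \<open>Suc j\<close> and turns
  the face \<open>j\<close> into the quotient of \<open>a\<close> by \<open>b\<close>, so only one
  face is left.\<close>

lemma two_face_boundary:
 assumes y: "y \<in> carrier (Grp G (Suc n))" and j: "j \<le> n"
  and a: "a \<in> moore_cycles G n" "face G n j y = a" and b: "b \<in> moore_cycles G n" "face G n (Suc j) y = b"
  and 1: "\<And>i. i \<le> Suc n ==> i \<noteq> j ==> i \<noteq> Suc j ==> face G n i y = \<one>\<^bsub>Grp G n\<^esub>"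
 shows "\<exists>y\<in>moore G (Suc n). face G n 0 y = a \<otimes>\<^bsub>Grp G n\<^esub> inv\<^bsub>Grp G n\<^esub> b"
proof (rule single_face_boundary)
 have c: "a \<in> carrier (Grp G n)" "b \<in> carrier (Grp G n)"
  using a(1) b(1) by (simp_all add: moore_cycles_carrier)
 let ?y = "y \<otimes>\<^bsub>Grp G (Suc n)\<^esub> inv\<^bsub>Grp G (Suc n)\<^esub> degen G n j b"
 show "?y \<in> carrier (Grp G (Suc n))"
  using y j c by simp
 have d: "face G n i ?y = face G n i y \<otimes>\<^bsub>Grp G n\<^esub> inv\<^bsub>Grp G n\<^esub> face G n i (degen G n j b)" if "i \<le> Suc n" for i
  using that y j c by (simp add: face_mult face_inv)
 show "face G n j ?y = a \<otimes>\<^bsub>Grp G n\<^esub> inv\<^bsub>Grp G n\<^esub> b"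
  using d[of j] j a b by (simp add: face_degen_cycle)
 show "face G n i ?y = \<one>\<^bsub>Grp G n\<^esub>" if i: "i \<le> Suc n" "i \<noteq> j" for i
 proof (cases "i = Suc j")
  case True
  then show ?thesis
   using d[of i] i j b c by (simp add: face_degen_cycle)
 next
  case False
  then show ?thesis
   using d[of i] i j 1[of i] b(1) by (simp add: face_degen_cycle)
 qed
 show "a \<otimes>\<^bsub>Grp G n\<^esub> inv\<^bsub>Grp G n\<^esub> b \<in> moore_cycles G n"
  using moore_cycles_subgroup a b by (simp add: subgroup.m_closed subgroup.m_inv_closed)
 show "j \<le> Suc n" using j by simp
qed

end

text \<open>The bound is strict. The \<open>m\<close>-th power of an ideal will be paired with
  \<open>acyclic_below m\<close>, which is vacuous for \<open>m = 0\<close>, where the power is the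
  whole ring. Connectivity \<open>n\<close> corresponds to \<open>Suc n\<close>.\<close>

definition acyclic_below :: "nat => 'g sgroup => bool" where
 "acyclic_below n G \<longleftrightarrow> (\<forall>j<n. \<forall>z\<in>moore_cycles G j. \<exists>y\<in>moore G (Suc j). face G j 0 y = z)"

lemma acyclic_belowE:
 assumes "acyclic_below n G" "j < n" "z \<in> moore_cycles G j"
 obtains y where "y \<in> moore G (Suc j)" "face G j 0 y = z"
 using assms unfolding acyclic_below_def by blast

lemma acyclic_below_0 [simp]: "acyclic_below 0 G"
 by (auto simp: acyclic_below_def)

lemma (in simplicial_abelian_group) connected_if_acyclic_below:
 assumes "acyclic_below (Suc n) G"
 shows "connected_simplicial_abelian_group n G"
 unfolding connected_simplicial_abelian_group_def
proof (intro conjI allI impI)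
 show "simplicial_abelian_group G"
  by (rule simplicial_abelian_group_axioms)
 fix p assume p: "p \<le> n"
 let ?Z = "(Grp G p)\<lparr>carrier := moore_cycles G p\<rparr>" and ?B = "face G p 0 ` moore G (Suc p)"
 have B: "?B = moore_cycles G p"
 proof (intro equalityI subsetI)
  fix z assume "z \<in> moore_cycles G p"
  then obtain y where "y \<in> moore G (Suc p)" "face G p 0 y = z"
   using assms p unfolding acyclic_below_def by (meson le_imp_less_Suc)
  then show "z \<in> ?B" by blast
 qed (use boundary_cycle in blast)
 interpret Z: comm_group ?Z
  by (simp add: Gp.comm_group_subgroup moore_cycles_subgroup)
 have "subgroup ?B ?Z"
  using Z.subgroup_self B by simp
 then have n: "?B \<lhd> ?Z"
  by (simp add: Z.subgroup_imp_normal)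
 have c: "?B #>\<^bsub>?Z\<^esub> a = ?B" if "a \<in> carrier ?Z" for a
  by (rule Z.coset_join2[OF that \<open>subgroup ?B ?Z\<close>]) (use that B in simp)
 have "carrier (?Z Mod ?B) = (\<lambda>a. ?B #>\<^bsub>?Z\<^esub> a) ` carrier ?Z"
  by (auto simp: FactGroup_def RCOSETS_def)
 also have "\<dots> = (\<lambda>a. ?B) ` carrier ?Z"
  by (rule image_cong[OF refl c])
 also have "\<dots> = {?B}"
  using Z.one_closed by blast
 finally have "carrier (?Z Mod ?B) = {?B}" .
 then show "trivial_group (homotopy_group G p)"
  using normal.factorgroup_is_group[OF n]
  by (simp add: homotopy_group_def trivial_group_def FactGroup_def)
qed

subsection \<open>Long exact sequences\<close>

definition sub_sgroup :: "'g sgroup => (nat => 'g set) => 'g sgroup" where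
 "sub_sgroup G C = \<lparr> Grp = (\<lambda>p. (Grp G p)\<lparr>carrier := C p\<rparr>), GStr = GStr G \<rparr>"

lemma sub_sgroup_simps [simp]:
 "carrier (Grp (sub_sgroup G C) p) = C p" "mult (Grp (sub_sgroup G C) p) = mult (Grp G p)"
 "one (Grp (sub_sgroup G C) p) = one (Grp G p)" "GStr (sub_sgroup G C) = GStr G"
 "face (sub_sgroup G C) = face G"
 by (auto simp: sub_sgroup_def face_def fun_eq_iff)

lemma (in simplicial_abelian_group) sub_sgroup:
 assumes "\<And>p. subgroup (C p) (Grp G p)"
  and "\<And>p q \<theta> x. \<theta> \<in> delta p q ==> x \<in> C q ==> GStr G p q \<theta> x \<in> C p"
 shows "simplicial_abelian_group (sub_sgroup G C)"
proof -
 have c: "x \<in> C p ==> x \<in> carrier (Grp G p)" for x p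
  using subgroup.mem_carrier[OF assms(1)] .
 show ?thesis
  by (rule simplicial_abelian_group.intro)
   (auto simp: sub_sgroup_def hom_def assms(2) GStr_mult GStr_id GStr_comp c intro!: Gp.comm_group_subgroup[OF assms(1)] GStr_comp)
qed

locale simplicial_hom = G: simplicial_abelian_group G + H: simplicial_abelian_group H
 for G :: "'g sgroup" and H :: "'h sgroup" +
 fixes f :: "nat => 'g => 'h"
 assumes f_hom: "f p \<in> hom (Grp G p) (Grp H p)"
  and f_natural: "\<theta> \<in> delta p q ==> x \<in> carrier (Grp G q) ==> f p (GStr G p q \<theta> x) = GStr H p q \<theta> (f q x)"
begin

lemma f_group_hom: "group_hom (Grp G p) (Grp H p) (f p)"
 by (simp add: group_hom_def group_hom_axioms_def f_hom)

lemma f_closed [simp]: "x \<in> carrier (Grp G p) ==> f p x \<in> carrier (Grp H p)"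
 using f_hom by (auto simp: hom_def)

lemma f_mult: "x \<in> carrier (Grp G p) ==> y \<in> carrier (Grp G p) ==> f p (x \<otimes>\<^bsub>Grp G p\<^esub> y) = f p x \<otimes>\<^bsub>Grp H p\<^esub> f p y"
 using f_hom by (auto simp: hom_def)

lemma f_one: "f p \<one>\<^bsub>Grp G p\<^esub> = \<one>\<^bsub>Grp H p\<^esub>"
 by (rule group_hom.hom_one[OF f_group_hom])

lemma f_inv: "x \<in> carrier (Grp G p) ==> f p (inv\<^bsub>Grp G p\<^esub> x) = inv\<^bsub>Grp H p\<^esub> f p x"
 by (rule group_hom.hom_inv[OF f_group_hom])

lemma f_face: "i \<le> Suc p ==> x \<in> carrier (Grp G (Suc p)) ==> f p (face G p i x) = face H p i (f (Suc p) x)"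
 by (simp add: face_coface f_natural)

lemma f_degen: "i \<le> p ==> x \<in> carrier (Grp G p) ==> f (Suc p) (degen G p i x) = degen H p i (f p x)"
 by (simp add: degen_def f_natural)

definition ker_sgroup :: "'g sgroup" where
 "ker_sgroup = sub_sgroup G (\<lambda>p. kernel (Grp G p) (Grp H p) (f p))"

lemma ker_sgroup_simps [simp]:
 "carrier (Grp ker_sgroup p) = kernel (Grp G p) (Grp H p) (f p)" "mult (Grp ker_sgroup p) = mult (Grp G p)"
 "one (Grp ker_sgroup p) = one (Grp G p)" "GStr ker_sgroup = GStr G"
 "face ker_sgroup = face G"
 by (auto simp: ker_sgroup_def)

lemma ker_sgroup_simplicial: "simplicial_abelian_group ker_sgroup"
 unfolding ker_sgroup_def
 by (rule G.sub_sgroup[OF group_hom.subgroup_kernel[OF f_group_hom]]) (auto simp: kernel_def f_natural H.GStr_one)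

sublocale K: simplicial_abelian_group ker_sgroup
 by (rule ker_sgroup_simplicial)

end

locale simplicial_surjection = simplicial_hom +
 assumes surj: "carrier (Grp H p) \<subseteq> f p ` carrier (Grp G p)"
begin

text \<open>Starting from any preimage, the faces are made trivial from the top index downwards. The
  correction \<open>?u\<close> is the degeneracy of the offending face. It maps to the unit because
  the faces of \<open>z\<close> with positive index vanish, and by the simplicial identities it
  leaves the faces already trivial untouched.\<close>

lemma moore_lift:
 assumes z: "z \<in> moore H n"
 obtains x where "x \<in> moore G n" "f n x = z"
proof (cases n)
 case 0
 then show ?thesis
  using z surj[of 0] that by force
next
 case (Suc k)
 have "\<exists>x\<in>carrier (Grp G (Suc k)). f (Suc k) x = z \<and> (\<forall>i. j < i \<longrightarrow> i \<le> Suc k \<longrightarrow> face G k i x = \<one>\<^bsub>Grp G k\<^esub>)"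
  if "j \<le> Suc k" for j
  using that
 proof (induction j rule: inc_induct)
  case base
  then show ?case
   using surj[of n] z Suc H.moore_carrier by force
 next
  case (step j)
  then obtain x where x: "x \<in> carrier (Grp G (Suc k))" "f (Suc k) x = z"
    "\<And>i. Suc j < i ==> i \<le> Suc k ==> face G k i x = \<one>\<^bsub>Grp G k\<^esub>"
   by auto
  let ?u = "degen G k j (face G k (Suc j) x)"
  let ?x = "x \<otimes>\<^bsub>Grp G (Suc k)\<^esub> inv\<^bsub>Grp G (Suc k)\<^esub> ?u"
  have jk: "j \<le> k" using step by simp
  have u: "?u \<in> carrier (Grp G (Suc k))" using x jk by simp
  have fz: "f k (face G k (Suc j) x) = \<one>\<^bsub>Grp H k\<^esub>"
   using x z Suc jk by (simp add: f_face)
  have "f (Suc k) ?u = \<one>\<^bsub>Grp H (Suc k)\<^esub>"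
   using x jk fz by (simp add: f_degen H.degen_one)
  then have 1: "f (Suc k) ?x = z"
   using x u H.moore_carrier z Suc by (simp add: f_mult f_inv)
  have "face G k i ?x = \<one>\<^bsub>Grp G k\<^esub>" if i: "j < i" "i \<le> Suc k" for i
  proof (cases "i = Suc j")
   case True
   then show ?thesis
    using x u jk by (simp add: G.face_mult G.face_inv G.face_degen_eq)
  next
   case False
   then obtain l where l: "k = Suc l"
    using i jk by (cases k) auto
   have "face G k i ?u = degen G l j (face G l (i - 1) (face G (Suc l) (Suc j) x))"
    using G.face_degen_greater[of j i l "face G k (Suc j) x"] False i l x jk by simp
   also have "face G l (i - 1) (face G (Suc l) (Suc j) x) = face G l (Suc j) (face G (Suc l) i x)"
    using G.face_face[of "Suc j" i l x] False i l x by simp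
   also have "\<dots> = \<one>\<^bsub>Grp G l\<^esub>"
    using x(3)[of i] False i l G.face_one[of "Suc j" l] by simp
   finally have "face G k i ?u = \<one>\<^bsub>Grp G k\<^esub>"
    using l False i G.degen_one[of j l] by simp
   then show ?thesis
    using x(1) x(3)[of i] False i u by (simp add: G.face_mult G.face_inv)
  qed
  then show ?case
   using 1 x u by (intro bexI[of _ ?x]) auto
 qed
 from this[of 0] obtain x where "x \<in> carrier (Grp G (Suc k))" "f (Suc k) x = z"
   "\<forall>i. 0 < i \<longrightarrow> i \<le> Suc k \<longrightarrow> face G k i x = \<one>\<^bsub>Grp G k\<^esub>"
  by blast
 then show ?thesis
  using that[of x] Suc by simp
qed

text \<open>The stretch pi_j(G) -> pi_j(H) -> pi_{j-1}(ker) of the long exact sequence. A Moore lift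
  of a cycle has its boundary in the kernel, and bounding it there corrects the lift to a cycle of
  \<open>G\<close>. Degree 0 asks nothing of the kernel, whence the truncated
  \<open>n - 1\<close>.\<close>

lemma acyclic_below_quotient:
 assumes G: "acyclic_below n G" and K: "acyclic_below (n - 1) ker_sgroup"
 shows "acyclic_below n H"
 unfolding acyclic_below_def
proof (intro allI impI ballI)
 fix j z assume j: "j < n" and z: "z \<in> moore_cycles H j"
 have "z \<in> moore H j"
  using z by (cases j) (auto simp: moore_cycles.simps)
 then obtain x where x: "x \<in> moore G j" "f j x = z"
  by (rule moore_lift)
 have "\<exists>x\<in>moore_cycles G j. f j x = z"
 proof (cases j)
  case 0
  then show ?thesis using x by (auto simp: moore_cycles.simps)
 next
  case (Suc k)
  have xc: "x \<in> carrier (Grp G (Suc k))"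
   using x G.moore_carrier Suc by auto
  have "face G k 0 x \<in> moore_cycles ker_sgroup k"
   using G.boundary_cycle[of x k] x Suc z xc
   by (auto simp: G.moore_cycles_iff K.moore_cycles_iff kernel_def f_face H.moore_cycles_iff)
  moreover have "k < n - 1"
   using j Suc by simp
  ultimately obtain y where y: "y \<in> moore ker_sgroup (Suc k)" "face G k 0 y = face G k 0 x"
   using acyclic_belowE[OF K] by (metis ker_sgroup_simps(5))
  have yc: "y \<in> carrier (Grp G (Suc k))" and fy: "f (Suc k) y = \<one>\<^bsub>Grp H (Suc k)\<^esub>"
   using y K.moore_carrier[of "Suc k"] by (auto simp: kernel_def)
  have fyi: "face G k i y = \<one>\<^bsub>Grp G k\<^esub>" if "1 \<le> i" "i \<le> Suc k" for i
   using y that by auto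
  let ?x = "x \<otimes>\<^bsub>Grp G (Suc k)\<^esub> inv\<^bsub>Grp G (Suc k)\<^esub> y"
  have xi: "face G k i x = \<one>\<^bsub>Grp G k\<^esub>" if "1 \<le> i" "i \<le> Suc k" for i
   using x that Suc by auto
  have "face G k i ?x = \<one>\<^bsub>Grp G k\<^esub>" if "i \<le> Suc k" for i
   using that xc yc y(2) xi[of i] fyi[of i] by (cases "i = 0") (auto simp: G.face_mult G.face_inv)
  then have "?x \<in> moore_cycles G j"
   using Suc xc yc by (auto simp: G.moore_cycles_iff)
  moreover have "f j ?x = z"
   using xc yc fy x(2) z Suc by (simp add: f_mult f_inv H.moore_cycles_iff)
  ultimately show ?thesis by blast
 qed
 then obtain x where x: "x \<in> moore_cycles G j" "f j x = z"
  by auto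
 obtain y where y: "y \<in> moore G (Suc j)" "face G j 0 y = x"
  by (rule acyclic_belowE[OF G j x(1)])
 then have "f (Suc j) y \<in> moore H (Suc j)"
  by (auto simp: f_face[symmetric] f_one)
 moreover have "face H j 0 (f (Suc j) y) = z"
  using y x by (auto simp: f_face[symmetric])
 ultimately show "\<exists>y\<in>moore H (Suc j). face H j 0 y = z"
  by blast
qed

text \<open>The stretch pi_{j+1}(H) -> pi_j(ker) -> pi_j(G). A chain of \<open>G\<close> that bounds
  a cycle of the kernel maps to a cycle of \<open>H\<close>. Bounding that one, lifting by
  \<open>moore_lift\<close> and subtracting the boundary of the lift moves the chain into the
  kernel.\<close>

lemma acyclic_below_kernel:
 assumes G: "acyclic_below n G" and H: "acyclic_below (Suc n) H"
 shows "acyclic_below n ker_sgroup"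
 unfolding acyclic_below_def
proof (intro allI impI ballI)
 fix j z assume j: "j < n" and z: "z \<in> moore_cycles ker_sgroup j"
 then have zG: "z \<in> moore_cycles G j" and fz: "f j z = \<one>\<^bsub>Grp H j\<^esub>"
  by (auto simp: G.moore_cycles_iff K.moore_cycles_iff kernel_def)
 obtain y where y: "y \<in> moore G (Suc j)" "face G j 0 y = z"
  by (rule acyclic_belowE[OF G j zG])
 then have yc: "y \<in> carrier (Grp G (Suc j))" and yi: "\<And>i. 1 \<le> i ==> i \<le> Suc j ==> face G j i y = \<one>\<^bsub>Grp G j\<^esub>"
  by auto
 have "face H j i (f (Suc j) y) = \<one>\<^bsub>Grp H j\<^esub>" if "i \<le> Suc j" for i
  using that y fz yc yi[of i] by (cases "i = 0") (auto simp: f_face[symmetric] f_one)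
 then have "f (Suc j) y \<in> moore_cycles H (Suc j)"
  using yc unfolding H.moore_cycles_iff by auto
 then obtain u where u: "u \<in> moore H (Suc (Suc j))" "face H (Suc j) 0 u = f (Suc j) y"
  using H j unfolding acyclic_below_def by (metis Suc_mono)
 obtain v where v: "v \<in> moore G (Suc (Suc j))" "f (Suc (Suc j)) v = u"
  using moore_lift[OF u(1)] by blast
 let ?w = "face G (Suc j) 0 v" and ?y = "y \<otimes>\<^bsub>Grp G (Suc j)\<^esub> inv\<^bsub>Grp G (Suc j)\<^esub> face G (Suc j) 0 v"
 have vc: "v \<in> carrier (Grp G (Suc (Suc j)))" using v by auto
 have w: "?w \<in> moore_cycles G (Suc j)"
  using G.boundary_cycle[OF v(1)] .
 have wc: "?w \<in> carrier (Grp G (Suc j))" using vc by simp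
 have wi: "face G j i ?w = \<one>\<^bsub>Grp G j\<^esub>" if "i \<le> Suc j" for i
  using w that unfolding G.moore_cycles_iff by blast
 have fw: "f (Suc j) ?w = f (Suc j) y"
  using vc v u by (simp add: f_face)
 have "?y \<in> moore ker_sgroup (Suc j)"
  using wc yc fw yi wi by (auto simp: kernel_def f_mult f_inv G.face_mult G.face_inv)
 moreover have "face ker_sgroup j 0 ?y = z"
  using wc yc wi[of 0] y zG by (simp add: G.face_mult G.face_inv G.moore_cycles_iff)
 ultimately show "\<exists>y\<in>moore ker_sgroup (Suc j). face ker_sgroup j 0 y = z"
  by blast
qed

end

subsection \<open>Contractions\<close>

text \<open>The index \<open>j\<close> stands for the simplex of \<open>\<Delta>\<^sup>1\<close> that sends exactly \<open>0, \<dots>, j - 1\<close> to the vertex 0; \<open>h\<close> is a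
 simplicial homotopy from 0 to the identity.\<close>

lemma (in simplicial_abelian_group) acyclic_if_homotopy:
 assumes h_closed: "\<And>p j x. j \<le> Suc p ==> x \<in> carrier (Grp G p) ==> h p j x \<in> carrier (Grp G p)"
  and h_one: "\<And>p j. j \<le> Suc p ==> h p j \<one>\<^bsub>Grp G p\<^esub> = \<one>\<^bsub>Grp G p\<^esub>"
  and h_0: "\<And>p x. x \<in> carrier (Grp G p) ==> h p 0 x = x"
  and h_Suc: "\<And>p x. x \<in> carrier (Grp G p) ==> h p (Suc p) x = \<one>\<^bsub>Grp G p\<^esub>"
  and h_natural: "\<And>p q \<theta> j x. \<theta> \<in> delta p q ==> j \<le> Suc q ==> x \<in> carrier (Grp G q) ==>
    GStr G p q \<theta> (h q j x) = h p (card {l\<in>{..p}. \<theta> l < j}) (GStr G p q \<theta> x)"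
 shows "acyclic_below n G"
 unfolding acyclic_below_def
proof (intro allI impI ballI)
 fix m z assume z: "z \<in> moore_cycles G m"
 have zc: "z \<in> carrier (Grp G m)"
  using z by (rule moore_cycles_carrier)
 have cut: "card {l\<in>{..p}. coface p i l < j} = (if j \<le> i then j else j - 1)" if "j \<le> Suc (Suc p)" "i \<le> Suc p" for p i j
 proof -
  have "{l\<in>{..p}. coface p i l < j} = {..<(if j \<le> i then j else j - 1)}"
   using that by (auto simp: coface_def)
  then show ?thesis by simp
 qed
 have face_h: "face G p i (h (Suc p) j x) = h p (if j \<le> i then j else j - 1) (face G p i x)"
  if "j \<le> Suc (Suc p)" "i \<le> Suc p" "x \<in> carrier (Grp G (Suc p))" for p i j x
  unfolding face_coface by (subst h_natural) (use that cut[of j p i] in auto)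
 have cycle: "h m j z \<in> moore_cycles G m" if "j \<le> Suc m" for j
 proof -
  have "face G k i (h m j z) = \<one>\<^bsub>Grp G k\<^esub>" if "m = Suc k" "i \<le> m" for k i
   using that \<open>j \<le> Suc m\<close> z face_h[of j k i z] h_one[of "if j \<le> i then j else j - 1" k] unfolding moore_cycles_iff
   by (cases "j \<le> i") auto
  then show ?thesis
   using h_closed[OF that zc] by (simp add: moore_cycles_iff)
 qed
 interpret B: subgroup "face G m 0 ` moore G (Suc m)" "Grp G m"
  by (rule boundary_subgroup)
 have step: "h m j z \<otimes>\<^bsub>Grp G m\<^esub> inv\<^bsub>Grp G m\<^esub> h m (Suc j) z \<in> face G m 0 ` moore G (Suc m)" if j: "j \<le> m" for j
 proof -
  \<comment> \<open>One simplex of the prism over the cycle \<open>z\<close>: its faces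
    \<open>j\<close> and \<open>Suc j\<close> are \<open>h m j z\<close> and
    \<open>h m (Suc j) z\<close>, the others are trivial. The differences telescope from
    \<open>z\<close> at 0 to the unit at \<open>Suc m\<close>.\<close>
  let ?y = "h (Suc m) (Suc j) (degen G m j z)"
  have f: "face G m i ?y = h m (if Suc j \<le> i then Suc j else j) (face G m i (degen G m j z))" if "i \<le> Suc m" for i
   using that j zc by (simp add: face_h)
  have "\<exists>y\<in>moore G (Suc m). face G m 0 y = h m j z \<otimes>\<^bsub>Grp G m\<^esub> inv\<^bsub>Grp G m\<^esub> h m (Suc j) z"
   by (rule two_face_boundary[where y = ?y and j = j])
    (use j zc z h_one in \<open>auto simp: f cycle h_closed face_degen_cycle\<close>)
  then show ?thesis by (metis imageI)
 qed
 have "z \<otimes>\<^bsub>Grp G m\<^esub> inv\<^bsub>Grp G m\<^esub> h m j z \<in> face G m 0 ` moore G (Suc m)" if "j \<le> Suc m" for j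
  using that
 proof (induction j)
  case 0
  then show ?case
   using B.one_closed zc by (simp add: h_0)
 next
  case (Suc j)
  have c: "h m j z \<in> carrier (Grp G m)" "h m (Suc j) z \<in> carrier (Grp G m)"
   using Suc.prems h_closed zc by auto
  have "z \<otimes>\<^bsub>Grp G m\<^esub> inv\<^bsub>Grp G m\<^esub> h m (Suc j) z =
    (z \<otimes>\<^bsub>Grp G m\<^esub> inv\<^bsub>Grp G m\<^esub> h m j z) \<otimes>\<^bsub>Grp G m\<^esub> (h m j z \<otimes>\<^bsub>Grp G m\<^esub> inv\<^bsub>Grp G m\<^esub> h m (Suc j) z)"
   using c zc by (simp add: Gp.m_assoc Gp.inv_solve_left)
  then show ?case
   using Suc step[of j] B.m_closed by simp
 qed
 from this[of "Suc m"] show "\<exists>y\<in>moore G (Suc m). face G m 0 y = z"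
  using zc h_Suc by auto
qed

section \<open>Decalage (join with a new initial vertex) and based paths\<close>

definition shift :: "nat => (nat => nat) => nat => nat" where
 "shift p \<theta> = (\<lambda>i\<in>{..Suc p}. case i of 0 => 0 | Suc j => Suc (\<theta> j))"

lemma shift_in [simp]: "\<theta> \<in> delta p q ==> shift p \<theta> \<in> delta (Suc p) (Suc q)"
 by (auto simp: delta_def shift_def mono_on_def split: nat.split)

lemma shift_id: "shift p (restrict id {..p}) = restrict id {..Suc p}"
 by (auto simp: shift_def fun_eq_iff split: nat.split)

lemma shift_comp: "\<theta> \<in> delta p q ==> shift p (compose {..p} \<psi> \<theta>) = compose {..Suc p} (shift q \<psi>) (shift p \<theta>)"
 by (auto simp: shift_def delta_def compose_def fun_eq_iff split: nat.split)

lemma coface_0_natural: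
 "\<theta> \<in> delta p q ==> compose {..p} (coface q 0) \<theta> = compose {..p} (shift p \<theta>) (coface p 0)"
 by (auto simp: shift_def delta_def coface_def compose_def fun_eq_iff)

definition base_vertex :: "nat => nat" where
 "base_vertex = (\<lambda>i\<in>{..0}. 0)"

definition path_sgroup :: "'g sgroup => 'g sgroup" where
 "path_sgroup G = \<lparr> Grp = (\<lambda>p. Grp G (Suc p)), GStr = (\<lambda>p q \<theta>. GStr G (Suc p) (Suc q) (shift p \<theta>)) \<rparr>"

text \<open>The simplices of the decalage whose initial vertex is 0. With the projection
  \<open>face G p 0\<close> and the loop object as kernel this is the path fibration that shifts
  degrees. The decalage contracts to the group in degree 0 only, whereas this part contracts to
  0.\<close>

definition based_paths :: "'g sgroup => 'g sgroup" where
 "based_paths G = sub_sgroup (path_sgroup G)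
   (\<lambda>p. kernel (Grp G (Suc p)) (Grp G 0) (GStr G 0 (Suc p) base_vertex))"

lemma vertex_in [simp]: "base_vertex \<in> delta 0 q"
 by (auto simp: base_vertex_def delta_def mono_on_def)

lemma based_paths_simps [simp]:
 "carrier (Grp (based_paths G) p) = kernel (Grp G (Suc p)) (Grp G 0) (GStr G 0 (Suc p) base_vertex)"
 "mult (Grp (based_paths G) p) = mult (Grp G (Suc p))"
 "one (Grp (based_paths G) p) = one (Grp G (Suc p))"
 "GStr (based_paths G) p q \<theta> = GStr G (Suc p) (Suc q) (shift p \<theta>)"
 by (auto simp: based_paths_def path_sgroup_def)

text \<open>The contraction of \<open>based_paths\<close> moves the vertices before \<open>j\<close> to the base vertex.\<close>

definition collapse :: "nat => nat => nat => nat" where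
 "collapse p j = (\<lambda>i\<in>{..Suc p}. if i \<le> j then 0 else i)"

lemma collapse_in [simp]: "collapse p j \<in> delta (Suc p) (Suc p)"
 by (auto simp: delta_def collapse_def mono_on_def)

text \<open>As \<open>\<theta>\<close> is monotone, the positions that it sends below
  \<open>j\<close> form an initial segment, which is known by its length. That length is the cut-off
  that \<open>acyclic_if_homotopy\<close> asks for.\<close>

lemma collapse_natural:
 assumes \<theta>: "\<theta> \<in> delta p q"
 shows "compose {..Suc p} (collapse q j) (shift p \<theta>) =
     compose {..Suc p} (shift p \<theta>) (collapse p (card {l\<in>{..p}. \<theta> l < j}))"
proof
 fix i
 define D where "D = {l\<in>{..p}. \<theta> l < j}"
 have mono: "a \<le> b ==> b \<le> p ==> \<theta> a \<le> \<theta> b" and val: "b \<le> p ==> \<theta> b \<le> q" for a b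
  using \<theta> by (auto simp: delta_def mono_on_def)
 have D: "l \<in> D \<longleftrightarrow> l < card D" if "l \<le> p" for l
 proof
  assume "l \<in> D"
  then have "{..l} \<subseteq> D"
   using mono[of _ l] that by (fastforce simp: D_def)
  then have "card {..l} \<le> card D"
   by (rule card_mono[rotated]) (simp add: D_def)
  then show "l < card D" by simp
 next
  assume "l < card D"
  show "l \<in> D"
  proof (rule ccontr)
   assume "l \<notin> D"
   have "a < l" if a: "a \<in> D" for a
   proof (rule ccontr)
    assume "\<not> a < l"
    then have "\<theta> l \<le> \<theta> a"
     using a by (intro mono) (auto simp: D_def)
    then show False
     using a \<open>l \<notin> D\<close> \<open>l \<le> p\<close> by (auto simp: D_def)
   qed
   then have "D \<subseteq> {..<l}"
    by blast
   then have "card D \<le> card {..<l}"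
    by (rule card_mono[rotated]) simp
   then show False using \<open>l < card D\<close> by simp
  qed
 qed
 show "compose {..Suc p} (collapse q j) (shift p \<theta>) i = compose {..Suc p} (shift p \<theta>) (collapse p (card D)) i"
 proof (cases i)
  case 0
  then show ?thesis by (simp add: compose_def collapse_def shift_def)
 next
  case (Suc l)
  show ?thesis
  proof (cases "l \<le> p")
   case True
   then have "\<theta> l < j \<longleftrightarrow> l < card D"
    using D[OF True] by (auto simp: D_def)
   then show ?thesis
    using Suc True val[OF True] by (auto simp: compose_def collapse_def shift_def)
  qed (simp add: Suc compose_def)
 qed
qed

context simplicial_abelian_group
begin

lemma path_sgroup: "simplicial_abelian_group (path_sgroup G)"
 by (rule simplicial_abelian_group.intro)
  (simp_all add: path_sgroup_def Grp GStr_hom shift_id GStr_id shift_comp GStr_comp)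

lemma based_paths: "simplicial_abelian_group (based_paths G)"
proof -
 interpret P: simplicial_abelian_group "path_sgroup G"
  by (rule path_sgroup)
 have base: "compose {..0} (shift p \<theta>) base_vertex = base_vertex" for p \<theta>
  by (auto simp: base_vertex_def compose_def shift_def fun_eq_iff)
 show ?thesis
  unfolding based_paths_def
 proof (rule P.sub_sgroup)
  fix p
  show "subgroup (kernel (Grp G (Suc p)) (Grp G 0) (GStr G 0 (Suc p) base_vertex)) (Grp (path_sgroup G) p)"
   using group_hom.subgroup_kernel[OF GStr_group_hom[OF vertex_in[of "Suc p"]]] by (simp add: path_sgroup_def)
 next
  fix p q \<theta> x
  assume \<theta>: "\<theta> \<in> delta p q" and x: "x \<in> kernel (Grp G (Suc q)) (Grp G 0) (GStr G 0 (Suc q) base_vertex)"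
  then have "GStr G 0 (Suc p) base_vertex (GStr G (Suc p) (Suc q) (shift p \<theta>) x) = \<one>\<^bsub>Grp G 0\<^esub>"
   using GStr_comp[OF vertex_in[of "Suc p"] shift_in[OF \<theta>], of x] base[of p \<theta>] by (simp add: kernel_def)
  then show "GStr (path_sgroup G) p q \<theta> x \<in> kernel (Grp G (Suc p)) (Grp G 0) (GStr G 0 (Suc p) base_vertex)"
   using x \<theta> by (simp add: path_sgroup_def kernel_def)
 qed
qed

lemma based_paths_proj: "simplicial_hom (based_paths G) G (\<lambda>p. face G p 0)"
proof -
 interpret P: simplicial_abelian_group "based_paths G"
  by (rule based_paths)
 show ?thesis
 proof
  show "face G p 0 \<in> hom (Grp (based_paths G) p) (Grp G p)" for p
   by (auto simp: hom_def kernel_def face_mult)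
  show "face G p 0 (GStr (based_paths G) p q \<theta> x) = GStr G p q \<theta> (face G q 0 x)"
   if "\<theta> \<in> delta p q" "x \<in> carrier (Grp (based_paths G) q)" for p q \<theta> x
   using that coface_0_natural[OF that(1)] GStr_comp[of "coface p 0" p "Suc p" "shift p \<theta>" "Suc q" x]
    GStr_comp[of \<theta> p q "coface q 0" "Suc q" x]
   by (simp add: kernel_def face_coface)
 qed
qed

text \<open>A simplex \<open>y\<close> is lifted to \<open>s\<^sub>0 y\<close>, corrected by degeneracies of a path from 0 to its first vertex.\<close>

lemma based_paths_surj:
 assumes "acyclic_below (Suc n) G"
 shows "simplicial_surjection (based_paths G) G (\<lambda>p. face G p 0)"
proof -
 interpret P: simplicial_hom "based_paths G" G "\<lambda>p. face G p 0"
  by (rule based_paths_proj)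
 show ?thesis
 proof
  fix p
  show "carrier (Grp G p) \<subseteq> face G p 0 ` carrier (Grp (based_paths G) p)"
  proof
   fix y assume y: "y \<in> carrier (Grp G p)"
   let ?v = "GStr G 0 p base_vertex y"
   have v: "?v \<in> carrier (Grp G 0)"
    using y by simp
   then have "?v \<in> moore_cycles G 0"
    by (simp add: moore_cycles_iff)
   then obtain e where "e \<in> moore G 1" and e0: "face G 0 0 e = ?v"
    by (rule acyclic_belowE[OF assms zero_less_Suc]) auto
   then have e: "e \<in> carrier (Grp G (Suc 0))" and e1: "face G 0 (Suc 0) e = \<one>\<^bsub>Grp G 0\<^esub>"
    by auto
   define k where "k = (\<lambda>i\<in>{..Suc p}. 0 :: nat)"
   define l where "l = (\<lambda>i\<in>{..Suc p}. if i = 0 then 0 else 1 :: nat)"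
   have k: "k \<in> delta (Suc p) 0" and l: "l \<in> delta (Suc p) (Suc 0)"
    by (auto simp: delta_def k_def l_def mono_on_def)
   \<comment> \<open>At the base vertex the three factors are \<open>?v\<close>, the inverse of
     \<open>?v\<close> and the unit, since \<open>e\<close> runs from 0 to \<open>?v\<close>. Under
     face 0 the last two become mutually inverse constants, and \<open>y\<close> remains.\<close>
   let ?x = "degen G p 0 y \<otimes>\<^bsub>Grp G (Suc p)\<^esub> (inv\<^bsub>Grp G (Suc p)\<^esub> GStr G (Suc p) 0 k ?v \<otimes>\<^bsub>Grp G (Suc p)\<^esub> GStr G (Suc p) (Suc 0) l e)"
   have x: "?x \<in> carrier (Grp G (Suc p))"
    using y v e k l by simp
   have "compose {..p} l (coface p 0) = compose {..p} (coface 0 0) (compose {..p} k (coface p 0))"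
    by (auto simp: compose_def l_def k_def coface_def fun_eq_iff)
   then have "face G p 0 (GStr G (Suc p) (Suc 0) l e) = GStr G p (Suc 0) (compose {..p} (coface 0 0) (compose {..p} k (coface p 0))) e"
    using GStr_comp[of "coface p 0" p "Suc p" l "Suc 0" e] l e by (simp add: face_coface)
   also have "\<dots> = GStr G p 0 (compose {..p} k (coface p 0)) ?v"
    using delta_comp[OF coface_in k, of 0] GStr_comp[of "compose {..p} k (coface p 0)" p 0 "coface 0 0" "Suc 0" e] k e e0
    by (simp add: face_coface)
   also have "\<dots> = face G p 0 (GStr G (Suc p) 0 k ?v)"
    using GStr_comp[of "coface p 0" p "Suc p" k 0 ?v] k v by (simp add: face_coface)
   finally have "face G p 0 ?x = y"
    using y v e k l by (simp add: face_mult face_inv face_degen_eq)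
   moreover have "?x \<in> carrier (Grp (based_paths G) p)"
   proof -
    let ?z = base_vertex
    have 1: "GStr G 0 (Suc p) ?z (degen G p 0 y) = ?v"
    proof -
     have "compose {..0} (codegeneracy p 0) ?z = ?z"
      by (auto simp: base_vertex_def compose_def codegeneracy_def fun_eq_iff)
     then show ?thesis
      using GStr_comp[of ?z 0 "Suc p" "codegeneracy p 0" p y] y by (simp add: degen_def)
    qed
    have 2: "GStr G 0 (Suc p) ?z (GStr G (Suc p) 0 k ?v) = ?v"
    proof -
     have "compose {..0} k ?z = restrict id {..0}"
      by (auto simp: base_vertex_def compose_def k_def fun_eq_iff)
     then show ?thesis
      using GStr_comp[of ?z 0 "Suc p" k 0 ?v] v k GStr_id[OF v] by simp
    qed
    have 3: "GStr G 0 (Suc p) ?z (GStr G (Suc p) (Suc 0) l e) = \<one>\<^bsub>Grp G 0\<^esub>"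
    proof -
     have "compose {..0} l ?z = coface 0 (Suc 0)"
      by (auto simp: base_vertex_def compose_def l_def coface_def fun_eq_iff)
     then show ?thesis
      using GStr_comp[of ?z 0 "Suc p" l "Suc 0" e] e e1 l by (simp add: face_coface)
    qed
    have "GStr G 0 (Suc p) ?z ?x = \<one>\<^bsub>Grp G 0\<^esub>"
     using y v e k l by (simp add: GStr_mult GStr_inv 1 2 3)
    then show ?thesis
     using x by (simp add: kernel_def)
   qed
   ultimately show "y \<in> face G p 0 ` carrier (Grp (based_paths G) p)"
    by force
  qed
 qed
qed

end

section \<open>Alternating tensors\<close>

text \<open>Orbits of a sign-reversing involution cancel in pairs. Fixed points are assumed trivial
  separately, because an element equal to its inverse may be 2-torsion.\<close>

lemma (in comm_group) finprod_involution:
 assumes "finite A" "\<And>x. x \<in> A ==> f x \<in> carrier G" "\<And>x. x \<in> A ==> s x \<in> A" "\<And>x. x \<in> A ==> s (s x) = x"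
  and "\<And>x. x \<in> A ==> f (s x) = inv f x" "\<And>x. x \<in> A ==> s x = x ==> f x = \<one>"
 shows "finprod G f A = \<one>"
 using assms
proof (induction "card A" arbitrary: A rule: less_induct)
 case less
 show ?case
 proof (cases "A = {}")
  case False
  then obtain x where x: "x \<in> A" by blast
  let ?B = "A - {x, s x}"
  have "finprod G f ?B = \<one>"
  proof (rule less.hyps)
   show "card ?B < card A"
    using x less.prems(1) by (intro psubset_card_mono) auto
   show "s y \<in> ?B" if "y \<in> ?B" for y
    using that x less.prems(3,4) by (metis Diff_iff insert_iff singleton_iff)
  qed (use less.prems in auto)
  moreover have "finprod G f A = finprod G f {x, s x} \<otimes> finprod G f ?B"
   using x less.prems by (subst finprod_Un_disjoint[symmetric]) (auto simp: Un_absorb1 insert_absorb intro!: arg_cong[of _ _ "finprod G f"])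
  moreover have "finprod G f {x, s x} = \<one>"
   using x less.prems by (cases "s x = x") (auto simp: insert_absorb)
  ultimately show ?thesis by simp
 qed simp
qed

lemma (in group_hom) hom_finprod:
 assumes "comm_group G" "comm_group H" "g \<in> A \<rightarrow> carrier G"
 shows "h (finprod G g A) = finprod H (\<lambda>x. h (g x)) A"
proof -
 interpret G: comm_group G by fact
 interpret H: comm_group H by fact
 show ?thesis
  using assms(3)
 proof (induction A rule: infinite_finite_induct)
  case (insert x A)
  then have "g x \<in> carrier G" "g \<in> A \<rightarrow> carrier G" "(\<lambda>x. h (g x)) \<in> A \<rightarrow> carrier H" "h (g x) \<in> carrier H"
   by (auto simp: Pi_iff)
  then show ?case
   using insert by (simp add: hom_mult)
 qed auto
qed

lemma (in comm_group) finprod_subgroup: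
 assumes "subgroup H G" "g \<in> A \<rightarrow> H"
 shows "finprod (G\<lparr>carrier := H\<rparr>) g A = finprod G g A" "finprod G g A \<in> H"
proof -
 interpret H: comm_group "G\<lparr>carrier := H\<rparr>"
  by (rule comm_group_subgroup[OF assms(1)])
 have "H \<subseteq> carrier G"
  by (rule subgroup.subset[OF assms(1)])
 show "finprod (G\<lparr>carrier := H\<rparr>) g A = finprod G g A"
  using assms(2)
 proof (induction A rule: infinite_finite_induct)
  case (insert x A)
  then have "g x \<in> H" "g x \<in> carrier G" "g \<in> A \<rightarrow> H" "g \<in> A \<rightarrow> carrier G"
   using \<open>H \<subseteq> carrier G\<close> by auto
  then show ?case
   using insert by simp
 qed auto
 then show "finprod G g A \<in> H"
  using H.finprod_closed[of g A] assms(2) by simp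
qed

definition words :: "nat => 'w set => 'w list set" where
 "words n W = {ws. length ws = n \<and> set ws \<subseteq> W}"

lemma finite_words [simp]: "finite W ==> finite (words n W)"
 using finite_lists_length_eq[of W n] by (simp add: words_def conj_commute)

lemma words_Cons [simp]: "w # ws \<in> words (Suc n) W \<longleftrightarrow> w \<in> W \<and> ws \<in> words n W"
 by (auto simp: words_def)

definition swap_at :: "nat => 'w list => 'w list" where
 "swap_at k ws = take k ws @ ws ! Suc k # ws ! k # drop (Suc (Suc k)) ws"

lemma split_at:
 assumes "Suc k < length ws"
 shows "ws = take k ws @ ws ! k # ws ! Suc k # drop (Suc (Suc k)) ws"
 using assms by (metis Cons_nth_drop_Suc Suc_lessD append_take_drop_id)

lemma swap_at_append [simp]: "swap_at (length us) (us @ x # y # vs) = us @ y # x # vs"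
 by (simp add: swap_at_def nth_append)

lemma length_swap_at: "Suc k < length ws ==> length (swap_at k ws) = length ws"
 by (simp add: swap_at_def)

lemma swap_at_swap_at: "Suc k < length ws ==> swap_at k (swap_at k ws) = ws"
 using split_at[of k ws] swap_at_append[of "take k ws"]
 by (metis Suc_lessD length_take min.absorb4)

lemma map_swap_at: "Suc k < length ws ==> map f (swap_at k ws) = swap_at k (map f ws)"
 by (simp add: swap_at_def take_map drop_map)

lemma set_swap_at: "Suc k < length ws ==> set (swap_at k ws) = set ws"
 by (subst (2) split_at[of k ws]) (auto simp: swap_at_def)

text \<open>For finite \<open>W\<close> these are the elements of the tensor product of
  \<open>G\<close> with the \<open>n\<close>-th exterior power of the free abelian group on
  \<open>W\<close>, encoded by their coefficients on all words. No order on \<open>W\<close> has to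
  be chosen. The condition on equal neighbours is separate because of 2-torsion.\<close>

definition alt :: "nat => 'w set => ('g, 'z) monoid_scheme => ('w list => 'g) set" where
 "alt n W G = {a. (\<forall>ws. a ws \<in> carrier G) \<and> (\<forall>ws. ws \<notin> words n W \<longrightarrow> a ws = \<one>\<^bsub>G\<^esub>) \<and>
   (\<forall>us x y vs. a (us @ x # y # vs) = inv\<^bsub>G\<^esub> a (us @ y # x # vs)) \<and>
   (\<forall>us x vs. a (us @ x # x # vs) = \<one>\<^bsub>G\<^esub>)}"

definition alt_group :: "nat => 'w set => ('g, 'z) monoid_scheme => ('w list => 'g) monoid" where
 "alt_group n W G = \<lparr>carrier = alt n W G, mult = (\<lambda>a b ws. a ws \<otimes>\<^bsub>G\<^esub> b ws), one = (\<lambda>ws. \<one>\<^bsub>G\<^esub>)\<rparr>"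

lemma alt_group_simps [simp]:
 "carrier (alt_group n W G) = alt n W G" "(a \<otimes>\<^bsub>alt_group n W G\<^esub> b) ws = a ws \<otimes>\<^bsub>G\<^esub> b ws"
 "\<one>\<^bsub>alt_group n W G\<^esub> = (\<lambda>ws. \<one>\<^bsub>G\<^esub>)"
 by (auto simp: alt_group_def)

lemma altI:
 assumes "\<And>ws. a ws \<in> carrier G" "\<And>ws. ws \<notin> words n W ==> a ws = \<one>\<^bsub>G\<^esub>"
  "\<And>us x y vs. a (us @ x # y # vs) = inv\<^bsub>G\<^esub> a (us @ y # x # vs)"
  "\<And>us x vs. a (us @ x # x # vs) = \<one>\<^bsub>G\<^esub>"
 shows "a \<in> alt n W G"
 using assms unfolding alt_def by blast

lemma alt_closed: "a \<in> alt n W G ==> a ws \<in> carrier G"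
 and alt_outside: "a \<in> alt n W G ==> ws \<notin> words n W ==> a ws = \<one>\<^bsub>G\<^esub>"
 and alt_swap: "a \<in> alt n W G ==> a (us @ x # y # vs) = inv\<^bsub>G\<^esub> a (us @ y # x # vs)"
 and alt_repeat: "a \<in> alt n W G ==> a (us @ x # x # vs) = \<one>\<^bsub>G\<^esub>"
 unfolding alt_def by blast+

lemma alt_swap_at: "a \<in> alt n W G ==> Suc k < length ws ==> a (swap_at k ws) = inv\<^bsub>G\<^esub> a ws"
 using alt_swap[of a n W G "take k ws" "ws ! Suc k" "ws ! k" "drop (Suc (Suc k)) ws"] split_at[of k ws]
 by (simp add: swap_at_def)

lemma alt_repeat_at: "a \<in> alt n W G ==> Suc k < length ws ==> ws ! k = ws ! Suc k ==> a ws = \<one>\<^bsub>G\<^esub>"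
 using alt_repeat[of a n W G "take k ws" "ws ! k" "drop (Suc (Suc k)) ws"] split_at[of k ws] by simp

context comm_group
begin

lemma alt_const_one: "(\<lambda>ws. \<one>) \<in> alt n W G"
 by (rule altI) auto

lemma alt_mult:
 assumes a: "a \<in> alt n W G" and b: "b \<in> alt n W G"
 shows "(\<lambda>ws. a ws \<otimes> b ws) \<in> alt n W G"
proof (rule altI)
 show "a (us @ x # y # vs) \<otimes> b (us @ x # y # vs) = inv (a (us @ y # x # vs) \<otimes> b (us @ y # x # vs))" for us x y vs
  using alt_swap[OF a, of us x y vs] alt_swap[OF b, of us x y vs] alt_closed[OF a] alt_closed[OF b]
  by (simp add: inv_mult)
qed (use alt_closed[OF a] alt_closed[OF b] alt_outside[OF a] alt_outside[OF b] alt_repeat[OF a] alt_repeat[OF b] in auto)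

lemma alt_inv:
 assumes a: "a \<in> alt n W G"
 shows "(\<lambda>ws. inv a ws) \<in> alt n W G"
proof (rule altI)
 show "inv a (us @ x # y # vs) = inv (inv a (us @ y # x # vs))" for us x y vs
  using alt_swap[OF a, of us x y vs] by simp
qed (use alt_closed[OF a] alt_outside[OF a] alt_repeat[OF a] in auto)

lemma alt_group: "comm_group (alt_group n W G)"
proof (rule comm_groupI)
 show "\<exists>b\<in>carrier (alt_group n W G). b \<otimes>\<^bsub>alt_group n W G\<^esub> a = \<one>\<^bsub>alt_group n W G\<^esub>"
  if "a \<in> carrier (alt_group n W G)" for a
  using that alt_inv[of a n W] by (intro bexI[of _ "\<lambda>ws. inv a ws"]) (auto simp: alt_group_def alt_closed)
qed (auto simp: alt_group_def alt_const_one alt_mult alt_closed m_assoc intro!: ext intro: m_comm)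

lemma alt_move:
 assumes a: "a \<in> alt n W G" and b: "b \<in> alt n W G" and "\<And>ws. a (v # ws) = b (v # ws)"
 shows "a (us @ v # vs) = b (us @ v # vs)"
proof (induction us arbitrary: vs rule: rev_induct)
 case (snoc u us)
 then show ?case
  using alt_swap[OF a, of us u v vs] alt_swap[OF b, of us u v vs] by simp
qed (use assms in simp)

lemma alt_repeated:
 assumes a: "a \<in> alt n W G" and "v \<in> set ws"
 shows "a (v # ws) = \<one>"
proof -
 obtain us vs where ws: "ws = us @ v # vs"
  using assms(2) by (auto simp: in_set_conv_decomp)
 have "a ((v # us) @ v # vs) = \<one>"
 proof (induction us arbitrary: vs rule: rev_induct)
  case Nil
  then show ?case
   using alt_repeat[OF a, of "[]"] by simp
 next
  case (snoc u us)
  then show ?case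
   using alt_swap[OF a, of "v # us" u v vs] by simp
 qed
 then show ?thesis
  by (simp add: ws)
qed

text \<open>Adjacent transpositions bring a letter \<open>v\<close> to the front, and a second
  \<open>v\<close> makes the value trivial. So an element splits into its values on words without
  \<open>v\<close> and on words \<open>v # ws\<close>: an exterior power of
  \<open>insert v W\<close> is the sum of two exterior powers of \<open>W\<close>. This drives the
  inductions over letters.\<close>

lemma alt_eqI:
 assumes a: "a \<in> alt (Suc n) (insert v W) G" and b: "b \<in> alt (Suc n) (insert v W) G"
  and 1: "\<And>ws. ws \<in> words (Suc n) W ==> a ws = b ws"
  and 2: "\<And>ws. ws \<in> words n W ==> a (v # ws) = b (v # ws)"
 shows "a = b"
proof
 fix ws
 have v: "a (v # ws) = b (v # ws)" for ws
 proof (cases "v \<in> set ws \<or> ws \<notin> words n (insert v W)")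
  case True
  then show ?thesis
   using alt_repeated[OF a, of v ws] alt_repeated[OF b, of v ws] alt_outside[OF a] alt_outside[OF b]
   by (metis words_Cons)
 next
  case False
  then show ?thesis
   by (intro 2) (auto simp: words_def)
 qed
 show "a ws = b ws"
 proof (cases "v \<in> set ws")
  case True
  then obtain us vs where "ws = us @ v # vs"
   by (auto simp: in_set_conv_decomp)
  then show ?thesis
   using alt_move[OF a b v] by simp
 next
  case False
  then show ?thesis
   using 1[of ws] alt_outside[OF a, of ws] alt_outside[OF b, of ws] by (fastforce simp: words_def)
 qed
qed

end

text \<open>The coefficients of the wedge of \<open>v\<close> with \<open>c\<close>: the letter
  \<open>v\<close> is moved to the front, each letter passed inverts the value, and a second
  \<open>v\<close> makes it trivial.\<close>

primrec slot :: "('g, 'z) monoid_scheme => 'w => ('w list => 'g) => 'w list => 'g" where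
 "slot G v c [] = \<one>\<^bsub>G\<^esub>"
| "slot G v c (x # ws) =
   (if x = v then if v \<in> set ws then \<one>\<^bsub>G\<^esub> else c ws else inv\<^bsub>G\<^esub> slot G v (\<lambda>us. c (x # us)) ws)"

text \<open>Inverse to the splitting of \<open>alt_eqI\<close>: \<open>b\<close> plus the wedge of
  \<open>v\<close> with \<open>c\<close>, for a letter \<open>v\<close> that does not occur in
  \<open>b\<close> and \<open>c\<close>.\<close>

definition alt_ext :: "('g, 'z) monoid_scheme => 'w => ('w list => 'g) => ('w list => 'g) => 'w list => 'g" where
 "alt_ext G v b c ws = (if v \<in> set ws then slot G v c ws else b ws)"

context comm_group
begin

lemma slot_closed: "(\<And>ws. c ws \<in> carrier G) ==> slot G v c ws \<in> carrier G"
 by (induction ws arbitrary: c) auto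

lemma slot_one: "slot G v (\<lambda>ws. \<one>) ws = \<one>"
 by (induction ws) auto

lemma slot_inv: "(\<And>ws. c ws \<in> carrier G) ==> slot G v (\<lambda>ws. inv c ws) ws = inv slot G v c ws"
proof (induction ws arbitrary: c)
 case (Cons x ws)
 then show ?case
  using Cons.IH[of "\<lambda>us. c (x # us)"] by simp
qed simp

lemma slot_support:
 assumes "slot G v c ws \<noteq> \<one>"
 shows "\<exists>us vs. ws = us @ v # vs \<and> c (us @ vs) \<noteq> \<one>"
 using assms
proof (induction ws arbitrary: c)
 case (Cons x ws)
 show ?case
 proof (cases "x = v")
  case True
  then show ?thesis
   using Cons.prems by (intro exI[of _ "[]"] exI[of _ ws]) (auto split: if_splits)
 next
  case False
  then have "slot G v (\<lambda>us. c (x # us)) ws \<noteq> \<one>"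
   using Cons.prems by auto
  from Cons.IH[OF this] show ?thesis
   by (metis append_Cons)
 qed
qed simp

lemma slot_swap:
 assumes "\<And>ws. c ws \<in> carrier G" "\<And>us x y vs. c (us @ x # y # vs) = inv c (us @ y # x # vs)"
  "\<And>us x vs. c (us @ x # x # vs) = \<one>"
 shows "slot G v c (us @ x # y # vs) = inv slot G v c (us @ y # x # vs)"
 using assms
proof (induction us arbitrary: c)
 case Nil
 have "slot G v (\<lambda>us. c (x # y # us)) vs = slot G v (\<lambda>us. inv c (y # x # us)) vs"
  using Nil(2)[of "[]" x y] by simp
 then have "slot G v (\<lambda>us. c (x # y # us)) vs = inv slot G v (\<lambda>us. c (y # x # us)) vs"
  using Nil(1) by (simp add: slot_inv)
 then show ?case
  using Nil(1) by (auto simp: slot_closed)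
next
 case (Cons u us)
 have "slot G v (\<lambda>ws. c (u # ws)) (us @ x # y # vs) = inv slot G v (\<lambda>ws. c (u # ws)) (us @ y # x # vs)"
 proof (rule Cons.IH)
  show "c (u # us @ x # y # vs) = inv c (u # us @ y # x # vs)" for us x y vs
   using Cons.prems(2)[of "u # us" x y vs] by simp
  show "c (u # us @ x # x # vs) = \<one>" for us x vs
   using Cons.prems(3)[of "u # us" x vs] by simp
 qed (rule Cons.prems(1))
 then show ?case
  using Cons.prems(1) Cons.prems(2)[of us x y vs] slot_closed[of "\<lambda>ws. c (u # ws)"] by auto
qed

lemma slot_repeat:
 assumes "\<And>ws. c ws \<in> carrier G" "\<And>us x vs. c (us @ x # x # vs) = \<one>"
 shows "slot G v c (us @ x # x # vs) = \<one>"
 using assms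
proof (induction us arbitrary: c)
 case Nil
 then show ?case
  using Nil(2)[of "[]" x] by (auto simp: slot_one)
next
 case (Cons u us)
 have "slot G v (\<lambda>ws. c (u # ws)) (us @ x # x # vs) = \<one>"
  by (rule Cons.IH) (use Cons.prems(1) Cons.prems(2)[of "u # _"] in auto)
 then show ?case
  using Cons.prems(2)[of us x vs] by auto
qed

lemma alt_ext:
 assumes b: "b \<in> alt (Suc n) W G" and c: "c \<in> alt n W G"
 shows "alt_ext G v b c \<in> alt (Suc n) (insert v W) G"
proof -
 note c' = alt_closed[OF c] alt_swap[OF c] alt_repeat[OF c]
 have "alt_ext G v b c ws = \<one>" if "ws \<notin> words (Suc n) (insert v W)" for ws
 proof (rule ccontr)
  assume *: "alt_ext G v b c ws \<noteq> \<one>"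
  have "b ws = \<one>"
   by (rule alt_outside[OF b]) (use that in \<open>auto simp: words_def\<close>)
  then have "slot G v c ws \<noteq> \<one>"
   using * by (auto simp: alt_ext_def split: if_splits)
  from slot_support[OF this] obtain us vs where ws: "ws = us @ v # vs" "c (us @ vs) \<noteq> \<one>"
   by blast
  then have "us @ vs \<in> words n W"
   using alt_outside[OF c] by blast
  then show False
   using that ws(1) by (auto simp: words_def)
 qed
 moreover have "alt_ext G v b c (us @ x # y # vs) = inv alt_ext G v b c (us @ y # x # vs)" for us x y vs
 proof (cases "v \<in> set (us @ x # y # vs)")
  case True
  then show ?thesis
   using slot_swap[of c v us x y vs, OF c'] by (auto simp: alt_ext_def)
 next
  case False
  then show ?thesis
   using alt_swap[OF b, of us x y vs] by (auto simp: alt_ext_def)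
 qed
 moreover have "alt_ext G v b c (us @ x # x # vs) = \<one>" for us x vs
  using slot_repeat[of c v us x vs, OF c'(1,3)] alt_repeat[OF b] by (simp add: alt_ext_def)
 moreover have "alt_ext G v b c ws \<in> carrier G" for ws
  using slot_closed[of c v ws, OF c'(1)] alt_closed[OF b] by (simp add: alt_ext_def)
 ultimately show ?thesis
  by (intro altI)
qed

lemma alt_ext_words: "v \<notin> W ==> ws \<in> words n W ==> alt_ext G v b c ws = b ws"
 by (auto simp: alt_ext_def words_def)

lemma alt_ext_Cons: "v \<notin> W ==> ws \<in> words n W ==> alt_ext G v b c (v # ws) = c ws"
 by (auto simp: alt_ext_def words_def)

lemma alt_restrict:
 assumes a: "a \<in> alt n W G"
 shows "(\<lambda>ws. if ws \<in> words n V then a ws else \<one>) \<in> alt n V G"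
proof (rule altI)
 have "us @ x # y # vs \<in> words n V \<longleftrightarrow> us @ y # x # vs \<in> words n V" for us vs x y
  by (auto simp: words_def)
 then show "(if us @ x # y # vs \<in> words n V then a (us @ x # y # vs) else \<one>) =
   inv (if us @ y # x # vs \<in> words n V then a (us @ y # x # vs) else \<one>)" for us x y vs
  using alt_swap[OF a, of us x y vs] by simp
qed (use alt_closed[OF a] alt_repeat[OF a] in auto)

lemma alt_slice:
 assumes a: "a \<in> alt (Suc n) W G"
 shows "(\<lambda>ws. if ws \<in> words n V then a (v # ws) else \<one>) \<in> alt n V G"
proof (rule altI)
 have "us @ x # y # vs \<in> words n V \<longleftrightarrow> us @ y # x # vs \<in> words n V" for us vs x y
  by (auto simp: words_def)
 then show "(if us @ x # y # vs \<in> words n V then a (v # us @ x # y # vs) else \<one>) =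
   inv (if us @ y # x # vs \<in> words n V then a (v # us @ y # x # vs) else \<one>)" for us x y vs
  using alt_swap[OF a, of "v # us" x y vs] by simp
 show "(if us @ x # x # vs \<in> words n V then a (v # us @ x # x # vs) else \<one>) = \<one>" for us x vs
  using alt_repeat[OF a, of "v # us" x vs] by simp
qed (use alt_closed[OF a] in auto)

lemma alt_comp:
 assumes "group_hom G H f" and a: "a \<in> alt n W G"
 shows "f \<circ> a \<in> alt n W H"
proof -
 interpret f: group_hom G H f by fact
 show ?thesis
 proof (rule altI)
  show "(f \<circ> a) (us @ x # y # vs) = inv\<^bsub>H\<^esub> (f \<circ> a) (us @ y # x # vs)" for us x y vs
   using alt_swap[OF a, of us x y vs] alt_closed[OF a] by simp
 qed (use alt_closed[OF a] alt_outside[OF a] alt_repeat[OF a] in auto)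
qed

text \<open>Preimages chosen word by word would not alternate. Splitting off one letter after the
  other leads to word length 0, a single value at the empty word, or to an empty alphabet, where
  everything is trivial.\<close>

lemma alt_lift:
 assumes "group_hom G H f" "comm_group H" and surj: "carrier H \<subseteq> f ` carrier G"
  and "finite W" "b \<in> alt n W H"
 shows "\<exists>a\<in>alt n W G. f \<circ> a = b"
proof -
 interpret f: group_hom G H f by fact
 interpret H: comm_group H by fact
 have 0: "\<exists>a\<in>alt 0 W G. f \<circ> a = b" if "b \<in> alt 0 W H" for W b
 proof -
  have b: "b ws \<in> carrier H" "ws \<noteq> [] ==> b ws = \<one>\<^bsub>H\<^esub>" for ws
   using alt_closed[OF that] alt_outside[OF that, of ws] by (auto simp: words_def)
  obtain g where g: "b [] = f g" "g \<in> carrier G"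
   by (rule imageE[OF subsetD[OF surj b(1)]])
  let ?a = "\<lambda>ws. if ws = [] then g else \<one>"
  have "f \<circ> ?a = b"
   using b g by (auto simp: fun_eq_iff)
  moreover have "?a \<in> alt 0 W G"
   using g by (auto simp: alt_def words_def)
  ultimately show ?thesis by blast
 qed
 show ?thesis
  using assms(4,5)
 proof (induction W arbitrary: n b rule: finite_induct)
  case empty
  show ?case
  proof (cases n)
   case (Suc m)
   then have "b = (\<lambda>ws. \<one>\<^bsub>H\<^esub>)"
    using alt_outside[OF empty] by (auto simp: fun_eq_iff words_def)
   then show ?thesis
    using alt_const_one[of n "{}"] by (intro bexI[of _ "\<lambda>ws. \<one>"]) auto
  qed (use 0 empty in blast)
 next
  case (insert v W)
  show ?case
  proof (cases n)
   case (Suc m)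
   have b: "b \<in> alt (Suc m) (insert v W) H"
    using insert.prems Suc by simp
   obtain a where a: "a \<in> alt (Suc m) W G" "f \<circ> a = (\<lambda>ws. if ws \<in> words (Suc m) W then b ws else \<one>\<^bsub>H\<^esub>)"
    using insert.IH[OF H.alt_restrict[OF b]] by blast
   obtain c where c: "c \<in> alt m W G" "f \<circ> c = (\<lambda>ws. if ws \<in> words m W then b (v # ws) else \<one>\<^bsub>H\<^esub>)"
    using insert.IH[OF H.alt_slice[OF b]] by blast
   have e: "alt_ext G v a c \<in> alt (Suc m) (insert v W) G"
    by (rule alt_ext[OF a(1) c(1)])
   have "f \<circ> alt_ext G v a c = b"
   proof (rule H.alt_eqI[OF alt_comp[OF assms(1) e] b])
    fix ws assume ws: "ws \<in> words (Suc m) W"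
    then show "(f \<circ> alt_ext G v a c) ws = b ws"
     using fun_cong[OF a(2), of ws] insert.hyps by (simp add: alt_ext_words)
   next
    fix ws assume ws: "ws \<in> words m W"
    then show "(f \<circ> alt_ext G v a c) (v # ws) = b (v # ws)"
     using fun_cong[OF c(2), of ws] insert.hyps by (simp add: alt_ext_Cons)
   qed
   then show ?thesis
    using e Suc by blast
  qed (use 0 insert.prems in blast)
 qed
qed

end

section \<open>Alternating tensors on a finite simplicial pointed set\<close>

locale pointed_family =
 fixes W :: "nat => 'w set" and Op :: "nat => nat => (nat => nat) => 'w => 'w option"
 assumes fin [simp]: "finite (W p)"
  and Op_in: "\<theta> \<in> delta p q ==> w \<in> W q ==> Op p q \<theta> w = Some v ==> v \<in> W p"
  and Op_id: "w \<in> W p ==> Op p p (restrict id {..p}) w = Some w"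
  and Op_comp: "\<theta> \<in> delta p q ==> \<psi> \<in> delta q r ==> w \<in> W r ==>
     Op p r (compose {..p} \<psi> \<theta>) w = Option.bind (Op q r \<psi> w) (Op p q \<theta>)"
begin

text \<open>\<open>None\<close> is the base point, so a word with a letter that is sent there lies
  in no fibre. Chains modulo the base point push forward by summing over these fibres.\<close>

definition fibre :: "nat => nat => (nat => nat) => nat => 'w list => 'w list set" where
 "fibre p q \<theta> n vs = {ws \<in> words n (W q). map (Op p q \<theta>) ws = map Some vs}"

lemma finite_fibre [simp]: "finite (fibre p q \<theta> n vs)"
 by (rule finite_subset[of _ "words n (W q)"]) (auto simp: fibre_def)

lemma fibre_outside:
 assumes "\<theta> \<in> delta p q" "vs \<notin> words n (W p)"
 shows "fibre p q \<theta> n vs = {}"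
proof (rule ccontr)
 assume "fibre p q \<theta> n vs \<noteq> {}"
 then obtain ws where ws: "ws \<in> words n (W q)" and m: "map (Op p q \<theta>) ws = map Some vs"
  by (auto simp: fibre_def)
 have "v \<in> W p" if "v \<in> set vs" for v
 proof -
  have "Some v \<in> Op p q \<theta> ` set ws"
   using that m by (metis imageI list.set_map)
  then show ?thesis
   using ws Op_in[OF assms(1)] by (auto simp: words_def)
 qed
 then show False
  using assms(2) ws map_eq_imp_length_eq[OF m] by (auto simp: words_def)
qed

lemma fibre_length: "ws \<in> fibre p q \<theta> n vs ==> length ws = length vs"
 unfolding fibre_def using map_eq_imp_length_eq by blast

lemma fibre_swap:
 assumes "ws \<in> fibre p q \<theta> n (us @ x # y # vs)"
 shows "swap_at (length us) ws \<in> fibre p q \<theta> n (us @ y # x # vs)"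
proof -
 let ?k = "length us"
 have k: "Suc ?k < length ws"
  using fibre_length[OF assms] by simp
 have "map (Op p q \<theta>) (swap_at ?k ws) = swap_at ?k (map Some (us @ x # y # vs))"
  using assms k by (simp add: map_swap_at fibre_def)
 also have "\<dots> = map Some (us @ y # x # vs)"
  using swap_at_append[of "us @ x # y # vs"] map_swap_at[of ?k "us @ x # y # vs" Some] by simp
 finally show ?thesis
  using assms k by (auto simp: fibre_def words_def set_swap_at length_swap_at)
qed

lemma fibre_swap_image:
 "fibre p q \<theta> n (us @ y # x # vs) = swap_at (length us) ` fibre p q \<theta> n (us @ x # y # vs)"
proof (intro equalityI subsetI)
 fix ws assume ws: "ws \<in> fibre p q \<theta> n (us @ y # x # vs)"
 then have "swap_at (length us) (swap_at (length us) ws) = ws"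
  by (intro swap_at_swap_at) (use fibre_length[OF ws] in simp)
 then show "ws \<in> swap_at (length us) ` fibre p q \<theta> n (us @ x # y # vs)"
  using fibre_swap[OF ws] by (metis imageI)
qed (use fibre_swap in blast)

text \<open>The degreewise tensor product of \<open>G\<close> with the \<open>n\<close>-th exterior
  power of the reduced integral chains on \<open>W\<close>. An operator acts on coefficients and
  letters at once.\<close>

definition alt_sgroup :: "nat => 'g sgroup => ('w list => 'g) sgroup" where
 "alt_sgroup n G = \<lparr> Grp = (\<lambda>p. alt_group n (W p) (Grp G p)),
   GStr = (\<lambda>p q \<theta> a vs. finprod (Grp G p) (\<lambda>ws. GStr G p q \<theta> (a ws)) (fibre p q \<theta> n vs)) \<rparr>"

lemma alt_sgroup_simps [simp]:
 "Grp (alt_sgroup n G) p = alt_group n (W p) (Grp G p)"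
 "GStr (alt_sgroup n G) p q \<theta> a vs = finprod (Grp G p) (\<lambda>ws. GStr G p q \<theta> (a ws)) (fibre p q \<theta> n vs)"
 by (auto simp: alt_sgroup_def)

end

context simplicial_abelian_group
begin

abbreviation vertices_to_base ("\<rho>") where
 "\<rho> p j \<equiv> GStr G (Suc p) (Suc p) (collapse p j)"

lemma collapse_hom:
 "group_hom (Grp (based_paths G) p) (Grp (based_paths G) p) (\<rho> p j)"
proof -
 interpret P: simplicial_abelian_group "based_paths G"
  by (rule based_paths)
 have "compose {..0} (collapse p j) base_vertex = base_vertex"
  by (auto simp: base_vertex_def collapse_def compose_def fun_eq_iff)
 then have "GStr G 0 (Suc p) base_vertex (\<rho> p j x) = GStr G 0 (Suc p) base_vertex x"
  if "x \<in> carrier (Grp G (Suc p))" for x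
  using GStr_comp[OF vertex_in collapse_in that, of j] by simp
 then have "\<rho> p j \<in> hom (Grp (based_paths G) p) (Grp (based_paths G) p)"
  by (auto simp: hom_def kernel_def GStr_mult)
 then show ?thesis
  by (simp add: group_hom_def group_hom_axioms_def P.Gp.is_group del: based_paths_simps)
qed

lemma collapse_0:
 assumes "x \<in> carrier (Grp (based_paths G) p)"
 shows "\<rho> p 0 x = x"
proof -
 have "collapse p 0 = restrict id {..Suc p}"
  by (auto simp: collapse_def fun_eq_iff)
 then show ?thesis
  using assms by (simp add: GStr_id kernel_def)
qed

lemma collapse_last:
 assumes "x \<in> carrier (Grp (based_paths G) p)"
 shows "\<rho> p (Suc p) x = \<one>\<^bsub>Grp G (Suc p)\<^esub>"
proof -
 have x: "x \<in> carrier (Grp G (Suc p))" "GStr G 0 (Suc p) base_vertex x = \<one>\<^bsub>Grp G 0\<^esub>"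
  using assms by (auto simp: kernel_def)
 have z: "(\<lambda>i\<in>{..Suc p}. 0) \<in> delta (Suc p) 0"
  by (auto simp: delta_def mono_on_def)
 have "collapse p (Suc p) = compose {..Suc p} base_vertex (\<lambda>i\<in>{..Suc p}. 0)"
  by (auto simp: collapse_def base_vertex_def compose_def fun_eq_iff)
 then show ?thesis
  using GStr_comp[OF z vertex_in x(1)] GStr_one[OF z] x(2) by simp
qed

lemma collapse_GStr:
 assumes "\<theta> \<in> delta p q" "x \<in> carrier (Grp (based_paths G) q)"
 shows "GStr (based_paths G) p q \<theta> (\<rho> q j x) =
  \<rho> p (card {l \<in> {..p}. \<theta> l < j}) (GStr (based_paths G) p q \<theta> x)"
 using GStr_comp[OF shift_in[OF assms(1)] collapse_in, of x j]
  GStr_comp[OF collapse_in shift_in[OF assms(1)], of x "card {l \<in> {..p}. \<theta> l < j}"]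
  collapse_natural[OF assms(1), of j] assms(2) by (simp add: kernel_def)

lemma based_paths_acyclic: "acyclic_below m (based_paths G)"
proof -
 interpret P: simplicial_abelian_group "based_paths G"
  by (rule based_paths)
 show ?thesis
 proof (rule P.acyclic_if_homotopy[where h = \<rho>])
  show "\<rho> p j x \<in> carrier (Grp (based_paths G) p)"
   if "x \<in> carrier (Grp (based_paths G) p)" for p j x
   using group_hom.hom_closed[OF collapse_hom that] .
  show "\<rho> p j \<one>\<^bsub>Grp (based_paths G) p\<^esub> = \<one>\<^bsub>Grp (based_paths G) p\<^esub>" for p j
   by (rule group_hom.hom_one[OF collapse_hom])
  show "\<rho> p (Suc p) x = \<one>\<^bsub>Grp (based_paths G) p\<^esub>"
   if "x \<in> carrier (Grp (based_paths G) p)" for p x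
   using collapse_last[OF that] by simp
 qed (use collapse_0 collapse_GStr in blast)+
qed

end

locale alt_simplicial = pointed_family W Op + simplicial_abelian_group G
 for W :: "nat => 'w set" and Op and G :: "'g sgroup"
begin

text \<open>Swapping two neighbouring letters carries one fibre to another and inverts the summands.
  Over a word with equal neighbours it is an involution of the fibre, and a word fixed by it has
  equal neighbours itself, hence trivial coefficient.\<close>

lemma push_alt:
 assumes \<theta>: "\<theta> \<in> delta p q" and a: "a \<in> alt n (W q) (Grp G q)"
 shows "GStr (alt_sgroup n G) p q \<theta> a \<in> alt n (W p) (Grp G p)"
proof -
 let ?f = "\<lambda>ws. GStr G p q \<theta> (a ws)"
 have f: "?f ws \<in> carrier (Grp G p)" for ws
  using \<theta> a by (simp add: alt_closed)
 have f_swap: "?f (swap_at (length us) ws) = inv\<^bsub>Grp G p\<^esub> ?f ws" if "ws \<in> fibre p q \<theta> n (us @ x # y # vs)" for us x y vs ws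
  using fibre_length[OF that] alt_swap_at[OF a, of "length us" ws] \<theta> alt_closed[OF a]
  by (simp add: GStr_inv)
 have swap_swap: "swap_at (length us) (swap_at (length us) ws) = ws" if "ws \<in> fibre p q \<theta> n (us @ x # y # vs)" for us x y vs ws
  using fibre_length[OF that] by (simp add: swap_at_swap_at)
 let ?S = "GStr (alt_sgroup n G) p q \<theta> a"
 show ?thesis
 proof (rule altI)
  show "?S ws \<in> carrier (Grp G p)" for ws
   using f by simp
  show "?S ws = \<one>\<^bsub>Grp G p\<^esub>" if "ws \<notin> words n (W p)" for ws
   using fibre_outside[OF \<theta> that] by simp
  show "?S (us @ x # y # vs) =
    inv\<^bsub>Grp G p\<^esub> ?S (us @ y # x # vs)" for us x y vs
  proof -
   let ?F = "fibre p q \<theta> n (us @ x # y # vs)"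
   have inj: "inj_on (swap_at (length us)) ?F"
    by (rule inj_on_inverseI[of _ "swap_at (length us)"]) (rule swap_swap)
   have "finprod (Grp G p) ?f (fibre p q \<theta> n (us @ y # x # vs)) = finprod (Grp G p) (\<lambda>ws. ?f (swap_at (length us) ws)) ?F"
    unfolding fibre_swap_image[of p q \<theta> n us y x vs] by (rule Gp.finprod_reindex[OF _ inj]) (use f in auto)
   also have "\<dots> = finprod (Grp G p) (\<lambda>ws. inv\<^bsub>Grp G p\<^esub> ?f ws) ?F"
    by (rule Gp.finprod_cong') (use f f_swap in auto)
   also have "\<dots> = inv\<^bsub>Grp G p\<^esub> finprod (Grp G p) ?f ?F"
   proof -
    have "finprod (Grp G p) (\<lambda>ws. inv\<^bsub>Grp G p\<^esub> ?f ws) ?F \<otimes>\<^bsub>Grp G p\<^esub> finprod (Grp G p) ?f ?F = \<one>\<^bsub>Grp G p\<^esub>"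
     using f by (subst Gp.finprod_multf[symmetric]) auto
    then show ?thesis
     using f by (intro Gp.inv_equality[symmetric]) auto
   qed
   finally show ?thesis
    using f by simp
  qed
  show "?S (us @ x # x # vs) = \<one>\<^bsub>Grp G p\<^esub>" for us x vs
   unfolding alt_sgroup_simps
  proof (rule Gp.finprod_involution[where s = "swap_at (length us)"])
   fix ws assume ws: "ws \<in> fibre p q \<theta> n (us @ x # x # vs)"
   show "swap_at (length us) ws \<in> fibre p q \<theta> n (us @ x # x # vs)"
    by (rule fibre_swap[OF ws])
   show "swap_at (length us) (swap_at (length us) ws) = ws"
    by (rule swap_swap[OF ws])
   show "?f (swap_at (length us) ws) = inv\<^bsub>Grp G p\<^esub> ?f ws"
    by (rule f_swap[OF ws])
   assume eq: "swap_at (length us) ws = ws"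
   have k: "Suc (length us) < length ws"
    using fibre_length[OF ws] by simp
   have "ws ! length us = swap_at (length us) ws ! length us"
    using eq by simp
   also have "\<dots> = ws ! Suc (length us)"
    using k by (simp add: swap_at_def nth_append)
   finally have "a ws = \<one>\<^bsub>Grp G q\<^esub>"
    using alt_repeat_at[OF a k] by simp
   then show "?f ws = \<one>\<^bsub>Grp G p\<^esub>"
    using \<theta> by (simp add: GStr_one)
  qed (use f in auto)
 qed
qed

lemma alt_simplicial: "simplicial_abelian_group (alt_sgroup n G)" (is "simplicial_abelian_group ?A")
proof (rule simplicial_abelian_group.intro)
 show "comm_group (Grp ?A p)" for p
  by (simp add: Gp.alt_group)
next
 fix p q \<theta> assume \<theta>: "\<theta> \<in> delta p q"
 show "GStr ?A p q \<theta> \<in> hom (Grp ?A q) (Grp ?A p)"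
 proof (rule homI)
  fix a b assume "a \<in> carrier (Grp ?A q)" "b \<in> carrier (Grp ?A q)"
  then have a: "a ws \<in> carrier (Grp G q)" and b: "b ws \<in> carrier (Grp G q)" for ws
   by (auto simp: alt_closed)
  show "GStr ?A p q \<theta> (a \<otimes>\<^bsub>Grp ?A q\<^esub> b) =
    GStr ?A p q \<theta> a \<otimes>\<^bsub>Grp ?A p\<^esub> GStr ?A p q \<theta> b"
   using a b \<theta> by (simp add: fun_eq_iff GStr_mult Gp.finprod_multf)
 qed (use push_alt[OF \<theta>] in simp)
next
 fix p a assume a: "a \<in> carrier (Grp ?A p)"
 then have a: "a \<in> alt n (W p) (Grp G p)" by simp
 show "GStr ?A p p (restrict id {..p}) a = a"
 proof
  fix vs
  have fib: "map (Op p p (restrict id {..p})) ws = map Some ws" if "ws \<in> words n (W p)" for ws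
   using that Op_id by (auto simp: words_def)
  show "GStr ?A p p (restrict id {..p}) a vs = a vs"
  proof (cases "vs \<in> words n (W p)")
   case True
   then have "ws \<in> fibre p p (restrict id {..p}) n vs \<longleftrightarrow> ws = vs" for ws
    unfolding fibre_def mem_Collect_eq by (metis fib inj_map_eq_map inj_Some)
   then have "fibre p p (restrict id {..p}) n vs = {vs}"
    by blast
   then show ?thesis
    using alt_closed[OF a] GStr_id[of "a vs" p] by simp
  next
   case False
   then show ?thesis
    using alt_outside[OF a False] fibre_outside[OF delta_id False] by simp
  qed
 qed
next
 fix p q r and \<theta> \<psi> :: "nat => nat" and a
 let ?c = "compose {..p} \<psi> \<theta>"
 assume \<theta>: "\<theta> \<in> delta p q" and \<psi>: "\<psi> \<in> delta q r" and "a \<in> carrier (Grp ?A r)"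
 then have a: "a ws \<in> carrier (Grp G r)" for ws
  by (simp add: alt_closed)
 show "GStr ?A p r ?c a = GStr ?A p q \<theta> (GStr ?A q r \<psi> a)"
 proof
  fix us
  let ?F = "\<lambda>vs. fibre q r \<psi> n vs"
  \<comment> \<open>A word over \<open>us\<close> lies over exactly one intermediate word: a letter
    sent to the base point on the way would stay there.\<close>
  have eq: "fibre p r ?c n us = \<Union>(?F ` fibre p q \<theta> n us)"
  proof (intro equalityI subsetI)
   fix ws assume ws: "ws \<in> fibre p r ?c n us"
   then have m: "map (Op p r ?c) ws = map Some us" and wW: "ws \<in> words n (W r)"
    by (auto simp: fibre_def)
   have ne: "Op q r \<psi> w \<noteq> None \<and> Op p r ?c w = Op p q \<theta> (the (Op q r \<psi> w))" if "w \<in> set ws" for w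
   proof -
    have "Op p r ?c w \<in> Some ` set us"
     using that m by (metis image_eqI image_set)
    moreover have "w \<in> W r"
     using that wW by (auto simp: words_def)
    ultimately show ?thesis
     using Op_comp[OF \<theta> \<psi>, of w] by (cases "Op q r \<psi> w") auto
   qed
   define vs where "vs = map (\<lambda>w. the (Op q r \<psi> w)) ws"
   have "map (Op q r \<psi>) ws = map Some vs"
    using ne by (auto simp: vs_def)
   then have A: "ws \<in> ?F vs"
    using wW by (simp add: fibre_def)
   have "map (Op p q \<theta>) vs = map (Op p r ?c) ws"
    using ne by (auto simp: vs_def)
   moreover have "vs \<in> words n (W q)"
    using fibre_outside[OF \<psi>, of vs n] A by blast
   ultimately have "vs \<in> fibre p q \<theta> n us"
    using m by (simp add: fibre_def)
   then show "ws \<in> \<Union>(?F ` fibre p q \<theta> n us)"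
    using A by blast
  next
   fix ws assume "ws \<in> \<Union>(?F ` fibre p q \<theta> n us)"
   then obtain vs where vs: "map (Op p q \<theta>) vs = map Some us" and ws: "ws \<in> words n (W r)" "map (Op q r \<psi>) ws = map Some vs"
    by (auto simp: fibre_def)
   have "map (Op p r ?c) ws = map (\<lambda>x. Option.bind x (Op p q \<theta>)) (map (Op q r \<psi>) ws)"
    using ws(1) Op_comp[OF \<theta> \<psi>] by (auto simp: words_def)
   also have "\<dots> = map (Op p q \<theta>) vs"
    by (simp add: ws(2) comp_def)
   also note vs
   finally show "ws \<in> fibre p r ?c n us"
    using ws by (simp add: fibre_def)
  qed
  have disj: "pairwise (\<lambda>vs vs'. disjnt (?F vs) (?F vs')) (fibre p q \<theta> n us)"
   using inj_map_eq_map[OF inj_Some] unfolding pairwise_def disjnt_def fibre_def by auto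
  have "finprod (Grp G p) (\<lambda>ws. GStr G p r ?c (a ws)) (fibre p r ?c n us) =
    finprod (Grp G p) (\<lambda>vs. finprod (Grp G p) (\<lambda>ws. GStr G p r ?c (a ws)) (?F vs)) (fibre p q \<theta> n us)"
   unfolding eq by (rule Gp.finprod_UN_disjoint[OF _ _ disj]) (use a \<theta> \<psi> in \<open>auto simp: GStr_comp\<close>)
  also have "\<dots> = finprod (Grp G p) (\<lambda>vs. GStr G p q \<theta> (finprod (Grp G q) (\<lambda>ws. GStr G q r \<psi> (a ws)) (?F vs))) (fibre p q \<theta> n us)"
  proof (rule Gp.finprod_cong')
   fix vs
   have "GStr G p q \<theta> (finprod (Grp G q) (\<lambda>ws. GStr G q r \<psi> (a ws)) (?F vs)) =
     finprod (Grp G p) (\<lambda>ws. GStr G p q \<theta> (GStr G q r \<psi> (a ws))) (?F vs)"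
    by (rule group_hom.hom_finprod[OF GStr_group_hom[OF \<theta>] Grp Grp]) (use a \<psi> in auto)
   then show "finprod (Grp G p) (\<lambda>ws. GStr G p r ?c (a ws)) (?F vs) =
     GStr G p q \<theta> (finprod (Grp G q) (\<lambda>ws. GStr G q r \<psi> (a ws)) (?F vs))"
    using GStr_comp[OF \<theta> \<psi>] a by simp
  qed (use a \<theta> \<psi> in auto)
  finally show "GStr ?A p r ?c a us =
    GStr ?A p q \<theta> (GStr ?A q r \<psi> a) us"
   by simp
 qed
qed

text \<open>The contraction of the coefficients is applied to the values. The cut-off in its
  naturality depends on \<open>\<theta>\<close> and \<open>j\<close> but not on the word, so it
  commutes with the sums over fibres.\<close>

lemma alt_based_paths_acyclic: "acyclic_below m (alt_sgroup n (based_paths G))" (is "acyclic_below m ?A")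
proof -
 let ?B = "based_paths G"
 interpret P: alt_simplicial W Op ?B
  by (simp add: alt_simplicial_def based_paths pointed_family_axioms)
 interpret A: simplicial_abelian_group ?A
  by (rule P.alt_simplicial)
 show ?thesis
 proof (rule A.acyclic_if_homotopy[where h = "\<lambda>p j a. \<rho> p j \<circ> a"])
  show "\<rho> p j \<circ> a \<in> carrier (Grp ?A p)"
   if "a \<in> carrier (Grp ?A p)" for p j a
   using that P.Gp.alt_comp[OF collapse_hom] by simp
  show "\<rho> p j \<circ> \<one>\<^bsub>Grp ?A p\<^esub> = \<one>\<^bsub>Grp ?A p\<^esub>" for p j
   by (simp add: GStr_one fun_eq_iff)
  fix p q \<theta> j a
  assume "a \<in> carrier (Grp ?A q)"
  then have a: "a ws \<in> carrier (Grp ?B q)" for ws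
   by (simp only: alt_sgroup_simps alt_group_simps alt_closed)
  show "\<rho> q 0 \<circ> a = a"
   using collapse_0[OF a] by (simp add: fun_eq_iff)
  show "\<rho> q (Suc q) \<circ> a = \<one>\<^bsub>Grp ?A q\<^esub>"
   using collapse_last[OF a] by (simp add: fun_eq_iff)
  assume \<theta>: "\<theta> \<in> delta p q"
  let ?j = "card {l \<in> {..p}. \<theta> l < j}"
  show "GStr ?A p q \<theta> (\<rho> q j \<circ> a) =
    \<rho> p ?j \<circ> GStr ?A p q \<theta> a"
  proof
   fix vs
   have "\<rho> p ?j (finprod (Grp ?B p) (\<lambda>ws. GStr ?B p q \<theta> (a ws)) (fibre p q \<theta> n vs)) =
     finprod (Grp ?B p) (\<lambda>ws. \<rho> p ?j (GStr ?B p q \<theta> (a ws))) (fibre p q \<theta> n vs)"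
    by (rule group_hom.hom_finprod[OF collapse_hom P.Grp P.Grp]) (rule Pi_I, rule P.GStr_closed[OF \<theta> a])
   then show "GStr ?A p q \<theta> (\<rho> q j \<circ> a) vs =
     (\<rho> p ?j \<circ> GStr ?A p q \<theta> a) vs"
    using collapse_GStr[OF \<theta> a, of j] by (simp del: based_paths_simps)
  qed
 qed
qed

end

lemma (in pointed_family) alt_sgroup_hom:
 assumes "simplicial_hom G H f"
 shows "simplicial_hom (alt_sgroup n G) (alt_sgroup n H) (\<lambda>p a. f p \<circ> a)"
proof -
 interpret f: simplicial_hom G H f by fact
 interpret AG: alt_simplicial W Op G
  by unfold_locales
 interpret AH: alt_simplicial W Op H
  by unfold_locales
 interpret A: simplicial_abelian_group "alt_sgroup n G" by (rule AG.alt_simplicial)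
 interpret B: simplicial_abelian_group "alt_sgroup n H" by (rule AH.alt_simplicial)
 show ?thesis
 proof
  show "(\<lambda>a. f p \<circ> a) \<in> hom (Grp (alt_sgroup n G) p) (Grp (alt_sgroup n H) p)" for p
   by (rule homI) (auto simp: f.G.Gp.alt_comp[OF f.f_group_hom] fun_eq_iff f.f_mult alt_closed)
  show "f p \<circ> GStr (alt_sgroup n G) p q \<theta> a = GStr (alt_sgroup n H) p q \<theta> (f q \<circ> a)"
   if "\<theta> \<in> delta p q" "a \<in> carrier (Grp (alt_sgroup n G) q)" for p q \<theta> a
  proof
   fix vs
   have a: "a ws \<in> carrier (Grp G q)" for ws
    using that by (simp add: alt_closed)
   have "f p (finprod (Grp G p) (\<lambda>ws. GStr G p q \<theta> (a ws)) (fibre p q \<theta> n vs)) =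
     finprod (Grp H p) (\<lambda>ws. f p (GStr G p q \<theta> (a ws))) (fibre p q \<theta> n vs)"
    by (rule group_hom.hom_finprod[OF f.f_group_hom f.G.Grp f.H.Grp]) (use a that in auto)
   then show "(f p \<circ> GStr (alt_sgroup n G) p q \<theta> a) vs = GStr (alt_sgroup n H) p q \<theta> (f q \<circ> a) vs"
    using that a by (simp add: f.f_natural)
  qed
 qed
qed

text \<open>\<open>acyclic_below\<close> is expressed through carriers, units and faces, so
  agreement of these decides it.\<close>

lemma acyclic_below_cong:
 assumes "acyclic_below n G" "simplicial_abelian_group G" "simplicial_abelian_group H"
  and c: "\<And>p. carrier (Grp G p) = carrier (Grp H p)" and o: "\<And>p. \<one>\<^bsub>Grp G p\<^esub> = \<one>\<^bsub>Grp H p\<^esub>"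
  and s: "\<And>p q \<theta> x. \<theta> \<in> delta p q ==> x \<in> carrier (Grp G q) ==> GStr G p q \<theta> x = GStr H p q \<theta> x"
 shows "acyclic_below n H"
proof -
 interpret G: simplicial_abelian_group G by fact
 interpret H: simplicial_abelian_group H by fact
 have f: "face G p i x = face H p i x" if "i \<le> Suc p" "x \<in> carrier (Grp G (Suc p))" for p i x
  using that s[of "coface p i" p "Suc p" x] by (simp add: face_coface)
 have m: "moore G p = moore H p" for p
  by (cases p) (auto simp: c o f)
 have "moore_cycles G p = moore_cycles H p" for p
  by (rule Set.set_eqI) (auto simp: G.moore_cycles_iff H.moore_cycles_iff c o f)
 then show ?thesis
  using assms(1) m f[of 0] G.moore_carrier unfolding acyclic_below_def by (metis bot_nat_0.extremum subsetD)
qed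

text \<open>Dimension shifting along the path fibration. Alternating tensors keep it degreewise
  exact, surjectivity being \<open>alt_lift\<close>, and keep its total object acyclic. The loop
  object is acyclic in one degree less than \<open>G\<close>, so the induction hypothesis applies to
  it.\<close>

theorem (in pointed_family) alt_sgroup_acyclic:
 assumes "simplicial_abelian_group G" "acyclic_below n G"
 shows "acyclic_below n (alt_sgroup k G)"
 using assms
proof (induction n arbitrary: G)
 case (Suc n)
 interpret G: alt_simplicial W Op G
  by (simp add: alt_simplicial_def Suc.prems pointed_family_axioms)
 interpret f: simplicial_surjection "based_paths G" G "\<lambda>p. face G p 0"
  by (rule G.based_paths_surj[OF Suc.prems(2)])
 interpret P: alt_simplicial W Op "based_paths G"
  by unfold_locales
 interpret K: alt_simplicial W Op f.ker_sgroup
  by unfold_locales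
 interpret F: simplicial_hom "alt_sgroup k (based_paths G)" "alt_sgroup k G" "\<lambda>p a. face G p 0 \<circ> a"
  by (rule alt_sgroup_hom) (rule f.simplicial_hom_axioms)
 interpret F: simplicial_surjection "alt_sgroup k (based_paths G)" "alt_sgroup k G" "\<lambda>p a. face G p 0 \<circ> a"
 proof
  show "carrier (Grp (alt_sgroup k G) p) \<subseteq> (\<lambda>a. face G p 0 \<circ> a) ` carrier (Grp (alt_sgroup k (based_paths G)) p)" for p
   using f.G.Gp.alt_lift[OF f.f_group_hom G.Grp f.surj fin, of _ k p] by (force simp del: based_paths_simps)
 qed
 have "acyclic_below n f.ker_sgroup"
  using f.acyclic_below_kernel[OF G.based_paths_acyclic Suc.prems(2)] .
 then have *: "acyclic_below n (alt_sgroup k f.ker_sgroup)"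
  by (intro Suc.IH) (rule f.ker_sgroup_simplicial)
 \<comment> \<open>The kernel of the map on alternating tensors consists of the alternating tensors
   with values in the loop object, with the same operators.\<close>
 have "acyclic_below n F.ker_sgroup"
 proof (rule acyclic_below_cong[OF * K.alt_simplicial F.ker_sgroup_simplicial])
  fix p
  show c: "carrier (Grp (alt_sgroup k f.ker_sgroup) p) = carrier (Grp F.ker_sgroup p)" for p
  proof (intro equalityI subsetI)
   fix a assume "a \<in> carrier (Grp (alt_sgroup k f.ker_sgroup) p)"
   then have a: "a \<in> alt k (W p) (Grp f.ker_sgroup p)" by simp
   have a1: "a ws \<in> kernel (Grp (based_paths G) p) (Grp G p) (face G p 0)" for ws
    using alt_closed[OF a, of ws] by (simp only: f.ker_sgroup_simps)
   have "a \<in> alt k (W p) (Grp (based_paths G) p)"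
   proof (rule altI)
    show "a (us @ x # y # vs) = inv\<^bsub>Grp (based_paths G) p\<^esub> a (us @ y # x # vs)" for us x y vs
     using alt_swap[OF a, of us x y vs] f.G.Gp.m_inv_consistent[OF group_hom.subgroup_kernel[OF f.f_group_hom] a1]
     by (simp add: f.ker_sgroup_def sub_sgroup_def del: based_paths_simps)
   qed (use a1 alt_outside[OF a] alt_repeat[OF a] in \<open>auto simp: kernel_def\<close>)
   then show "a \<in> carrier (Grp F.ker_sgroup p)"
    using a1 by (auto simp: kernel_def fun_eq_iff)
  next
   fix a assume "a \<in> carrier (Grp F.ker_sgroup p)"
   then have a: "a \<in> alt k (W p) (Grp (based_paths G) p)" and a0: "face G p 0 \<circ> a = (\<lambda>ws. \<one>\<^bsub>Grp G p\<^esub>)"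
    by (auto simp: kernel_def simp del: based_paths_simps)
   have a1: "a ws \<in> kernel (Grp (based_paths G) p) (Grp G p) (face G p 0)" for ws
    using alt_closed[OF a, of ws] fun_cong[OF a0, of ws] by (simp add: kernel_def)
   have "a \<in> alt k (W p) (Grp f.ker_sgroup p)"
   proof (rule altI)
    show "a (us @ x # y # vs) = inv\<^bsub>Grp f.ker_sgroup p\<^esub> a (us @ y # x # vs)" for us x y vs
     using alt_swap[OF a, of us x y vs] f.G.Gp.m_inv_consistent[OF group_hom.subgroup_kernel[OF f.f_group_hom] a1]
     by (simp add: f.ker_sgroup_def sub_sgroup_def del: based_paths_simps)
   qed (use a1 alt_outside[OF a] alt_repeat[OF a] in \<open>auto simp: kernel_def\<close>)
   then show "a \<in> carrier (Grp (alt_sgroup k f.ker_sgroup) p)"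
    by simp
  qed
  show "\<one>\<^bsub>Grp (alt_sgroup k f.ker_sgroup) p\<^esub> = \<one>\<^bsub>Grp F.ker_sgroup p\<^esub>"
   by simp
  fix q \<theta> a assume \<theta>: "\<theta> \<in> delta p q" and a: "a \<in> carrier (Grp (alt_sgroup k f.ker_sgroup) q)"
  have a1: "GStr (based_paths G) p q \<theta> (a ws) \<in> kernel (Grp (based_paths G) p) (Grp G p) (face G p 0)" for ws
   using f.K.GStr_closed[OF \<theta>, of "a ws"] alt_closed[of a k "W q" "Grp f.ker_sgroup q" ws] a
   by (simp only: f.ker_sgroup_simps alt_sgroup_simps alt_group_simps)
  show "GStr (alt_sgroup k f.ker_sgroup) p q \<theta> a = GStr F.ker_sgroup p q \<theta> a"
  proof
   fix vs
   show "GStr (alt_sgroup k f.ker_sgroup) p q \<theta> a vs = GStr F.ker_sgroup p q \<theta> a vs"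
    using f.G.Gp.finprod_subgroup(1)[OF group_hom.subgroup_kernel[OF f.f_group_hom], of "\<lambda>ws. GStr (based_paths G) p q \<theta> (a ws)"] a1
    by (simp add: f.ker_sgroup_def sub_sgroup_def Pi_iff del: based_paths_simps)
  qed
 qed
 then show ?case
  using F.acyclic_below_quotient[of "Suc n"] G.alt_based_paths_acyclic by simp
qed simp

section \<open>Koszul complexes\<close>

lemma (in comm_group) alt_subgroup:
 assumes H: "subgroup H G"
 shows "a \<in> alt n W (G\<lparr>carrier := H\<rparr>) \<longleftrightarrow> a \<in> alt n W G \<and> (\<forall>ws. a ws \<in> H)"
proof
 assume a: "a \<in> alt n W (G\<lparr>carrier := H\<rparr>)"
 have c: "a ws \<in> H" for ws
  using alt_closed[OF a] by simp
 have "a \<in> alt n W G"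
 proof (rule altI)
  show "a (us @ x # y # vs) = inv a (us @ y # x # vs)" for us x y vs
   using alt_swap[OF a, of us x y vs] m_inv_consistent[OF H c] by simp
 qed (use c subgroup.subset[OF H] alt_outside[OF a] alt_repeat[OF a] in auto)
 then show "a \<in> alt n W G \<and> (\<forall>ws. a ws \<in> H)"
  using c by blast
next
 assume a: "a \<in> alt n W G \<and> (\<forall>ws. a ws \<in> H)"
 show "a \<in> alt n W (G\<lparr>carrier := H\<rparr>)"
 proof (rule altI)
  show "a (us @ x # y # vs) = inv\<^bsub>G\<lparr>carrier := H\<rparr>\<^esub> a (us @ y # x # vs)" for us x y vs
   using alt_swap[of a n W G us x y vs] a m_inv_consistent[OF H] by simp
 qed (use a alt_outside[of a n W G] alt_repeat[of a n W G] in auto)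
qed

lemma (in comm_monoid) finprod_Times:
 assumes "finite A" "finite B" "\<And>a b. a \<in> A ==> b \<in> B ==> f (a, b) \<in> carrier G"
 shows "finprod G f (A \<times> B) = finprod G (\<lambda>a. finprod G (\<lambda>b. f (a, b)) B) A"
 using assms(1,3)
proof (induction A rule: finite_induct)
 case (insert a A)
 have "finprod G f (Pair a ` B \<union> A \<times> B) = finprod G f (Pair a ` B) \<otimes> finprod G f (A \<times> B)"
  using insert assms(2) by (intro finprod_Un_disjoint) auto
 moreover have "insert a A \<times> B = Pair a ` B \<union> A \<times> B"
  by auto
 moreover have "finprod G f (Pair a ` B) = finprod G (\<lambda>b. f (a, b)) B"
  by (rule finprod_reindex) (use insert.prems in \<open>auto simp: inj_on_def\<close>)
 ultimately have "finprod G f (insert a A \<times> B) = finprod G (\<lambda>b. f (a, b)) B \<otimes> finprod G f (A \<times> B)"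
  by simp
 then show ?case
  using insert by (simp add: Pi_iff)
qed simp

lemma (in abelian_group) finsum_minus:
 assumes "f \<in> A \<rightarrow> carrier G"
 shows "finsum G (\<lambda>x. \<ominus> f x) A = \<ominus> finsum G f A"
 using assms
proof (induction A rule: infinite_finite_induct)
 case (insert x A)
 then have "f x \<in> carrier G" "f \<in> A \<rightarrow> carrier G" "(\<lambda>x. \<ominus> f x) \<in> A \<rightarrow> carrier G"
  by auto
 then show ?case
  using insert by (simp add: minus_add)
qed (auto simp: a_inv_def)

lemma (in abelian_group) eq_minusI:
 assumes "x = y \<oplus> z" "y \<in> carrier G" "z \<in> carrier G"
 shows "z = x \<ominus> y"
 using assms by (simp add: a_minus_def a_comm[of y z] a_assoc r_neg)

text \<open>\<open>\<xi>\<close> are variables of filtration degree one and \<open>e S\<close> sets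
  those in \<open>S\<close> to 0. In the application \<open>Fil m\<close> is an ideal power within
  the elements free of the variables killed earlier, so \<open>Fil 0\<close> need not be all of
  \<open>B\<close>. Division by a variable, \<open>e_factor\<close>, lowers the filtration by
  exactly one.\<close>

locale koszul_ring = cring B for B :: "'a ring" (structure) +
 fixes W :: "'w set" and Fil :: "nat => 'a set" and \<xi> :: "'w => 'a" and e :: "'w set => 'a => 'a"
 assumes finite_W: "finite W"
  and Fil_additive: "additive_subgroup (Fil m) B"
  and \<xi>_closed [simp]: "w \<in> W ==> \<xi> w \<in> carrier B"
  and \<xi>_mult: "w \<in> W ==> x \<in> Fil m ==> \<xi> w \<otimes> x \<in> Fil (Suc m)"
  and e_hom: "S \<subseteq> W ==> e S \<in> ring_hom B B"
  and e_empty: "x \<in> Fil m ==> e {} x = x"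
  and e_insert: "S \<subseteq> W ==> w \<in> W ==> x \<in> carrier B ==> e (insert w S) x = e S (e {w} x)"
  and e_Fil: "S \<subseteq> W ==> x \<in> Fil m ==> e S x \<in> Fil m"
  and e_\<xi>: "S \<subseteq> W ==> w \<in> W ==> e S (\<xi> w) = (if w \<in> S then \<zero> else \<xi> w)"
  and e_factor: "w \<in> W ==> x \<in> Fil (Suc m) ==> \<exists>g\<in>Fil m. x = e {w} x \<oplus> \<xi> w \<otimes> g"
  and \<xi>_regular: "w \<in> W ==> g \<in> carrier B ==> \<xi> w \<otimes> g = \<zero> ==> g = \<zero>"
begin

lemma Fil_closed: "x \<in> Fil m ==> x \<in> carrier B"
 using additive_subgroup.a_Hcarr[OF Fil_additive] .

lemma Fil_subgroup: "subgroup (Fil m) (add_monoid B)"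
 using additive_subgroup.a_subgroup[OF Fil_additive] .

lemma e_ring_hom: "S \<subseteq> W ==> ring_hom_cring B B (e S)"
 by (simp add: ring_hom_cring_def ring_hom_cring_axioms_def is_cring e_hom)

definition Fgrp :: "nat => 'a monoid" where
 "Fgrp m = (add_monoid B)\<lparr>carrier := Fil m\<rparr>"

lemma Fgrp_simps [simp]: "carrier (Fgrp m) = Fil m" "x \<otimes>\<^bsub>Fgrp m\<^esub> y = x \<oplus> y" "\<one>\<^bsub>Fgrp m\<^esub> = \<zero>"
 by (auto simp: Fgrp_def)

lemma comm_group_Fgrp: "comm_group (Fgrp m)"
 unfolding Fgrp_def by (rule comm_group.comm_group_subgroup[OF a_comm_group Fil_subgroup])

lemma inv_Fgrp: "x \<in> Fil m ==> inv\<^bsub>Fgrp m\<^esub> x = \<ominus> x"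
 unfolding Fgrp_def a_inv_def by (rule group.m_inv_consistent[OF a_group Fil_subgroup])

lemma finprod_Fgrp: "g \<in> A \<rightarrow> Fil m ==> finprod (Fgrp m) g A = finsum B g A"
 unfolding Fgrp_def finsum_def by (rule comm_group.finprod_subgroup[OF a_comm_group Fil_subgroup])

lemma finsum_Fil: "g \<in> A \<rightarrow> Fil m ==> finsum B g A \<in> Fil m"
 unfolding finsum_def by (rule comm_group.finprod_subgroup[OF a_comm_group Fil_subgroup])

lemma alt_Fgrp: "a \<in> alt n V (Fgrp m) \<longleftrightarrow> a \<in> alt n V (add_monoid B) \<and> (\<forall>ws. a ws \<in> Fil m)"
 unfolding Fgrp_def by (rule comm_group.alt_subgroup[OF a_comm_group Fil_subgroup])

text \<open>The Koszul differential: contraction with the family of variables.\<close>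

definition kz :: "'w set => ('w list => 'a) => 'w list => 'a" where
 "kz V a ws = (\<Oplus>w\<in>V. \<xi> w \<otimes> a (w # ws))"

lemma kz_closed: "V \<subseteq> W ==> (\<And>ws. a ws \<in> carrier B) ==> kz V a ws \<in> carrier B"
 unfolding kz_def by (rule finsum_closed) auto

lemma kz_alt:
 assumes V: "V \<subseteq> W" and a: "a \<in> alt (Suc n) V (add_monoid B)"
 shows "kz V a \<in> alt n V (add_monoid B)"
proof -
 have c: "a ws \<in> carrier B" for ws
  using alt_closed[OF a] by simp
 show ?thesis
 proof (rule altI)
  show "kz V a ws \<in> carrier (add_monoid B)" for ws
   using kz_closed[OF V c] by simp
  show "kz V a ws = \<one>\<^bsub>add_monoid B\<^esub>" if "ws \<notin> words n V" for ws
  proof -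
   have "a (w # ws) = \<zero>" for w
    using alt_outside[OF a, of "w # ws"] that by simp
   then have "kz V a ws = (\<Oplus>w\<in>V. \<zero>)"
    unfolding kz_def using V by (intro finsum_cong') auto
   then show ?thesis by simp
  qed
  show "kz V a (us @ x # y # vs) = inv\<^bsub>add_monoid B\<^esub> kz V a (us @ y # x # vs)" for us x y vs
  proof -
   have "a (w # us @ x # y # vs) = \<ominus> a (w # us @ y # x # vs)" for w
    using alt_swap[OF a, of "w # us" x y vs] by (simp add: a_inv_def)
   then have "kz V a (us @ x # y # vs) = (\<Oplus>w\<in>V. \<ominus> (\<xi> w \<otimes> a (w # us @ y # x # vs)))"
    unfolding kz_def using V c by (intro finsum_cong') (auto simp: r_minus subset_eq)
   also have "\<dots> = \<ominus> kz V a (us @ y # x # vs)"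
    unfolding kz_def using V c by (intro finsum_minus) auto
   finally show ?thesis
    by (simp add: a_inv_def)
  qed
  show "kz V a (us @ x # x # vs) = \<one>\<^bsub>add_monoid B\<^esub>" for us x vs
  proof -
   have "a (w # us @ x # x # vs) = \<zero>" for w
    using alt_repeat[OF a, of "w # us" x vs] by simp
   then have "kz V a (us @ x # x # vs) = (\<Oplus>w\<in>V. \<zero>)"
    unfolding kz_def using V by (intro finsum_cong') auto
   then show ?thesis by simp
  qed
 qed
qed

lemma kz_Fil:
 assumes "V \<subseteq> W" "\<And>ws. a ws \<in> Fil m"
 shows "kz V a ws \<in> Fil (Suc m)"
 unfolding kz_def by (rule finsum_Fil) (use assms \<xi>_mult in blast)

lemma kz_alt_Fgrp:
 "V \<subseteq> W ==> a \<in> alt (Suc n) V (Fgrp m) ==> kz V a \<in> alt n V (Fgrp (Suc m))"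
 unfolding alt_Fgrp using kz_alt kz_Fil by blast

text \<open>In the double sum the terms for \<open>(w, w')\<close> and \<open>(w', w)\<close> are
  opposite and the diagonal vanishes, because \<open>a\<close> alternates.\<close>

lemma kz_kz:
 assumes V: "V \<subseteq> W" and a: "a \<in> alt (Suc (Suc n)) V (add_monoid B)"
 shows "kz V (kz V a) ws = \<zero>"
proof -
 have c: "a ws \<in> carrier B" for ws
  using alt_closed[OF a] by simp
 have fin: "finite V"
  using V finite_W by (rule finite_subset)
 have \<xi>: "w \<in> V ==> \<xi> w \<in> carrier B" for w
  using V by auto
 define f where "f = (\<lambda>(w, w'). \<xi> w \<otimes> (\<xi> w' \<otimes> a (w' # w # ws)))"
 define s where "s = (\<lambda>(w, w'). (w' :: 'w, w :: 'w))"
 have f: "f (w, w') \<in> carrier B" if "w \<in> V" "w' \<in> V" for w w'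
  using that \<xi> c by (simp add: f_def)
 have "kz V (kz V a) ws = (\<Oplus>w\<in>V. \<Oplus>w'\<in>V. f (w, w'))"
  unfolding kz_def
 proof (rule finsum_cong')
  fix w assume w: "w \<in> V"
  show "\<xi> w \<otimes> (\<Oplus>w'\<in>V. \<xi> w' \<otimes> a (w' # w # ws)) = (\<Oplus>w'\<in>V. f (w, w'))"
   using finsum_rdistr[OF fin, of "\<xi> w" "\<lambda>w'. \<xi> w' \<otimes> a (w' # w # ws)"] \<xi> w c by (auto simp: f_def)
 qed (use f in auto)
 also have "\<dots> = finsum B f (V \<times> V)"
  unfolding finsum_def using f fin by (intro comm_monoid.finprod_Times[OF a_comm_monoid, symmetric]) auto
 also have "finsum B f (V \<times> V) = \<one>\<^bsub>add_monoid B\<^esub>"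
  unfolding finsum_def
 proof (rule comm_group.finprod_involution[OF a_comm_group, where s = s])
  fix x assume "x \<in> V \<times> V"
  then obtain w w' where x: "x = (w, w')" and w: "w \<in> V" "w' \<in> V"
   by auto
  show "f x \<in> carrier (add_monoid B)"
   using f w x by simp
  show "s x \<in> V \<times> V" "s (s x) = x"
   using w x by (auto simp: s_def)
  have "a (w # w' # ws) = \<ominus> a (w' # w # ws)"
   using alt_swap[OF a, of "[]" w w' ws] by (simp add: a_inv_def)
  then have "f (w', w) = \<ominus> f (w, w')"
   unfolding f_def using w \<xi> c by (simp add: r_minus m_lcomm)
  then show "f (s x) = inv\<^bsub>add_monoid B\<^esub> f x"
   by (simp add: x s_def a_inv_def)
  show "f x = \<one>\<^bsub>add_monoid B\<^esub>" if "s x = x"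
  proof -
   have "fst (s x) = fst x"
    by (simp only: that)
   then have "w' = w"
    by (simp add: x s_def)
   then show ?thesis
    using alt_repeat[OF a, of "[]" w ws] \<xi>[OF w(1)] by (simp add: x f_def)
  qed
 qed (use fin in auto)
 finally show ?thesis
  by simp
qed

lemma e_kz:
 assumes "V \<subseteq> W" "\<And>ws. a ws \<in> carrier B"
 shows "e V (kz V a ws) = \<zero>"
proof -
 interpret E: ring_hom_cring B B "e V"
  by (rule e_ring_hom) fact
 have "e V (kz V a ws) = (\<Oplus>w\<in>V. e V (\<xi> w \<otimes> a (w # ws)))"
  unfolding kz_def using assms by (subst E.hom_finsum) (auto simp: comp_def)
 also have "\<dots> = (\<Oplus>w\<in>V. \<zero>)"
  using assms by (intro finsum_cong') (auto simp: e_\<xi> subset_eq)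
 finally show ?thesis by simp
qed

text \<open>In degree 0 the augmentation \<open>e V\<close> takes the place of the differential.
  Exactness there says that the kernel of \<open>e V\<close> is generated by the variables, with
  cofactors one step lower in the filtration.\<close>

definition kz_cycle :: "nat => 'w set => ('w list => 'a) => bool" where
 "kz_cycle n V a \<longleftrightarrow> (if n = 0 then e V (a []) = \<zero> else \<forall>ws. kz V a ws = \<zero>)"

lemma kz_insert:
 assumes "insert v V \<subseteq> W" "v \<notin> V" "\<And>ws. a ws \<in> carrier B"
 shows "kz (insert v V) a ws = \<xi> v \<otimes> a (v # ws) \<oplus> kz V a ws"
 unfolding kz_def using assms finite_subset[OF _ finite_W] by (subst finsum_insert) auto

lemma kz_cong: "V \<subseteq> W ==> (\<And>w. w \<in> V ==> a (w # ws) = b (w # ws)) ==> (\<And>ws. b ws \<in> carrier B) ==> kz V a ws = kz V b ws"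
 unfolding kz_def by (intro finsum_cong') auto

lemma \<xi>_cancel:
 assumes "w \<in> W" "g \<in> carrier B" "h \<in> carrier B" "\<xi> w \<otimes> g = \<xi> w \<otimes> h"
 shows "g = h"
proof -
 have "\<xi> w \<otimes> (g \<ominus> h) = \<zero>"
  using assms by (simp add: a_minus_def r_distr r_minus r_neg)
 then have "g \<ominus> h = \<zero>"
  using assms \<xi>_regular by simp
 then show ?thesis
  using assms by simp
qed

text \<open>Induction on the variables. For a new \<open>v\<close>, the part of \<open>a\<close> on
  words without \<open>v\<close> is \<open>e {v}\<close> of it plus \<open>\<xi> v\<close> times
  some \<open>c\<close>. The first summand is a cycle for the old variables, hence the boundary of
  some \<open>b\<close>, and \<open>alt_ext\<close> of \<open>b\<close> and \<open>c\<close> has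
  boundary \<open>a\<close>. Division in the filtration provides \<open>c\<close>; regularity of
  \<open>\<xi> v\<close> makes it alternate.\<close>

theorem koszul_exact:
 assumes "V \<subseteq> W" "a \<in> alt n V (Fgrp (Suc m))" "kz_cycle n V a"
 shows "\<exists>b\<in>alt (Suc n) V (Fgrp m). kz V b = a"
proof -
 have "finite V"
  using assms(1) finite_W by (rule finite_subset)
 then show ?thesis
  using assms
 proof (induction V arbitrary: n a m rule: finite_induct)
  case empty
  interpret G: comm_group "Fgrp m" by (rule comm_group_Fgrp)
  have a: "a ws \<in> carrier B" "ws \<notin> words n {} ==> a ws = \<zero>" for ws
   using empty.prems(2) alt_closed[of a] alt_outside[of a] Fil_closed by fastforce+
  have "a ws = \<zero>" for ws
  proof (cases "n = 0 \<and> ws = []")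
   case True
   then show ?thesis
    using empty.prems(3) e_empty[OF alt_closed[OF empty.prems(2), of "[]", unfolded Fgrp_simps]] by (simp add: kz_cycle_def)
  next
   case False
   then show ?thesis
    by (intro a(2)) (auto simp: words_def)
  qed
  then have "kz {} (\<lambda>ws. \<zero>) = a"
   by (simp add: kz_def fun_eq_iff)
  then show ?case
   using G.alt_const_one[of "Suc n" "{}"] by auto
 next
  case (insert v V)
  have v: "v \<in> W" and V: "V \<subseteq> W"
   using insert.prems(1) by auto
  interpret G: comm_group "Fgrp m" by (rule comm_group_Fgrp)
  interpret G': comm_group "Fgrp (Suc m)" by (rule comm_group_Fgrp)
  interpret E: ring_hom_cring B B "e {v}"
   by (rule e_ring_hom) (use v in simp)
  have a: "a ws \<in> Fil (Suc m)" for ws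
   using alt_closed[OF insert.prems(2)] by simp
  have ac: "a ws \<in> carrier B" for ws
   using a Fil_closed by blast
  let ?a0 = "\<lambda>ws. if ws \<in> words n V then a ws else \<zero>"
  have a0: "?a0 \<in> alt n V (Fgrp (Suc m))"
   using G'.alt_restrict[OF insert.prems(2), of V] by (simp cong: if_cong)
  have gh: "group_hom (Fgrp (Suc m)) (Fgrp (Suc m)) (e {v})"
   using e_Fil[of "{v}"] v Fil_closed
   by (intro group_hom.intro group_hom_axioms.intro G'.is_group) (auto simp: hom_def)
  let ?ea = "e {v} \<circ> ?a0"
  have ea: "?ea \<in> alt n V (Fgrp (Suc m))"
   by (rule G'.alt_comp[OF gh a0])
  have a0c: "?a0 ws \<in> carrier B" for ws
   using ac by simp
  have cyc: "\<xi> v \<otimes> a (v # ws) \<oplus> kz V a ws = \<zero>" if "n = Suc k" for k ws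
   using insert.prems(3) kz_insert[of v V a ws, OF insert.prems(1) insert.hyps(2) ac] that
   by (simp add: kz_cycle_def)
  \<comment> \<open>Applying \<open>e {v}\<close> to the cycle equation of \<open>a\<close> removes
    the term with \<open>\<xi> v\<close>.\<close>
  have "kz_cycle n V ?ea"
  proof (cases n)
   case 0
   then show ?thesis
    using insert.prems(3) e_insert[OF V v ac, of "[]"] by (simp add: kz_cycle_def words_def)
  next
   case (Suc k)
   have kzea: "kz V ?ea ws = e {v} (kz V ?a0 ws)" for ws
   proof -
    have "e {v} (kz V ?a0 ws) = (\<Oplus>w\<in>V. e {v} (\<xi> w \<otimes> ?a0 (w # ws)))"
     unfolding kz_def using V a0c by (subst E.hom_finsum) (auto simp: comp_def)
    also have "\<dots> = kz V ?ea ws"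
     unfolding kz_def using V v a0c insert.hyps(2) by (intro finsum_cong') (auto simp: e_\<xi> subset_eq)
    finally show ?thesis by simp
   qed
   have "kz V ?ea ws = \<zero>" for ws
   proof (cases "ws \<in> words k V")
    case True
    have "kz V ?a0 ws = kz V a ws"
     by (rule kz_cong[OF V]) (use True ac Suc in auto)
    moreover have "e {v} (\<xi> v \<otimes> a (v # ws) \<oplus> kz V a ws) = \<zero>"
     using cyc[OF Suc] by simp
    then have "e {v} (kz V a ws) = \<zero>"
     using v ac kz_closed[of V a, OF V ac] by (simp add: e_\<xi>)
    ultimately show ?thesis
     using kzea by simp
   next
    case False
    then have "kz V ?a0 ws = (\<Oplus>w\<in>V. \<zero>)"
     unfolding kz_def using V Suc by (intro finsum_cong') auto
    then show ?thesis
     using kzea by simp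
   qed
   then show ?thesis
    using Suc by (simp add: kz_cycle_def)
  qed
  then obtain b where b: "b \<in> alt (Suc n) V (Fgrp m)" "kz V b = ?ea"
   using insert.IH[OF V ea] by blast
  have "\<forall>ws. \<exists>g\<in>Fil m. ?a0 ws = ?ea ws \<oplus> \<xi> v \<otimes> g"
   using e_factor[OF v] alt_closed[OF a0] by simp
  then obtain c where c: "\<And>ws. c ws \<in> Fil m" "\<And>ws. ?a0 ws = ?ea ws \<oplus> \<xi> v \<otimes> c ws"
   by metis
  have cc: "c ws \<in> carrier B" for ws
   using c(1) Fil_closed by blast
  have c': "\<xi> v \<otimes> c ws = ?a0 ws \<ominus> ?ea ws" for ws
   by (rule eq_minusI[OF c(2)]) (use v cc E.hom_closed[OF a0c[of ws]] in simp_all)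
  \<comment> \<open>\<open>c\<close> was chosen word by word. The alternating identities hold after
    multiplication by \<open>\<xi> v\<close>, which can be cancelled.\<close>
  have calt: "c \<in> alt n V (Fgrp m)"
  proof (rule altI)
   show "c ws = \<one>\<^bsub>Fgrp m\<^esub>" if "ws \<notin> words n V" for ws
    using c'[of ws] that v cc by (auto intro: \<xi>_regular)
   have ea0: "?ea ws = \<zero>" if "?a0 ws = \<zero>" for ws
    using that by simp
   show "c (us @ x # x # vs) = \<one>\<^bsub>Fgrp m\<^esub>" for us x vs
    using c'[of "us @ x # x # vs"] alt_repeat[OF a0, of us x vs] ea0 v cc by (auto intro: \<xi>_regular)
   show "c (us @ x # y # vs) = inv\<^bsub>Fgrp m\<^esub> c (us @ y # x # vs)" for us x y vs
   proof -
    let ?s = "us @ x # y # vs" and ?t = "us @ y # x # vs"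
    have 1: "?a0 ?s = \<ominus> ?a0 ?t" "?ea ?s = \<ominus> ?ea ?t"
     using alt_swap[OF a0, of us x y vs] alt_swap[OF ea, of us x y vs] alt_closed[OF a0, of ?t] alt_closed[OF ea, of ?t]
     by (simp_all only: inv_Fgrp Fgrp_simps)
    have t: "?a0 ?t \<in> carrier B" "?ea ?t \<in> carrier B"
     using a0c[of ?t] E.hom_closed[OF a0c[of ?t]] by simp_all
    have "\<xi> v \<otimes> c ?s = \<ominus> (\<xi> v \<otimes> c ?t)"
     unfolding c' 1 using t by (simp only: a_minus_def minus_add minus_minus a_inv_closed)
    also have "\<dots> = \<xi> v \<otimes> (\<ominus> c ?t)"
     using v cc by (simp add: r_minus)
    finally have "c ?s = \<ominus> c ?t"
     using \<xi>_cancel[OF v cc] cc by simp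
    then show ?thesis
     using c(1) by (simp add: inv_Fgrp)
   qed
  qed (use c in simp)
  let ?b = "alt_ext (Fgrp m) v b c"
  let ?kb = "kz (insert v V) ?b"
  have b': "?b \<in> alt (Suc n) (insert v V) (Fgrp m)"
   by (rule G.alt_ext[OF b(1) calt])
  then have bc: "?b ws \<in> carrier B" "b ws \<in> carrier B" for ws
   using alt_closed[OF b'] alt_closed[OF b(1)] Fil_closed by auto
  note kb = kz_alt_Fgrp[OF insert.prems(1) b'] and kbc = kz_closed[of _ ?b, OF insert.prems(1) bc(1)]
  have 1: "?kb ws = a ws" if ws: "ws \<in> words n V" for ws
  proof -
   have "kz V ?b ws = kz V b ws"
    by (rule kz_cong[OF V]) (use bc ws insert.hyps in \<open>auto intro!: G.alt_ext_words[of _ V _ "Suc n"]\<close>)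
   then have "?kb ws = \<xi> v \<otimes> c ws \<oplus> ?ea ws"
    using bc ws by (simp add: kz_insert[OF insert.prems(1) insert.hyps(2)] G.alt_ext_Cons[OF insert.hyps(2) ws] b(2))
   also have "\<dots> = ?a0 ws"
    using c(2)[of ws] cc[of ws] v E.hom_closed[OF a0c[of ws]] by (simp only: a_comm comp_def \<xi>_closed m_closed)
   finally show ?thesis
    using ws by simp
  qed
  have "?kb = a"
  proof (cases n)
   case 0
   have "?kb ws = a ws" if "ws \<notin> words n V" for ws
    using alt_outside[OF kb, of ws] alt_outside[OF insert.prems(2), of ws] that 0 by (simp add: words_def)
   then show ?thesis
    using 1 by blast
  next
   case (Suc k)
   show ?thesis
   proof (rule G'.alt_eqI[of _ k v V])
    fix ws assume ws: "ws \<in> words k V"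
    \<comment> \<open>\<open>?kb\<close> and \<open>a\<close> are both cycles and agree on words
      without \<open>v\<close>. The cycle equation then determines the product of
      \<open>\<xi> v\<close> with the value at \<open>v # ws\<close>.\<close>
    have "kz V ?kb ws = kz V a ws"
     by (rule kz_cong[OF V]) (use 1 ws Suc ac in auto)
    moreover have "kz (insert v V) ?kb ws = \<zero>"
     by (rule kz_kz[OF insert.prems(1), of _ k]) (use b' Suc in \<open>simp add: alt_Fgrp\<close>)
    ultimately have "\<xi> v \<otimes> ?kb (v # ws) \<oplus> kz V a ws = \<xi> v \<otimes> a (v # ws) \<oplus> kz V a ws"
     using kz_insert[of v V ?kb ws, OF insert.prems(1) insert.hyps(2) kbc] cyc[OF Suc] by simp
    then have "\<xi> v \<otimes> ?kb (v # ws) = \<xi> v \<otimes> a (v # ws)"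
     using v ac kbc kz_closed[of V a, OF V ac] by simp
    then show "?kb (v # ws) = a (v # ws)"
     by (rule \<xi>_cancel[OF v kbc ac])
   qed (use 1 kb insert.prems(2) Suc in simp_all)
  qed
  then show ?case
   using b' by blast
 qed
qed

end

section \<open>Killing a sphere of variables\<close>

definition additive_sgroup ::
 "(nat => ('a, 'z) ring_scheme) => (nat => 'a set) => (nat => nat => (nat => nat) => 'a => 'a) => 'a sgroup"
 where "additive_sgroup B C f =
  \<lparr> Grp = (\<lambda>p. \<lparr>carrier = C p, mult = add (B p), one = \<zero>\<^bsub>B p\<^esub>\<rparr>), GStr = f \<rparr>"

lemma additive_sgroup_simps [simp]:
 "carrier (Grp (additive_sgroup B C f) p) = C p" "x \<otimes>\<^bsub>Grp (additive_sgroup B C f) p\<^esub> y = x \<oplus>\<^bsub>B p\<^esub> y"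
 "\<one>\<^bsub>Grp (additive_sgroup B C f) p\<^esub> = \<zero>\<^bsub>B p\<^esub>" "GStr (additive_sgroup B C f) = f"
 by (auto simp: additive_sgroup_def)

lemma additive_sgroup_simplicial:
 assumes "\<And>p. abelian_group (B p)" and C: "\<And>p. additive_subgroup (C p) (B p)"
  and "\<And>p q \<theta> x. \<theta> \<in> delta p q ==> x \<in> C q ==> f p q \<theta> x \<in> C p"
  and "\<And>p q \<theta> x y. \<theta> \<in> delta p q ==> x \<in> C q ==> y \<in> C q ==> f p q \<theta> (x \<oplus>\<^bsub>B q\<^esub> y) = f p q \<theta> x \<oplus>\<^bsub>B p\<^esub> f p q \<theta> y"
  and "\<And>p x. x \<in> C p ==> f p p (restrict id {..p}) x = x"
  and "\<And>p q r \<theta> \<psi> x. \<theta> \<in> delta p q ==> \<psi> \<in> delta q r ==> x \<in> C r ==>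
    f p r (compose {..p} \<psi> \<theta>) x = f p q \<theta> (f q r \<psi> x)"
 shows "simplicial_abelian_group (additive_sgroup B C f)"
proof (rule simplicial_abelian_group.intro)
 fix p
 interpret B: abelian_group "B p" by fact
 interpret C: additive_subgroup "C p" "B p" by (rule C)
 show "comm_group (Grp (additive_sgroup B C f) p)"
 proof (rule comm_groupI)
  show "\<exists>y\<in>carrier (Grp (additive_sgroup B C f) p). y \<otimes>\<^bsub>Grp (additive_sgroup B C f) p\<^esub> x = \<one>\<^bsub>Grp (additive_sgroup B C f) p\<^esub>"
   if "x \<in> carrier (Grp (additive_sgroup B C f) p)" for x
   using that C.a_inv_closed[of x] C.a_Hcarr[of x] by (auto intro!: bexI[of _ "\<ominus>\<^bsub>B p\<^esub> x"] B.l_neg)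
 qed (use C.a_Hcarr in \<open>auto simp: B.a_ac\<close>)
qed (use assms in \<open>auto simp: hom_def\<close>)

lemma (in comm_monoid) finprod_swap:
 assumes "finite A" "finite B" "\<And>a b. a \<in> A ==> b \<in> B ==> f a b \<in> carrier G"
 shows "finprod G (\<lambda>a. finprod G (f a) B) A = finprod G (\<lambda>b. finprod G (\<lambda>a. f a b) A) B"
 using assms(1,3)
proof (induction A rule: finite_induct)
 case (insert a A)
 have "finprod G (\<lambda>b. finprod G (\<lambda>a. f a b) (insert a A)) B = finprod G (\<lambda>b. f a b \<otimes> finprod G (\<lambda>a. f a b) A) B"
  using insert by (intro finprod_cong') (auto intro!: finprod_insert finprod_closed)
 also have "\<dots> = finprod G (f a) B \<otimes> finprod G (\<lambda>b. finprod G (\<lambda>a. f a b) A) B"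
  using insert by (intro finprod_multf) (auto intro!: finprod_closed)
 finally show ?case
  using insert by (subst finprod_insert) (auto intro!: finprod_closed)
qed simp

text \<open>Exactness is used in the form of a surjection onto a kernel. Shrinking the target to the
  image changes neither the map nor its kernel.\<close>

lemma corestrict:
 assumes "simplicial_hom G H f" "simplicial_abelian_group (sub_sgroup H C)" "\<And>p. f p ` carrier (Grp G p) = C p"
 shows "simplicial_surjection G (sub_sgroup H C) f"
  and "simplicial_hom.ker_sgroup G (sub_sgroup H C) f = simplicial_hom.ker_sgroup G H f"
proof -
 interpret f: simplicial_hom G H f by fact
 interpret C: simplicial_abelian_group "sub_sgroup H C" by fact
 have im: "x \<in> carrier (Grp G p) ==> f p x \<in> C p" for x p
  using assms(3) by blast
 interpret g: simplicial_hom G "sub_sgroup H C" f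
  by unfold_locales (auto simp: hom_def im f.f_mult f.f_natural)
 show "simplicial_surjection G (sub_sgroup H C) f"
  by unfold_locales (simp add: assms(3))
 show "simplicial_hom.ker_sgroup G (sub_sgroup H C) f = simplicial_hom.ker_sgroup G H f"
  unfolding f.ker_sgroup_def g.ker_sgroup_def by (simp add: kernel_def)
qed

text \<open>Under the operators the variables form a simplicial pointed set. The ring modulo the
  variables is modelled inside \<open>B\<close> by the image of \<open>e p (W p)\<close>;
  \<open>e_opr_e\<close> says that the operators respect the kernel of this substitution, hence
  descend.\<close>

locale kill_sphere = pointed_family W Op
 for W :: "nat => 'w set" and Op +
 fixes B :: "nat => 'a ring" and Fil :: "nat => nat => 'a set" and \<xi> :: "nat => 'w => 'a"
  and e :: "nat => 'w set => 'a => 'a" and opr :: "nat => nat => (nat => nat) => 'a => 'a"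
 assumes koszul: "koszul_ring (B p) (W p) (Fil p) (\<xi> p) (e p)"
  and opr_hom: "\<theta> \<in> delta p q ==> opr p q \<theta> \<in> ring_hom (B q) (B p)"
  and opr_id: "x \<in> Fil p m ==> opr p p (restrict id {..p}) x = x"
  and opr_comp: "\<theta> \<in> delta p q ==> \<psi> \<in> delta q r ==> x \<in> carrier (B r) ==>
     opr p r (compose {..p} \<psi> \<theta>) x = opr p q \<theta> (opr q r \<psi> x)"
  and opr_Fil: "\<theta> \<in> delta p q ==> x \<in> Fil q m ==> opr p q \<theta> x \<in> Fil p m"
  and opr_\<xi>: "\<theta> \<in> delta p q ==> w \<in> W q ==>
     opr p q \<theta> (\<xi> q w) = (case Op p q \<theta> w of None => \<zero>\<^bsub>B p\<^esub> | Some v => \<xi> p v)"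
  and e_opr_e: "\<theta> \<in> delta p q ==> x \<in> carrier (B q) ==>
     e p (W p) (opr p q \<theta> (e q (W q) x)) = e p (W p) (opr p q \<theta> x)"
begin

sublocale K: koszul_ring "B p" "W p" "Fil p" "\<xi> p" "e p" for p
 by (rule koszul)

abbreviation "eW p \<equiv> e p (W p)"

definition filt :: "nat => 'a sgroup" where
 "filt m = additive_sgroup B (\<lambda>p. Fil p m) opr"

definition quotient_filt :: "nat => 'a sgroup" where
 "quotient_filt m = additive_sgroup B (\<lambda>p. eW p ` Fil p m) (\<lambda>p q \<theta> x. eW p (opr p q \<theta> x))"

lemma Grp_filt: "Grp (filt m) p = K.Fgrp p m"
 by (simp add: filt_def additive_sgroup_def K.Fgrp_def)

lemma GStr_filt [simp]: "GStr (filt m) = opr"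
 by (simp add: filt_def)

abbreviation "Alt n m \<equiv> alt_sgroup n (filt m)"
abbreviation "kz p \<equiv> K.kz p (W p)"

lemma opr_ring_hom: "\<theta> \<in> delta p q ==> ring_hom_cring (B q) (B p) (opr p q \<theta>)"
 by (simp add: ring_hom_cring_def ring_hom_cring_axioms_def K.is_cring opr_hom)

lemma filt_simplicial: "simplicial_abelian_group (filt m)"
 unfolding filt_def
proof (rule additive_sgroup_simplicial)
 show "abelian_group (B p)" for p
  by (rule K.is_abelian_group)
 show "additive_subgroup (Fil p m) (B p)" for p
  by (rule K.Fil_additive)
qed (use K.Fil_closed in \<open>auto simp: opr_Fil opr_id opr_comp ring_hom_add[OF opr_hom]\<close>)

sublocale F: alt_simplicial W Op "filt m" for m
 by (intro alt_simplicial.intro pointed_family_axioms filt_simplicial)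

lemma W_finprod_fibre:
 assumes \<theta>: "\<theta> \<in> delta p q" and f: "\<And>ws. f ws \<in> carrier (B p)" and n: "v \<in> W p"
 shows "finsum (B p) f (fibre p q \<theta> (Suc n) (v # vs)) =
  finsum (B p) (\<lambda>w. finsum (B p) (\<lambda>ws. f (w # ws)) (fibre p q \<theta> n vs)) {w \<in> W q. Op p q \<theta> w = Some v}"
proof -
 have eq: "fibre p q \<theta> (Suc n) (v # vs) = (\<lambda>(w, ws). w # ws) ` ({w \<in> W q. Op p q \<theta> w = Some v} \<times> fibre p q \<theta> n vs)"
 proof (intro equalityI subsetI)
  fix ws assume ws: "ws \<in> fibre p q \<theta> (Suc n) (v # vs)"
  then obtain w us where "ws = w # us"
   by (cases ws) (auto simp: fibre_def words_def)
  then show "ws \<in> (\<lambda>(w, ws). w # ws) ` ({w \<in> W q. Op p q \<theta> w = Some v} \<times> fibre p q \<theta> n vs)"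
   using ws by (auto simp: fibre_def)
 qed (auto simp: fibre_def)
 have "finsum (B p) f (fibre p q \<theta> (Suc n) (v # vs)) =
   finsum (B p) (\<lambda>x. f ((\<lambda>(w, ws). w # ws) x)) ({w \<in> W q. Op p q \<theta> w = Some v} \<times> fibre p q \<theta> n vs)"
  unfolding eq by (rule K.finsum_reindex) (auto simp: f inj_on_def)
 also have "\<dots> = finsum (B p) (\<lambda>w. finsum (B p) (\<lambda>ws. f (w # ws)) (fibre p q \<theta> n vs)) {w \<in> W q. Op p q \<theta> w = Some v}"
  using comm_monoid.finprod_Times[OF K.a_comm_monoid, of "{w \<in> W q. Op p q \<theta> w = Some v}" "fibre p q \<theta> n vs"
    "\<lambda>x. f ((\<lambda>(w, ws). w # ws) x)" p]
  by (simp add: f finsum_def)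
 finally show ?thesis .
qed

lemma push_filt:
 "\<theta> \<in> delta p q ==> (\<And>ws. a ws \<in> Fil q m) ==>
  GStr (Alt n m) p q \<theta> a vs = finsum (B p) (\<lambda>ws. opr p q \<theta> (a ws)) (fibre p q \<theta> n vs)"
 by (simp add: Grp_filt opr_Fil K.finprod_Fgrp)

lemma kz_natural:
 assumes \<theta>: "\<theta> \<in> delta p q" and a: "\<And>ws. a ws \<in> Fil q m"
 shows "kz p (GStr (Alt (Suc n) m) p q \<theta> a) vs =
  GStr (Alt n (Suc m)) p q \<theta> (kz q a) vs"
proof -
 interpret H: ring_hom_cring "B q" "B p" "opr p q \<theta>"
  by (rule opr_ring_hom[OF \<theta>])
 have ac: "a ws \<in> carrier (B q)" "opr p q \<theta> (a ws) \<in> carrier (B p)" for ws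
  using K.Fil_closed[OF a] H.hom_closed by auto
 let ?o = "opr p q \<theta>" and ?fib = "fibre p q \<theta> n vs"
 let ?W = "\<lambda>v. {w \<in> W q. Op p q \<theta> w = Some v}"
 define g where "g w = finsum (B p) (\<lambda>ws. ?o (\<xi> q w) \<otimes>\<^bsub>B p\<^esub> ?o (a (w # ws))) ?fib" for w
 have g: "w \<in> W q ==> g w \<in> carrier (B p)" for w
  unfolding g_def using ac by (intro K.finsum_closed) auto
 have "kz p (GStr (Alt (Suc n) m) p q \<theta> a) vs = finsum (B p) (\<lambda>v. finsum (B p) g (?W v)) (W p)"
  unfolding K.kz_def
 proof (rule K.finsum_cong')
  show "(\<lambda>v. finsum (B p) g (?W v)) \<in> W p \<rightarrow> carrier (B p)"
   using g by (auto intro!: K.finsum_closed)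
  fix v assume v: "v \<in> W p"
  have "GStr (Alt (Suc n) m) p q \<theta> a (v # vs) =
    finsum (B p) (\<lambda>w. finsum (B p) (\<lambda>ws. ?o (a (w # ws))) ?fib) (?W v)"
   unfolding push_filt[OF \<theta> a] by (rule W_finprod_fibre[OF \<theta> ac(2) v])
  then have "\<xi> p v \<otimes>\<^bsub>B p\<^esub> GStr (Alt (Suc n) m) p q \<theta> a (v # vs) =
    finsum (B p) (\<lambda>w. \<xi> p v \<otimes>\<^bsub>B p\<^esub> finsum (B p) (\<lambda>ws. ?o (a (w # ws))) ?fib) (?W v)"
   using v ac by (simp add: K.finsum_rdistr Pi_iff)
  also have "\<dots> = finsum (B p) g (?W v)"
  proof (rule K.finsum_cong')
   fix w assume w: "w \<in> ?W v"
   then have "?o (\<xi> q w) = \<xi> p v"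
    using opr_\<xi>[OF \<theta>, of w] by simp
   then show "\<xi> p v \<otimes>\<^bsub>B p\<^esub> finsum (B p) (\<lambda>ws. ?o (a (w # ws))) ?fib = g w"
    unfolding g_def using v ac by (simp add: K.finsum_rdistr)
  qed (use g in auto)
  finally show "\<xi> p v \<otimes>\<^bsub>B p\<^esub> GStr (Alt (Suc n) m) p q \<theta> a (v # vs) = finsum (B p) g (?W v)" .
 qed simp
 also have "\<dots> = finsum (B p) g (\<Union>(?W ` W p))"
  unfolding finsum_def
  by (rule comm_monoid.finprod_UN_disjoint[OF K.a_comm_monoid, symmetric])
   (use g in \<open>auto simp: pairwise_def disjnt_def\<close>)
 also have "\<dots> = finsum (B p) g (W q)"
  unfolding finsum_def
 proof (rule comm_monoid.finprod_mono_neutral_cong_left[OF K.a_comm_monoid])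
  fix w assume w: "w \<in> W q - \<Union>(?W ` W p)"
  then have "Op p q \<theta> w = None"
   using Op_in[OF \<theta>, of w] by (cases "Op p q \<theta> w") auto
  then have "?o (\<xi> q w) = \<zero>\<^bsub>B p\<^esub>"
   using opr_\<xi>[OF \<theta>, of w] w by simp
  then have "g w = finsum (B p) (\<lambda>ws. \<zero>\<^bsub>B p\<^esub>) ?fib"
   unfolding g_def using ac by (intro K.finsum_cong') auto
  then show "g w = \<one>\<^bsub>add_monoid (B p)\<^esub>"
   by simp
 qed (use g in auto)
 also have "\<dots> = finsum (B p) (\<lambda>ws. finsum (B p) (\<lambda>w. ?o (\<xi> q w) \<otimes>\<^bsub>B p\<^esub> ?o (a (w # ws))) (W q)) ?fib"
  unfolding g_def finsum_def
  by (rule comm_monoid.finprod_swap[OF K.a_comm_monoid]) (use ac in auto)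
 also have "\<dots> = finsum (B p) (\<lambda>ws. ?o (kz q a ws)) ?fib"
 proof (rule K.finsum_cong')
  fix ws
  show "finsum (B p) (\<lambda>w. ?o (\<xi> q w) \<otimes>\<^bsub>B p\<^esub> ?o (a (w # ws))) (W q) = ?o (kz q a ws)"
   unfolding K.kz_def using ac by (subst H.hom_finsum) (auto simp: comp_def intro!: K.finsum_cong')
 qed (use K.kz_closed[of "W q" q a] ac in auto)
 also have "\<dots> = GStr (Alt n (Suc m)) p q \<theta> (kz q a) vs"
  by (rule push_filt[symmetric, OF \<theta> K.kz_Fil[OF order_refl a]])
 finally show ?thesis .
qed

lemma kz_simplicial_hom:
 "simplicial_hom (Alt (Suc n) m) (Alt n (Suc m)) kz"
proof -
 interpret A: simplicial_abelian_group "Alt (Suc n) m" by (rule F.alt_simplicial)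
 interpret A': simplicial_abelian_group "Alt n (Suc m)" by (rule F.alt_simplicial)
 show ?thesis
 proof
  show "kz p \<in> hom (Grp (Alt (Suc n) m) p) (Grp (Alt n (Suc m)) p)" for p
  proof (rule homI)
   fix a b assume "a \<in> carrier (Grp (Alt (Suc n) m) p)" "b \<in> carrier (Grp (Alt (Suc n) m) p)"
   then have "a ws \<in> Fil p m" "b ws \<in> Fil p m" for ws
    by (auto simp: Grp_filt K.alt_Fgrp)
   then have c: "a ws \<in> carrier (B p)" "b ws \<in> carrier (B p)" for ws
    by (blast intro: K.Fil_closed)+
   have "kz p (\<lambda>ws. a ws \<oplus>\<^bsub>B p\<^esub> b ws) ws = kz p a ws \<oplus>\<^bsub>B p\<^esub> kz p b ws" for ws
   proof -
    have "kz p (\<lambda>ws. a ws \<oplus>\<^bsub>B p\<^esub> b ws) ws =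
      finsum (B p) (\<lambda>w. \<xi> p w \<otimes>\<^bsub>B p\<^esub> a (w # ws) \<oplus>\<^bsub>B p\<^esub> \<xi> p w \<otimes>\<^bsub>B p\<^esub> b (w # ws)) (W p)"
     unfolding K.kz_def using c by (intro K.finsum_cong') (auto simp: K.r_distr)
    then show ?thesis
     unfolding K.kz_def using c by (simp add: K.finsum_addf Pi_iff)
   qed
   then show "kz p (a \<otimes>\<^bsub>Grp (Alt (Suc n) m) p\<^esub> b) =
     kz p a \<otimes>\<^bsub>Grp (Alt n (Suc m)) p\<^esub> kz p b"
    by (simp add: Grp_filt alt_group_def fun_eq_iff)
  qed (simp add: Grp_filt K.kz_alt_Fgrp)
  show "kz p (GStr (Alt (Suc n) m) p q \<theta> a) =
    GStr (Alt n (Suc m)) p q \<theta> (kz q a)"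
   if "\<theta> \<in> delta p q" "a \<in> carrier (Grp (Alt (Suc n) m) q)" for p q \<theta> a
   using that kz_natural[OF that(1), of a m n] by (auto simp: Grp_filt K.alt_Fgrp simp del: alt_sgroup_simps(2))
 qed
qed

sublocale D: simplicial_hom "Alt (Suc n) m" "Alt n (Suc m)" kz for n m
 by (rule kz_simplicial_hom)

lemma quotient_filt_simplicial: "simplicial_abelian_group (quotient_filt m)"
 and quotient_map: "simplicial_surjection (filt m) (quotient_filt m) eW"
proof -
 have e: "ring_hom_cring (B p) (B p) (eW p)" for p
  by (rule K.e_ring_hom) simp
 have ec: "x \<in> carrier (B p) ==> eW p x \<in> carrier (B p)" for p x
  using ring_hom_closed[OF K.e_hom[OF order_refl]] .
 have oc: "\<theta> \<in> delta p q ==> x \<in> carrier (B q) ==> opr p q \<theta> x \<in> carrier (B p)" for p q \<theta> x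
  using ring_hom_closed[OF opr_hom] .
 note fc = K.Fil_closed
 show s: "simplicial_abelian_group (quotient_filt m)"
  unfolding quotient_filt_def
 proof (rule additive_sgroup_simplicial)
  show "abelian_group (B p)" for p
   by (rule K.is_abelian_group)
  show "additive_subgroup (eW p ` Fil p m) (B p)" for p
  proof -
   interpret e: ring_hom_cring "B p" "B p" "eW p" by (rule e)
   have "group_hom (add_monoid (B p)) (add_monoid (B p)) (eW p)"
    by (intro group_hom.intro group_hom_axioms.intro K.a_group) (auto simp: hom_def)
   then show ?thesis
    using group_hom.subgroup_img_is_subgroup[OF _ K.Fil_subgroup] by (simp add: additive_subgroup_def)
  qed
  show "eW p (opr p q \<theta> x) \<in> eW p ` Fil p m"
   if "\<theta> \<in> delta p q" "x \<in> eW q ` Fil q m" for p q \<theta> x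
   using that opr_Fil fc by (auto simp: e_opr_e)
  show "eW p (opr p q \<theta> (x \<oplus>\<^bsub>B q\<^esub> y)) = eW p (opr p q \<theta> x) \<oplus>\<^bsub>B p\<^esub> eW p (opr p q \<theta> y)"
   if "\<theta> \<in> delta p q" "x \<in> eW q ` Fil q m" "y \<in> eW q ` Fil q m" for p q \<theta> x y
  proof -
   have "x \<in> carrier (B q)" "y \<in> carrier (B q)"
    using that ec fc by auto
   then show ?thesis
    using that oc by (simp add: ring_hom_add[OF opr_hom] ring_hom_add[OF K.e_hom[OF order_refl]])
  qed
  show "eW p (opr p p (restrict id {..p}) x) = x" if "x \<in> eW p ` Fil p m" for p x
   using that fc e_opr_e[OF delta_id[of p]] by (auto simp: opr_id)
  show "eW p (opr p r (compose {..p} \<psi> \<theta>) x) = eW p (opr p q \<theta> (eW q (opr q r \<psi> x)))"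
   if "\<theta> \<in> delta p q" "\<psi> \<in> delta q r" "x \<in> eW r ` Fil r m" for p q r \<theta> \<psi> x
  proof -
   have "x \<in> carrier (B r)"
    using that ec fc by auto
   then show ?thesis
    using that by (simp add: opr_comp e_opr_e oc)
  qed
 qed
 interpret Q: simplicial_abelian_group "quotient_filt m" by (rule s)
 show "simplicial_surjection (filt m) (quotient_filt m) eW"
 proof
  show "eW p \<in> hom (Grp (filt m) p) (Grp (quotient_filt m) p)" for p
   using fc ring_hom_add[OF K.e_hom[OF order_refl]] by (auto simp: hom_def filt_def quotient_filt_def)
  show "eW p (GStr (filt m) p q \<theta> x) = GStr (quotient_filt m) p q \<theta> (eW q x)"
   if "\<theta> \<in> delta p q" "x \<in> carrier (Grp (filt m) q)" for p q \<theta> x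
   using that fc by (simp add: quotient_filt_def filt_def e_opr_e)
  show "carrier (Grp (quotient_filt m) p) \<subseteq> eW p ` carrier (Grp (filt m) p)" for p
   by (simp add: filt_def quotient_filt_def)
 qed
qed

text \<open>By exactness the kernel for exponent \<open>Suc k\<close> is the image of the tensors
  with words one letter longer and exponent \<open>k\<close>. These are acyclic below
  \<open>k\<close>, the kernel of that surjection is acyclic below \<open>k - 1\<close> by
  induction, so the image is acyclic below \<open>k\<close>. The loss in the exponent is made up by
  the shift in degree.\<close>

lemma ker_kz_acyclic:
 assumes "\<And>m. acyclic_below m (filt m)"
 shows "acyclic_below (m - 1) (D.ker_sgroup n m)"
proof (induction m arbitrary: n)
 case (Suc k)
 show ?case
 proof (cases k)
  case 0
  then show ?thesis by simp
 next
  case (Suc l)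
  let ?C = "\<lambda>p. kernel (Grp (Alt (Suc n) (Suc k)) p) (Grp (Alt n (Suc (Suc k))) p) (kz p)"
  have im: "kz p ` carrier (Grp (Alt (Suc (Suc n)) k) p) = ?C p" for p
  proof (intro equalityI subsetI)
   fix b assume "b \<in> kz p ` carrier (Grp (Alt (Suc (Suc n)) k) p)"
   then obtain a where a: "a \<in> alt (Suc (Suc n)) (W p) (K.Fgrp p k)" and b: "b = kz p a"
    by (auto simp: Grp_filt)
   have "a \<in> alt (Suc (Suc n)) (W p) (add_monoid (B p))"
    using a K.alt_Fgrp by blast
   then show "b \<in> ?C p"
    using K.kz_alt_Fgrp[OF order_refl a] K.kz_kz[OF order_refl] by (simp add: b kernel_def Grp_filt fun_eq_iff)
  next
   fix b assume "b \<in> ?C p"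
   then have "b \<in> alt (Suc n) (W p) (K.Fgrp p (Suc k))" "K.kz_cycle p (Suc n) (W p) b"
    by (auto simp: kernel_def Grp_filt K.kz_cycle_def fun_eq_iff)
   from K.koszul_exact[OF order_refl this] show "b \<in> kz p ` carrier (Grp (Alt (Suc (Suc n)) k) p)"
    by (auto simp: Grp_filt)
  qed
  have s: "simplicial_abelian_group (sub_sgroup (Alt (Suc n) (Suc k)) ?C)"
   using D.ker_sgroup_simplicial[of n "Suc k"] unfolding D.ker_sgroup_def .
  interpret S: simplicial_surjection "Alt (Suc (Suc n)) k" "sub_sgroup (Alt (Suc n) (Suc k)) ?C" kz
   by (rule corestrict(1)[OF D.simplicial_hom_axioms s im])
  have "acyclic_below k (Alt (Suc (Suc n)) k)"
   by (rule alt_sgroup_acyclic[OF filt_simplicial assms])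
  moreover have "acyclic_below (k - 1) S.ker_sgroup"
   using Suc.IH[of "Suc n"] corestrict(2)[OF D.simplicial_hom_axioms s im] by simp
  ultimately show ?thesis
   using S.acyclic_below_quotient[of k] unfolding D.ker_sgroup_def by simp
 qed
qed simp

text \<open>The end of the same complex. In exponent \<open>Suc k\<close> the kernel of setting the
  variables to 0 is the image of the words of length one with exponent \<open>k\<close>. So it is
  acyclic below \<open>k\<close>, which suffices for a quotient acyclic below
  \<open>Suc k\<close>.\<close>

theorem quotient_filt_acyclic:
 assumes "\<And>m. acyclic_below m (filt m)"
 shows "acyclic_below m (quotient_filt m)"
proof -
 interpret Q: simplicial_surjection "filt m" "quotient_filt m" eW
  by (rule quotient_map)
 have "acyclic_below (m - 1) Q.ker_sgroup"
 proof (cases m)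
  case (Suc k)
  let ?C = "\<lambda>p. kernel (Grp (filt m) p) (Grp (quotient_filt m) p) (eW p)"
  \<comment> \<open>The value at the empty word identifies tensors of word length 0 with their
    coefficients, so that the Koszul differential ends in the filtration itself.\<close>
  let ?f = "\<lambda>p a. kz p a []"
  interpret A: simplicial_abelian_group "Alt (Suc 0) k" by (rule F.alt_simplicial)
  have mult: "kz p (a \<otimes>\<^bsub>Grp (Alt (Suc 0) k) p\<^esub> b) ws = kz p a ws \<oplus>\<^bsub>B p\<^esub> kz p b ws"
   if "a \<in> alt (Suc 0) (W p) (K.Fgrp p k)" "b \<in> alt (Suc 0) (W p) (K.Fgrp p k)" for a b p ws
   using D.f_mult[of a 0 k p b] that by (simp add: Grp_filt)
  have h: "simplicial_hom (Alt (Suc 0) k) (filt m) ?f"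
  proof
   show "?f p \<in> hom (Grp (Alt (Suc 0) k) p) (Grp (filt m) p)" for p
    using mult by (auto simp: hom_def Grp_filt Suc K.alt_Fgrp intro!: K.kz_Fil)
   show "?f p (GStr (Alt (Suc 0) k) p q \<theta> a) = GStr (filt m) p q \<theta> (?f q a)"
    if \<theta>: "\<theta> \<in> delta p q" and "a \<in> carrier (Grp (Alt (Suc 0) k) q)" for p q \<theta> a
   proof -
    have a: "a ws \<in> Fil q k" for ws
     using that(2) by (simp add: Grp_filt K.alt_Fgrp)
    have f: "fibre p q \<theta> 0 [] = {[]}"
     by (auto simp: fibre_def words_def)
    have "opr p q \<theta> (kz q a []) \<in> carrier (B p)"
     using ring_hom_closed[OF opr_hom[OF \<theta>] K.Fil_closed[OF K.kz_Fil[where a = a, OF order_refl a]]] .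
    then show ?thesis
     using kz_natural[of \<theta> p q a k 0 "[]", OF \<theta> a]
      push_filt[of \<theta> p q "kz q a" "Suc k" 0 "[]", OF \<theta> K.kz_Fil[where a = a, OF order_refl a]]
     by (simp add: f)
   qed
  qed
  have im: "?f p ` carrier (Grp (Alt (Suc 0) k) p) = ?C p" for p
  proof (intro equalityI subsetI)
   fix x assume "x \<in> ?f p ` carrier (Grp (Alt (Suc 0) k) p)"
   then obtain a where "a \<in> alt (Suc 0) (W p) (K.Fgrp p k)" and x: "x = kz p a []"
    by (auto simp: Grp_filt)
   then have a: "a ws \<in> Fil p k" for ws
    using K.alt_Fgrp by blast
   show "x \<in> ?C p"
    using K.kz_Fil[where a = a, OF order_refl a] K.e_kz[of "W p" p a] K.Fil_closed[OF a]
    by (simp add: x kernel_def Grp_filt quotient_filt_def Suc)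
  next
   fix x assume "x \<in> ?C p"
   then have x: "x \<in> Fil p (Suc k)" "eW p x = \<zero>\<^bsub>B p\<^esub>"
    by (auto simp: kernel_def Grp_filt quotient_filt_def Suc)
   let ?a = "\<lambda>ws. if ws = [] then x else \<zero>\<^bsub>B p\<^esub>"
   have "?a \<in> alt 0 (W p) (K.Fgrp p (Suc k))"
    using x additive_subgroup.zero_closed[OF K.Fil_additive]
    by (intro altI) (auto simp: words_def K.inv_Fgrp)
   moreover have "K.kz_cycle p 0 (W p) ?a"
    using x by (simp add: K.kz_cycle_def)
   ultimately obtain b where "b \<in> alt (Suc 0) (W p) (K.Fgrp p k)" "kz p b = ?a"
    using K.koszul_exact[OF order_refl] by blast
   then show "x \<in> ?f p ` carrier (Grp (Alt (Suc 0) k) p)"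
    by (intro image_eqI[of _ _ b]) (auto simp: Grp_filt)
  qed
  have s: "simplicial_abelian_group (sub_sgroup (filt m) ?C)"
   using Q.ker_sgroup_simplicial unfolding Q.ker_sgroup_def .
  interpret S: simplicial_surjection "Alt (Suc 0) k" "sub_sgroup (filt m) ?C" ?f
   by (rule corestrict(1)[OF h s im])
  interpret h: simplicial_hom "Alt (Suc 0) k" "filt m" ?f
   by (rule h)
  have "h.ker_sgroup = D.ker_sgroup 0 k"
  proof -
   have "kernel (Grp (Alt (Suc 0) k) p) (Grp (filt m) p) (?f p) =
     kernel (Grp (Alt (Suc 0) k) p) (Grp (Alt 0 (Suc k)) p) (kz p)" for p
   proof -
    have "kz p a [] = \<zero>\<^bsub>B p\<^esub> \<longleftrightarrow> kz p a = (\<lambda>ws. \<zero>\<^bsub>B p\<^esub>)"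
     if "a \<in> alt (Suc 0) (W p) (K.Fgrp p k)" for a
    proof
     assume 0: "kz p a [] = \<zero>\<^bsub>B p\<^esub>"
     show "kz p a = (\<lambda>ws. \<zero>\<^bsub>B p\<^esub>)"
     proof
      fix ws
      show "kz p a ws = \<zero>\<^bsub>B p\<^esub>"
       using 0 alt_outside[OF K.kz_alt_Fgrp[OF order_refl that], of ws] by (cases ws) (auto simp: words_def)
     qed
    qed simp
    then show ?thesis
     unfolding kernel_def by (intro Collect_cong conj_cong) (simp_all add: Grp_filt)
   qed
   then show ?thesis
    unfolding h.ker_sgroup_def D.ker_sgroup_def by simp
  qed
  then have "acyclic_below (k - 1) S.ker_sgroup"
   using ker_kz_acyclic[OF assms, of k 0] corestrict(2)[OF h s im] by simp
  moreover have "acyclic_below k (Alt (Suc 0) k)"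
   by (rule alt_sgroup_acyclic[OF filt_simplicial assms])
  ultimately show ?thesis
   using S.acyclic_below_quotient[of k] Suc unfolding Q.ker_sgroup_def by simp
 qed simp
 then show ?thesis
  by (rule Q.acyclic_below_quotient[OF assms])
qed

end

section \<open>Killing the cells one at a time\<close>

text \<open>With a trivial group in degree 0 the base vertex always vanishes, so the decalage
  coincides with the contractible object of based paths.\<close>

lemma (in simplicial_abelian_group) path_sgroup_acyclic:
 assumes "carrier (Grp G 0) = {\<one>\<^bsub>Grp G 0\<^esub>}"
 shows "acyclic_below n (path_sgroup G)"
proof (rule acyclic_below_cong[OF based_paths_acyclic based_paths path_sgroup])
 fix p
 show "carrier (Grp (based_paths G) p) = carrier (Grp (path_sgroup G) p)"
  using GStr_closed[OF vertex_in[of "Suc p"]] assms by (auto simp: kernel_def path_sgroup_def)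
qed (simp_all add: path_sgroup_def)

text \<open>A cycle is carried over by \<open>i\<close>, bounded there, and the bounding chain is
  carried back by \<open>r\<close>. Units and faces are what this has to respect; \<open>i\<close>
  and \<open>r\<close> will be the degeneracy s_0 and the face d_0.\<close>

lemma acyclic_below_retract:
 assumes G: "simplicial_abelian_group G" and H: "simplicial_abelian_group H" "acyclic_below n H"
  and i: "\<And>p x. x \<in> carrier (Grp G p) ==> i p x \<in> carrier (Grp H p) \<and> r p (i p x) = x" "\<And>p. i p \<one>\<^bsub>Grp G p\<^esub> = \<one>\<^bsub>Grp H p\<^esub>"
  and i_face: "\<And>p j x. j \<le> Suc p ==> x \<in> carrier (Grp G (Suc p)) ==> face H p j (i (Suc p) x) = i p (face G p j x)"
  and r: "\<And>p x. x \<in> carrier (Grp H p) ==> r p x \<in> carrier (Grp G p)" "\<And>p. r p \<one>\<^bsub>Grp H p\<^esub> = \<one>\<^bsub>Grp G p\<^esub>"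
  and r_face: "\<And>p j x. j \<le> Suc p ==> x \<in> carrier (Grp H (Suc p)) ==> face G p j (r (Suc p) x) = r p (face H p j x)"
 shows "acyclic_below n G"
 unfolding acyclic_below_def
proof (intro allI impI ballI)
 interpret G: simplicial_abelian_group G by fact
 interpret H: simplicial_abelian_group H by fact
 fix j z assume j: "j < n" and z: "z \<in> moore_cycles G j"
 have "i j z \<in> moore_cycles H j"
  using z unfolding G.moore_cycles_iff H.moore_cycles_iff by (auto simp: i i_face)
 then obtain y where y: "y \<in> moore H (Suc j)" "face H j 0 y = i j z"
  by (rule acyclic_belowE[OF H(2) j])
 then have "r (Suc j) y \<in> moore G (Suc j)" "face G j 0 (r (Suc j) y) = z"
  using i(1)[OF G.moore_cycles_carrier[OF z]] by (auto simp: r r_face)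
 then show "\<exists>y\<in>moore G (Suc j). face G j 0 y = z"
  by blast
qed

section \<open>Powers of an ideal and division by a variable\<close>

lemma (in ring) ideal_power_ideal: "ideal I R ==> ideal (ideal_power R I m) R"
 by (induction m) (auto simp: oneideal ideal_prod_is_ideal)

lemma ideal_power_hom:
 assumes "ring R" "ring S" "h \<in> ring_hom R S" "ideal I R" "\<And>x. x \<in> I ==> h x \<in> J" "x \<in> ideal_power R I m"
 shows "h x \<in> ideal_power S J m"
proof -
 interpret R: ring R by fact
 show ?thesis
  using assms(6)
 proof (induction m arbitrary: x)
  case 0
  then show ?case using assms(3) by (auto simp: ring_hom_closed)
 next
  case (Suc m)
  have c: "x \<in> ideal_prod R I (ideal_power R I m) ==> x \<in> carrier R" for x
   using R.ideal_prod_in_carrier[OF assms(4) R.ideal_power_ideal[OF assms(4)]] by blast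
  from Suc.prems have "x \<in> ideal_prod R I (ideal_power R I m)" by simp
  then have "h x \<in> ideal_prod S J (ideal_power S J m)"
  proof (induction x rule: ideal_prod.induct)
   case (prod i j)
   then have "i \<in> carrier R" "j \<in> carrier R"
    using ideal.Icarr[OF assms(4)] ideal.Icarr[OF R.ideal_power_ideal[OF assms(4)]] by auto
   then show ?case
    using prod assms(3,5) Suc.IH by (auto simp: ring_hom_mult intro: ideal_prod.prod)
  next
   case (sum s t)
   then show ?case
    using c assms(3) by (auto simp: ring_hom_add intro: ideal_prod.sum)
  qed
  then show ?case by simp
 qed
qed

text \<open>A Leibniz rule. If a = h a + t g and b = h b + t k, then a b = h (a b) + t (g b + h a
  k). With \<open>a\<close> in the ideal, \<open>b\<close> in its power \<open>Suc m\<close> and, by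
  induction, \<open>k\<close> in its power \<open>m\<close>, both terms in the bracket lie in the
  power \<open>Suc m\<close>. So division by \<open>t\<close> costs a single power, however many
  factors there are.\<close>

lemma (in cring) factor_ideal_power:
 assumes h: "h \<in> ring_hom R R" and I: "ideal I R" "\<And>x. x \<in> I ==> h x \<in> I" and t: "t \<in> carrier R"
  and factor: "\<And>f. f \<in> carrier R ==> \<exists>g\<in>carrier R. f = h f \<oplus> t \<otimes> g" and f: "f \<in> ideal_power R I (Suc m)"
 shows "\<exists>g\<in>ideal_power R I m. f = h f \<oplus> t \<otimes> g"
 using f
proof (induction m arbitrary: f)
 case 0
 then show ?case
  using factor[OF ideal.Icarr[OF ideal_power_ideal[OF I(1)] 0]] by simp
next
 case (Suc m)
 interpret J: ideal "ideal_power R I (Suc m)" R by (rule ideal_power_ideal[OF I(1)])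
 have hc: "x \<in> carrier R ==> h x \<in> carrier R" for x
  using ring_hom_closed[OF h] .
 have Pc: "x \<in> ideal_power R I k ==> x \<in> carrier R" for x k
  using ideal.Icarr[OF ideal_power_ideal[OF I(1)]] .
 have "f \<in> ideal_prod R I (ideal_power R I (Suc m))"
  using Suc.prems by simp
 then show ?case
 proof (induction f rule: ideal_prod.induct)
  case (prod a b)
  have ab: "a \<in> carrier R" "b \<in> carrier R"
   using prod ideal.Icarr[OF I(1)] Pc by auto
  obtain g where g: "g \<in> carrier R" "a = h a \<oplus> t \<otimes> g"
   using factor[OF ab(1)] by blast
  obtain k where k: "k \<in> ideal_power R I m" "b = h b \<oplus> t \<otimes> k"
   using Suc.IH[OF prod(2)] by blast
  note c = ab hc[OF ab(1)] hc[OF ab(2)] g(1) Pc[OF k(1)] t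
  have "h a \<otimes> k \<in> ideal_power R I (Suc m)"
   using ideal_prod.prod[OF I(2)[OF prod(1)] k(1)] by simp
  then have "g \<otimes> b \<oplus> h a \<otimes> k \<in> ideal_power R I (Suc m)"
   using J.I_l_closed[OF prod(2) g(1)] by (intro J.a_closed)
  moreover have "a \<otimes> b = h (a \<otimes> b) \<oplus> t \<otimes> (g \<otimes> b \<oplus> h a \<otimes> k)"
  proof -
   have "a \<otimes> b = h a \<otimes> b \<oplus> t \<otimes> (g \<otimes> b)"
    using c g(2) by (metis l_distr m_assoc m_closed)
   also have "h a \<otimes> b = h (a \<otimes> b) \<oplus> t \<otimes> (h a \<otimes> k)"
    using c k(2) ring_hom_mult[OF h ab] by (metis r_distr m_lcomm m_closed)
   finally show ?thesis
    using c hc[of "a \<otimes> b"] by (simp add: r_distr a_ac)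
  qed
  ultimately show ?case by blast
 next
  case (sum a b)
  then obtain g k where g: "g \<in> ideal_power R I (Suc m)" "a = h a \<oplus> t \<otimes> g" and k: "k \<in> ideal_power R I (Suc m)" "b = h b \<oplus> t \<otimes> k"
   by blast
  have ab: "a \<in> carrier R" "b \<in> carrier R"
   using sum(1,2) Pc[of _ "Suc (Suc m)"] by auto
  note c = hc[OF ab(1)] hc[OF ab(2)] Pc[OF g(1)] Pc[OF k(1)] t
  have "a \<oplus> b = (h a \<oplus> t \<otimes> g) \<oplus> (h b \<oplus> t \<otimes> k)"
   using g(2) k(2) by simp
  also have "\<dots> = h (a \<oplus> b) \<oplus> t \<otimes> (g \<oplus> k)"
   using c ab by (simp add: ring_hom_add[OF h] r_distr a_ac)
  finally show ?case
   using J.a_closed[OF g(1) k(1)] by blast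
 qed
qed

lemma next_stage:
 fixes \<beta> :: "'i::wellorder"
 assumes "\<beta> < \<delta>"
 shows "\<beta> < next_stage \<beta>" "next_stage \<beta> \<le> \<delta>" "\<gamma> < next_stage \<beta> \<longleftrightarrow> \<gamma> \<le> \<beta>"
proof -
 show 1: "\<beta> < next_stage \<beta>"
  unfolding next_stage_def by (rule LeastI[of "\<lambda>\<gamma>. \<beta> < \<gamma>", OF assms])
 show "next_stage \<beta> \<le> \<delta>"
  unfolding next_stage_def by (rule Least_le[of "\<lambda>\<gamma>. \<beta> < \<gamma>", OF assms])
 show "\<gamma> < next_stage \<beta> \<longleftrightarrow> \<gamma> \<le> \<beta>"
  using 1 not_less_Least[of \<gamma> "\<lambda>\<gamma>. \<beta> < \<gamma>"] unfolding next_stage_def by (meson leI less_le_trans not_less order.strict_trans1)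
qed

text \<open>The interface between the homotopy argument and the algebra. In degree \<open>p\<close>
  of the decalage, \<open>Y p \<beta>\<close> indexes the variables of the cells before
  \<open>\<beta>\<close> and \<open>e p S\<close> sets those in \<open>S\<close> to 0.
  \<open>e_opr_\<xi>\<close> says that operators respect the variables of a cell up to those of
  earlier cells, and \<open>e_all\<close> that killing all variables projects the decalage onto the
  image of s_0, a copy of the ring one degree lower.\<close>

locale cell_ring =
 fixes Rg :: "nat => ('a, 'z) ring_scheme" and opr :: "nat => nat => (nat => nat) => 'a => 'a"
  and I :: "nat => 'a set" and L :: "'i::wellorder" and V :: "'i => nat => 'w set"
  and Op :: "'i => nat => nat => (nat => nat) => 'w => 'w option"
  and \<xi> :: "nat => 'i \<times> 'w => 'a" and e :: "nat => ('i \<times> 'w) set => 'a => 'a"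
  and Y :: "nat => 'i => ('i \<times> 'w) set"
 defines "Y \<equiv> \<lambda>p \<beta>. {(\<gamma>, w). \<gamma> < \<beta> \<and> w \<in> V \<gamma> p}"
 assumes cring: "cring (Rg p)"
  and opr_hom: "\<theta> \<in> delta p q ==> opr p q \<theta> \<in> ring_hom (Rg q) (Rg p)"
  and opr_id: "x \<in> carrier (Rg p) ==> opr p p (restrict id {..p}) x = x"
  and opr_comp: "\<theta> \<in> delta p q ==> \<psi> \<in> delta q r ==> x \<in> carrier (Rg r) ==>
     opr p r (compose {..p} \<psi> \<theta>) x = opr p q \<theta> (opr q r \<psi> x)"
  and I_ideal: "ideal (I p) (Rg p)"
  and I_opr: "\<theta> \<in> delta p q ==> x \<in> I q ==> opr p q \<theta> x \<in> I p"
  and I_0: "I 0 = {\<zero>\<^bsub>Rg 0\<^esub>}"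
  and pointed: "\<gamma> < L ==> pointed_family (V \<gamma>) (Op \<gamma>)"
  and e_hom: "S \<subseteq> Y p L ==> e p S \<in> ring_hom (Rg (Suc p)) (Rg (Suc p))"
  and e_empty: "f \<in> carrier (Rg (Suc p)) ==> e p {} f = f"
  and e_Un: "S \<subseteq> Y p L ==> U \<subseteq> Y p L ==> f \<in> carrier (Rg (Suc p)) ==> e p S (e p U f) = e p (S \<union> U) f"
  and e_I: "S \<subseteq> Y p L ==> f \<in> I (Suc p) ==> e p S f \<in> I (Suc p)"
  and e_finite: "f \<in> carrier (Rg (Suc p)) ==> \<exists>D. finite D \<and> (\<forall>S. S \<subseteq> Y p L \<longrightarrow> e p S f = e p (S \<inter> D) f)"
  and \<xi>_I: "c \<in> Y p L ==> \<xi> p c \<in> I (Suc p)"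
  and e_\<xi>: "S \<subseteq> Y p L ==> c \<in> Y p L ==> e p S (\<xi> p c) = (if c \<in> S then \<zero>\<^bsub>Rg (Suc p)\<^esub> else \<xi> p c)"
  and e_factor: "c \<in> Y p L ==> f \<in> carrier (Rg (Suc p)) ==>
     \<exists>g\<in>carrier (Rg (Suc p)). f = e p {c} f \<oplus>\<^bsub>Rg (Suc p)\<^esub> \<xi> p c \<otimes>\<^bsub>Rg (Suc p)\<^esub> g"
  and \<xi>_regular: "c \<in> Y p L ==> g \<in> carrier (Rg (Suc p)) ==>
     \<xi> p c \<otimes>\<^bsub>Rg (Suc p)\<^esub> g = \<zero>\<^bsub>Rg (Suc p)\<^esub> ==> g = \<zero>\<^bsub>Rg (Suc p)\<^esub>"
  and e_opr_\<xi>: "\<gamma> < L ==> w \<in> V \<gamma> q ==> \<theta> \<in> delta p q ==>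
     e p (Y p \<gamma>) (opr (Suc p) (Suc q) (shift p \<theta>) (\<xi> q (\<gamma>, w))) =
     (case Op \<gamma> p q \<theta> w of None => \<zero>\<^bsub>Rg (Suc p)\<^esub> | Some v => \<xi> p (\<gamma>, v))"
  and e_all: "f \<in> carrier (Rg (Suc p)) ==>
     e p (Y p L) f = opr (Suc p) p (codegeneracy p 0) (opr p (Suc p) (coface p 0) f)"
begin

sublocale Rg: cring "Rg p" for p
 by (rule cring)

abbreviation P :: "nat => nat => 'a set" where
 "P p m \<equiv> ideal_power (Rg p) (I p) m"

abbreviation "Rs p \<equiv> Rg (Suc p)"
abbreviation "E p \<beta> \<equiv> e p (Y p \<beta>)"
abbreviation "EP p \<beta> m \<equiv> E p \<beta> ` P (Suc p) m"
abbreviation "ops p q \<theta> \<equiv> opr (Suc p) (Suc q) (shift p \<theta>)"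

lemma Y_mono: "\<beta> \<le> \<gamma> ==> Y p \<beta> \<subseteq> Y p \<gamma>"
 by (auto simp: Y_def)

lemma P_ideal: "ideal (P p m) (Rg p)"
 by (rule Rg.ideal_power_ideal[OF I_ideal])

lemma P_closed: "x \<in> P p m ==> x \<in> carrier (Rg p)"
 using ideal.Icarr[OF P_ideal] .

lemma I_closed: "x \<in> I p ==> x \<in> carrier (Rg p)"
 using ideal.Icarr[OF I_ideal] .

lemma opr_closed: "\<theta> \<in> delta p q ==> x \<in> carrier (Rg q) ==> opr p q \<theta> x \<in> carrier (Rg p)"
 using ring_hom_closed[OF opr_hom] .

lemma e_closed: "S \<subseteq> Y p L ==> f \<in> carrier (Rs p) ==> e p S f \<in> carrier (Rs p)"
 using ring_hom_closed[OF e_hom] .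

lemma \<xi>_closed: "x \<in> Y p L ==> \<xi> p x \<in> carrier (Rs p)"
 by (rule I_closed[OF \<xi>_I])

lemma opr_P: "\<theta> \<in> delta p q ==> x \<in> P q m ==> opr p q \<theta> x \<in> P p m"
 by (rule ideal_power_hom[OF Rg.ring_axioms Rg.ring_axioms opr_hom I_ideal I_opr])

lemma e_P: "S \<subseteq> Y p L ==> x \<in> P (Suc p) m ==> e p S x \<in> P (Suc p) m"
 by (rule ideal_power_hom[OF Rg.ring_axioms Rg.ring_axioms e_hom I_ideal e_I])

lemma ring_hom_zero': "h \<in> ring_hom (Rg p) (Rg q) ==> h \<zero>\<^bsub>Rg p\<^esub> = \<zero>\<^bsub>Rg q\<^esub>"
 by (rule ring_hom_zero[OF _ Rg.ring_axioms Rg.ring_axioms])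

lemma e_factor_P: "x \<in> Y p L ==> f \<in> P (Suc p) (Suc m) ==>
  \<exists>g\<in>P (Suc p) m. f = e p {x} f \<oplus>\<^bsub>Rs p\<^esub> \<xi> p x \<otimes>\<^bsub>Rs p\<^esub> g"
 by (rule Rg.factor_ideal_power[OF e_hom I_ideal e_I \<xi>_closed e_factor]) auto

text \<open>Setting one variable \<open>x\<close> to 0 changes an element by a multiple of
  \<open>\<xi> q x\<close>. The operator sends \<open>\<xi> q x\<close>, up to variables of earlier
  cells, to a variable of the same cell or to 0, and \<open>E p \<beta>\<close> kills all of these.
  Since an element involves finitely many variables, a finite induction reaches
  \<open>E q \<beta>\<close>.\<close>

lemma e_opr_e:
 assumes \<beta>: "\<beta> \<le> L" and \<theta>: "\<theta> \<in> delta p q" and f: "f \<in> carrier (Rs q)"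
 shows "E p \<beta> (ops p q \<theta> (E q \<beta> f)) =
  E p \<beta> (ops p q \<theta> f)"
proof -
 let ?o = "ops p q \<theta>"
 note Yp = Y_mono[OF \<beta>, of p] and Yq = Y_mono[OF \<beta>, of q]
 note \<theta>' = shift_in[OF \<theta>]
 have "E p \<beta> (?o (e q D f)) = E p \<beta> (?o f)" if "finite D" "D \<subseteq> Y q \<beta>" for D
  using that
 proof (induction D rule: finite_induct)
  case empty
  then show ?case by (simp add: e_empty[OF f])
 next
  case (insert x D)
  have x: "x \<in> Y q \<beta>" "x \<in> Y q L" and D: "D \<subseteq> Y q L"
   using insert.prems Yq by auto
  obtain \<delta> w where xw: "x = (\<delta>, w)" "\<delta> < \<beta>" "w \<in> V \<delta> q"
   using x(1) by (auto simp: Y_def)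
  have \<delta>: "\<delta> < L" "Y p \<delta> \<subseteq> Y p \<beta>" "Y p \<delta> \<subseteq> Y p L"
   using xw(2) \<beta> Y_mono[of \<delta> \<beta> p] Y_mono[of \<delta> L p] by auto
  interpret pf: pointed_family "V \<delta>" "Op \<delta>"
   by (rule pointed[OF \<delta>(1)])
  let ?h = "e q D f"
  have h: "?h \<in> carrier (Rs q)"
   by (rule e_closed[OF D f])
  obtain g where g: "g \<in> carrier (Rs q)" "?h = e q {x} ?h \<oplus>\<^bsub>Rs q\<^esub> \<xi> q x \<otimes>\<^bsub>Rs q\<^esub> g"
   using e_factor[OF x(2) h] by blast
  have o\<xi>: "?o (\<xi> q x) \<in> carrier (Rs p)"
   by (rule opr_closed[OF \<theta>' \<xi>_closed[OF x(2)]])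
  have "E p \<beta> (?o (\<xi> q x)) = E p \<beta> (E p \<delta> (?o (\<xi> q x)))"
   using e_Un[OF Yp \<delta>(3) o\<xi>] \<delta>(2) by (simp add: Un_absorb2)
  also have "\<dots> = \<zero>\<^bsub>Rs p\<^esub>"
  proof (cases "Op \<delta> p q \<theta> w")
   case None
   then show ?thesis
    using e_opr_\<xi>[OF \<delta>(1) xw(3) \<theta>] ring_hom_zero'[OF e_hom[OF Yp]] by (simp add: xw)
  next
   case (Some v)
   have "v \<in> V \<delta> p"
    using pf.Op_in[OF \<theta> xw(3) Some] .
   then have v: "(\<delta>, v) \<in> Y p \<beta>"
    using xw(2) by (simp add: Y_def)
   show ?thesis
    using Some e_opr_\<xi>[OF \<delta>(1) xw(3) \<theta>] e_\<xi>[OF Yp subsetD[OF Yp v]] v by (simp add: xw)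
  qed
  finally have 0: "E p \<beta> (?o (\<xi> q x)) = \<zero>\<^bsub>Rs p\<^esub>" .
  have xs: "{x} \<subseteq> Y q L" using x by simp
  note cl = e_closed[OF xs h] \<xi>_closed[OF x(2)] g(1)
  have "E p \<beta> (?o ?h) = E p \<beta> (?o (e q {x} ?h \<oplus>\<^bsub>Rs q\<^esub> \<xi> q x \<otimes>\<^bsub>Rs q\<^esub> g))"
   by (rule arg_cong[OF g(2)])
  also have "\<dots> = E p \<beta> (?o (e q {x} ?h))"
   using cl 0 opr_closed[OF \<theta>' cl(1)] opr_closed[OF \<theta>' g(1)] e_closed[OF Yp]
   by (simp add: ring_hom_add[OF opr_hom[OF \<theta>']] ring_hom_mult[OF opr_hom[OF \<theta>']]
     ring_hom_add[OF e_hom[OF Yp]] ring_hom_mult[OF e_hom[OF Yp]] o\<xi>)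
  also have "e q {x} ?h = e q (insert x D) f"
   using e_Un[OF xs D f] by simp
  finally show ?case
   using insert.IH insert.prems by simp
 qed
 moreover obtain D where "finite D" "E q \<beta> f = e q (Y q \<beta> \<inter> D) f"
  using e_finite[OF f] Yq by blast
 ultimately show ?thesis by simp
qed

text \<open>The ring \<open>Rs p\<close> without the further fields of its record.\<close>

definition shifted_ring :: "nat => 'a ring" where
 "shifted_ring p = \<lparr>carrier = carrier (Rs p), mult = mult (Rs p),
   one = \<one>\<^bsub>Rs p\<^esub>, zero = \<zero>\<^bsub>Rs p\<^esub>, add = add (Rs p)\<rparr>"

lemma shifted_ring_simps [simp]:
 "carrier (shifted_ring p) = carrier (Rs p)" "mult (shifted_ring p) = mult (Rs p)" "add (shifted_ring p) = add (Rs p)"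
 "\<one>\<^bsub>shifted_ring p\<^esub> = \<one>\<^bsub>Rs p\<^esub>" "\<zero>\<^bsub>shifted_ring p\<^esub> = \<zero>\<^bsub>Rs p\<^esub>"
 by (simp_all add: shifted_ring_def)

lemma shifted_ring_cring: "cring (shifted_ring p)"
 by (intro cringI abelian_groupI comm_monoidI) (auto simp: Rg.a_ac Rg.m_ac Rg.r_distr intro: bexI[of _ "\<ominus>\<^bsub>Rs p\<^esub> _"] Rg.l_neg)

sublocale S: cring "shifted_ring p" for p
 by (rule shifted_ring_cring)

lemma shifted_ring_hom: "ring_hom (shifted_ring p) (shifted_ring q) = ring_hom (Rs p) (Rs q)"
 by (simp add: ring_hom_def)

text \<open>The \<open>m\<close>-th ideal power in the decalage after killing the variables of the
  cells before \<open>\<beta>\<close>, in normal forms. The operators are followed by the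
  substitution, which returns to normal forms.\<close>

definition stage :: "'i => nat => 'a sgroup" where
 "stage \<beta> m = additive_sgroup shifted_ring (\<lambda>p. EP p \<beta> m)
   (\<lambda>p q \<theta> f. E p \<beta> (ops p q \<theta> f))"

lemma additive_image:
 assumes "S \<subseteq> Y p L" shows "additive_subgroup (e p S ` P (Suc p) m) (shifted_ring p)"
proof -
 have "group_hom (add_monoid (Rs p)) (add_monoid (shifted_ring p)) (e p S)"
  using e_closed[OF assms] ring_hom_add[OF e_hom[OF assms]]
  by (intro group_hom.intro group_hom_axioms.intro Rg.a_group S.a_group) (auto simp: hom_def)
 then show ?thesis
  using group_hom.subgroup_img_is_subgroup[OF _ additive_subgroup.a_subgroup[OF ideal.axioms(1)[OF P_ideal]]]
  by (simp add: additive_subgroup_def)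
qed

lemma e_idem: "S \<subseteq> Y p L ==> f \<in> carrier (Rs p) ==> e p S (e p S f) = e p S f"
 by (simp add: e_Un)

lemma stage_simplicial:
 assumes \<beta>: "\<beta> \<le> L" shows "simplicial_abelian_group (stage \<beta> m)"
 unfolding stage_def
proof (rule additive_sgroup_simplicial)
 note Y = Y_mono[OF \<beta>]
 show "abelian_group (shifted_ring p)" for p
  by (rule S.is_abelian_group)
 show "additive_subgroup (EP p \<beta> m) (shifted_ring p)" for p
  by (rule additive_image[OF Y])
 fix p q r \<theta> \<psi> x y
 {
  assume x: "x \<in> EP q \<beta> m"
  then have xc: "x \<in> carrier (Rs q)"
   using P_closed e_closed[OF Y] by auto
  show "E q \<beta> (ops q q (restrict id {..q}) x) = x"
   using x xc P_closed by (auto simp: shift_id opr_id e_idem[OF Y])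
  assume \<theta>: "\<theta> \<in> delta p q"
  show "E p \<beta> (ops p q \<theta> x) \<in> EP p \<beta> m"
   using x e_P[OF Y] opr_P[OF shift_in[OF \<theta>]] by blast
  assume y: "y \<in> EP q \<beta> m"
  then have yc: "y \<in> carrier (Rs q)"
   using P_closed e_closed[OF Y] by auto
  show "E p \<beta> (ops p q \<theta> (x \<oplus>\<^bsub>shifted_ring q\<^esub> y)) =
    E p \<beta> (ops p q \<theta> x) \<oplus>\<^bsub>shifted_ring p\<^esub> E p \<beta> (ops p q \<theta> y)"
   using xc yc opr_closed[OF shift_in[OF \<theta>]] by (simp add: ring_hom_add[OF opr_hom[OF shift_in[OF \<theta>]]] ring_hom_add[OF e_hom[OF Y]])
 }
 assume \<theta>: "\<theta> \<in> delta p q" and \<psi>: "\<psi> \<in> delta q r" and "x \<in> EP r \<beta> m"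
 then have "x \<in> carrier (Rs r)"
  using P_closed e_closed[OF Y] by auto
 then show "E p \<beta> (ops p r (compose {..p} \<psi> \<theta>) x) =
   E p \<beta> (ops p q \<theta> (E q \<beta> (ops q r \<psi> x)))"
  using e_opr_e[OF \<beta> \<theta>] opr_comp[OF shift_in[OF \<theta>] shift_in[OF \<psi>]] opr_closed[OF shift_in[OF \<psi>]]
  by (simp add: shift_comp[OF \<theta>])
qed

text \<open>Normal forms are the fixed points of \<open>E p \<gamma>\<close>, which commutes with
  the other substitutions and fixes the variables of the cell \<open>\<gamma>\<close>. Applying it
  to a factorisation in the whole ring puts the cofactor into normal form.\<close>

lemma stage_koszul:
 assumes \<gamma>: "\<gamma> < L"
 shows "koszul_ring (shifted_ring p) (V \<gamma> p) (\<lambda>m. EP p \<gamma> m) (\<lambda>w. \<xi> p (\<gamma>, w)) (\<lambda>S. e p ({\<gamma>} \<times> S))"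
proof -
 note Y = Y_mono[OF less_imp_le[OF \<gamma>], of p]
 have in_P: "x \<in> EP p \<gamma> m \<longleftrightarrow> x \<in> P (Suc p) m \<and> E p \<gamma> x = x" for x m
  using e_P[OF Y] e_idem[OF Y P_closed] by (auto intro: rev_image_eqI)
 note hom = ring_hom_add[OF e_hom[OF Y]] ring_hom_mult[OF e_hom[OF Y]]
 have S: "{\<gamma>} \<times> S \<subseteq> Y p L" if "S \<subseteq> V \<gamma> p" for S
  using that \<gamma> by (auto simp: Y_def)
 have w: "(\<gamma>, w) \<in> Y p L" "E p \<gamma> (\<xi> p (\<gamma>, w)) = \<xi> p (\<gamma>, w)" if "w \<in> V \<gamma> p" for w
  using that \<gamma> e_\<xi>[OF Y, of "(\<gamma>, w)"] by (auto simp: Y_def)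
 have comm: "E p \<gamma> (e p U f) = e p U (E p \<gamma> f)" if "U \<subseteq> Y p L" "f \<in> carrier (Rs p)" for U f
  using that Y by (simp add: e_Un Un_commute)
 show ?thesis
 proof (intro koszul_ring.intro koszul_ring_axioms.intro shifted_ring_cring additive_image[OF Y])
  show "finite (V \<gamma> p)"
   by (rule pointed_family.fin[OF pointed[OF \<gamma>]])
 next
  fix w assume wV: "w \<in> V \<gamma> p"
  note w = w[OF wV]
  show "\<xi> p (\<gamma>, w) \<in> carrier (shifted_ring p)"
   using \<xi>_closed[OF w(1)] by simp
  show "\<xi> p (\<gamma>, w) \<otimes>\<^bsub>shifted_ring p\<^esub> x \<in> EP p \<gamma> (Suc m)" if "x \<in> EP p \<gamma> m" for x m
   using that w(2) \<xi>_closed[OF w(1)] P_closed unfolding in_P by (auto simp: hom intro: ideal_prod.prod \<xi>_I[OF w(1)])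
  show "e p ({\<gamma>} \<times> S) (\<xi> p (\<gamma>, w)) = (if w \<in> S then \<zero>\<^bsub>shifted_ring p\<^esub> else \<xi> p (\<gamma>, w))" if "S \<subseteq> V \<gamma> p" for S
   using e_\<xi>[OF S[OF that] w(1)] by simp
  show "\<exists>g\<in>EP p \<gamma> m. x = e p ({\<gamma>} \<times> {w}) x \<oplus>\<^bsub>shifted_ring p\<^esub> \<xi> p (\<gamma>, w) \<otimes>\<^bsub>shifted_ring p\<^esub> g"
   if "x \<in> EP p \<gamma> (Suc m)" for x m
  proof -
   have x: "x \<in> P (Suc p) (Suc m)" "E p \<gamma> x = x" "x \<in> carrier (Rs p)"
    using that P_closed unfolding in_P by blast+
   obtain g where g: "g \<in> P (Suc p) m" "x = e p {(\<gamma>, w)} x \<oplus>\<^bsub>Rs p\<^esub> \<xi> p (\<gamma>, w) \<otimes>\<^bsub>Rs p\<^esub> g"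
    using e_factor_P[OF w(1) x(1)] by blast
   have s: "{(\<gamma>, w)} \<subseteq> Y p L" using w by simp
   have "x = E p \<gamma> (e p {(\<gamma>, w)} x \<oplus>\<^bsub>Rs p\<^esub> \<xi> p (\<gamma>, w) \<otimes>\<^bsub>Rs p\<^esub> g)"
    using x(2) g(2) by simp
   also have "\<dots> = e p {(\<gamma>, w)} x \<oplus>\<^bsub>Rs p\<^esub> \<xi> p (\<gamma>, w) \<otimes>\<^bsub>Rs p\<^esub> E p \<gamma> g"
    using x(2,3) P_closed[OF g(1)] e_closed[OF s x(3)] \<xi>_closed[OF w(1)] comm[OF s x(3)] w(2) by (simp add: hom)
   finally show ?thesis
    using g(1) by auto
  qed
  show "g = \<zero>\<^bsub>shifted_ring p\<^esub>" if "g \<in> carrier (shifted_ring p)" "\<xi> p (\<gamma>, w) \<otimes>\<^bsub>shifted_ring p\<^esub> g = \<zero>\<^bsub>shifted_ring p\<^esub>" for g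
   using that \<xi>_regular[OF w(1)] by simp
  fix U x assume U: "U \<subseteq> V \<gamma> p" and x: "x \<in> carrier (shifted_ring p)"
  have "{\<gamma>} \<times> {w} \<subseteq> Y p L" using w by simp
  from e_Un[OF S[OF U] this, of x] show "e p ({\<gamma>} \<times> insert w U) x = e p ({\<gamma>} \<times> U) (e p ({\<gamma>} \<times> {w}) x)"
   using x by (simp add: Sigma_Un_distrib2[symmetric] Un_commute[of "{\<gamma>} \<times> U"] flip: insert_is_Un)
 next
  fix U assume U: "U \<subseteq> V \<gamma> p"
  show "e p ({\<gamma>} \<times> U) \<in> ring_hom (shifted_ring p) (shifted_ring p)"
   unfolding shifted_ring_hom by (rule e_hom[OF S[OF U]])
  show "e p ({\<gamma>} \<times> U) x \<in> EP p \<gamma> m" if "x \<in> EP p \<gamma> m" for x m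
   using that comm[OF S[OF U] P_closed, of x m] e_P[OF S[OF U]] unfolding in_P by auto
 qed (use P_closed e_closed[OF Y] in \<open>auto simp: e_empty\<close>)
qed

text \<open>Substitutions compose by uniting their index sets: killing the variables before
  \<open>\<gamma>\<close> and then the sphere of \<open>\<gamma>\<close> kills exactly those before
  \<open>next_stage \<gamma>\<close>.\<close>

lemma stage_successor:
 assumes \<gamma>: "\<gamma> < L" and IH: "\<And>m. acyclic_below m (stage \<gamma> m)"
 shows "acyclic_below m (stage (next_stage \<gamma>) m)"
proof -
 note \<gamma>L = less_imp_le[OF \<gamma>]
 note n = next_stage[OF \<gamma>]
 note Y = Y_mono[OF \<gamma>L] and Yn = Y_mono[OF n(2)]
 interpret pf: pointed_family "V \<gamma>" "Op \<gamma>"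
  by (rule pointed[OF \<gamma>])
 have S: "{\<gamma>} \<times> V \<gamma> p \<subseteq> Y p L" for p
  using \<gamma> by (auto simp: Y_def)
 have Un: "{\<gamma>} \<times> V \<gamma> p \<union> Y p \<gamma> = Y p (next_stage \<gamma>)" for p
  by (auto simp: Y_def n(3) le_less)
 have ee: "e p ({\<gamma>} \<times> V \<gamma> p) (E p \<gamma> x) = E p (next_stage \<gamma>) x" if "x \<in> carrier (Rs p)" for p x
  using e_Un[OF S Y that] by (simp add: Un)
 let ?o = "\<lambda>p q \<theta> x. E p \<gamma> (ops p q \<theta> x)"
 interpret kill_sphere "V \<gamma>" "Op \<gamma>" shifted_ring "\<lambda>p m. EP p \<gamma> m" "\<lambda>p w. \<xi> p (\<gamma>, w)"
  "\<lambda>p S. e p ({\<gamma>} \<times> S)" ?o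
 proof (intro kill_sphere.intro kill_sphere_axioms.intro)
  show "pointed_family (V \<gamma>) (Op \<gamma>)"
   by (rule pf.pointed_family_axioms)
  show "koszul_ring (shifted_ring p) (V \<gamma> p) (\<lambda>m. EP p \<gamma> m) (\<lambda>w. \<xi> p (\<gamma>, w)) (\<lambda>S. e p ({\<gamma>} \<times> S))" for p
   by (rule stage_koszul[OF \<gamma>])
  show "?o p p (restrict id {..p}) x = x" if "x \<in> EP p \<gamma> m" for p m x
   using that P_closed e_closed[OF Y] by (auto simp: shift_id opr_id e_idem[OF Y])
 next
  fix p q and \<theta> :: "nat => nat" assume \<theta>: "\<theta> \<in> delta p q"
  show "?o p q \<theta> \<in> ring_hom (shifted_ring q) (shifted_ring p)"
   using ring_hom_trans[OF opr_hom[OF shift_in[OF \<theta>]] e_hom[OF Y]] by (simp add: shifted_ring_hom comp_def)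
  note oc = opr_closed[OF shift_in[OF \<theta>]]
  show "?o p q \<theta> x \<in> EP p \<gamma> m" if "x \<in> EP q \<gamma> m" for x m
   using that e_P[OF Y] opr_P[OF shift_in[OF \<theta>]] by blast
  show "?o p q \<theta> (\<xi> q (\<gamma>, w)) = (case Op \<gamma> p q \<theta> w of None => \<zero>\<^bsub>shifted_ring p\<^esub> | Some v => \<xi> p (\<gamma>, v))"
   if "w \<in> V \<gamma> q" for w
   using e_opr_\<xi>[OF \<gamma> that \<theta>] by (simp cong: option.case_cong)
  show "e p ({\<gamma>} \<times> V \<gamma> p) (?o p q \<theta> (e q ({\<gamma>} \<times> V \<gamma> q) x)) = e p ({\<gamma>} \<times> V \<gamma> p) (?o p q \<theta> x)"
   if "x \<in> carrier (shifted_ring q)" for x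
  proof -
   have x: "x \<in> carrier (Rs q)" and vx: "e q ({\<gamma>} \<times> V \<gamma> q) x \<in> carrier (Rs q)"
    using that e_closed[OF S] by simp_all
   have "E q (next_stage \<gamma>) (e q ({\<gamma>} \<times> V \<gamma> q) x) = E q (next_stage \<gamma>) x"
    using e_Un[OF Yn S x] by (simp add: Un[symmetric] Un_ac)
   then show ?thesis
    using ee[OF oc[OF vx]] ee[OF oc[OF x]] e_opr_e[OF n(2) \<theta> x] e_opr_e[OF n(2) \<theta> vx] by simp
  qed
  fix r \<psi> x assume \<psi>: "\<psi> \<in> delta q r" and "x \<in> carrier (shifted_ring r)"
  then have "x \<in> carrier (Rs r)"
   by simp
  then show "?o p r (compose {..p} \<psi> \<theta>) x = ?o p q \<theta> (?o q r \<psi> x)"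
   using e_opr_e[OF \<gamma>L \<theta>] opr_comp[OF shift_in[OF \<theta>] shift_in[OF \<psi>]] opr_closed[OF shift_in[OF \<psi>]]
   by (simp add: shift_comp[OF \<theta>])
 qed
 have "filt m = stage \<gamma> m" for m
  unfolding filt_def stage_def ..
 then have "acyclic_below m (quotient_filt m)"
  using IH by (intro quotient_filt_acyclic) simp
 then show ?thesis
 proof (rule acyclic_below_cong[OF _ quotient_filt_simplicial stage_simplicial[OF n(2)]])
  fix p
  show c: "carrier (Grp (quotient_filt m) p) = carrier (Grp (stage (next_stage \<gamma>) m) p)" for p
   unfolding quotient_filt_def stage_def using ee[OF P_closed] by (simp add: image_image)
  show "\<one>\<^bsub>Grp (quotient_filt m) p\<^esub> = \<one>\<^bsub>Grp (stage (next_stage \<gamma>) m) p\<^esub>"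
   unfolding quotient_filt_def stage_def by simp
  fix q \<theta> x assume \<theta>: "\<theta> \<in> delta p q" and "x \<in> carrier (Grp (quotient_filt m) q)"
  then have "x \<in> carrier (Rs q)"
   unfolding c using P_closed e_closed[OF Yn] by (auto simp: stage_def)
  then show "GStr (quotient_filt m) p q \<theta> x = GStr (stage (next_stage \<gamma>) m) p q \<theta> x"
   unfolding quotient_filt_def stage_def using ee[OF opr_closed[OF shift_in[OF \<theta>]]] by simp
 qed
qed

section \<open>Transfinite induction over the stages\<close>

abbreviation PI :: "nat => 'a sgroup" where
 "PI m \<equiv> additive_sgroup Rg (\<lambda>p. P p m) opr"

lemma PI_simplicial: "simplicial_abelian_group (PI m)"
proof (rule additive_sgroup_simplicial)
 show "additive_subgroup (P p m) (Rg p)" for p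
  by (rule ideal.axioms(1)[OF P_ideal])
qed (auto simp: Rg.is_abelian_group opr_P opr_id opr_comp P_closed ring_hom_add[OF opr_hom])

text \<open>The place where reducedness enters. The exponent 0 is excluded because that power is the
  whole ring.\<close>

lemma P_0: "0 < m ==> P 0 m = {\<zero>\<^bsub>Rg 0\<^esub>}"
proof (cases m)
 case (Suc k)
 have "x = \<zero>\<^bsub>Rg 0\<^esub>" if "x \<in> ideal_prod (Rg 0) (I 0) (P 0 k)" for x
  using that
 proof (induction x rule: ideal_prod.induct)
  case (prod i j)
  then show ?case
   using P_closed[of j 0 k] by (simp add: I_0)
 next
  case (sum s t)
  then show ?case
   by (simp only: Rg.l_zero Rg.zero_closed)
 qed
 moreover have "\<zero>\<^bsub>Rg 0\<^esub> \<in> P 0 m"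
  by (rule additive_subgroup.zero_closed[OF ideal.axioms(1)[OF P_ideal]])
 ultimately show ?thesis
  unfolding Suc ideal_power.simps by blast
qed simp

lemma stage_bottom:
 assumes "\<beta> \<le> L" "\<And>\<gamma>. \<not> \<gamma> < \<beta>"
 shows "acyclic_below m (stage \<beta> m)"
proof (cases "m = 0")
 case False
 interpret G: simplicial_abelian_group "PI m"
  by (rule PI_simplicial)
 have Y: "Y p \<beta> = {}" for p
  using assms(2) by (auto simp: Y_def)
 have "acyclic_below m (path_sgroup (PI m))"
  by (rule G.path_sgroup_acyclic) (use False P_0 in simp)
 then show ?thesis
 proof (rule acyclic_below_cong[OF _ G.path_sgroup stage_simplicial[OF assms(1)]])
  fix p q \<theta> x
  show c: "carrier (Grp (path_sgroup (PI m)) p) = carrier (Grp (stage \<beta> m) p)" for p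
   by (auto simp: path_sgroup_def stage_def Y e_empty P_closed intro: rev_image_eqI)
  show "\<one>\<^bsub>Grp (path_sgroup (PI m)) p\<^esub> = \<one>\<^bsub>Grp (stage \<beta> m) p\<^esub>"
   by (simp add: path_sgroup_def stage_def)
  assume "\<theta> \<in> delta p q" "x \<in> carrier (Grp (path_sgroup (PI m)) q)"
  then have "ops p q \<theta> x \<in> carrier (Rs p)"
   using P_closed by (auto simp: path_sgroup_def intro!: opr_closed)
  then show "GStr (path_sgroup (PI m)) p q \<theta> x = GStr (stage \<beta> m) p q \<theta> x"
   by (simp add: path_sgroup_def stage_def Y e_empty)
 qed
qed simp

text \<open>A cycle and its finitely many faces involve finitely many variables, so it is already a
  cycle at some earlier stage \<open>\<gamma>\<close>. A bounding chain found there is carried to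
  the stage \<open>\<beta>\<close> by killing the remaining variables.\<close>

lemma stage_limit:
 assumes \<beta>: "\<beta> \<le> L" and lim: "\<And>\<gamma>. \<gamma> < \<beta> ==> next_stage \<gamma> < \<beta>" and \<gamma>0: "\<gamma>0 < \<beta>"
  and IH: "\<And>\<gamma>. \<gamma> < \<beta> ==> acyclic_below m (stage \<gamma> m)"
 shows "acyclic_below m (stage \<beta> m)"
 unfolding acyclic_below_def
proof (intro allI impI ballI)
 fix n z assume n: "n < m" and z: "z \<in> moore_cycles (stage \<beta> m) n"
 interpret G: simplicial_abelian_group "stage \<beta> m"
  by (rule stage_simplicial[OF \<beta>])
 note Y = Y_mono[OF \<beta>]
 have "z \<in> EP n \<beta> m"
  using G.moore_cycles_carrier[OF z] by (simp add: stage_def)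
 then have zP: "z \<in> P (Suc n) m" and ez: "E n \<beta> z = z"
  using e_P[OF Y] e_idem[OF Y P_closed] by auto
 note zc = P_closed[OF zP]
 let ?d = "\<lambda>k i. ops k (Suc k) (coface k i)"
 have dc: "?d k i x \<in> carrier (Rs k)" if "i \<le> Suc k" "x \<in> carrier (Rg (Suc (Suc k)))" for k i x
  using that by (intro opr_closed) auto
 have face: "face (stage \<delta> m) k i x = E k \<delta> (?d k i x)" for \<delta> k i x
  by (simp add: face_coface stage_def)
 have stable: "\<exists>\<delta><\<beta>. \<forall>\<gamma>. \<delta> \<le> \<gamma> \<longrightarrow> \<gamma> \<le> \<beta> \<longrightarrow> E k \<gamma> f = E k \<beta> f" if f: "f \<in> carrier (Rs k)" for k f
 proof -
  obtain D where D: "finite D" "\<And>S. S \<subseteq> Y k L ==> e k S f = e k (S \<inter> D) f"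
   using e_finite[OF f] by blast
  \<comment> \<open>\<open>\<gamma>0\<close> keeps the set nonempty when no variable below
    \<open>\<beta>\<close> occurs, so that its maximum is still below
    \<open>\<beta>\<close>.\<close>
  let ?F = "insert \<gamma>0 (fst ` (D \<inter> Y k \<beta>))"
  have fin: "finite ?F" using D(1) by simp
  have m: "Max ?F < \<beta>"
   using fin \<gamma>0 by (auto simp: Y_def)
  have "Y k \<gamma> \<inter> D = Y k \<beta> \<inter> D" if "next_stage (Max ?F) \<le> \<gamma>" "\<gamma> \<le> \<beta>" for \<gamma>
  proof -
   have "fst x < \<gamma>" if "x \<in> Y k \<beta> \<inter> D" for x
    using Max_ge[OF fin, of "fst x"] that next_stage(1)[OF m] \<open>next_stage (Max ?F) \<le> \<gamma>\<close> by (force intro: le_less_trans less_le_trans)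
   then show ?thesis
    using \<open>\<gamma> \<le> \<beta>\<close> by (fastforce simp: Y_def)
  qed
  then show ?thesis
   using lim[OF m] D(2) Y_mono[OF \<beta>, of k] Y_mono[of _ L k] \<beta> by (intro exI[of _ "next_stage (Max ?F)"]) (metis order_trans)
 qed
 have "\<exists>\<delta><\<beta>. \<forall>\<gamma>. \<delta> \<le> \<gamma> \<longrightarrow> \<gamma> < \<beta> \<longrightarrow> z \<in> moore_cycles (stage \<gamma> m) n"
 proof -
  obtain \<delta>z where \<delta>z: "\<delta>z < \<beta>" "\<And>\<gamma>. \<delta>z \<le> \<gamma> ==> \<gamma> \<le> \<beta> ==> E n \<gamma> z = z"
   using stable[OF zc] ez by metis
  have carr: "z \<in> carrier (Grp (stage \<gamma> m) n)" if "\<delta>z \<le> \<gamma>" "\<gamma> \<le> \<beta>" for \<gamma>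
   using \<delta>z(2)[OF that] zP by (auto simp: stage_def intro: rev_image_eqI)
  show ?thesis
  proof (cases n)
   case 0
   then show ?thesis
    using \<delta>z(1) carr by (intro exI[of _ \<delta>z]) (auto simp: moore_cycles.simps)
  next
   case (Suc k)
   have "\<exists>\<delta><\<beta>. \<forall>\<gamma>. \<delta> \<le> \<gamma> \<longrightarrow> \<gamma> \<le> \<beta> \<longrightarrow> E k \<gamma> (?d k i z) = \<zero>\<^bsub>Rs k\<^esub>" if i: "i \<le> Suc k" for i
   proof -
    have 0: "E k \<beta> (?d k i z) = \<zero>\<^bsub>Rs k\<^esub>"
     using z i Suc unfolding G.moore_cycles_iff face by (simp add: stage_def)
    have "z \<in> carrier (Rg (Suc (Suc k)))"
     using zc Suc by simp
    from stable[OF dc[OF i this]] show ?thesis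
     unfolding 0 .
   qed
   then obtain \<delta> where \<delta>: "\<And>i. i \<le> Suc k ==> \<delta> i < \<beta>"
    "\<And>i \<gamma>. i \<le> Suc k ==> \<delta> i \<le> \<gamma> ==> \<gamma> \<le> \<beta> ==> E k \<gamma> (?d k i z) = \<zero>\<^bsub>Rs k\<^esub>"
    by metis
   let ?F = "insert \<delta>z (\<delta> ` {..Suc k})"
   have "Max ?F < \<beta>"
    using \<delta>(1) \<delta>z(1) by auto
   moreover have "z \<in> moore_cycles (stage \<gamma> m) n" if "Max ?F \<le> \<gamma>" "\<gamma> < \<beta>" for \<gamma>
   proof -
    have le: "\<delta>z \<le> \<gamma>" "\<And>i. i \<le> Suc k ==> \<delta> i \<le> \<gamma>"
     using that(1) by auto
    interpret S: simplicial_abelian_group "stage \<gamma> m"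
     by (rule stage_simplicial) (use that \<beta> in simp)
    show ?thesis
     unfolding S.moore_cycles_iff face using carr[OF le(1)] \<delta>(2) le(2) that(2) Suc by (auto simp: stage_def)
   qed
   ultimately show ?thesis by blast
  qed
 qed
 then obtain \<gamma> where \<gamma>: "\<gamma> < \<beta>" "z \<in> moore_cycles (stage \<gamma> m) n"
  by blast
 then obtain y where y: "y \<in> moore (stage \<gamma> m) (Suc n)" "face (stage \<gamma> m) n 0 y = z"
  using acyclic_belowE[OF IH n] by blast
 note Y\<gamma> = Y_mono[OF order_trans[OF less_imp_le[OF \<gamma>(1)] \<beta>]]
 have "y \<in> e (Suc n) (Y (Suc n) \<gamma>) ` P (Suc (Suc n)) m"
  using y(1) by (simp add: stage_def)
 then have yP: "y \<in> P (Suc (Suc n)) m"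
  using e_P[OF Y\<gamma>] by auto
 note yc = P_closed[OF yP]
 let ?y = "e (Suc n) (Y (Suc n) \<beta>) y"
 have f: "face (stage \<beta> m) n i ?y = E n \<beta> (face (stage \<gamma> m) n i y)" if "i \<le> Suc n" for i
 proof -
  have "face (stage \<beta> m) n i ?y = E n \<beta> (?d n i y)"
   unfolding face by (rule e_opr_e[OF \<beta> coface_in[OF that] yc])
  also have "\<dots> = E n \<beta> (E n \<gamma> (?d n i y))"
   using e_Un[OF Y Y\<gamma> dc[OF that yc]] Y_mono[OF less_imp_le[OF \<gamma>(1)], of n] by (simp add: Un_absorb2)
  finally show ?thesis
   by (simp add: face)
 qed
 have "?y \<in> moore (stage \<beta> m) (Suc n)"
  using y(1) yP ring_hom_zero'[OF e_hom[OF Y]] f by (auto simp: stage_def)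
 moreover have "face (stage \<beta> m) n 0 ?y = z"
  using f[of 0] y(2) ez by simp
 ultimately show "\<exists>y\<in>moore (stage \<beta> m) (Suc n). face (stage \<beta> m) n 0 y = z"
  by blast
qed

lemma stage_acyclic: "\<beta> \<le> L ==> acyclic_below m (stage \<beta> m)"
proof (induction \<beta> arbitrary: m rule: less_induct)
 case (less \<beta>)
 show ?case
 proof (cases "\<exists>\<gamma><\<beta>. \<not> next_stage \<gamma> < \<beta>")
  case True
  then obtain \<gamma> where \<gamma>: "\<gamma> < \<beta>" "next_stage \<gamma> = \<beta>"
   using next_stage(2) by (metis order.not_eq_order_implies_strict)
  then have "acyclic_below m (stage \<gamma> m)" for m
   using less by simp
  then show ?thesis
   using stage_successor[of \<gamma> m] \<gamma> less.prems by auto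
 next
  case False
  then show ?thesis
   using stage_bottom[OF less.prems] stage_limit[OF less.prems] less
   by (metis (no_types, lifting) dual_order.strict_trans1 order.strict_implies_order)
 qed
qed

text \<open>At the last stage the substitution is s_0 d_0, so the normal forms are the elements s_0
  x, and d_0 recovers x from them: the last stage is a copy of \<open>PI m\<close>.\<close>

theorem PI_acyclic: "acyclic_below m (PI m)"
proof -
 let ?d = "\<lambda>p. opr p (Suc p) (coface p 0)" and ?s = "\<lambda>p. opr (Suc p) p (codegeneracy p 0)"
 have sc: "?s p x \<in> carrier (Rs p)" if "x \<in> carrier (Rg p)" for p x
  by (rule opr_closed[OF codegeneracy_in that]) simp
 have ds: "?d p (?s p x) = x" if "x \<in> carrier (Rg p)" for p x
 proof -
  have "compose {..p} (codegeneracy p 0) (coface p 0) = restrict id {..p}"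
   by (auto simp: compose_def coface_def codegeneracy_def fun_eq_iff)
  then show ?thesis
   using opr_comp[of "coface p 0" p "Suc p" "codegeneracy p 0" p x] that opr_id[OF that] by simp
 qed
 have face: "face (stage L m) p j x = ?s p (opr p (Suc p) (coface p j) (?d (Suc p) x))" if j: "j \<le> Suc p" and x: "x \<in> carrier (Rg (Suc (Suc p)))" for p j x
  using e_all[OF opr_closed[OF shift_in[OF coface_in[OF j]] x]] opr_comp[of "coface p 0" p "Suc p" "shift p (coface p j)" "Suc (Suc p)" x]
   opr_comp[of "coface p j" p "Suc p" "coface (Suc p) 0" "Suc (Suc p)" x] coface_0_natural[OF coface_in[OF j]] j x
  by (simp add: face_coface stage_def)
 have zero: "?s p \<zero>\<^bsub>Rg p\<^esub> = \<zero>\<^bsub>Rs p\<^esub>" "?d p \<zero>\<^bsub>Rs p\<^esub> = \<zero>\<^bsub>Rg p\<^esub>" for p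
  by (rule ring_hom_zero'[OF opr_hom]; simp)+
 have sP: "x \<in> P (Suc p) m" if "x \<in> carrier (Grp (stage L m) p)" for x p
  using that e_P[OF order_refl] by (auto simp: stage_def)
 show ?thesis
 proof (rule acyclic_below_retract[where i = ?s and r = ?d, OF PI_simplicial stage_simplicial[OF order_refl] stage_acyclic[OF order_refl]])
  fix p x assume "x \<in> carrier (Grp (PI m) p)"
  then have x: "x \<in> P p m" "x \<in> carrier (Rg p)"
   using P_closed by auto
  then have "?s p x = E p L (?s p x)"
   using e_all[OF sc] ds by simp
  then show "?s p x \<in> carrier (Grp (stage L m) p) \<and> ?d p (?s p x) = x"
   using opr_P[OF codegeneracy_in[of 0 p] x(1)] ds[OF x(2)] by (simp add: stage_def)
 next
  fix p j x assume j: "j \<le> Suc p" and "x \<in> carrier (Grp (PI m) (Suc p))"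
  then have x: "x \<in> carrier (Rs p)"
   using P_closed by auto
  show "face (stage L m) p j (?s (Suc p) x) = ?s p (face (PI m) p j x)"
   unfolding face[OF j sc[OF x]] ds[OF x] by (simp add: face_coface)
 next
  fix p j x assume j: "j \<le> Suc p" and "x \<in> carrier (Grp (stage L m) (Suc p))"
  then have x: "x \<in> carrier (Rg (Suc (Suc p)))"
   using P_closed[OF sP] by blast
  have "?d (Suc p) x \<in> carrier (Rs p)"
   by (rule opr_closed[OF coface_in x]) simp
  then show "face (PI m) p j (?d (Suc p) x) = ?d p (face (stage L m) p j x)"
   unfolding face[OF j x] using j ds[OF opr_closed[OF coface_in]] by (simp add: face_coface)
 qed (use sP opr_P[OF coface_in] in \<open>auto simp: stage_def zero\<close>)
qed

end

section \<open>The ring of polynomials\<close>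

lemma finite_submultisets: "finite {A. A \<subseteq># M}"
proof (induction M)
 case (add x M)
 have "A \<subseteq># M \<or> A \<in> add_mset x ` {A. A \<subseteq># M}" if "A \<subseteq># add_mset x M" for A
 proof (cases "x \<in># A")
  case False
  then show ?thesis
   using that by (metis diff_single_trivial diff_union_cancelR add_mset_add_single subset_eq_diff_conv)
 qed (use that in \<open>auto dest!: multi_member_split\<close>)
 then have "{A. A \<subseteq># add_mset x M} \<subseteq> {A. A \<subseteq># M} \<union> add_mset x ` {A. A \<subseteq># M}"
  by blast
 then show ?case
  using add finite_subset by blast
qed simp

lemma (in comm_monoid) finprod_Sigma:
 assumes "finite A" "\<And>a. a \<in> A ==> finite (B a)" "\<And>a b. a \<in> A ==> b \<in> B a ==> f (a, b) \<in> carrier G"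
 shows "finprod G f (Sigma A B) = finprod G (\<lambda>a. finprod G (\<lambda>b. f (a, b)) (B a)) A"
proof -
 have "finprod G f (Sigma A B) = finprod G f (\<Union>((\<lambda>a. Pair a ` B a) ` A))"
  by (rule arg_cong[of _ _ "finprod G f"]) auto
 also have "\<dots> = finprod G (\<lambda>a. finprod G f (Pair a ` B a)) A"
  by (rule finprod_UN_disjoint) (use assms in \<open>auto simp: pairwise_def disjnt_def\<close>)
 also have "\<dots> = finprod G (\<lambda>a. finprod G (\<lambda>b. f (a, b)) (B a)) A"
 proof (rule finprod_cong')
  fix a assume a: "a \<in> A"
  show "finprod G f (Pair a ` B a) = finprod G (\<lambda>b. f (a, b)) (B a)"
   by (rule finprod_reindex) (use assms a in \<open>auto simp: inj_on_def\<close>)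
 qed (use assms in \<open>auto intro!: finprod_closed\<close>)
 finally show ?thesis .
qed

context cring
begin

abbreviation MP :: "(nat multiset => 'a) ring" where
 "MP \<equiv> mpoly_ring R"

abbreviation mpoly_plus (infixl "[+]" 65) where
 "p [+] q \<equiv> p \<oplus>\<^bsub>MP\<^esub> q"

abbreviation mpoly_times (infixl "[*]" 70) where
 "p [*] q \<equiv> p \<otimes>\<^bsub>MP\<^esub> q"

abbreviation "pset J \<equiv> indexed_pset J (carrier R)"
abbreviation "parts M \<equiv> {A :: nat multiset. A \<subseteq># M}"

lemma mpoly_carrier: "carrier MP = pset UNIV"
 and mpoly_add: "p [+] q = (\<lambda>M. p M \<oplus> q M)"
 and mpoly_mult: "p [*] q = (\<lambda>M. \<Oplus>A\<in>parts M. p A \<otimes> q (M - A))"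
 and mpoly_zero: "\<zero>\<^bsub>MP\<^esub> = (\<lambda>M. \<zero>)"
 and mpoly_one: "\<one>\<^bsub>MP\<^esub> = indexed_const \<one>"
 by (auto simp: mpoly_ring_def indexed_padd_def indexed_const_def)

lemma pset_closed: "p \<in> pset J ==> p M \<in> carrier R"
 using indexed_pset_in_carrier[of "carrier R" p J] by (simp add: carrier_coeff_def)

lemma conv_closed:
 assumes "\<And>M. p M \<in> carrier R" "\<And>M. q M \<in> carrier R"
 shows "(p [*] q) M \<in> carrier R"
 unfolding mpoly_mult using assms by (intro finsum_closed) auto

lemma conv_comm:
 assumes "\<And>M. p M \<in> carrier R" "\<And>M. q M \<in> carrier R"
 shows "p [*] q = q [*] p"
proof
 fix M :: "nat multiset"
 have dd: "M - (M - A) = A" if "A \<subseteq># M" for A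
  using that by (auto simp: multiset_eq_iff subseteq_mset_def)
 have "A \<in> (\<lambda>A. M - A) ` parts M" if "A \<subseteq># M" for A
  using dd[OF that] by (intro image_eqI[of _ _ "M - A"]) auto
 then have "parts M = (\<lambda>A. M - A) ` parts M"
  by auto
 then have "(p [*] q) M = finsum R (\<lambda>A. p A \<otimes> q (M - A)) ((\<lambda>A. M - A) ` parts M)"
  unfolding mpoly_mult by (rule arg_cong)
 also have "\<dots> = finsum R (\<lambda>A. p (M - A) \<otimes> q (M - (M - A))) (parts M)"
 proof (rule finsum_reindex)
  show "inj_on (\<lambda>A. M - A) (parts M)"
   by (rule inj_on_inverseI[of _ "\<lambda>A. M - A"]) (simp add: dd)
 qed (use assms in auto)
 also have "\<dots> = finsum R (\<lambda>A. q A \<otimes> p (M - A)) (parts M)"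
 proof (rule finsum_cong')
  fix A assume "A \<in> parts M"
  then have "M - (M - A) = A"
   by (simp add: dd)
  then show "p (M - A) \<otimes> q (M - (M - A)) = q A \<otimes> p (M - A)"
   using assms by (simp add: m_comm)
 qed (use assms in auto)
 finally show "(p [*] q) M = (q [*] p) M"
  by (simp add: mpoly_mult)
qed

lemma conv_assoc:
 assumes "\<And>M. p M \<in> carrier R" "\<And>M. q M \<in> carrier R" "\<And>M. r M \<in> carrier R"
 shows "(p [*] q) [*] r = p [*] (q [*] r)"
proof
 fix M :: "nat multiset"
 let ?f = "\<lambda>(A, B). p B \<otimes> q (A - B) \<otimes> r (M - A)" and ?g = "\<lambda>(B, D). p B \<otimes> (q D \<otimes> r (M - B - D))"
 let ?S = "SIGMA A:(parts M). parts A" and ?T = "SIGMA B:parts M. parts (M - B)"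
 have "((p [*] q) [*] r) M = (\<Oplus>A\<in>parts M. \<Oplus>B\<in>parts A. ?f (A, B))"
  unfolding mpoly_mult using assms by (intro finsum_cong') (auto simp: finsum_ldistr finite_submultisets intro!: finsum_closed)
 also have "\<dots> = finsum R ?f ?S"
  unfolding finsum_def using assms
  by (intro comm_monoid.finprod_Sigma[OF a_comm_monoid, symmetric]) (auto simp: finite_submultisets)
 also have "\<dots> = finsum R ?g ?T"
 proof -
  \<comment> \<open>Both sums run over the decompositions of \<open>M\<close> into three parts: a
    nested pair \<open>B\<close> inside \<open>A\<close> corresponds to the consecutive pieces
    \<open>B\<close> and \<open>A - B\<close>.\<close>
  have "?T = (\<lambda>(A, B). (B, A - B)) ` ?S"
  proof (intro equalityI subsetI)
   fix x assume "x \<in> ?T"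
   then obtain B D where x: "x = (B, D)" "B \<subseteq># M" "D \<subseteq># M - B"
    by auto
   then have "B + D \<subseteq># M"
    by (metis add.commute subset_mset.le_diff_conv2)
   then show "x \<in> (\<lambda>(A, B). (B, A - B)) ` ?S"
    using x by (intro image_eqI[of _ _ "(B + D, B)"]) auto
  next
   fix x assume "x \<in> (\<lambda>(A, B). (B, A - B)) ` ?S"
   then show "x \<in> ?T"
    by (auto simp: subseteq_mset_def intro: order_trans intro!: diff_le_mono)
  qed
  then have "finsum R ?g ?T = finsum R ?g ((\<lambda>(A, B). (B, A - B)) ` ?S)"
   by (rule arg_cong)
  also have "\<dots> = finsum R (\<lambda>x. ?g ((\<lambda>(A, B). (B, A - B)) x)) ?S"
  proof (rule finsum_reindex)
   show "inj_on (\<lambda>(A, B). (B, A - B)) ?S"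
    by (rule inj_on_inverseI[of _ "\<lambda>(B, D). (B + D, B)"]) (auto simp: subset_mset.add_diff_inverse)
  qed (use assms in auto)
  also have "\<dots> = finsum R ?f ?S"
  proof (rule finsum_cong')
   fix x assume "x \<in> ?S"
   then obtain A B where x: "x = (A, B)" "A \<subseteq># M" "B \<subseteq># A"
    by auto
   have "M - B - (A - B) = M - A"
    using x by (simp add: subset_mset.add_diff_inverse)
   then show "?g ((\<lambda>(A, B). (B, A - B)) x) = ?f x"
    using assms x by (simp add: m_assoc)
  qed (use assms in auto)
  finally show ?thesis by simp
 qed
 also have "\<dots> = (\<Oplus>B\<in>parts M. \<Oplus>D\<in>parts (M - B). ?g (B, D))"
  unfolding finsum_def using assms
  by (intro comm_monoid.finprod_Sigma[OF a_comm_monoid]) (auto simp: finite_submultisets)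
 also have "\<dots> = (p [*] (q [*] r)) M"
  unfolding mpoly_mult using assms by (intro finsum_cong') (auto simp: finsum_rdistr finite_submultisets intro!: finsum_closed)
 finally show "((p [*] q) [*] r) M = (p [*] (q [*] r)) M" .
qed

lemma conv_distr:
 assumes "\<And>M. p M \<in> carrier R" "\<And>M. q M \<in> carrier R" "\<And>M. r M \<in> carrier R"
 shows "(p [+] q) [*] r = p [*] r [+] q [*] r"
proof
 fix M :: "nat multiset"
 have "(\<Oplus>A\<in>parts M. (p A \<oplus> q A) \<otimes> r (M - A)) = (\<Oplus>A\<in>parts M. p A \<otimes> r (M - A) \<oplus> q A \<otimes> r (M - A))"
  using assms by (intro finsum_cong') (auto simp: l_distr)
 also have "\<dots> = (\<Oplus>A\<in>parts M. p A \<otimes> r (M - A)) \<oplus> (\<Oplus>A\<in>parts M. q A \<otimes> r (M - A))"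
  using assms by (intro finsum_addf) auto
 finally show "((p [+] q) [*] r) M = (p [*] r [+] q [*] r) M"
  by (simp add: mpoly_mult mpoly_add)
qed

definition monomial :: "nat multiset => 'a => nat multiset => 'a" where
 "monomial N r = (\<lambda>M. if M = N then r else \<zero>)"

lemma monomial_closed: "r \<in> carrier R ==> monomial N r M \<in> carrier R"
 by (simp add: monomial_def)

lemma conv_monomial:
 assumes "r \<in> carrier R" "\<And>M. q M \<in> carrier R"
 shows "(monomial N r [*] q) M = (if N \<subseteq># M then r \<otimes> q (M - N) else \<zero>)"
proof -
 have "(monomial N r [*] q) M = (\<Oplus>A\<in>parts M. if N = A then r \<otimes> q (M - A) else \<zero>)"
  unfolding mpoly_mult monomial_def using assms by (intro finsum_cong') auto
 also have "\<dots> = (if N \<subseteq># M then r \<otimes> q (M - N) else \<zero>)"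
 proof (cases "N \<subseteq># M")
  case True
  then show ?thesis
   using comm_monoid.finprod_singleton[OF a_comm_monoid, of N "parts M" "\<lambda>A. r \<otimes> q (M - A)"] assms
   by (simp add: finsum_def finite_submultisets cong: if_cong)
 next
  case False
  then have "(\<Oplus>A\<in>parts M. if N = A then r \<otimes> q (M - A) else \<zero>) = (\<Oplus>A\<in>parts M. \<zero>)"
   by (intro finsum_cong') auto
  then show ?thesis
   using False by simp
 qed
 finally show ?thesis .
qed

lemma const_monomial: "indexed_const r = monomial {#} r"
 by (simp add: indexed_const_def monomial_def)

lemma var_monomial: "indexed_var i = monomial {#i#} \<one>"
proof
 fix M
 show "indexed_var i M = monomial {#i#} \<one> M"
 proof -
  have "(i \<in># M \<and> M - {#i#} = {#}) \<longleftrightarrow> M = {#i#}"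
   by (metis add_mset_remove_trivial insert_DiffM multi_member_last)
  then show ?thesis
   by (auto simp: indexed_var_def indexed_pmult_def indexed_const_def monomial_def)
 qed
qed

lemma pmult_conv:
 assumes "\<And>M. q M \<in> carrier R"
 shows "indexed_pmult q i = monomial {#i#} \<one> [*] q"
 using assms by (auto simp: fun_eq_iff conv_monomial indexed_pmult_def)

text \<open>Polynomials in given variables arise inductively from constants, sums and multiplication
  by a variable, so the factors are taken apart; associativity of the convolution deals with
  multiplication by a variable.\<close>

lemma pset_mult:
 assumes p: "p \<in> pset J" and q: "q \<in> pset J"
 shows "p [*] q \<in> pset J"
 using p
proof (induction p rule: indexed_pset.induct)
 case (indexed_const k)
 show ?case
  using q
 proof (induction q rule: indexed_pset.induct)
  case (indexed_const l)
  have "indexed_const k [*] indexed_const l = indexed_const (k \<otimes> l)"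
   using indexed_const \<open>k \<in> carrier R\<close> by (auto simp: const_monomial fun_eq_iff conv_monomial monomial_closed) (auto simp: monomial_def)
  then show ?case
   using indexed_const \<open>k \<in> carrier R\<close> by (simp add: indexed_pset.indexed_const)
 next
  case (indexed_padd P Q)
  have "indexed_const k [*] indexed_padd P Q = indexed_padd (indexed_const k [*] P) (indexed_const k [*] Q)"
   using \<open>k \<in> carrier R\<close> pset_closed[OF indexed_padd(1)] pset_closed[OF indexed_padd(2)]
   by (auto simp: const_monomial fun_eq_iff conv_monomial indexed_padd_def r_distr)
  then show ?case
   using indexed_padd by (simp add: indexed_pset.indexed_padd)
 next
  case (indexed_pmult P i)
  have "indexed_const k [*] indexed_pmult P i = indexed_pmult (indexed_const k [*] P) i"
   using \<open>k \<in> carrier R\<close> pset_closed[OF indexed_pmult(1)]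
   by (auto simp: const_monomial fun_eq_iff conv_monomial indexed_pmult_def)
  then show ?case
   using indexed_pmult by (simp add: indexed_pset.indexed_pmult)
 qed
next
 case (indexed_padd P Q)
 have "indexed_padd P Q [*] q = indexed_padd (P [*] q) (Q [*] q)"
  using conv_distr[of P Q q] pset_closed[OF indexed_padd(1)] pset_closed[OF indexed_padd(2)] pset_closed[OF q]
  by (simp add: mpoly_ring_def)
 then show ?case
  using indexed_padd by (simp add: indexed_pset.indexed_padd)
next
 case (indexed_pmult P i)
 have "indexed_pmult P i [*] q = indexed_pmult (P [*] q) i"
  using pset_closed[OF indexed_pmult(1)] pset_closed[OF q]
  by (simp add: pmult_conv conv_closed conv_assoc monomial_closed)
 then show ?case
  using indexed_pmult by (simp add: indexed_pset.indexed_pmult)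
qed

lemma pset_const: "r \<in> carrier R ==> indexed_const r \<in> pset J"
 by (rule indexed_pset.indexed_const)

lemma pset_add:
 "p \<in> pset J ==> q \<in> pset J ==> p [+] q \<in> pset J"
 using indexed_pset.indexed_padd[of p J "carrier R" q] by (simp add: mpoly_ring_def)

lemma pset_var: "i \<in> J ==> indexed_var i \<in> pset J"
 unfolding indexed_var_def by (intro indexed_pset.intros) auto

lemma pset_mono: "p \<in> pset J ==> J \<subseteq> J' ==> p \<in> pset J'"
 by (induction p rule: indexed_pset.induct) (auto intro: indexed_pset.intros)

lemma const_conv:
 assumes "r \<in> carrier R" "\<And>M. q M \<in> carrier R"
 shows "indexed_const r [*] q = (\<lambda>M. r \<otimes> q M)"
 using assms by (simp add: const_monomial fun_eq_iff conv_monomial)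

theorem mpoly_cring: "cring MP"
proof (rule cringI)
 have c: "p M \<in> carrier R" if "p \<in> carrier MP" for p M
  using that pset_closed[of p UNIV M] by (simp add: mpoly_carrier)
 show "abelian_group MP"
 proof (rule abelian_groupI)
  show "\<zero>\<^bsub>MP\<^esub> \<in> carrier MP"
   using pset_const[of \<zero> UNIV] by (simp add: mpoly_carrier mpoly_zero indexed_const_def)
  show "p [+] q \<in> carrier MP" if "p \<in> carrier MP" "q \<in> carrier MP" for p q
   using that pset_add by (simp add: mpoly_carrier)
  fix p assume p: "p \<in> carrier MP"
  show "\<exists>q\<in>carrier MP. q [+] p = \<zero>\<^bsub>MP\<^esub>"
  proof
   show "indexed_const (\<ominus> \<one>) [*] p \<in> carrier MP"
    using p pset_mult[OF pset_const] by (simp add: mpoly_carrier)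
   show "(indexed_const (\<ominus> \<one>) [*] p) [+] p = \<zero>\<^bsub>MP\<^esub>"
    using c[OF p] by (simp add: const_conv mpoly_add mpoly_zero fun_eq_iff l_minus l_neg)
  qed
  show "\<zero>\<^bsub>MP\<^esub> [+] p = p"
   using c[OF p] by (simp add: mpoly_add mpoly_zero)
 next
  fix p q assume "p \<in> carrier MP" "q \<in> carrier MP"
  note c[OF this(1)] c[OF this(2)]
  then show "p [+] q = q [+] p"
   by (simp add: mpoly_add fun_eq_iff a_comm)
 next
  fix p q r assume "p \<in> carrier MP" "q \<in> carrier MP" "r \<in> carrier MP"
  note c[OF this(1)] c[OF this(2)] c[OF this(3)]
  then show "p [+] q [+] r = p [+] (q [+] r)"
   by (simp add: mpoly_add fun_eq_iff a_assoc)
 qed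
 show "comm_monoid MP"
 proof (rule comm_monoidI)
  show "p [*] q \<in> carrier MP" if "p \<in> carrier MP" "q \<in> carrier MP" for p q
   using that pset_mult by (simp add: mpoly_carrier)
  show "\<one>\<^bsub>MP\<^esub> \<in> carrier MP"
   by (simp add: mpoly_carrier mpoly_one pset_const)
  show "\<one>\<^bsub>MP\<^esub> [*] p = p" if "p \<in> carrier MP" for p
   using c[OF that] by (simp add: mpoly_one const_conv)
  show "p [*] q = q [*] p" if "p \<in> carrier MP" "q \<in> carrier MP" for p q
   by (rule conv_comm) (fact c[OF that(1)] c[OF that(2)])+
  show "p [*] q [*] r = p [*] (q [*] r)" if "p \<in> carrier MP" "q \<in> carrier MP" "r \<in> carrier MP" for p q r
   by (rule conv_assoc) (fact c[OF that(1)] c[OF that(2)] c[OF that(3)])+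
 qed
 show "(p [+] q) [*] r = p [*] r [+] q [*] r"
  if "p \<in> carrier MP" "q \<in> carrier MP" "r \<in> carrier MP" for p q r
  by (rule conv_distr) (fact c[OF that(1)] c[OF that(2)] c[OF that(3)])+
qed

interpretation MP: cring MP
 by (rule mpoly_cring)

lemma const_in [simp]: "r \<in> carrier R ==> indexed_const r \<in> carrier MP"
 and var_in [simp]: "indexed_var i \<in> carrier MP"
 by (auto simp: mpoly_carrier pset_const pset_var)

text \<open>Summing over a finite superset of the support makes the evaluation of monomials uniform:
  for a zero coefficient, in particular over the zero ring, the support itself would shrink.\<close>

lemma subst_eq:
 assumes S: "finite S" "{M. p M \<noteq> \<zero>} \<subseteq> S" and p: "\<And>M. M \<in> S ==> p M \<in> carrier R"
  and qs: "\<And>M i. M \<in> S ==> i \<in># M ==> qs ! i \<in> carrier MP"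
 shows "mpoly_subst R qs p =
  (\<Oplus>\<^bsub>MP\<^esub>M\<in>S. indexed_const (p M) [*] (\<Otimes>\<^bsub>MP\<^esub>i\<in>set_mset M. (qs ! i) [^]\<^bsub>MP\<^esub> count M i))"
proof -
 let ?m = "\<lambda>M. \<Otimes>\<^bsub>MP\<^esub>i\<in>set_mset M. (qs ! i) [^]\<^bsub>MP\<^esub> count M i"
 have m: "?m M \<in> carrier MP" if "M \<in> S" for M
  using qs[OF that] by (intro MP.finprod_closed) auto
 have t: "indexed_const (p M) [*] ?m M \<in> carrier MP" if "M \<in> S" for M
  using m[OF that] p[OF that] by simp
 show ?thesis
  unfolding mpoly_subst_def finsum_def
 proof (rule comm_monoid.finprod_mono_neutral_cong_left[OF MP.a_comm_monoid S])
  show "indexed_const (p M) [*] ?m M = \<one>\<^bsub>add_monoid MP\<^esub>" if "M \<in> S - {M. p M \<noteq> \<zero>}" for M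
  proof -
   have "indexed_const (p M) = \<zero>\<^bsub>MP\<^esub>"
    using that by (simp add: mpoly_zero indexed_const_def)
   then show ?thesis
    using m that by simp
  qed
 qed (use t in auto)
qed

lemma subst_monomial:
 assumes "r \<in> carrier R" "\<And>i. i \<in># N ==> qs ! i \<in> carrier MP"
 shows "mpoly_subst R qs (monomial N r) =
  indexed_const r [*] (\<Otimes>\<^bsub>MP\<^esub>i\<in>set_mset N. (qs ! i) [^]\<^bsub>MP\<^esub> count N i)"
proof -
 have "(\<Otimes>\<^bsub>MP\<^esub>i\<in>set_mset N. (qs ! i) [^]\<^bsub>MP\<^esub> count N i) \<in> carrier MP"
  using assms(2) by (intro MP.finprod_closed) auto
 then have "indexed_const r [*] (\<Otimes>\<^bsub>MP\<^esub>i\<in>set_mset N. (qs ! i) [^]\<^bsub>MP\<^esub> count N i) \<in> carrier MP"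
  using assms(1) by simp
 then show ?thesis
  using assms by (subst subst_eq[of "{N}"]) (auto simp: monomial_def)
qed

lemma subst_var: "qs ! i \<in> carrier MP ==> mpoly_subst R qs (indexed_var i) = qs ! i"
 unfolding var_monomial by (subst subst_monomial) (auto simp flip: mpoly_one)

lemma subst_const: "r \<in> carrier R ==> mpoly_subst R qs (indexed_const r) = indexed_const r"
 unfolding const_monomial by (subst subst_monomial) (auto simp flip: const_monomial)

lemma var_mult_var: "indexed_var i [*] indexed_var j = monomial {#i, j#} \<one>"
proof
 fix M
 have "({#i#} \<subseteq># M \<and> M - {#i#} = {#j#}) \<longleftrightarrow> M = {#i, j#}"
  by (auto simp: add_mset_commute insert_DiffM2) (metis add_mset_commute insert_DiffM)
 then show "(indexed_var i [*] indexed_var j) M = monomial {#i, j#} \<one> M"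
  unfolding var_monomial by (subst conv_monomial) (auto simp: monomial_closed monomial_def)
qed

lemma const_mult_var: "r \<in> carrier R ==> indexed_const r [*] indexed_var i = monomial {#i#} r"
 unfolding var_monomial by (subst const_conv) (auto simp: monomial_closed monomial_def fun_eq_iff)

lemma subst_add:
 assumes "i \<noteq> j" "qs ! i \<in> carrier MP" "qs ! j \<in> carrier MP"
 shows "mpoly_subst R qs (indexed_var i [+] indexed_var j) = qs ! i [+] qs ! j"
proof -
 let ?p = "indexed_var i [+] indexed_var j"
 have p: "?p = (\<lambda>M. if M = {#i#} \<or> M = {#j#} then \<one> else \<zero>)"
  using assms(1) by (auto simp: mpoly_add var_monomial monomial_def fun_eq_iff)
 show ?thesis
  unfolding p using assms by (subst subst_eq[of "{{#i#}, {#j#}}"]) (auto simp flip: mpoly_one)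
qed

lemma subst_mult:
 assumes "i \<noteq> j" "qs ! i \<in> carrier MP" "qs ! j \<in> carrier MP"
 shows "mpoly_subst R qs (indexed_var i [*] indexed_var j) = qs ! i [*] qs ! j"
 unfolding var_mult_var using assms by (subst subst_monomial) (auto simp flip: mpoly_one)

lemma subst_smult:
 assumes "r \<in> carrier R" "qs ! i \<in> carrier MP"
 shows "mpoly_subst R qs (indexed_const r [*] indexed_var i) = indexed_const r [*] qs ! i"
 using assms by (subst const_mult_var, simp) (subst subst_monomial, auto)

lemma const_add: "indexed_const (r \<oplus> s) = indexed_const r [+] indexed_const s" if "r \<in> carrier R" "s \<in> carrier R"
 using that by (auto simp: mpoly_add indexed_const_def)

lemma const_mult: "indexed_const (r \<otimes> s) = indexed_const r [*] indexed_const s" if "r \<in> carrier R" "s \<in> carrier R"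
 using that by (subst const_conv) (auto simp: indexed_const_def fun_eq_iff)

end

section \<open>Algebras over a Lawvere theory\<close>

declare One_nat_def [simp del] One_nat_def [symmetric, simp]

context talgebra
begin

lemma Ob_eqI:
 assumes "x \<in> Ob A n" "y \<in> Ob A n" "\<And>i. i < n ==> Act A n 1 (Prj T n i) x = Act A n 1 (Prj T n i) y"
 shows "x = y"
proof -
 have "\<exists>!z. z \<in> Ob A n \<and> (\<forall>i<n. Act A n 1 (Prj T n i) z = Act A n 1 (Prj T n i) x)"
  by (rule preserves_power) (use assms Act_in Prj_in in blast)
 then show ?thesis
  using assms by metis
qed

lemma tuple_unique:
 assumes "set xs \<subseteq> Ob A 1"
 shows "\<exists>!x. x \<in> Ob A (length xs) \<and> (\<forall>i<length xs. Act A (length xs) 1 (Prj T (length xs) i) x = xs ! i)"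
 by (rule preserves_power) (use assms nth_mem in blast)

lemma tuple_in: "set xs \<subseteq> Ob A 1 ==> tuple T A xs \<in> Ob A (length xs)"
 and tuple_nth: "set xs \<subseteq> Ob A 1 ==> i < length xs ==>
  Act A (length xs) 1 (Prj T (length xs) i) (tuple T A xs) = xs ! i"
 using theI'[OF tuple_unique, of xs] unfolding tuple_def by auto

lemma tuple_eqI:
 assumes "x \<in> Ob A (length xs)" "\<And>i. i < length xs ==> Act A (length xs) 1 (Prj T (length xs) i) x = xs ! i"
 shows "tuple T A xs = x"
proof -
 have "xs ! i \<in> Ob A 1" if "i < length xs" for i
  using Act_in[OF Prj_in[OF that] assms(1)] assms(2)[OF that] by simp
 then have "set xs \<subseteq> Ob A 1"
  by (metis in_set_conv_nth subsetI)
 note xs = tuple_in[OF this] tuple_nth[OF this]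
 show ?thesis
  by (rule Ob_eqI[OF xs(1) assms(1)]) (simp only: xs(2) assms(2))
qed

lemma op_in: "t \<in> Hom T (length xs) 1 ==> set xs \<subseteq> Ob A 1 ==> talg_op T A t xs \<in> Ob A 1"
 unfolding talg_op_def by (intro Act_in tuple_in)

lemma op_Prj: "set xs \<subseteq> Ob A 1 ==> i < length xs ==> talg_op T A (Prj T (length xs) i) xs = xs ! i"
 unfolding talg_op_def by (rule tuple_nth)

lemma tuple_components:
 assumes "x \<in> Ob A n"
 shows "tuple T A (map (\<lambda>i. Act A n 1 (Prj T n i) x) [0..<n]) = x"
 using assms by (intro tuple_eqI) auto

lemma Act_tuple:
 assumes "g \<in> Hom T (length xs) n" "set xs \<subseteq> Ob A 1"
 shows "Act A (length xs) n g (tuple T A xs) = tuple T A (map (\<lambda>i. talg_op T A (Cmp T (Prj T n i) g) xs) [0..<n])"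
 by (rule tuple_eqI[symmetric])
  (use assms in \<open>auto simp: talg_op_def Act_Cmp[OF _ Prj_in] tuple_in intro!: Act_in[OF assms(1)]\<close>)

lemma op_Cmp:
 assumes "g \<in> Hom T (length xs) n" "t \<in> Hom T n 1" "set xs \<subseteq> Ob A 1"
 shows "talg_op T A (Cmp T t g) xs = talg_op T A t (map (\<lambda>i. talg_op T A (Cmp T (Prj T n i) g) xs) [0..<n])"
 using Act_tuple[OF assms(1,3)] Act_Cmp[OF assms(1,2) tuple_in[OF assms(3)]] by (simp add: talg_op_def)

end

lemma (in lawvere_theory) represented_talgebra: "talgebra T (represented T k)"
proof
 show "\<exists>!x. x \<in> Ob (represented T k) n \<and> (\<forall>i<n. Act (represented T k) n 1 (Prj T n i) x = xs i)"
  if "\<And>i. i < n ==> xs i \<in> Ob (represented T k) 1" for n xs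
  using power[of n xs k] that by (simp add: represented_def)
qed (auto simp: represented_def Cmp_in Idn_left Cmp_assoc)

lemma represented_simps [simp]:
 "Ob (represented T k) = Hom T k" "Act (represented T k) m n f x = Cmp T f x"
 by (simp_all add: represented_def)

lemma op_represented: "talg_op T (represented T m) t fs = Cmp T t (tuple T (represented T m) fs)"
 by (simp add: talg_op_def)

context lawvere_theory
begin

lemma tuple_arrow: "set fs \<subseteq> Hom T m 1 ==> tuple T (represented T m) fs \<in> Hom T m (length fs)"
 and Prj_tuple_arrow: "set fs \<subseteq> Hom T m 1 ==> i < length fs ==>
  Cmp T (Prj T (length fs) i) (tuple T (represented T m) fs) = fs ! i"
 using talgebra.tuple_in[OF represented_talgebra[of m], of fs]
  talgebra.tuple_nth[OF represented_talgebra[of m], of fs i] by auto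

lemma tuple_Prjs: "tuple T (represented T m) (map (Prj T m) [0..<m]) = Idn T m"
 by (rule talgebra.tuple_eqI[OF represented_talgebra]) (auto simp: Idn_in Idn_right[OF Prj_in])

end

text \<open>The inner operations are collected into one arrow by the power property of the theory,
  and the action is functorial. Closure of generated sets and evaluation of arrows both rest on this
  composition law.\<close>

lemma (in talgebra) op_tuple:
 assumes "set fs \<subseteq> Hom T (length xs) 1" "t \<in> Hom T (length fs) 1" "set xs \<subseteq> Ob A 1"
 shows "talg_op T A (talg_op T (represented T (length xs)) t fs) xs = talg_op T A t (map (\<lambda>f. talg_op T A f xs) fs)"
proof -
 have "map (\<lambda>i. talg_op T A (Cmp T (Prj T (length fs) i) (tuple T (represented T (length xs)) fs)) xs) [0..<length fs] =
  map (\<lambda>f. talg_op T A f xs) fs"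
  by (rule nth_equalityI) (auto simp: Prj_tuple_arrow[OF assms(1)])
 then show ?thesis
  using op_Cmp[OF tuple_arrow[OF assms(1)] assms(2,3)] by (simp add: op_represented)
qed

text \<open>An algebra amounts to the set \<open>Ob A 1\<close> with the operations given by arrows
  to 1, and a morphism is determined by its component there. Working with that component alone
  avoids carrying the powers \<open>Ob A n\<close>; \<open>talg_hom_clone\<close> and
  \<open>clone_lift_hom\<close> translate.\<close>

definition clone_hom :: "'t lawvere => ('t, 'a) talg => ('t, 'b) talg => ('a => 'b) set" where
 "clone_hom T A B = {\<phi> \<in> Ob A 1 \<rightarrow> Ob B 1. \<forall>t xs. set xs \<subseteq> Ob A 1 \<longrightarrow> t \<in> Hom T (length xs) 1 \<longrightarrow>
   \<phi> (talg_op T A t xs) = talg_op T B t (map \<phi> xs)}"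

lemma clone_hom_in: "\<phi> \<in> clone_hom T A B ==> a \<in> Ob A 1 ==> \<phi> a \<in> Ob B 1"
 and clone_hom_op: "\<phi> \<in> clone_hom T A B ==> set xs \<subseteq> Ob A 1 ==> t \<in> Hom T (length xs) 1 ==>
  \<phi> (talg_op T A t xs) = talg_op T B t (map \<phi> xs)"
 by (auto simp: clone_hom_def)

lemma clone_homI:
 assumes "\<And>a. a \<in> Ob A 1 ==> \<phi> a \<in> Ob B 1"
  and "\<And>t xs. set xs \<subseteq> Ob A 1 ==> t \<in> Hom T (length xs) 1 ==> \<phi> (talg_op T A t xs) = talg_op T B t (map \<phi> xs)"
 shows "\<phi> \<in> clone_hom T A B"
 using assms by (auto simp: clone_hom_def)

lemma clone_hom_comp:
 assumes "\<phi> \<in> clone_hom T A B" "\<psi> \<in> clone_hom T B C"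
 shows "(\<lambda>a. \<psi> (\<phi> a)) \<in> clone_hom T A C"
proof (rule clone_homI)
 fix t xs assume xs: "set xs \<subseteq> Ob A 1" "t \<in> Hom T (length xs) 1"
 then have "set (map \<phi> xs) \<subseteq> Ob B 1"
  using clone_hom_in[OF assms(1)] by auto
 then show "\<psi> (\<phi> (talg_op T A t xs)) = talg_op T C t (map (\<lambda>a. \<psi> (\<phi> a)) xs)"
  using xs clone_hom_op[OF assms(2), of "map \<phi> xs" t] clone_hom_op[OF assms(1) xs] by (simp add: comp_def)
qed (fact clone_hom_in[OF assms(2) clone_hom_in[OF assms(1)]])

lemma clone_hom_id: "(\<lambda>a. a) \<in> clone_hom T A A"
 by (rule clone_homI) auto

lemma (in talgebra) eval_clone_hom:
 assumes "set xs \<subseteq> Ob A 1"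
 shows "(\<lambda>f. talg_op T A f xs) \<in> clone_hom T (represented T (length xs)) A"
 by (rule clone_homI) (use assms in \<open>auto simp: op_in op_tuple\<close>)

lemma talg_hom_in: "h \<in> talg_hom T A B ==> x \<in> Ob A n ==> h n x \<in> Ob B n"
 and talg_hom_Act: "h \<in> talg_hom T A B ==> f \<in> Hom T m n ==> x \<in> Ob A m ==>
  h n (Act A m n f x) = Act B m n f (h m x)"
 and talg_hom_undef: "h \<in> talg_hom T A B ==> x \<notin> Ob A n ==> h n x = undefined"
 by (auto simp: talg_hom_def PiE_iff extensional_def)

lemma talg_hom_tuple:
 assumes A: "talgebra T A" and B: "talgebra T B" and h: "h \<in> talg_hom T A B" and xs: "set xs \<subseteq> Ob A 1"
 shows "h (length xs) (tuple T A xs) = tuple T B (map (h 1) xs)"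
proof -
 interpret A: talgebra T A by (rule A)
 show ?thesis
 proof (rule talgebra.tuple_eqI[OF B, symmetric])
  show "h (length xs) (tuple T A xs) \<in> Ob B (length (map (h 1) xs))"
   using talg_hom_in[OF h A.tuple_in[OF xs]] by simp
  show "Act B (length (map (h 1) xs)) 1 (Prj T (length (map (h 1) xs)) i) (h (length xs) (tuple T A xs)) = map (h 1) xs ! i"
   if "i < length (map (h 1) xs)" for i
   using that talg_hom_Act[OF h A.Prj_in A.tuple_in[OF xs]] by (simp add: A.tuple_nth xs)
 qed
qed

lemma talg_hom_clone:
 assumes A: "talgebra T A" and B: "talgebra T B" and h: "h \<in> talg_hom T A B"
 shows "h 1 \<in> clone_hom T A B"
proof (rule clone_homI)
 show "h 1 (talg_op T A t xs) = talg_op T B t (map (h 1) xs)" if "set xs \<subseteq> Ob A 1" "t \<in> Hom T (length xs) 1" for t xs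
  using that talg_hom_tuple[OF A B h] talg_hom_Act[OF h _ talgebra.tuple_in[OF A]] by (simp add: talg_op_def)
qed (use talg_hom_in[OF h] in auto)

lemma talg_hom_eqI:
 assumes A: "talgebra T A" and B: "talgebra T B" and h: "h \<in> talg_hom T A B" "h' \<in> talg_hom T A B"
  and eq: "\<And>a. a \<in> Ob A 1 ==> h 1 a = h' 1 a"
 shows "h = h'"
proof (intro ext)
 fix n x
 interpret A: talgebra T A by (rule A)
 show "h n x = h' n x"
 proof (cases "x \<in> Ob A n")
  case True
  show ?thesis
  proof (rule talgebra.Ob_eqI[OF B talg_hom_in[OF h(1) True] talg_hom_in[OF h(2) True]])
   fix i assume i: "i < n"
   show "Act B n 1 (Prj T n i) (h n x) = Act B n 1 (Prj T n i) (h' n x)"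
    unfolding talg_hom_Act[OF h(1) A.Prj_in[OF i] True, symmetric] talg_hom_Act[OF h(2) A.Prj_in[OF i] True, symmetric]
    by (rule eq[OF A.Act_in[OF A.Prj_in[OF i] True]])
  qed
 next
  case False
  then show ?thesis
   using talg_hom_undef[OF h(1)] talg_hom_undef[OF h(2)] by simp
 qed
qed

definition clone_lift :: "'t lawvere => ('t, 'a) talg => ('t, 'b) talg => ('a => 'b) => nat => 'a => 'b" where
 "clone_lift T A B \<phi> n = (\<lambda>x\<in>Ob A n. tuple T B (map (\<lambda>i. \<phi> (Act A n 1 (Prj T n i) x)) [0..<n]))"

lemma clone_lift_1:
 assumes A: "talgebra T A" and B: "talgebra T B" and \<phi>: "\<phi> \<in> clone_hom T A B" and a: "a \<in> Ob A 1"
 shows "clone_lift T A B \<phi> 1 a = \<phi> a"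
proof -
 interpret A: talgebra T A by (rule A)
 interpret B: talgebra T B by (rule B)
 have "tuple T B [\<phi> a] = \<phi> a"
  using clone_hom_in[OF \<phi> a] by (intro B.tuple_eqI) (auto simp: A.Prj_1 B.Act_Idn)
 moreover have "[0..<1] = [0::nat]"
  by (simp add: upt_rec)
 ultimately show ?thesis
  using a by (simp add: clone_lift_def A.Prj_1 A.Act_Idn)
qed

lemma clone_lift_hom:
 assumes A: "talgebra T A" and B: "talgebra T B" and \<phi>: "\<phi> \<in> clone_hom T A B"
 shows "clone_lift T A B \<phi> \<in> talg_hom T A B"
proof -
 interpret A: talgebra T A by (rule A)
 interpret B: talgebra T B by (rule B)
 let ?c = "\<lambda>n x. map (\<lambda>i. Act A n 1 (Prj T n i) x) [0..<n]"
 have c: "set (?c n x) \<subseteq> Ob A 1" if "x \<in> Ob A n" for n x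
  using that A.Act_in A.Prj_in by auto
 have L: "clone_lift T A B \<phi> n x = tuple T B (map \<phi> (?c n x))" if "x \<in> Ob A n" for n x
  using that by (simp add: clone_lift_def comp_def)
 have c': "set (map \<phi> (?c n x)) \<subseteq> Ob B 1" if "x \<in> Ob A n" for n x
  using c[OF that] clone_hom_in[OF \<phi>] by auto
 have "clone_lift T A B \<phi> n x \<in> Ob B n" if "x \<in> Ob A n" for n x
  using B.tuple_in[OF c'[OF that]] by (simp add: L[OF that])
 moreover have "clone_lift T A B \<phi> n (Act A m n f x) = Act B m n f (clone_lift T A B \<phi> m x)"
  if f: "f \<in> Hom T m n" and x: "x \<in> Ob A m" for m n f x
 proof -
  have y: "Act A m n f x \<in> Ob A n"
   using f x by (rule A.Act_in)
  have "Act B m n f (clone_lift T A B \<phi> m x) =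
   tuple T B (map (\<lambda>i. talg_op T B (Cmp T (Prj T n i) f) (map \<phi> (?c m x))) [0..<n])"
   using B.Act_tuple[OF _ c'[OF x], of f n] f by (simp add: L[OF x])
  also have "\<dots> = tuple T B (map \<phi> (?c n (Act A m n f x)))"
  proof (rule arg_cong[of _ _ "tuple T B"], rule nth_equalityI)
   fix i assume "i < length (map (\<lambda>i. talg_op T B (Cmp T (Prj T n i) f) (map \<phi> (?c m x))) [0..<n])"
   then have i: "i < n" by simp
   have pf: "Cmp T (Prj T n i) f \<in> Hom T m 1"
    using f A.Prj_in[OF i] by (rule A.Cmp_in)
   have "Act A n 1 (Prj T n i) (Act A m n f x) = talg_op T A (Cmp T (Prj T n i) f) (?c m x)"
    using A.tuple_components[OF x] A.Act_Cmp[OF f A.Prj_in[OF i] x] by (simp add: talg_op_def)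
   then show "map (\<lambda>i. talg_op T B (Cmp T (Prj T n i) f) (map \<phi> (?c m x))) [0..<n] ! i = map \<phi> (?c n (Act A m n f x)) ! i"
    using i clone_hom_op[OF \<phi> c[OF x], of "Cmp T (Prj T n i) f"] pf by simp
  qed simp
  finally show ?thesis
   by (simp add: L[OF y])
 qed
 ultimately show ?thesis
  by (auto simp: talg_hom_def clone_lift_def)
qed

lemma talg_homI:
 assumes "\<And>n x. x \<in> Ob A n ==> h n x \<in> Ob B n" "\<And>n x. x \<notin> Ob A n ==> h n x = undefined"
  and "\<And>m n f x. f \<in> Hom T m n ==> x \<in> Ob A m ==> h n (Act A m n f x) = Act B m n f (h m x)"
 shows "h \<in> talg_hom T A B"
 using assms by (auto simp: talg_hom_def PiE_iff extensional_def)

lemma talg_comp_apply: "x \<in> Ob A n ==> talg_comp A g h n x = g n (h n x)"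
 by (simp add: talg_comp_def compose_def)

lemma talg_comp_in:
 assumes "talgebra T A" "h \<in> talg_hom T A B" "g \<in> talg_hom T B C"
 shows "talg_comp A g h \<in> talg_hom T A C"
proof (rule talg_homI)
 show "talg_comp A g h n (Act A m n f x) = Act C m n f (talg_comp A g h m x)" if "f \<in> Hom T m n" "x \<in> Ob A m" for m n f x
  using that talg_hom_Act[OF assms(2) that] talg_hom_Act[OF assms(3) that(1) talg_hom_in[OF assms(2) that(2)]]
  by (simp add: talg_comp_apply talgebra.Act_in[OF assms(1) that])
qed (auto simp: talg_comp_apply talg_comp_def compose_def intro: talg_hom_in[OF assms(2)] talg_hom_in[OF assms(3)])

subsection \<open>Subalgebras and transport of structure\<close>

definition op_closed :: "'t lawvere => ('t, 'a) talg => 'a set => bool" where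
 "op_closed T A G \<longleftrightarrow> G \<subseteq> Ob A 1 \<and> (\<forall>xs t. set xs \<subseteq> G \<longrightarrow> t \<in> Hom T (length xs) 1 \<longrightarrow> talg_op T A t xs \<in> G)"

lemma op_closed_op: "op_closed T A G ==> set xs \<subseteq> G ==> t \<in> Hom T (length xs) 1 ==> talg_op T A t xs \<in> G"
 by (auto simp: op_closed_def)

definition sub_talg :: "'t lawvere => ('t, 'a) talg => 'a set => ('t, 'a) talg" where
 "sub_talg T A G = \<lparr> Ob = (\<lambda>n. {x \<in> Ob A n. \<forall>i<n. Act A n 1 (Prj T n i) x \<in> G}), Act = Act A \<rparr>"

lemma sub_talg_1:
 assumes "talgebra T A" "op_closed T A G"
 shows "Ob (sub_talg T A G) 1 = G"
proof -
 interpret talgebra T A by fact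
 show ?thesis
  using assms(2) by (auto simp: sub_talg_def op_closed_def Prj_1 Act_Idn)
qed

lemma sub_talg_algebra:
 assumes "talgebra T A" "op_closed T A G"
 shows "talgebra T (sub_talg T A G)"
proof -
 interpret talgebra T A by fact
 show ?thesis
 proof
  fix f m n x assume f: "f \<in> Hom T m n" and "x \<in> Ob (sub_talg T A G) m"
  then have x: "x \<in> Ob A m" "\<And>i. i < m ==> Act A m 1 (Prj T m i) x \<in> G"
   by (auto simp: sub_talg_def)
  let ?xs = "map (\<lambda>i. Act A m 1 (Prj T m i) x) [0..<m]"
  have xs: "set ?xs \<subseteq> G"
   using x by auto
  have "Act A n 1 (Prj T n i) (Act A m n f x) \<in> G" if i: "i < n" for i
  proof -
   have "talg_op T A (Cmp T (Prj T n i) f) ?xs \<in> G"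
    by (rule op_closed_op[OF assms(2) xs]) (simp add: Cmp_in[OF f Prj_in[OF i]])
   then show ?thesis
    using tuple_components[OF x(1)] Act_Cmp[OF f Prj_in[OF i] x(1)] by (simp add: talg_op_def)
  qed
  then show "Act (sub_talg T A G) m n f x \<in> Ob (sub_talg T A G) n"
   using Act_in[OF f x(1)] by (simp add: sub_talg_def)
 next
  fix n :: nat and xs assume "\<And>i. i < n ==> xs i \<in> Ob (sub_talg T A G) 1"
  then have xs: "\<And>i. i < n ==> xs i \<in> G" "G \<subseteq> Ob A 1"
   using assms(2) by (auto simp: sub_talg_1[OF assms] op_closed_def)
  then have "\<exists>!x. x \<in> Ob A n \<and> (\<forall>i<n. Act A n 1 (Prj T n i) x = xs i)"
   by (intro preserves_power) auto
  moreover have "x \<in> Ob (sub_talg T A G) n \<and> (\<forall>i<n. Act (sub_talg T A G) n 1 (Prj T n i) x = xs i) \<longleftrightarrow>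
   x \<in> Ob A n \<and> (\<forall>i<n. Act A n 1 (Prj T n i) x = xs i)" for x
   using xs(1) by (auto simp: sub_talg_def)
  ultimately show "\<exists>!x. x \<in> Ob (sub_talg T A G) n \<and> (\<forall>i<n. Act (sub_talg T A G) n 1 (Prj T n i) x = xs i)"
   by simp
 qed (auto simp: sub_talg_def Act_Idn Act_Cmp)
qed

lemma sub_talg_corestrict:
 assumes "talgebra T A" "talgebra T B" "h \<in> talg_hom T B A" "\<And>b. b \<in> Ob B 1 ==> h 1 b \<in> G"
 shows "h \<in> talg_hom T B (sub_talg T A G)"
proof (rule talg_homI)
 interpret B: talgebra T B by fact
 fix n :: nat and x assume x: "x \<in> Ob B n"
 have "Act A n 1 (Prj T n i) (h n x) \<in> G" if "i < n" for i
  using talg_hom_Act[OF assms(3) B.Prj_in[OF that] x] assms(4)[OF B.Act_in[OF B.Prj_in[OF that] x]] by simp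
 then show "h n x \<in> Ob (sub_talg T A G) n"
  using talg_hom_in[OF assms(3) x] by (simp add: sub_talg_def)
qed (auto simp: sub_talg_def talg_hom_Act[OF assms(3)] talg_hom_undef[OF assms(3)])

lemma sub_talg_incl: "h \<in> talg_hom T B (sub_talg T A G) ==> h \<in> talg_hom T B A"
 by (rule talg_homI) (use talg_hom_in[of h T B "sub_talg T A G"] talg_hom_undef[of h T B] talg_hom_Act[of h T B "sub_talg T A G"] in
  \<open>auto simp: sub_talg_def\<close>)

text \<open>Universal properties are at hand for algebras in one test type. An algebra in another
  type is copied along an injection into the test type, and the morphism found there is copied
  back.\<close>

definition transport_talg :: "(nat => 'a => 'b) => ('t, 'a) talg => ('t, 'b) talg" where
 "transport_talg j A = \<lparr> Ob = (\<lambda>n. j n ` Ob A n), Act = (\<lambda>m n f y. j n (Act A m n f (inv_into (Ob A m) (j m) y))) \<rparr>"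

lemma transport_talg_simps:
 assumes "\<And>n. inj_on (j n) (Ob A n)"
 shows "Ob (transport_talg j A) n = j n ` Ob A n"
  "x \<in> Ob A m ==> Act (transport_talg j A) m n f (j m x) = j n (Act A m n f x)"
 using assms by (auto simp: transport_talg_def)

lemma transport_talg_algebra:
 assumes "talgebra T A" and inj: "\<And>n. inj_on (j n) (Ob A n)"
 shows "talgebra T (transport_talg j A)"
proof -
 interpret talgebra T A by fact
 note s = transport_talg_simps[of j A, OF inj]
 show ?thesis
 proof
  fix n :: nat and xs assume xs: "\<And>i. i < n ==> xs i \<in> Ob (transport_talg j A) 1"
  let ?y = "\<lambda>i. inv_into (Ob A 1) (j 1) (xs i)"
  have y: "?y i \<in> Ob A 1" "j 1 (?y i) = xs i" if "i < n" for i
   using xs[OF that] by (auto simp: s inv_into_into f_inv_into_f)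
  obtain x where x: "x \<in> Ob A n" "\<forall>i<n. Act A n 1 (Prj T n i) x = ?y i"
   using preserves_power[of n ?y] y(1) by blast
  show "\<exists>!x. x \<in> Ob (transport_talg j A) n \<and> (\<forall>i<n. Act (transport_talg j A) n 1 (Prj T n i) x = xs i)"
  proof (intro ex1I[of _ "j n x"] conjI allI impI)
   show "j n x \<in> Ob (transport_talg j A) n"
    using x by (simp add: s)
   show "Act (transport_talg j A) n 1 (Prj T n i) (j n x) = xs i" if "i < n" for i
    using x y that by (simp add: s)
   fix z assume z: "z \<in> Ob (transport_talg j A) n \<and> (\<forall>i<n. Act (transport_talg j A) n 1 (Prj T n i) z = xs i)"
   then obtain w where w: "w \<in> Ob A n" "z = j n w"
    by (auto simp: s)
   have "Act A n 1 (Prj T n i) w = ?y i" if "i < n" for i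
   proof -
    have "xs i = j 1 (Act A n 1 (Prj T n i) w)"
     using z that by (simp add: w(2) s(2)[OF w(1)])
    then show ?thesis
     using inv_into_f_f[OF inj Act_in[OF Prj_in[OF that] w(1)]] by simp
   qed
   then have "w = x"
    by (intro Ob_eqI[OF w(1) x(1)]) (simp only: x(2))
   then show "z = j n x"
    using w by simp
  qed
 qed (auto simp: s Act_in Act_Idn Idn_in Act_Cmp)
qed

abbreviation "transport_to j A \<equiv> \<lambda>n. restrict (j n) (Ob A n)"
abbreviation "transport_from j A \<equiv> \<lambda>n. restrict (inv_into (Ob A n) (j n)) (j n ` Ob A n)"

lemma transport_talg_to:
 assumes "talgebra T A" "\<And>n. inj_on (j n) (Ob A n)"
 shows "transport_to j A \<in> talg_hom T A (transport_talg j A)"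
proof (rule talg_homI)
 show "transport_to j A n (Act A m n f x) = Act (transport_talg j A) m n f (transport_to j A m x)"
  if "f \<in> Hom T m n" "x \<in> Ob A m" for m n f x
  using that assms(2) talgebra.Act_in[OF assms(1)] by (simp add: transport_talg_simps)
qed (auto simp: transport_talg_simps[of j A, OF assms(2)])

lemma transport_talg_from:
 assumes "talgebra T A" "\<And>n. inj_on (j n) (Ob A n)"
 shows "transport_from j A \<in> talg_hom T (transport_talg j A) A"
proof (rule talg_homI)
 fix m n f y assume f: "f \<in> Hom T m n" and "y \<in> Ob (transport_talg j A) m"
 then obtain x where "x \<in> Ob A m" "y = j m x"
  using assms(2) by (auto simp: transport_talg_simps)
 then show "transport_from j A n (Act (transport_talg j A) m n f y) =
  Act A m n f (transport_from j A m y)"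
  using f assms(2) talgebra.Act_in[OF assms(1) f] by (simp add: transport_talg_simps)
qed (auto simp: transport_talg_simps[of j A, OF assms(2)] assms(2))

section \<open>The ring underlying an algebra\<close>

locale com_theory = R: cring R + \<kappa>: lawvere_morphism "Com R" T \<kappa>
 for R :: "('r, 'z) ring_scheme" and T :: "'t lawvere" and \<kappa>
begin

abbreviation "MP \<equiv> mpoly_ring R"
abbreviation "V \<equiv> ring.indexed_var R"
abbreviation "K \<equiv> ring.indexed_const R"
abbreviation "pset n \<equiv> ring.indexed_pset R {..<n::nat} (carrier R)"

lemma Com_simps: "ps \<in> Hom (Com R) m n \<longleftrightarrow> length ps = n \<and> set ps \<subseteq> pset m"
 "Cmp (Com R) g f = map (mpoly_subst R f) g" "Prj (Com R) n i = [V i]"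
 by (auto simp: Com_def)

lemma pset_MP: "p \<in> pset n ==> p \<in> carrier MP"
 unfolding R.mpoly_carrier by (rule R.pset_mono) auto

lemma pset_intros: "i < n ==> V i \<in> pset n" "r \<in> carrier R ==> K r \<in> pset n"
 "p \<in> pset n ==> q \<in> pset n ==> p [+] q \<in> pset n"
 "p \<in> pset n ==> q \<in> pset n ==> p [*] q \<in> pset n"
 by (auto intro: R.pset_var R.pset_const R.pset_add R.pset_mult)

lemma \<kappa>_in: "p \<in> pset n ==> \<kappa> n 1 [p] \<in> Hom T n 1"
 by (rule \<kappa>.arr) (simp add: Com_simps)

definition ev :: "('t, 'a) talg => 'a list => (nat multiset => 'r) => 'a" where
 "ev A xs p = talg_op T A (\<kappa> (length xs) 1 [p]) xs"

lemma ev_in: "talgebra T A ==> set xs \<subseteq> Ob A 1 ==> p \<in> pset (length xs) ==> ev A xs p \<in> Ob A 1"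
 unfolding ev_def by (rule talgebra.op_in) (auto intro: \<kappa>_in)

lemma ev_var: "talgebra T A ==> set xs \<subseteq> Ob A 1 ==> i < length xs ==> ev A xs (V i) = xs ! i"
 using \<kappa>.Prj[of i "length xs"] by (simp add: ev_def Com_simps talgebra.op_Prj)

text \<open>Substitution of polynomials is composition in \<open>Com R\<close>, and
  \<open>\<kappa>\<close> respects composition and projections. The compatibility of
  \<open>ev\<close> with each ring operation is an instance.\<close>

lemma ev_subst:
 assumes A: "talgebra T A" and xs: "set xs \<subseteq> Ob A 1" and qs: "set qs \<subseteq> pset (length xs)" and p: "p \<in> pset (length qs)"
 shows "ev A xs (mpoly_subst R qs p) = ev A (map (ev A xs) qs) p"
proof -
 let ?n = "length xs" and ?m = "length qs"
 interpret A: talgebra T A by fact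
 have q: "qs \<in> Hom (Com R) ?n ?m" and p': "[p] \<in> Hom (Com R) ?m 1"
  using qs p by (auto simp: Com_simps)
 have pr: "Cmp T (Prj T ?m i) (\<kappa> ?n ?m qs) = \<kappa> ?n 1 [qs ! i]" if "i < ?m" for i
 proof -
  have "[V i] \<in> Hom (Com R) ?m 1"
   using that by (auto simp: Com_simps intro: pset_intros)
  then have "\<kappa> ?n 1 (Cmp (Com R) [V i] qs) = Cmp T (\<kappa> ?m 1 [V i]) (\<kappa> ?n ?m qs)"
   using q by (rule \<kappa>.Cmp[rotated])
  moreover have "qs ! i \<in> carrier MP"
   using qs that by (intro pset_MP) auto
  ultimately show ?thesis
   using \<kappa>.Prj[OF that] by (simp add: Com_simps R.subst_var)
 qed
 have "ev A xs (mpoly_subst R qs p) = talg_op T A (Cmp T (\<kappa> ?m 1 [p]) (\<kappa> ?n ?m qs)) xs"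
  using \<kappa>.Cmp[OF q p'] by (simp add: ev_def Com_simps)
 also have "\<dots> = talg_op T A (\<kappa> ?m 1 [p]) (map (\<lambda>i. talg_op T A (Cmp T (Prj T ?m i) (\<kappa> ?n ?m qs)) xs) [0..<?m])"
  by (rule A.op_Cmp) (use q p' xs \<kappa>.arr in auto)
 also have "map (\<lambda>i. talg_op T A (Cmp T (Prj T ?m i) (\<kappa> ?n ?m qs)) xs) [0..<?m] = map (ev A xs) qs"
  by (rule nth_equalityI) (auto simp: pr ev_def)
 finally show ?thesis
  by (simp add: ev_def)
qed

abbreviation "U A \<equiv> underlying R T \<kappa> A"

lemma underlying_simps: "carrier (U A) = Ob A 1"
 "a \<oplus>\<^bsub>U A\<^esub> b = ev A [a, b] (V 0 [+] V 1)" "a \<otimes>\<^bsub>U A\<^esub> b = ev A [a, b] (V 0 [*] V 1)"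
 "\<zero>\<^bsub>U A\<^esub> = ev A [] \<zero>\<^bsub>MP\<^esub>" "\<one>\<^bsub>U A\<^esub> = ev A [] \<one>\<^bsub>MP\<^esub>" "s \<odot>\<^bsub>U A\<^esub> a = ev A [a] (K s [*] V 0)"
 by (simp_all add: underlying_def Let_def ev_def)

lemma zero_K: "\<zero>\<^bsub>MP\<^esub> = K \<zero>\<^bsub>R\<^esub>" and one_K: "\<one>\<^bsub>MP\<^esub> = K \<one>\<^bsub>R\<^esub>"
 by (simp_all add: mpoly_ring_def)

context
 fixes A :: "('t, 'a) talg" and xs
 assumes A: "talgebra T A" and xs: "set xs \<subseteq> Ob A 1"
begin

lemma ev_add: "p \<in> pset (length xs) ==> q \<in> pset (length xs) ==> ev A xs (p [+] q) = ev A xs p \<oplus>\<^bsub>U A\<^esub> ev A xs q"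
 using ev_subst[OF A xs, of "[p, q]" "V 0 [+] V 1"] R.subst_add[of 0 1 "[p, q]"]
 by (simp add: underlying_simps pset_MP pset_intros)

lemma ev_mult: "p \<in> pset (length xs) ==> q \<in> pset (length xs) ==> ev A xs (p [*] q) = ev A xs p \<otimes>\<^bsub>U A\<^esub> ev A xs q"
 using ev_subst[OF A xs, of "[p, q]" "V 0 [*] V 1"] R.subst_mult[of 0 1 "[p, q]"]
 by (simp add: underlying_simps pset_MP pset_intros)

lemma ev_smult: "p \<in> pset (length xs) ==> s \<in> carrier R ==> ev A xs (K s [*] p) = s \<odot>\<^bsub>U A\<^esub> ev A xs p"
 using ev_subst[OF A xs, of "[p]" "K s [*] V 0"] R.subst_smult[of s "[p]" 0]
 by (simp add: underlying_simps pset_MP pset_intros)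

lemma ev_const: "s \<in> carrier R ==> ev A xs (K s) = ev A [] (K s)"
 using ev_subst[OF A xs, of "[]" "K s"] R.subst_const[of s "[]"] by (simp add: R.pset_const)

lemma ev_zero: "ev A xs \<zero>\<^bsub>MP\<^esub> = \<zero>\<^bsub>U A\<^esub>" and ev_one: "ev A xs \<one>\<^bsub>MP\<^esub> = \<one>\<^bsub>U A\<^esub>"
 by (simp_all add: underlying_simps zero_K one_K ev_const)

end

text \<open>Every ring axiom is an identity between polynomials in at most three variables. It holds
  in \<open>MP\<close> and is evaluated at the given elements.\<close>

lemma underlying_cring:
 assumes A: "talgebra T A"
 shows "cring (U A)"
proof -
 interpret MP: cring MP by (rule R.mpoly_cring)
 note [simp] = underlying_simps(1)
 have add: "a \<oplus>\<^bsub>U A\<^esub> b \<in> Ob A 1" and mult: "a \<otimes>\<^bsub>U A\<^esub> b \<in> Ob A 1" if "a \<in> Ob A 1" "b \<in> Ob A 1" for a b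
  unfolding underlying_simps using that A by (auto intro!: ev_in pset_intros)
 have unit: "\<zero>\<^bsub>U A\<^esub> \<in> Ob A 1" "\<one>\<^bsub>U A\<^esub> \<in> Ob A 1"
  unfolding underlying_simps zero_K one_K using A by (auto intro!: ev_in pset_intros)
 note ev = ev_add ev_mult ev_zero ev_one ev_var pset_intros
 have ring: "a \<oplus>\<^bsub>U A\<^esub> b \<oplus>\<^bsub>U A\<^esub> c = a \<oplus>\<^bsub>U A\<^esub> (b \<oplus>\<^bsub>U A\<^esub> c)" "a \<otimes>\<^bsub>U A\<^esub> b \<otimes>\<^bsub>U A\<^esub> c = a \<otimes>\<^bsub>U A\<^esub> (b \<otimes>\<^bsub>U A\<^esub> c)"
  "(a \<oplus>\<^bsub>U A\<^esub> b) \<otimes>\<^bsub>U A\<^esub> c = a \<otimes>\<^bsub>U A\<^esub> c \<oplus>\<^bsub>U A\<^esub> b \<otimes>\<^bsub>U A\<^esub> c"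
  if abc: "a \<in> Ob A 1" "b \<in> Ob A 1" "c \<in> Ob A 1" for a b c
 proof -
  let ?e = "ev A [a, b, c]"
  have "?e (V 0 [+] V 1 [+] V 2) = ?e (V 0 [+] (V 1 [+] V 2))" "?e (V 0 [*] V 1 [*] V 2) = ?e (V 0 [*] (V 1 [*] V 2))"
   "?e ((V 0 [+] V 1) [*] V 2) = ?e (V 0 [*] V 2 [+] V 1 [*] V 2)"
   by (simp_all add: MP.a_assoc MP.m_assoc MP.l_distr)
  then show "a \<oplus>\<^bsub>U A\<^esub> b \<oplus>\<^bsub>U A\<^esub> c = a \<oplus>\<^bsub>U A\<^esub> (b \<oplus>\<^bsub>U A\<^esub> c)" "a \<otimes>\<^bsub>U A\<^esub> b \<otimes>\<^bsub>U A\<^esub> c = a \<otimes>\<^bsub>U A\<^esub> (b \<otimes>\<^bsub>U A\<^esub> c)"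
   "(a \<oplus>\<^bsub>U A\<^esub> b) \<otimes>\<^bsub>U A\<^esub> c = a \<otimes>\<^bsub>U A\<^esub> c \<oplus>\<^bsub>U A\<^esub> b \<otimes>\<^bsub>U A\<^esub> c"
   using abc A by (simp_all add: ev)
 qed
 have comm: "a \<oplus>\<^bsub>U A\<^esub> b = b \<oplus>\<^bsub>U A\<^esub> a" "a \<otimes>\<^bsub>U A\<^esub> b = b \<otimes>\<^bsub>U A\<^esub> a" if ab: "a \<in> Ob A 1" "b \<in> Ob A 1" for a b
 proof -
  let ?e = "ev A [a, b]"
  have "?e (V 0 [+] V 1) = ?e (V 1 [+] V 0)" "?e (V 0 [*] V 1) = ?e (V 1 [*] V 0)"
   by (simp_all add: MP.a_comm MP.m_comm)
  then show "a \<oplus>\<^bsub>U A\<^esub> b = b \<oplus>\<^bsub>U A\<^esub> a" "a \<otimes>\<^bsub>U A\<^esub> b = b \<otimes>\<^bsub>U A\<^esub> a"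
   using ab A by (simp_all add: ev)
 qed
 have unary: "\<exists>b\<in>Ob A 1. b \<oplus>\<^bsub>U A\<^esub> a = \<zero>\<^bsub>U A\<^esub>" "\<zero>\<^bsub>U A\<^esub> \<oplus>\<^bsub>U A\<^esub> a = a" "\<one>\<^bsub>U A\<^esub> \<otimes>\<^bsub>U A\<^esub> a = a" if a: "a \<in> Ob A 1" for a
 proof -
  let ?n = "K (\<ominus>\<^bsub>R\<^esub> \<one>\<^bsub>R\<^esub>) [*] V 0"
  have p: "\<zero>\<^bsub>MP\<^esub> \<in> pset 1" "\<one>\<^bsub>MP\<^esub> \<in> pset 1" "?n \<in> pset 1" "V 0 \<in> pset 1"
   by (auto simp: zero_K one_K intro: pset_intros)
  have "?n [+] V 0 = (K (\<ominus>\<^bsub>R\<^esub> \<one>\<^bsub>R\<^esub>) [+] K \<one>\<^bsub>R\<^esub>) [*] V 0"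
   by (simp add: MP.l_distr) (simp flip: one_K)
  also have "\<dots> = \<zero>\<^bsub>MP\<^esub>"
   by (simp add: R.const_add[symmetric] R.l_neg) (simp flip: zero_K)
  finally show "\<exists>b\<in>Ob A 1. b \<oplus>\<^bsub>U A\<^esub> a = \<zero>\<^bsub>U A\<^esub>"
   using a A p ev_add[of A "[a]" ?n "V 0"] by (intro bexI[of _ "ev A [a] ?n"]) (auto simp: ev_zero ev_var ev_in)
  show "\<zero>\<^bsub>U A\<^esub> \<oplus>\<^bsub>U A\<^esub> a = a" "\<one>\<^bsub>U A\<^esub> \<otimes>\<^bsub>U A\<^esub> a = a"
   using a A p ev_add[of A "[a]" "\<zero>\<^bsub>MP\<^esub>" "V 0"] ev_mult[of A "[a]" "\<one>\<^bsub>MP\<^esub>" "V 0"] by (auto simp: ev_zero ev_one ev_var)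
 qed
 show ?thesis
  by (intro cringI abelian_groupI comm_monoidI) (use add mult unit ring comm unary in auto)
qed

lemma underlying_module:
 assumes A: "talgebra T A"
 shows "module R (U A)"
proof -
 interpret MP: cring MP by (rule R.mpoly_cring)
 interpret UA: cring "U A" by (rule underlying_cring[OF A])
 note [simp] = underlying_simps(1) and ev = ev_add ev_smult ev_var pset_intros
 show ?thesis
 proof (rule module.intro[OF R.is_cring], unfold_locales)
  fix a assume "a \<in> carrier (U A)"
  then have a: "a \<in> Ob A 1" by simp
  have "ev A [a] (K \<one>\<^bsub>R\<^esub> [*] V 0) = ev A [a] (V 0)"
   by (simp flip: one_K)
  then show "\<one>\<^bsub>R\<^esub> \<odot>\<^bsub>U A\<^esub> a = a"
   using a A by (simp add: ev)
  fix r assume r: "r \<in> carrier R"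
  show "r \<odot>\<^bsub>U A\<^esub> a \<in> carrier (U A)"
   unfolding underlying_simps using a r A by (auto intro!: ev_in pset_intros)
  fix s assume s: "s \<in> carrier R"
  have "ev A [a] (K (r \<oplus>\<^bsub>R\<^esub> s) [*] V 0) = ev A [a] (K r [*] V 0 [+] K s [*] V 0)"
   "ev A [a] (K (r \<otimes>\<^bsub>R\<^esub> s) [*] V 0) = ev A [a] (K r [*] (K s [*] V 0))"
   using r s by (simp_all add: R.const_add MP.l_distr R.const_mult MP.m_assoc)
  then show "(r \<oplus>\<^bsub>R\<^esub> s) \<odot>\<^bsub>U A\<^esub> a = r \<odot>\<^bsub>U A\<^esub> a \<oplus>\<^bsub>U A\<^esub> s \<odot>\<^bsub>U A\<^esub> a"
   "(r \<otimes>\<^bsub>R\<^esub> s) \<odot>\<^bsub>U A\<^esub> a = r \<odot>\<^bsub>U A\<^esub> (s \<odot>\<^bsub>U A\<^esub> a)"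
   using r s a A by (simp_all add: ev)
  fix b assume "b \<in> carrier (U A)"
  then have b: "b \<in> Ob A 1" by simp
  have "ev A [a, b] (K r [*] (V 0 [+] V 1)) = ev A [a, b] (K r [*] V 0 [+] K r [*] V 1)"
   using r by (simp add: MP.r_distr)
  then show "r \<odot>\<^bsub>U A\<^esub> (a \<oplus>\<^bsub>U A\<^esub> b) = r \<odot>\<^bsub>U A\<^esub> a \<oplus>\<^bsub>U A\<^esub> r \<odot>\<^bsub>U A\<^esub> b"
   using r a b A by (simp add: ev)
 qed
qed

lemma clone_hom_ev:
 assumes "\<phi> \<in> clone_hom T A B" "set xs \<subseteq> Ob A 1" "p \<in> pset (length xs)"
 shows "\<phi> (ev A xs p) = ev B (map \<phi> xs) p"
 using clone_hom_op[OF assms(1,2) \<kappa>_in[OF assms(3)]] by (simp add: ev_def)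

lemma clone_hom_ops:
 assumes "\<phi> \<in> clone_hom T A B"
 shows "a \<in> Ob A 1 ==> b \<in> Ob A 1 ==> \<phi> (a \<oplus>\<^bsub>U A\<^esub> b) = \<phi> a \<oplus>\<^bsub>U B\<^esub> \<phi> b"
  "a \<in> Ob A 1 ==> b \<in> Ob A 1 ==> \<phi> (a \<otimes>\<^bsub>U A\<^esub> b) = \<phi> a \<otimes>\<^bsub>U B\<^esub> \<phi> b"
  "\<phi> \<zero>\<^bsub>U A\<^esub> = \<zero>\<^bsub>U B\<^esub>" "\<phi> \<one>\<^bsub>U A\<^esub> = \<one>\<^bsub>U B\<^esub>"
  "s \<in> carrier R ==> a \<in> Ob A 1 ==> \<phi> (s \<odot>\<^bsub>U A\<^esub> a) = s \<odot>\<^bsub>U B\<^esub> \<phi> a"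
 unfolding underlying_simps zero_K one_K
 by (subst clone_hom_ev[OF assms]; auto intro!: pset_intros R.pset_const)+

lemma clone_hom_ring_hom: "\<phi> \<in> clone_hom T A B ==> \<phi> \<in> ring_hom (U A) (U B)"
 by (rule ring_hom_memI) (auto simp: underlying_simps(1) clone_hom_ops clone_hom_in)

end

section \<open>Free families\<close>

definition position :: "'j list => 'j => nat" where
 "position js i = (SOME k. k < length js \<and> js ! k = i)"

lemma position: "i \<in> set js ==> position js i < length js" "i \<in> set js ==> js ! position js i = i"
 using someI_ex[of "\<lambda>k. k < length js \<and> js ! k = i"] by (auto simp: position_def in_set_conv_nth)

text \<open>Rewrites an operation in the variables \<open>ks\<close> as one in a list
  \<open>js\<close> that contains them. Different presentations become comparable over one list, and
  repeated variables can be merged.\<close>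

definition rename_vars :: "'t lawvere => 'j list => 'j list => 't => 't" where
 "rename_vars T ks js t = talg_op T (represented T (length js)) t (map (\<lambda>i. Prj T (length js) (position js i)) ks)"

lemma (in lawvere_theory) rename_vars_in:
 assumes "set ks \<subseteq> set js" "t \<in> Hom T (length ks) 1"
 shows "rename_vars T ks js t \<in> Hom T (length js) 1"
proof -
 have "set (map (\<lambda>i. Prj T (length js) (position js i)) ks) \<subseteq> Ob (represented T (length js)) 1"
  using assms(1) position(1)[of _ js] Prj_in by auto
 then show ?thesis
  using talgebra.op_in[OF represented_talgebra, of t "map (\<lambda>i. Prj T (length js) (position js i)) ks"] assms(2)
  by (simp add: rename_vars_def)
qed

lemma (in talgebra) op_rename_vars:
 assumes "set ks \<subseteq> set js" "t \<in> Hom T (length ks) 1" "\<And>i. i \<in> set js ==> x i \<in> Ob A 1"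
 shows "talg_op T A (rename_vars T ks js t) (map x js) = talg_op T A t (map x ks)"
proof -
 let ?ps = "map (\<lambda>i. Prj T (length js) (position js i)) ks"
 have xs: "set (map x js) \<subseteq> Ob A 1"
  using assms(3) by auto
 have "talg_op T A (talg_op T (represented T (length (map x js))) t ?ps) (map x js) = talg_op T A t (map (\<lambda>f. talg_op T A f (map x js)) ?ps)"
  by (rule op_tuple) (use assms xs position(1)[of _ js] Prj_in in auto)
 also have "map (\<lambda>f. talg_op T A f (map x js)) ?ps = map x ks"
 proof (rule nth_equalityI)
  fix k assume "k < length (map (\<lambda>f. talg_op T A f (map x js)) ?ps)"
  then have k: "k < length ks" "ks ! k \<in> set js"
   using assms(1) by auto
  then show "map (\<lambda>f. talg_op T A f (map x js)) ?ps ! k = map x ks ! k"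
   using op_Prj[OF xs, of "position js (ks ! k)"] position[OF k(2)] by simp
 qed simp
 finally show ?thesis
  by (simp add: rename_vars_def)
qed

definition generated :: "'t lawvere => ('t, 'a) talg => 'j set => ('j => 'a) => 'a set" where
 "generated T A J x = {talg_op T A t (map x js) |t js. set js \<subseteq> J \<and> t \<in> Hom T (length js) 1}"

text \<open>Independence is asked for lists without repetition: with a repeated variable, different
  arrows can give the same value in a free algebra.\<close>

definition free_on :: "'t lawvere => ('t, 'a) talg => 'j set => ('j => 'a) => bool" where
 "free_on T A J x \<longleftrightarrow> x ` J \<subseteq> Ob A 1 \<and> Ob A 1 \<subseteq> generated T A J x \<and>
  (\<forall>js t t'. distinct js \<longrightarrow> set js \<subseteq> J \<longrightarrow> t \<in> Hom T (length js) 1 \<longrightarrow> t' \<in> Hom T (length js) 1 \<longrightarrow>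
    talg_op T A t (map x js) = talg_op T A t' (map x js) \<longrightarrow> t = t')"

lemma generatedI: "set js \<subseteq> J ==> t \<in> Hom T (length js) 1 ==> talg_op T A t (map x js) \<in> generated T A J x"
 by (auto simp: generated_def)

lemma generatedE:
 assumes "a \<in> generated T A J x"
 obtains t js where "set js \<subseteq> J" "t \<in> Hom T (length js) 1" "a = talg_op T A t (map x js)"
 using assms by (auto simp: generated_def)

lemma generated_mono: "J \<subseteq> J' ==> generated T A J x \<subseteq> generated T A J' x"
 by (auto simp: generated_def)

lemma generated_least: "op_closed T A G ==> x ` J \<subseteq> G ==> generated T A J x \<subseteq> G"
 by (auto elim!: generatedE intro!: op_closed_op simp: image_subset_iff subset_iff)

lemma clone_hom_eq_on_generated:
 assumes "\<phi> \<in> clone_hom T A B" "\<psi> \<in> clone_hom T A B" "x ` J \<subseteq> Ob A 1" "\<And>i. i \<in> J ==> \<phi> (x i) = \<psi> (x i)"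
  and "a \<in> generated T A J x"
 shows "\<phi> a = \<psi> a"
proof -
 obtain t js where a: "set js \<subseteq> J" "t \<in> Hom T (length js) 1" "a = talg_op T A t (map x js)"
  using assms(5) by (rule generatedE)
 have "set (map x js) \<subseteq> Ob A 1" "map \<phi> (map x js) = map \<psi> (map x js)"
  using a(1) assms(3,4) by auto
 then show ?thesis
  using a clone_hom_op[OF assms(1), of "map x js" t] clone_hom_op[OF assms(2), of "map x js" t] by (simp del: map_map map_eq_conv list.map_comp)
qed

lemma clone_hom_generated:
 assumes "\<phi> \<in> clone_hom T A B" "x ` J \<subseteq> Ob A 1" "a \<in> generated T A J x"
 shows "\<phi> a \<in> generated T B J (\<lambda>i. \<phi> (x i))"
proof -
 obtain t js where a: "set js \<subseteq> J" "t \<in> Hom T (length js) 1" "a = talg_op T A t (map x js)"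
  using assms(3) by (rule generatedE)
 have "set (map x js) \<subseteq> Ob A 1"
  using a(1) assms(2) by auto
 then have "\<phi> a = talg_op T B t (map (\<lambda>i. \<phi> (x i)) js)"
  using a clone_hom_op[OF assms(1)] by (simp add: comp_def)
 then show ?thesis
  using a by (simp add: generatedI)
qed

context talgebra
begin

lemma generated_Ob: "x ` J \<subseteq> Ob A 1 ==> generated T A J x \<subseteq> Ob A 1"
 by (auto elim!: generatedE intro!: op_in simp: image_subset_iff subset_iff)

lemma generated_base: "x ` J \<subseteq> Ob A 1 ==> i \<in> J ==> x i \<in> generated T A J x"
proof -
 assume x: "x ` J \<subseteq> Ob A 1" "i \<in> J"
 then have "talg_op T A (Prj T 1 0) (map x [i]) = x i"
  using op_Prj[of "[x i]" 0] by auto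
 then show ?thesis
  using generatedI[of "[i]" J "Prj T 1 0" T A x] Prj_in[of 0 1] x by simp
qed

lemma generated_common:
 assumes x: "x ` J \<subseteq> Ob A 1" and "set as \<subseteq> generated T A J x"
 shows "\<exists>js ts. distinct js \<and> set js \<subseteq> J \<and> set ts \<subseteq> Hom T (length js) 1 \<and> as = map (\<lambda>t. talg_op T A t (map x js)) ts"
 using assms(2)
proof (induction as)
 case Nil
 show ?case
  by (intro exI[of _ "[]"]) auto
next
 case (Cons a as)
 then obtain js ts where js: "distinct js" "set js \<subseteq> J" "set ts \<subseteq> Hom T (length js) 1" "as = map (\<lambda>t. talg_op T A t (map x js)) ts"
  by auto
 obtain t ks where ks: "set ks \<subseteq> J" "t \<in> Hom T (length ks) 1" "a = talg_op T A t (map x ks)"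
  using Cons.prems by (auto elim: generatedE)
 let ?ls = "remdups (ks @ js)"
 have xl: "\<And>i. i \<in> set ?ls ==> x i \<in> Ob A 1"
  using js(2) ks(1) x by (auto simp: image_subset_iff subset_iff)
 have a: "a = talg_op T A (rename_vars T ks ?ls t) (map x ?ls)"
  using ks xl by (subst op_rename_vars) auto
 have "as = map (\<lambda>t. talg_op T A t (map x ?ls)) (map (rename_vars T js ?ls) ts)"
  unfolding js(4) map_map comp_def
 proof (rule map_cong[OF refl])
  fix u assume "u \<in> set ts"
  then show "talg_op T A u (map x js) = talg_op T A (rename_vars T js ?ls u) (map x ?ls)"
   using js xl by (subst op_rename_vars) auto
 qed
 moreover have "set (rename_vars T ks ?ls t # map (rename_vars T js ?ls) ts) \<subseteq> Hom T (length ?ls) 1"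
  using js(3) ks(2) rename_vars_in[of ks ?ls] rename_vars_in[of js ?ls] by auto
 moreover have "distinct ?ls" "set ?ls \<subseteq> J"
  using js ks by auto
 ultimately show ?case
  using a by (intro exI[of _ ?ls] exI[of _ "rename_vars T ks ?ls t # map (rename_vars T js ?ls) ts"]) simp
qed

lemma generated_closed:
 assumes x: "x ` J \<subseteq> Ob A 1"
 shows "op_closed T A (generated T A J x)"
 unfolding op_closed_def
proof (intro conjI allI impI)
 fix as t assume as: "set as \<subseteq> generated T A J x" and t: "t \<in> Hom T (length as) 1"
 obtain js ts where js: "set js \<subseteq> J" "set ts \<subseteq> Hom T (length js) 1" "as = map (\<lambda>t. talg_op T A t (map x js)) ts"
  using generated_common[OF x as] by blast
 have "set (map x js) \<subseteq> Ob A 1"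
  using js(1) x by auto
 then have "talg_op T A t as = talg_op T A (talg_op T (represented T (length js)) t ts) (map x js)"
  using op_tuple[of ts "map x js" t] js(2,3) t by simp
 moreover have "talg_op T (represented T (length js)) t ts \<in> Hom T (length js) 1"
  using talgebra.op_in[OF represented_talgebra, of t ts "length js"] js(2,3) t by simp
 ultimately show "talg_op T A t as \<in> generated T A J x"
  using js(1) by (simp add: generatedI)
qed (rule generated_Ob[OF x])

end

context
 fixes T :: "'t lawvere" and A :: "('t, 'a) talg" and B :: "('t, 'b) talg" and J :: "'j set" and x :: "'j => 'a" and s :: "'j => 'b"
 assumes A: "talgebra T A" and B: "talgebra T B" and free: "free_on T A J x" and s: "s ` J \<subseteq> Ob B 1"
begin

private lemma wd:
 assumes "set js \<subseteq> J" "t \<in> Hom T (length js) 1" "set ks \<subseteq> J" "u \<in> Hom T (length ks) 1"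
  and eq: "talg_op T A t (map x js) = talg_op T A u (map x ks)"
 shows "talg_op T B t (map s js) = talg_op T B u (map s ks)"
proof -
 interpret A: talgebra T A by (rule A)
 interpret B: talgebra T B by (rule B)
 let ?ls = "remdups (js @ ks)"
 have l: "set js \<subseteq> set ?ls" "set ks \<subseteq> set ?ls" "distinct ?ls" "set ?ls \<subseteq> J"
  using assms by auto
 have xs: "\<And>i. i \<in> set ?ls ==> x i \<in> Ob A 1" "\<And>i. i \<in> set ?ls ==> s i \<in> Ob B 1"
  using subsetD[OF l(4)] s free unfolding free_on_def by blast+
 have "talg_op T A (rename_vars T js ?ls t) (map x ?ls) = talg_op T A (rename_vars T ks ?ls u) (map x ?ls)"
  using eq A.op_rename_vars[OF l(1) assms(2) xs(1)] A.op_rename_vars[OF l(2) assms(4) xs(1)] by simp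
 then have "rename_vars T js ?ls t = rename_vars T ks ?ls u"
  using free l(3,4) A.rename_vars_in[OF l(1) assms(2)] A.rename_vars_in[OF l(2) assms(4)] unfolding free_on_def by blast
 then show ?thesis
  using B.op_rename_vars[OF l(1) assms(2) xs(2)] B.op_rename_vars[OF l(2) assms(4) xs(2)] by simp
qed

text \<open>The value of an operation at generators is sent to its value at their prescribed images.
  This is well defined by \<open>wd\<close>: two presentations of an element are given by the same
  arrow once rewritten over a common list without repetition.\<close>

lemma free_on_extend: "\<exists>\<phi>\<in>clone_hom T A B. \<forall>i\<in>J. \<phi> (x i) = s i"
proof -
 interpret A: talgebra T A by (rule A)
 interpret B: talgebra T B by (rule B)
 have x: "x ` J \<subseteq> Ob A 1" and gen: "Ob A 1 \<subseteq> generated T A J x"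
  using free unfolding free_on_def by blast+
 define \<phi> where "\<phi> a = (THE b. \<exists>js t. set js \<subseteq> J \<and> t \<in> Hom T (length js) 1 \<and> a = talg_op T A t (map x js) \<and> b = talg_op T B t (map s js))" for a
 have \<phi>: "\<phi> (talg_op T A t (map x js)) = talg_op T B t (map s js)" if "set js \<subseteq> J" "t \<in> Hom T (length js) 1" for t js
 proof -
  have "\<exists>ks u. set ks \<subseteq> J \<and> u \<in> Hom T (length ks) 1 \<and> talg_op T A t (map x js) = talg_op T A u (map x ks) \<and>
    talg_op T B t (map s js) = talg_op T B u (map s ks)"
   using that by blast
  moreover have "b = talg_op T B t (map s js)" if b: "\<exists>ks u. set ks \<subseteq> J \<and> u \<in> Hom T (length ks) 1 \<and>
   talg_op T A t (map x js) = talg_op T A u (map x ks) \<and> b = talg_op T B u (map s ks)" for b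
   using b wd[OF \<open>set js \<subseteq> J\<close> \<open>t \<in> Hom T (length js) 1\<close>] by auto
  ultimately show ?thesis
   unfolding \<phi>_def by (intro the_equality)
 qed
 have "\<phi> \<in> clone_hom T A B"
 proof (rule clone_homI)
  fix a assume "a \<in> Ob A 1"
  then have "a \<in> generated T A J x"
   using gen by auto
  then obtain t js where "set js \<subseteq> J" "t \<in> Hom T (length js) 1" "a = talg_op T A t (map x js)"
   by (rule generatedE)
  moreover from this have "set (map s js) \<subseteq> Ob B 1"
   using s by auto
  ultimately show "\<phi> a \<in> Ob B 1"
   using B.op_in[of t "map s js"] by (simp add: \<phi>)
 next
  fix t as assume "set as \<subseteq> Ob A 1" and t: "t \<in> Hom T (length as) 1"
  then obtain js ts where js: "set js \<subseteq> J" "set ts \<subseteq> Hom T (length js) 1" "as = map (\<lambda>t. talg_op T A t (map x js)) ts"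
   using A.generated_common[OF x, of as] gen by blast
  have xs: "set (map x js) \<subseteq> Ob A 1" "set (map s js) \<subseteq> Ob B 1"
   using js(1) x s by auto
  have u: "talg_op T (represented T (length js)) t ts \<in> Hom T (length js) 1"
   using talgebra.op_in[OF A.represented_talgebra, of t ts "length js"] js(2,3) t by simp
  have "talg_op T A t as = talg_op T A (talg_op T (represented T (length js)) t ts) (map x js)"
   using A.op_tuple[of ts "map x js" t] js(2,3) t xs by simp
  then have "\<phi> (talg_op T A t as) = talg_op T B (talg_op T (represented T (length js)) t ts) (map s js)"
   using \<phi>[OF js(1) u] by simp
  also have "\<dots> = talg_op T B t (map (\<lambda>f. talg_op T B f (map s js)) ts)"
   using B.op_tuple[of ts "map s js" t] js(2,3) t xs by simp
  also have "map (\<lambda>f. talg_op T B f (map s js)) ts = map \<phi> as"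
   unfolding js(3) map_map comp_def using js(2) by (intro map_cong) (auto simp: \<phi> js(1))
  finally show "\<phi> (talg_op T A t as) = talg_op T B t (map \<phi> as)" .
 qed
 moreover have "\<phi> (x i) = s i" if "i \<in> J" for i
 proof -
  have "talg_op T A (Prj T 1 0) (map x [i]) = x i" "talg_op T B (Prj T 1 0) (map s [i]) = s i"
   using A.op_Prj[of "[x i]" 0] B.op_Prj[of "[s i]" 0] x s that by auto
  then show ?thesis
   using \<phi>[of "[i]" "Prj T 1 0"] that A.Prj_in[of 0 1] by simp
 qed
 ultimately show ?thesis by blast
qed

end

lemma free_onD:
 assumes "free_on T A J x"
 shows "x ` J \<subseteq> Ob A 1" "a \<in> Ob A 1 ==> a \<in> generated T A J x" "i \<in> J ==> x i \<in> Ob A 1"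
 using assms unfolding free_on_def by blast+

lemma free_on_automorphism:
 assumes A: "talgebra T A" and free: "free_on T A J x"
  and \<alpha>: "\<alpha> \<in> clone_hom T A A" "\<And>i. i \<in> J ==> \<alpha> (x i) = y i"
  and \<beta>: "\<beta> \<in> clone_hom T A A" "\<And>a. a \<in> Ob A 1 ==> \<beta> (\<alpha> a) = a" "\<And>a. a \<in> Ob A 1 ==> \<alpha> (\<beta> a) = a"
 shows "free_on T A J y"
proof -
 interpret A: talgebra T A by (rule A)
 note x = free_onD[OF free]
 have y: "y ` J \<subseteq> Ob A 1"
  using clone_hom_in[OF \<alpha>(1) x(3)] \<alpha>(2) by auto
 have \<alpha>op: "\<alpha> (talg_op T A t (map x js)) = talg_op T A t (map y js)" if "set js \<subseteq> J" "t \<in> Hom T (length js) 1" for t js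
 proof -
  have "set (map x js) \<subseteq> Ob A 1" "map \<alpha> (map x js) = map y js"
   using that(1) x(1) \<alpha>(2) by auto
  then show ?thesis
   using clone_hom_op[OF \<alpha>(1), of "map x js" t] that(2) by (simp del: map_map map_eq_conv list.map_comp)
 qed
 show ?thesis
  unfolding free_on_def
 proof (intro conjI allI impI y subsetI)
  fix a assume a: "a \<in> Ob A 1"
  obtain t js where "set js \<subseteq> J" "t \<in> Hom T (length js) 1" "\<beta> a = talg_op T A t (map x js)"
   using x(2)[OF clone_hom_in[OF \<beta>(1) a]] by (rule generatedE)
  then show "a \<in> generated T A J y"
   using \<alpha>op[of js t] \<beta>(3)[OF a] generatedI[of js J t T A y] by simp
 next
  fix js t t'
  assume js: "distinct js" "set js \<subseteq> J" and t: "t \<in> Hom T (length js) 1" "t' \<in> Hom T (length js) 1"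
   and eq: "talg_op T A t (map y js) = talg_op T A t' (map y js)"
  have "set (map x js) \<subseteq> Ob A 1"
   using js(2) x(1) by auto
  then have "talg_op T A t (map x js) \<in> Ob A 1" "talg_op T A t' (map x js) \<in> Ob A 1"
   using t A.op_in[of _ "map x js"] by simp_all
  then have "talg_op T A t (map x js) = talg_op T A t' (map x js)"
   using eq \<alpha>op[OF js(2) t(1)] \<alpha>op[OF js(2) t(2)] \<beta>(2) by metis
  then show "t = t'"
   using free js t unfolding free_on_def by blast
 qed
qed

section \<open>Consequences of the Fermat property\<close>

declare Suc_eq_plus1 [symmetric, simp] upt_Suc [simp del]

lemma (in com_theory) clone_hom_minus:
 assumes "talgebra T A" "talgebra T B" "\<phi> \<in> clone_hom T A B" "a \<in> Ob A 1" "b \<in> Ob A 1"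
 shows "a \<ominus>\<^bsub>U A\<^esub> b \<in> Ob A 1" "\<phi> (a \<ominus>\<^bsub>U A\<^esub> b) = \<phi> a \<ominus>\<^bsub>U B\<^esub> \<phi> b"
proof -
 interpret UA: cring "U A" by (rule underlying_cring[OF assms(1)])
 interpret UB: cring "U B" by (rule underlying_cring[OF assms(2)])
 interpret h: ring_hom_ring "U A" "U B" \<phi>
  by (rule ring_hom_ringI2[OF UA.ring_axioms UB.ring_axioms clone_hom_ring_hom[OF assms(3)]])
 have c: "a \<in> carrier (U A)" "b \<in> carrier (U A)"
  using assms by (simp_all add: underlying_simps)
 show "\<phi> (a \<ominus>\<^bsub>U A\<^esub> b) = \<phi> a \<ominus>\<^bsub>U B\<^esub> \<phi> b"
  using c by (simp add: UA.minus_eq UB.minus_eq)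
 show "a \<ominus>\<^bsub>U A\<^esub> b \<in> Ob A 1"
  using UA.minus_closed[OF c] by (simp add: underlying_simps)
qed

context fermat_theory
begin

sublocale Z: com_theory \<Z> T \<iota>
 by unfold_locales

lemma fermat_arrow:
 assumes f: "f \<in> Hom T (Suc m) 1"
 defines "B \<equiv> represented T (Suc (Suc m))"
 defines "l1 \<equiv> Prj T (Suc (Suc m)) 0" and "l2 \<equiv> Prj T (Suc (Suc m)) 1" and "s \<equiv> map (Prj T (Suc (Suc m))) [2..<Suc (Suc m)]"
 shows "\<exists>!g. g \<in> Hom T (Suc (Suc m)) 1 \<and>
  talg_op T B f (l1 # s) \<ominus>\<^bsub>Z.U B\<^esub> talg_op T B f (l2 # s) = (l1 \<ominus>\<^bsub>Z.U B\<^esub> l2) \<otimes>\<^bsub>Z.U B\<^esub> g"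
proof -
 have B: "talgebra T B"
  unfolding B_def by (rule T.represented_talgebra)
 have l: "l1 \<in> Ob B 1" "l2 \<in> Ob B 1" "set s \<subseteq> Ob B 1" "length s = m"
  by (auto simp: B_def l1_def l2_def s_def intro: T.Prj_in)
 have op: "talg_op T B f (l # s) \<in> Hom T (Suc (Suc m)) 1" if "l \<in> Ob B 1" for l
  using talgebra.op_in[OF B, of f "l # s"] f l that by (simp add: B_def)
 have P: "Cmp T (Prj T 1 0) g = g" if "g \<in> Hom T (Suc (Suc m)) 1" for g
  using that by (simp add: T.Prj_1 T.Idn_left)
 have "(\<forall>j<1. Cmp T (Prj T 1 j) (Cmp T f (tuple T B (l1 # s))) \<ominus>\<^bsub>Z.U B\<^esub> Cmp T (Prj T 1 j) (Cmp T f (tuple T B (l2 # s))) =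
   (l1 \<ominus>\<^bsub>Z.U B\<^esub> l2) \<otimes>\<^bsub>Z.U B\<^esub> Cmp T (Prj T 1 j) g) \<longleftrightarrow>
   talg_op T B f (l1 # s) \<ominus>\<^bsub>Z.U B\<^esub> talg_op T B f (l2 # s) = (l1 \<ominus>\<^bsub>Z.U B\<^esub> l2) \<otimes>\<^bsub>Z.U B\<^esub> g"
  if "g \<in> Hom T (Suc (Suc m)) 1" for g
  using that op[OF l(1)] op[OF l(2)] by (simp add: P B_def op_represented)
 then show ?thesis
  using fermat[OF f] unfolding Let_def B_def l1_def l2_def s_def by (simp cong: conj_cong)
qed

text \<open>The Fermat property is stated for arrows, that is, in a represented algebra. Evaluation
  of arrows at \<open>y # z # ys\<close> is a homomorphism and carries the identity to any
  algebra.\<close>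

lemma hadamard:
 assumes A: "talgebra T A" and f: "f \<in> Hom T (Suc (length ys)) 1" and ys: "y \<in> Ob A 1" "z \<in> Ob A 1" "set ys \<subseteq> Ob A 1"
 shows "\<exists>g\<in>Ob A 1. talg_op T A f (y # ys) \<ominus>\<^bsub>Z.U A\<^esub> talg_op T A f (z # ys) = (y \<ominus>\<^bsub>Z.U A\<^esub> z) \<otimes>\<^bsub>Z.U A\<^esub> g"
proof -
 interpret A: talgebra T A by (rule A)
 let ?m = "length ys"
 define B where "B = represented T (Suc (Suc ?m))"
 let ?l1 = "Prj T (Suc (Suc ?m)) 0" and ?l2 = "Prj T (Suc (Suc ?m)) 1" and ?s = "map (Prj T (Suc (Suc ?m))) [2..<Suc (Suc ?m)]"
 let ?d = "?l1 \<ominus>\<^bsub>Z.U B\<^esub> ?l2"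
 have B: "talgebra T B"
  unfolding B_def by (rule T.represented_talgebra)
 obtain g where g: "g \<in> Ob B 1" "talg_op T B f (?l1 # ?s) \<ominus>\<^bsub>Z.U B\<^esub> talg_op T B f (?l2 # ?s) = ?d \<otimes>\<^bsub>Z.U B\<^esub> g"
  using fermat_arrow[OF f] unfolding B_def by auto
 define xs where "xs = y # z # ys"
 define \<phi> where "\<phi> = (\<lambda>f. talg_op T A f xs)"
 have xs: "set xs \<subseteq> Ob A 1" "length xs = Suc (Suc ?m)"
  using ys by (auto simp: xs_def)
 have \<phi>: "\<phi> \<in> clone_hom T B A"
  using A.eval_clone_hom[OF xs(1)] by (simp add: \<phi>_def B_def xs(2))
 interpret UA: cring "Z.U A" by (rule Z.underlying_cring[OF A])
 interpret UB: cring "Z.U B" by (rule Z.underlying_cring[OF B])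
 have P: "\<phi> (Prj T (Suc (Suc ?m)) i) = xs ! i" if "i < Suc (Suc ?m)" for i
  using A.op_Prj[OF xs(1), of i] that by (simp add: \<phi>_def xs(2))
 have s: "map \<phi> ?s = ys"
  by (rule nth_equalityI) (auto simp: P xs_def nth_Cons' simp flip: Suc_1)
 have l: "?l1 \<in> Ob B 1" "?l2 \<in> Ob B 1" "set ?s \<subseteq> Ob B 1"
  by (auto simp: B_def intro: T.Prj_in)
 have op: "\<phi> (talg_op T B f (l # ?s)) = talg_op T A f (\<phi> l # ys)" if "l \<in> Ob B 1" for l
  using clone_hom_op[OF \<phi>, of "l # ?s" f] that f l by (simp only: list.map s) simp
 have opB: "talg_op T B f (l # ?s) \<in> Ob B 1" if "l \<in> Ob B 1" for l
  using talgebra.op_in[OF B, of f "l # ?s"] that f l by simp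
 have c: "carrier (Z.U B) = Ob B 1" "carrier (Z.U A) = Ob A 1"
  by (simp_all add: Z.underlying_simps)
 have "\<phi> (talg_op T B f (?l1 # ?s) \<ominus>\<^bsub>Z.U B\<^esub> talg_op T B f (?l2 # ?s)) = \<phi> (?d \<otimes>\<^bsub>Z.U B\<^esub> g)"
  using g(2) by simp
 then have "\<phi> (talg_op T B f (?l1 # ?s)) \<ominus>\<^bsub>Z.U A\<^esub> \<phi> (talg_op T B f (?l2 # ?s)) = (\<phi> ?l1 \<ominus>\<^bsub>Z.U A\<^esub> \<phi> ?l2) \<otimes>\<^bsub>Z.U A\<^esub> \<phi> g"
  using l(1,2) g(1) opB[OF l(1)] opB[OF l(2)] by (simp add: Z.clone_hom_minus[OF B A \<phi>] Z.clone_hom_ops(2)[OF \<phi>])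
 moreover have "\<phi> ?l1 = y" "\<phi> ?l2 = z"
  using P[of 0] P[of 1] by (simp_all add: xs_def)
 ultimately show ?thesis
  using op[OF l(1)] op[OF l(2)] clone_hom_in[OF \<phi> g(1)] by auto
qed

text \<open>Uniqueness of the Fermat quotient, applied to the zero arrow. For d = l1 - l2 the
  assumption makes the product of d and t(d, s) vanish, so t(d, s) and 0 are both quotients of the
  zero difference and coincide. Setting l2 to 0 then recovers \<open>t\<close>.\<close>

lemma Prj_regular:
 assumes t: "t \<in> Hom T (Suc m) 1"
  and eq: "Prj T (Suc m) 0 \<otimes>\<^bsub>Z.U (represented T (Suc m))\<^esub> t = \<zero>\<^bsub>Z.U (represented T (Suc m))\<^esub>"
 shows "t = \<zero>\<^bsub>Z.U (represented T (Suc m))\<^esub>"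
proof -
 define B0 where "B0 = represented T (Suc m)"
 define B where "B = represented T (Suc (Suc m))"
 let ?l1 = "Prj T (Suc (Suc m)) 0" and ?l2 = "Prj T (Suc (Suc m)) 1" and ?s = "map (Prj T (Suc (Suc m))) [2..<Suc (Suc m)]"
 let ?d = "?l1 \<ominus>\<^bsub>Z.U B\<^esub> ?l2"
 have B0: "talgebra T B0" and B: "talgebra T B"
  unfolding B0_def B_def by (rule T.represented_talgebra)+
 interpret UB0: cring "Z.U B0" by (rule Z.underlying_cring[OF B0])
 interpret UB: cring "Z.U B" by (rule Z.underlying_cring[OF B])
 have c: "carrier (Z.U B) = Ob B 1" "carrier (Z.U B0) = Ob B0 1"
  by (simp_all add: Z.underlying_simps)
 have zero: "\<zero>\<^bsub>Z.U B0\<^esub> \<in> Hom T (Suc m) 1"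
  using UB0.zero_closed unfolding c by (simp add: B0_def)
 have l: "?l1 \<in> Ob B 1" "?l2 \<in> Ob B 1" "set ?s \<subseteq> Ob B 1" "length ?s = m"
  by (auto simp: B_def intro: T.Prj_in)
 have d: "?d \<in> Ob B 1"
  using l UB.minus_closed[of ?l1 ?l2] unfolding c by simp
 have ev: "(\<lambda>f. talg_op T B f (y # ?s)) \<in> clone_hom T B0 B" if "y \<in> Ob B 1" for y
  using talgebra.eval_clone_hom[OF B, of "y # ?s"] that l by (simp add: B0_def)
 have ev0: "talg_op T B \<zero>\<^bsub>Z.U B0\<^esub> (y # ?s) = \<zero>\<^bsub>Z.U B\<^esub>" if "y \<in> Ob B 1" for y
  using Z.clone_hom_ops(3)[OF ev[OF that]] .
 define G where "G = talg_op T B t (?d # ?s)"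
 have G: "G \<in> Ob B 1"
  unfolding G_def using t d l by (intro talgebra.op_in[OF B]) auto
 have "?d \<otimes>\<^bsub>Z.U B\<^esub> G = \<zero>\<^bsub>Z.U B\<^esub>"
 proof -
  have "talg_op T B (Prj T (Suc m) 0) (?d # ?s) = ?d"
   using talgebra.op_Prj[OF B, of "?d # ?s" 0] d l by simp
  then show ?thesis
   using Z.clone_hom_ops(2)[OF ev[OF d], of "Prj T (Suc m) 0" t] ev0[OF d] eq t T.Prj_in[of 0 "Suc m"]
   by (simp add: B0_def G_def)
 qed
 moreover have "talg_op T B \<zero>\<^bsub>Z.U B0\<^esub> (?l1 # ?s) \<ominus>\<^bsub>Z.U B\<^esub> talg_op T B \<zero>\<^bsub>Z.U B0\<^esub> (?l2 # ?s) = \<zero>\<^bsub>Z.U B\<^esub>"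
  using l by (simp only: ev0) (simp add: UB.minus_eq)
 moreover have "?d \<otimes>\<^bsub>Z.U B\<^esub> \<zero>\<^bsub>Z.U B\<^esub> = \<zero>\<^bsub>Z.U B\<^esub>"
  using d by (simp add: c)
 moreover have "\<zero>\<^bsub>Z.U B\<^esub> \<in> Ob B 1"
  using UB.zero_closed unfolding c .
 ultimately have G0: "G = \<zero>\<^bsub>Z.U B\<^esub>"
  using fermat_arrow[OF zero, folded B_def] G unfolding B_def[symmetric] by (metis B_def represented_simps(1))
 \<comment> \<open>Evaluation here sends \<open>?l2\<close> to 0, \<open>?l1\<close> to the first
   projection and the parameters to the remaining ones, so that \<open>?d\<close> becomes the first
   projection.\<close>
 let ?vs = "Prj T (Suc m) 0 # \<zero>\<^bsub>Z.U B0\<^esub> # map (Prj T (Suc m)) [1..<Suc m]"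
 define \<psi> where "\<psi> = (\<lambda>f. talg_op T B0 f ?vs)"
 have vs: "set ?vs \<subseteq> Ob B0 1" "length ?vs = Suc (Suc m)"
  using zero by (auto simp: B0_def intro: T.Prj_in)
 have \<psi>: "\<psi> \<in> clone_hom T B B0"
  using talgebra.eval_clone_hom[OF B0 vs(1)] unfolding \<psi>_def vs(2) B_def .
 have P: "\<psi> (Prj T (Suc (Suc m)) i) = ?vs ! i" if "i < Suc (Suc m)" for i
  using talgebra.op_Prj[OF B0 vs(1), of i] that unfolding vs(2) \<psi>_def by simp
 have p0: "Prj T (Suc m) 0 \<in> carrier (Z.U B0)"
  unfolding c using T.Prj_in[of 0 "Suc m"] by (simp add: B0_def)
 have "map \<psi> ?s = map (Prj T (Suc m)) [1..<Suc m]"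
  by (rule nth_equalityI) (auto simp: P nth_Cons' simp flip: Suc_1)
 moreover have "\<psi> ?d = Prj T (Suc m) 0"
  using l P[of 0] P[of 1] p0 by (simp add: Z.clone_hom_minus[OF B B0 \<psi>]) (simp add: UB0.minus_eq)
 ultimately have "map \<psi> (?d # ?s) = map (Prj T (Suc m)) [0..<Suc m]"
  by (simp add: upt_conv_Cons del: upt_Suc)
 then have "\<psi> G = talg_op T B0 t (map (Prj T (Suc m)) [0..<Suc m])"
  using clone_hom_op[OF \<psi>, of "?d # ?s" t] d l t by (simp add: G_def)
 also have "\<dots> = t"
  using t T.Idn_right[OF t] T.tuple_Prjs[of "Suc m"] by (simp add: B0_def op_represented)
 finally show ?thesis
  using G0 Z.clone_hom_ops(3)[OF \<psi>] by (simp add: B0_def)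
qed

end

context fermat_theory_over
begin

sublocale com_theory R T \<kappa>
 by unfold_locales

lemma Com_base_1: "Com_base R m 1 [Z.V 0 \<oplus>\<^bsub>Z.MP\<^esub> Z.V 1] = [V 0 [+] V 1]" (is ?add)
 "Com_base R m 1 [Z.V 0 \<otimes>\<^bsub>Z.MP\<^esub> Z.V 1] = [V 0 [*] V 1]" (is ?mult)
 "Com_base R m 1 [\<zero>\<^bsub>Z.MP\<^esub>] = [\<zero>\<^bsub>MP\<^esub>]" (is ?zero) "Com_base R m 1 [\<one>\<^bsub>Z.MP\<^esub>] = [\<one>\<^bsub>MP\<^esub>]" (is ?one)
proof -
 have int_mult: "add_pow R (0::int) \<one>\<^bsub>R\<^esub> = \<zero>\<^bsub>R\<^esub>" "add_pow R (1::int) \<one>\<^bsub>R\<^esub> = \<one>\<^bsub>R\<^esub>"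
  by (simp_all add: add_pow_def int_pow_def2 One_nat_def del: One_nat_def[symmetric])
 have "Z.V 0 \<oplus>\<^bsub>Z.MP\<^esub> Z.V 1 = (\<lambda>M. if M = {#0#} \<or> M = {#1#} then 1 else 0)"
  by (auto simp: Z.R.mpoly_add Z.R.var_monomial Z.R.monomial_def fun_eq_iff)
 moreover have "V 0 [+] V 1 = (\<lambda>M. if M = {#0#} \<or> M = {#1#} then \<one>\<^bsub>R\<^esub> else \<zero>\<^bsub>R\<^esub>)"
  by (auto simp: R.mpoly_add R.var_monomial R.monomial_def fun_eq_iff)
 ultimately show ?add
  by (auto simp: Com_base_def fun_eq_iff int_mult)
 show ?mult ?zero ?one
  by (auto simp: int_mult Com_base_def fun_eq_iff Z.R.var_mult_var R.var_mult_var Z.R.monomial_def R.monomial_def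
  Z.zero_K zero_K Z.one_K one_K Z.R.const_monomial R.const_monomial)
qed

text \<open>The Fermat property speaks of the ring structure obtained through
  \<open>\<iota>\<close>, the rest of the argument of the one through \<open>\<kappa>\<close>. The
  factorisation of \<open>\<iota>\<close> identifies them.\<close>

lemma underlying_base:
 assumes "talgebra T A"
 shows "a \<oplus>\<^bsub>Z.U A\<^esub> b = a \<oplus>\<^bsub>U A\<^esub> b" "a \<otimes>\<^bsub>Z.U A\<^esub> b = a \<otimes>\<^bsub>U A\<^esub> b"
  "\<zero>\<^bsub>Z.U A\<^esub> = \<zero>\<^bsub>U A\<^esub>" "\<one>\<^bsub>Z.U A\<^esub> = \<one>\<^bsub>U A\<^esub>"
  "\<ominus>\<^bsub>Z.U A\<^esub> a = \<ominus>\<^bsub>U A\<^esub> a" "a \<ominus>\<^bsub>Z.U A\<^esub> b = a \<ominus>\<^bsub>U A\<^esub> b"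
proof -
 have \<iota>: "\<iota> m 1 [p] = \<kappa> m 1 (Com_base R m 1 [p])" if "p \<in> Z.pset m" for p m
  using that by (intro factorization) (simp add: Z.Com_simps)
 have \<iota>1: "\<iota> 2 1 [Z.V 0 \<oplus>\<^bsub>Z.MP\<^esub> Z.V 1] = \<kappa> 2 1 [V 0 [+] V 1]"
  "\<iota> 2 1 [Z.V 0 \<otimes>\<^bsub>Z.MP\<^esub> Z.V 1] = \<kappa> 2 1 [V 0 [*] V 1]"
  using \<iota>[OF Z.pset_intros(3)[OF Z.pset_intros(1)[of 0 2] Z.pset_intros(1)[of 1 2]]]
   \<iota>[OF Z.pset_intros(4)[OF Z.pset_intros(1)[of 0 2] Z.pset_intros(1)[of 1 2]]] by (simp_all add: Com_base_1)
 have \<iota>0: "\<iota> 0 1 [\<zero>\<^bsub>Z.MP\<^esub>] = \<kappa> 0 1 [\<zero>\<^bsub>MP\<^esub>]" "\<iota> 0 1 [\<one>\<^bsub>Z.MP\<^esub>] = \<kappa> 0 1 [\<one>\<^bsub>MP\<^esub>]"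
  using \<iota>[of "\<zero>\<^bsub>Z.MP\<^esub>" 0] \<iota>[of "\<one>\<^bsub>Z.MP\<^esub>" 0] Z.R.pset_const
  unfolding Com_base_1 unfolding Z.zero_K Z.one_K by auto
 show add: "a \<oplus>\<^bsub>Z.U A\<^esub> b = a \<oplus>\<^bsub>U A\<^esub> b" for a b
  by (simp add: underlying_simps Z.underlying_simps ev_def Z.ev_def \<iota>1)
 show "a \<otimes>\<^bsub>Z.U A\<^esub> b = a \<otimes>\<^bsub>U A\<^esub> b"
  by (simp add: underlying_simps Z.underlying_simps ev_def Z.ev_def \<iota>1)
 show zero: "\<zero>\<^bsub>Z.U A\<^esub> = \<zero>\<^bsub>U A\<^esub>" and "\<one>\<^bsub>Z.U A\<^esub> = \<one>\<^bsub>U A\<^esub>"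
  by (simp_all add: underlying_simps Z.underlying_simps ev_def Z.ev_def \<iota>0)
 show inv: "\<ominus>\<^bsub>Z.U A\<^esub> a = \<ominus>\<^bsub>U A\<^esub> a" for a
  by (simp add: a_inv_def m_inv_def add zero underlying_simps(1) Z.underlying_simps(1))
 show "a \<ominus>\<^bsub>Z.U A\<^esub> b = a \<ominus>\<^bsub>U A\<^esub> b"
  unfolding a_minus_def inv add ..
qed

text \<open>Hadamard's lemma with 0 as second point. The generator \<open>x c\<close> has to be the
  first argument and to occur once, so all its occurrences in a presentation of \<open>f\<close> are
  merged by renaming; \<open>\<phi> f\<close> is then the value at 0.\<close>

lemma free_factor:
 assumes A: "talgebra T A" and free: "free_on T A J x" and c: "c \<in> J"
  and \<phi>: "\<phi> \<in> clone_hom T A A" "\<phi> (x c) = \<zero>\<^bsub>U A\<^esub>" "\<And>i. i \<in> J ==> i \<noteq> c ==> \<phi> (x i) = x i"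
  and f: "f \<in> Ob A 1"
 shows "\<exists>g\<in>Ob A 1. f = \<phi> f \<oplus>\<^bsub>U A\<^esub> x c \<otimes>\<^bsub>U A\<^esub> g"
proof -
 interpret A: talgebra T A by (rule A)
 interpret UA: cring "U A" by (rule underlying_cring[OF A])
 note x = free_onD[OF free]
 have carr: "carrier (U A) = Ob A 1"
  by (simp add: underlying_simps)
 obtain t js where js: "set js \<subseteq> J" "t \<in> Hom T (length js) 1" "f = talg_op T A t (map x js)"
  using x(2)[OF f] by (rule generatedE)
 define ks where "ks = filter (\<lambda>i. i \<noteq> c) js"
 define u where "u = rename_vars T js (c # ks) t"
 have k: "set js \<subseteq> set (c # ks)" "set ks \<subseteq> J - {c}" "\<And>i. i \<in> set (c # ks) ==> x i \<in> Ob A 1"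
  using js(1) x(3) c by (auto simp: ks_def)
 have u: "u \<in> Hom T (Suc (length (map x ks))) 1"
  using T.rename_vars_in[OF k(1) js(2)] by (simp add: u_def)
 have fu: "f = talg_op T A u (x c # map x ks)"
  using A.op_rename_vars[of js "c # ks" t x, OF k(1) js(2) k(3)] js(3) by (simp add: u_def)
 have xs: "set (x c # map x ks) \<subseteq> Ob A 1"
  using k(3) by auto
 have "map \<phi> (map x ks) = map x ks"
  using \<phi>(3) k(2) by auto
 then have \<phi>f: "\<phi> f = talg_op T A u (\<zero>\<^bsub>U A\<^esub> # map x ks)"
  using clone_hom_op[OF \<phi>(1) xs, of u] u \<phi>(2) by (simp add: fu del: map_map map_eq_conv list.map_comp)
 have zero: "\<zero>\<^bsub>U A\<^esub> \<in> Ob A 1"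
  using UA.zero_closed carr by simp
 obtain g where g: "g \<in> Ob A 1" "f \<ominus>\<^bsub>U A\<^esub> \<phi> f = (x c \<ominus>\<^bsub>U A\<^esub> \<zero>\<^bsub>U A\<^esub>) \<otimes>\<^bsub>U A\<^esub> g"
  using hadamard[OF A u, of "x c" "\<zero>\<^bsub>U A\<^esub>"] xs zero unfolding underlying_base[OF A] fu[symmetric] \<phi>f[symmetric] by auto
 then have "f \<ominus>\<^bsub>U A\<^esub> \<phi> f = x c \<otimes>\<^bsub>U A\<^esub> g"
  using x(3)[OF c] by (simp add: UA.minus_eq carr)
 moreover have "f = \<phi> f \<oplus>\<^bsub>U A\<^esub> (f \<ominus>\<^bsub>U A\<^esub> \<phi> f)"
  using f clone_hom_in[OF \<phi>(1) f] unfolding carr[symmetric] by (simp add: UA.minus_eq UA.a_lcomm[of "\<phi> f"] UA.r_neg)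
 ultimately show ?thesis
  using g(1) by auto
qed

text \<open>Independence turns the equation between elements into one between arrows with
  \<open>c\<close> as first variable, where \<open>Prj_regular\<close> applies.\<close>

lemma free_regular:
 assumes A: "talgebra T A" and free: "free_on T A J x" and c: "c \<in> J"
  and g: "g \<in> Ob A 1" and eq: "x c \<otimes>\<^bsub>U A\<^esub> g = \<zero>\<^bsub>U A\<^esub>"
 shows "g = \<zero>\<^bsub>U A\<^esub>"
proof -
 interpret A: talgebra T A by (rule A)
 note x = free_onD[OF free]
 obtain t js where js: "set js \<subseteq> J" "t \<in> Hom T (length js) 1" "g = talg_op T A t (map x js)"
  using x(2)[OF g] by (rule generatedE)
 define ks where "ks = remdups (filter (\<lambda>i. i \<noteq> c) js)"
 define u where "u = rename_vars T js (c # ks) t"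
 have k: "set js \<subseteq> set (c # ks)" "distinct (c # ks)" "set (c # ks) \<subseteq> J" "\<And>i. i \<in> set (c # ks) ==> x i \<in> Ob A 1"
  using js(1) x(3) c by (auto simp: ks_def)
 have u: "u \<in> Hom T (Suc (length ks)) 1"
  using T.rename_vars_in[OF k(1) js(2)] by (simp add: u_def)
 have gu: "g = talg_op T A u (map x (c # ks))"
  using A.op_rename_vars[of js "c # ks" t x, OF k(1) js(2) k(4)] js(3) by (simp add: u_def)
 have xs: "set (map x (c # ks)) \<subseteq> Ob A 1" "length (map x (c # ks)) = Suc (length ks)"
  using k(4) by auto
 let ?B = "represented T (Suc (length ks))"
 have B: "talgebra T ?B" by (rule T.represented_talgebra)
 interpret UB: cring "U ?B" by (rule underlying_cring[OF B])
 have carr: "carrier (U ?B) = Hom T (Suc (length ks)) 1"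
  by (simp add: underlying_simps)
 have \<phi>: "(\<lambda>f. talg_op T A f (map x (c # ks))) \<in> clone_hom T ?B A"
  using A.eval_clone_hom[OF xs(1)] unfolding xs(2) .
 have p: "Prj T (Suc (length ks)) 0 \<in> Hom T (Suc (length ks)) 1"
  by (rule T.Prj_in) simp
 have pc: "talg_op T A (Prj T (Suc (length ks)) 0) (map x (c # ks)) = x c"
  using A.op_Prj[OF xs(1), of 0] by simp
 have "talg_op T A (Prj T (Suc (length ks)) 0 \<otimes>\<^bsub>U ?B\<^esub> u) (map x (c # ks)) = talg_op T A \<zero>\<^bsub>U ?B\<^esub> (map x (c # ks))"
  using clone_hom_ops(2)[OF \<phi>, of "Prj T (Suc (length ks)) 0" u] clone_hom_ops(3)[OF \<phi>] p u eq
  unfolding represented_simps pc gu[symmetric] by simp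
 moreover have "Prj T (Suc (length ks)) 0 \<otimes>\<^bsub>U ?B\<^esub> u \<in> Hom T (length (c # ks)) 1" "\<zero>\<^bsub>U ?B\<^esub> \<in> Hom T (length (c # ks)) 1"
  using UB.m_closed[of "Prj T (Suc (length ks)) 0" u] UB.zero_closed p u unfolding carr by simp_all
 ultimately have "Prj T (Suc (length ks)) 0 \<otimes>\<^bsub>U ?B\<^esub> u = \<zero>\<^bsub>U ?B\<^esub>"
  using free k(2,3) unfolding free_on_def by blast
 then have "u = \<zero>\<^bsub>U ?B\<^esub>"
  using Prj_regular[OF u] unfolding underlying_base[OF B] by blast
 then show ?thesis
  using clone_hom_ops(3)[OF \<phi>] gu by simp
qed

end

section \<open>Free algebras on reduced chains\<close>

lemma talg_id_hom: "talgebra T A ==> (\<lambda>n. restrict id (Ob A n)) \<in> talg_hom T A A"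
 by (rule talg_homI) (auto simp: talgebra.Act_in)

lemma transport_talg_inverse:
 assumes "talgebra T A" "\<And>n. inj_on (j n) (Ob A n)" "h \<in> talg_hom T E A"
 shows "talg_comp E (transport_from j A) (talg_comp E (transport_to j A) h) = h"
proof (intro ext)
 fix n x show "talg_comp E (transport_from j A) (talg_comp E (transport_to j A) h) n x = h n x"
  using talg_hom_in[OF assms(3), of x n] talg_hom_undef[OF assms(3), of x n] assms(2) by (cases "x \<in> Ob E n") (auto simp: talg_comp_def compose_def)
qed

lemma ex1_unique: "\<exists>!x. P x ==> P a ==> P b ==> a = b"
 by blast

text \<open>\<open>P\<close> will be a universal property for an arbitrary target and
  \<open>Q\<close> the same property for a copy of the target in the test type.\<close>

lemma ex1_retract: "\<exists>!y. Q y ==> (\<And>y. Q y ==> P (g y)) ==> (\<And>x. P x ==> Q (f x) \<and> g (f x) = x) ==> \<exists>!x. P x"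
 by metis

lemma sub_talg_op:
 assumes A: "talgebra T A" and G: "op_closed T A G" and xs: "set xs \<subseteq> G" and t: "t \<in> Hom T (length xs) 1"
 shows "talg_op T (sub_talg T A G) t xs = talg_op T A t xs"
proof -
 let ?S = "sub_talg T A G"
 have S: "talgebra T ?S"
  by (rule sub_talg_algebra[OF A G])
 let ?h = "\<lambda>n. restrict id (Ob ?S n)"
 have h: "?h \<in> talg_hom T ?S A"
  by (rule sub_talg_incl[OF talg_id_hom[OF S]])
 have S1: "Ob ?S 1 = G"
  by (rule sub_talg_1[OF A G])
 have "?h 1 (talg_op T ?S t xs) = talg_op T A t (map (?h 1) xs)"
  using clone_hom_op[OF talg_hom_clone[OF S A h]] xs t unfolding S1 by blast
 moreover have "map (?h 1) xs = xs"
  using xs by (intro map_idI) (auto simp: S1)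
 moreover have "talg_op T ?S t xs \<in> G"
  using talgebra.op_in[OF S t] xs unfolding S1 by blast
 ultimately show ?thesis
  by (simp add: S1)
qed

lemma mod_homD:
 assumes "\<phi> \<in> mod_hom R M N"
 shows "x \<in> carrier M ==> \<phi> x \<in> carrier N"
  "x \<in> carrier M ==> y \<in> carrier M ==> \<phi> (x \<oplus>\<^bsub>M\<^esub> y) = \<phi> x \<oplus>\<^bsub>N\<^esub> \<phi> y"
  "r \<in> carrier R ==> x \<in> carrier M ==> \<phi> (r \<odot>\<^bsub>M\<^esub> x) = r \<odot>\<^bsub>N\<^esub> \<phi> x"
 using assms by (auto simp: mod_hom_def)

lemma mod_homI:
 assumes "\<And>x. x \<in> carrier M ==> \<phi> x \<in> carrier N" "\<And>x. x \<notin> carrier M ==> \<phi> x = undefined"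
  "\<And>x y. x \<in> carrier M ==> y \<in> carrier M ==> \<phi> (x \<oplus>\<^bsub>M\<^esub> y) = \<phi> x \<oplus>\<^bsub>N\<^esub> \<phi> y"
  "\<And>r x. r \<in> carrier R ==> x \<in> carrier M ==> \<phi> (r \<odot>\<^bsub>M\<^esub> x) = r \<odot>\<^bsub>N\<^esub> \<phi> x"
 shows "\<phi> \<in> mod_hom R M N"
 using assms by (auto simp: mod_hom_def PiE_iff extensional_def)

lemma mod_hom_comp:
 assumes M: "module R M" and \<phi>: "\<phi> \<in> mod_hom R M N"
  and \<psi>: "\<And>x. x \<in> carrier N ==> \<psi> x \<in> carrier P"
  "\<And>x y. x \<in> carrier N ==> y \<in> carrier N ==> \<psi> (x \<oplus>\<^bsub>N\<^esub> y) = \<psi> x \<oplus>\<^bsub>P\<^esub> \<psi> y"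
  "\<And>r x. r \<in> carrier R ==> x \<in> carrier N ==> \<psi> (r \<odot>\<^bsub>N\<^esub> x) = r \<odot>\<^bsub>P\<^esub> \<psi> x"
 shows "(\<lambda>x\<in>carrier M. \<psi> (\<phi> x)) \<in> mod_hom R M P"
proof -
 interpret M: module R M by (rule M)
 show ?thesis
  by (rule mod_homI) (auto simp: mod_homD[OF \<phi>] \<psi>)
qed

locale free_theory = com_theory R T \<kappa> + free_functor R T \<kappa> F \<eta>
 for R :: "('r, 'z) ring_scheme" and T :: "'t lawvere" and \<kappa>
  and F :: "('r, 'm) module => ('t, 'f) talg" and \<eta> :: "('r, 'm) module => 'm => 'f"
begin

lemma clone_hom_mod_hom:
 assumes "module R M" "\<phi> \<in> mod_hom R M (U A)" "\<psi> \<in> clone_hom T A B"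
 shows "(\<lambda>x\<in>carrier M. \<psi> (\<phi> x)) \<in> mod_hom R M (U B)"
 by (rule mod_hom_comp[OF assms(1,2)]) (auto simp: underlying_simps(1) clone_hom_in[OF assms(3)] clone_hom_ops[OF assms(3)])

lemma universal_embedded:
 fixes B :: "('t, 'b) talg" and j :: "nat => 'b => 't \<times> ('m + 'f) list"
 assumes M: "module R M" and B: "talgebra T B" and inj: "\<And>n. inj_on (j n) (Ob B n)" and \<phi>: "\<phi> \<in> mod_hom R M (U B)"
 shows "\<exists>!h. h \<in> talg_hom T (F M) B \<and> (\<forall>x\<in>carrier M. h 1 (\<eta> M x) = \<phi> x)"
proof (rule ex1_retract)
 let ?to = "transport_to j B" and ?from = "transport_from j B"
 have \<eta>: "\<eta> M x \<in> Ob (F M) 1" and \<phi>B: "\<phi> x \<in> Ob B 1" if "x \<in> carrier M" for x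
  using mod_homD(1)[OF unit[OF M] that] mod_homD(1)[OF \<phi> that] by (simp_all add: underlying_simps)
 note B' = transport_talg_algebra[OF B inj] and to = transport_talg_to[OF B inj] and inverse = transport_talg_inverse[OF B inj]
 show "\<exists>!h. h \<in> talg_hom T (F M) (transport_talg j B) \<and> (\<forall>x\<in>carrier M. h 1 (\<eta> M x) = (\<lambda>x\<in>carrier M. ?to 1 (\<phi> x)) x)"
  by (rule universal[OF M B' clone_hom_mod_hom[OF M \<phi> talg_hom_clone[OF B B' to]]])
 fix h
 show "talg_comp (F M) ?from h \<in> talg_hom T (F M) B \<and> (\<forall>x\<in>carrier M. talg_comp (F M) ?from h 1 (\<eta> M x) = \<phi> x)"
  if "h \<in> talg_hom T (F M) (transport_talg j B) \<and> (\<forall>x\<in>carrier M. h 1 (\<eta> M x) = (\<lambda>x\<in>carrier M. ?to 1 (\<phi> x)) x)"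
  using that talg_comp_in[OF F_algebra[OF M] _ transport_talg_from[OF B inj]] by (auto simp: talg_comp_apply \<eta> \<phi>B inv_into_f_f[OF inj])
 fix h
 show "(talg_comp (F M) ?to h \<in> talg_hom T (F M) (transport_talg j B) \<and>
   (\<forall>x\<in>carrier M. talg_comp (F M) ?to h 1 (\<eta> M x) = (\<lambda>x\<in>carrier M. ?to 1 (\<phi> x)) x)) \<and> talg_comp (F M) ?from (talg_comp (F M) ?to h) = h"
  if "h \<in> talg_hom T (F M) B \<and> (\<forall>x\<in>carrier M. h 1 (\<eta> M x) = \<phi> x)"
  using that talg_comp_in[OF F_algebra[OF M] _ to] inverse by (auto simp: talg_comp_apply \<eta> \<phi>B)
qed

lemma free_lift_props:
 fixes B :: "('t, 'b) talg" and j :: "nat => 'b => 't \<times> ('m + 'f) list"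
 assumes M: "module R M" and B: "talgebra T B" and inj: "\<And>n. inj_on (j n) (Ob B n)"
  and \<phi>: "restrict \<phi> (carrier M) \<in> mod_hom R M (U B)"
 shows "free_lift T F \<eta> M B \<phi> \<in> talg_hom T (F M) B" "x \<in> carrier M ==> free_lift T F \<eta> M B \<phi> 1 (\<eta> M x) = \<phi> x"
 using theI'[OF universal_embedded[OF M B inj \<phi>]] by (simp_all add: free_lift_def)

text \<open>The unit takes values in the subalgebra generated by \<open>x\<close>, so the universal
  property gives a morphism from \<open>F M\<close> to it. Followed by the inclusion this is the
  identity, by uniqueness, so nothing lies outside.\<close>

lemma generated_by_unit:
 assumes M: "module R M" and x: "x ` J \<subseteq> Ob (F M) 1" and gen: "\<And>m. m \<in> carrier M ==> \<eta> M m \<in> generated T (F M) J x"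
 shows "Ob (F M) 1 \<subseteq> generated T (F M) J x"
proof -
 interpret FM: talgebra T "F M" by (rule F_algebra[OF M])
 note FM = FM.talgebra_axioms
 let ?G = "generated T (F M) J x"
 let ?S = "sub_talg T (F M) ?G"
 have G: "op_closed T (F M) ?G"
  by (rule FM.generated_closed[OF x])
 have S: "talgebra T ?S" and S1: "Ob ?S 1 = ?G"
  by (rule sub_talg_algebra[OF FM G], rule sub_talg_1[OF FM G])
 let ?inj = "\<lambda>n x. (undefined, [Inr x]) :: 't \<times> ('m + 'f) list"
 have ev: "ev ?S xs p = ev (F M) xs p" if "set xs \<subseteq> ?G" "p \<in> pset (length xs)" for xs p
  unfolding ev_def by (rule sub_talg_op[OF FM G that(1) \<kappa>_in[OF that(2)]])
 have \<eta>: "\<eta> M \<in> mod_hom R M (U ?S)"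
 proof (rule mod_homI)
  interpret M: module R M by (rule M)
  fix m assume m: "m \<in> carrier M"
  show "\<eta> M m \<in> carrier (U ?S)"
   using gen[OF m] unfolding underlying_simps(1) S1 .
  show "\<eta> M (r \<odot>\<^bsub>M\<^esub> m) = r \<odot>\<^bsub>U ?S\<^esub> \<eta> M m" if "r \<in> carrier R" for r
   unfolding mod_homD(3)[OF unit[OF M] that m] underlying_simps using that gen[OF m] by (intro ev[symmetric]) (auto intro!: pset_intros)
  fix m' assume m': "m' \<in> carrier M"
  show "\<eta> M (m \<oplus>\<^bsub>M\<^esub> m') = \<eta> M m \<oplus>\<^bsub>U ?S\<^esub> \<eta> M m'"
   unfolding mod_homD(2)[OF unit[OF M] m m'] underlying_simps using gen[OF m] gen[OF m'] by (intro ev[symmetric]) (auto intro!: pset_intros)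
 qed (use unit[OF M] in \<open>auto simp: mod_hom_def PiE_iff extensional_def\<close>)
 have "\<exists>h. h \<in> talg_hom T (F M) ?S \<and> (\<forall>m\<in>carrier M. h 1 (\<eta> M m) = \<eta> M m)"
  using universal_embedded[OF M S, of ?inj, OF _ \<eta>] by (auto simp: inj_on_def)
 then obtain h where h: "h \<in> talg_hom T (F M) ?S" "\<forall>m\<in>carrier M. h 1 (\<eta> M m) = \<eta> M m"
  by blast
 have "h \<in> talg_hom T (F M) (F M) \<and> (\<forall>m\<in>carrier M. h 1 (\<eta> M m) = \<eta> M m)"
  using h sub_talg_incl[OF h(1)] by simp
 moreover have "(\<lambda>n. restrict id (Ob (F M) n)) \<in> talg_hom T (F M) (F M) \<and> (\<forall>m\<in>carrier M. restrict id (Ob (F M) 1) (\<eta> M m) = \<eta> M m)"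
  using talg_id_hom[OF FM] mod_homD(1)[OF unit[OF M]] by (auto simp: underlying_simps(1))
 ultimately have "h = (\<lambda>n. restrict id (Ob (F M) n))"
  using universal_embedded[OF M FM, of ?inj, OF _ unit[OF M]] by (auto simp: inj_on_def)
 then show ?thesis
  using talg_hom_in[OF h(1), of _ 1] unfolding S1 by auto
qed

end

section \<open>Bases of reduced chains\<close>

definition chain_unit :: "('r, 'z) ring_scheme => 'x => 'x => 'r" where
 "chain_unit R b = (\<lambda>x. if x = b then \<one>\<^bsub>R\<^esub> else \<zero>\<^bsub>R\<^esub>)"

lemma reduced_chains_simps:
 "c \<in> carrier (reduced_chains R K p) \<longleftrightarrow> (\<forall>x. c x \<in> carrier R) \<and> finite {x. c x \<noteq> \<zero>\<^bsub>R\<^esub>} \<and> {x. c x \<noteq> \<zero>\<^bsub>R\<^esub>} \<subseteq> Smp K p - {Bas K p}"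
 "\<zero>\<^bsub>reduced_chains R K p\<^esub> = (\<lambda>x. \<zero>\<^bsub>R\<^esub>)"
 "c \<oplus>\<^bsub>reduced_chains R K p\<^esub> d = (\<lambda>x. c x \<oplus>\<^bsub>R\<^esub> d x)"
 "r \<odot>\<^bsub>reduced_chains R K p\<^esub> c = (\<lambda>x. r \<otimes>\<^bsub>R\<^esub> c x)"
 by (simp_all add: reduced_chains_def)

abbreviation "basis D p \<equiv> Smp D p - {Bas D p}"

context cring
begin

abbreviation "rchains \<equiv> reduced_chains R"
abbreviation "supp c \<equiv> {x. c x \<noteq> \<zero>}"

lemma chains_add_closed: "c \<in> carrier (rchains K p) ==> d \<in> carrier (rchains K p) ==> c \<oplus>\<^bsub>rchains K p\<^esub> d \<in> carrier (rchains K p)"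
proof -
 assume cd: "c \<in> carrier (rchains K p)" "d \<in> carrier (rchains K p)"
 have "{x. c x \<oplus> d x \<noteq> \<zero>} \<subseteq> supp c \<union> supp d"
  by auto
 from finite_subset[OF this] subset_trans[OF this] cd show ?thesis
  unfolding reduced_chains_simps by simp
qed

lemma chains_smult_closed: "r \<in> carrier R ==> c \<in> carrier (rchains K p) ==> r \<odot>\<^bsub>rchains K p\<^esub> c \<in> carrier (rchains K p)"
proof -
 assume rc: "r \<in> carrier R" "c \<in> carrier (rchains K p)"
 then have "{x. r \<otimes> c x \<noteq> \<zero>} \<subseteq> supp c"
  by auto
 from finite_subset[OF this] subset_trans[OF this] rc show ?thesis
  unfolding reduced_chains_simps by simp
qed

lemma chains_module: "module R (rchains K p)"
proof (rule moduleI[OF is_cring])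
 show "abelian_group (rchains K p)"
 proof (rule abelian_groupI)
  fix c assume c: "c \<in> carrier (rchains K p)"
  have "(\<ominus> \<one>) \<odot>\<^bsub>rchains K p\<^esub> c \<oplus>\<^bsub>rchains K p\<^esub> c = \<zero>\<^bsub>rchains K p\<^esub>"
   using c by (auto simp: reduced_chains_simps fun_eq_iff l_minus l_neg)
  then show "\<exists>d\<in>carrier (rchains K p). d \<oplus>\<^bsub>rchains K p\<^esub> c = \<zero>\<^bsub>rchains K p\<^esub>"
   using chains_smult_closed[OF _ c, of "\<ominus> \<one>"] by auto
 next
  show "\<zero>\<^bsub>rchains K p\<^esub> \<in> carrier (rchains K p)"
   by (simp add: reduced_chains_simps)
 qed (rule chains_add_closed, assumption+, auto simp: reduced_chains_simps fun_eq_iff a_ac)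
qed (rule chains_smult_closed, assumption+, auto simp: reduced_chains_simps l_distr r_distr m_assoc)

lemma chain_unit_in: "b \<in> basis K p ==> chain_unit R b \<in> carrier (rchains K p)"
 by (auto simp: reduced_chains_simps chain_unit_def intro: finite_subset[of _ "{b}"])

lemma chains_induct [consumes 1, case_names zero step]:
 fixes K :: "'x psset" and P :: "('x => 'a) => bool"
 assumes "c \<in> carrier (rchains K p)" "P (\<lambda>x. \<zero>)"
  and step: "\<And>c r b. c \<in> carrier (rchains K p) ==> P c ==> r \<in> carrier R ==> b \<in> basis K p ==>
   P (c \<oplus>\<^bsub>rchains K p\<^esub> r \<odot>\<^bsub>rchains K p\<^esub> chain_unit R b)"
 shows "P c"
 using assms(1)
proof (induction "card (supp c)" arbitrary: c)
 case 0
 then have "c = (\<lambda>x. \<zero>)"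
  by (auto simp: reduced_chains_simps)
 then show ?case using assms(2) by simp
next
 case (Suc n)
 then obtain b where "b \<in> supp c"
  by (metis card.empty equals0I nat.distinct(1))
 then have b: "c b \<noteq> \<zero>" "b \<in> basis K p" "c b \<in> carrier R"
  using Suc.prems by (auto simp: reduced_chains_simps)
 define d where "d = c (b := \<zero>)"
 have "supp d = supp c - {b}"
  by (auto simp: d_def)
 then have d: "d \<in> carrier (rchains K p)" "n = card (supp d)"
  using Suc b(1) by (auto simp: reduced_chains_simps d_def)
 have "c = d \<oplus>\<^bsub>rchains K p\<^esub> c b \<odot>\<^bsub>rchains K p\<^esub> chain_unit R b"
  using Suc.prems by (auto simp: reduced_chains_simps d_def chain_unit_def fun_eq_iff)
 then show ?case
  using step[OF d(1) Suc.hyps(1)[OF d(2,1)] b(3,2)] by simp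
qed

definition linear_extension :: "('a, 'm) module => ('x => 'm) => ('x => 'a) => 'm" where
 "linear_extension N s c = (\<Oplus>\<^bsub>N\<^esub>b\<in>supp c. c b \<odot>\<^bsub>N\<^esub> s b)"

lemma linear_extension:
 assumes N: "module R N" and s: "\<And>b. b \<in> basis K p ==> s b \<in> carrier N"
 shows "restrict (linear_extension N s) (carrier (rchains K p)) \<in> mod_hom R (rchains K p) N"
  "b \<in> basis K p ==> linear_extension N s (chain_unit R b) = s b"
proof -
 interpret N: module R N by (rule N)
 interpret C: module R "rchains K p" by (rule chains_module)
 let ?J = "basis K p"
 let ?f = "linear_extension N s" and ?r = "restrict (linear_extension N s) (carrier (rchains K p))"
 have f: "?f c = (\<Oplus>\<^bsub>N\<^esub>b\<in>S. c b \<odot>\<^bsub>N\<^esub> s b)" if "finite S" "supp c \<subseteq> S" "S \<subseteq> ?J" "\<And>x. c x \<in> carrier R" for c S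
  unfolding linear_extension_def finsum_def
  by (rule comm_monoid.finprod_mono_neutral_cong_left[OF N.a_comm_monoid that(1,2)])
   (use that s in \<open>auto simp: subset_eq\<close>)
 show "?r \<in> mod_hom R (rchains K p) N"
 proof (rule mod_homI)
  fix c assume c: "c \<in> carrier (rchains K p)"
  note cc = c[unfolded reduced_chains_simps]
  show "?r c \<in> carrier N"
   using c cc s unfolding linear_extension_def by (auto intro!: N.finsum_closed simp: subset_eq)
  show "?r (r \<odot>\<^bsub>rchains K p\<^esub> c) = r \<odot>\<^bsub>N\<^esub> ?r c" if r: "r \<in> carrier R" for r
  proof -
   have "?f (r \<odot>\<^bsub>rchains K p\<^esub> c) = (\<Oplus>\<^bsub>N\<^esub>b\<in>supp c. (r \<otimes> c b) \<odot>\<^bsub>N\<^esub> s b)"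
    using cc r by (subst f[of "supp c"]) (auto simp: reduced_chains_simps)
   also have "\<dots> = r \<odot>\<^bsub>N\<^esub> ?f c"
    unfolding linear_extension_def using cc r s
    by (subst N.finsum_smult_ldistr) (auto simp: subset_eq N.smult_assoc1 intro!: N.finsum_cong')
   finally show ?thesis
    using c r by simp
  qed
  fix d assume d: "d \<in> carrier (rchains K p)"
  note dd = d[unfolded reduced_chains_simps]
  let ?S = "supp c \<union> supp d"
  have S: "finite ?S" "?S \<subseteq> ?J"
   using cc dd by auto
  have sS: "s b \<in> carrier N" if "b \<in> ?S" for b
   using s S(2) that by auto
  have "?f (c \<oplus>\<^bsub>rchains K p\<^esub> d) = (\<Oplus>\<^bsub>N\<^esub>b\<in>?S. (c b \<oplus> d b) \<odot>\<^bsub>N\<^esub> s b)"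
   using cc dd S by (subst f[of ?S]) (auto simp: reduced_chains_simps)
  also have "\<dots> = (\<Oplus>\<^bsub>N\<^esub>b\<in>?S. c b \<odot>\<^bsub>N\<^esub> s b \<oplus>\<^bsub>N\<^esub> d b \<odot>\<^bsub>N\<^esub> s b)"
   using cc dd sS by (intro N.finsum_cong') (auto simp: N.smult_l_distr)
  also have "\<dots> = (\<Oplus>\<^bsub>N\<^esub>b\<in>?S. c b \<odot>\<^bsub>N\<^esub> s b) \<oplus>\<^bsub>N\<^esub> (\<Oplus>\<^bsub>N\<^esub>b\<in>?S. d b \<odot>\<^bsub>N\<^esub> s b)"
   using cc dd sS by (intro N.finsum_addf) auto
  also have "\<dots> = ?f c \<oplus>\<^bsub>N\<^esub> ?f d"
   using cc dd S by (simp add: f[of ?S])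
  finally show "?r (c \<oplus>\<^bsub>rchains K p\<^esub> d) = ?r c \<oplus>\<^bsub>N\<^esub> ?r d"
   using c d by simp
 qed simp
 show "?f (chain_unit R b) = s b" if "b \<in> ?J" for b
 proof -
  have "?f (chain_unit R b) = (\<Oplus>\<^bsub>N\<^esub>b\<in>{b}. chain_unit R b b \<odot>\<^bsub>N\<^esub> s b)"
   using that s[OF that] by (subst f[of "{b}"]) (auto simp: chain_unit_def)
  then show ?thesis
   using s[OF that] by (simp add: chain_unit_def)
 qed
qed

definition scalars :: "('a, 'a) module" where
 "scalars = \<lparr>carrier = carrier R, mult = mult R, one = \<one>, zero = \<zero>, add = add R, smult = mult R\<rparr>"

lemma scalars_simps: "carrier scalars = carrier R" "\<zero>\<^bsub>scalars\<^esub> = \<zero>" "add scalars = add R" "smult scalars = mult R"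
 "finsum scalars g A = finsum R g A"
 by (simp_all add: scalars_def finsum_def finprod_def)

lemma scalars_module: "module R scalars"
 by (intro moduleI[OF is_cring] abelian_groupI)
  (auto simp: scalars_simps a_ac m_assoc l_distr r_distr intro: bexI[of _ "\<ominus> _"] l_neg)

text \<open>Away from the base point, each coordinate \<open>y\<close> of the chain map is the
  linear extension of the indicator of \<open>f x = y\<close> with values in \<open>scalars\<close>,
  so linearity is inherited. The coordinate at the base point is 0.\<close>

lemma chain_map_hom:
 assumes f: "\<And>x. x \<in> basis K q ==> f x \<in> Smp L p"
 shows "chain_map R K q L p f \<in> mod_hom R (rchains K q) (rchains L p)"
  "b \<in> basis K q ==> chain_map R K q L p f (chain_unit R b) = (if f b = Bas L p then \<zero>\<^bsub>rchains L p\<^esub> else chain_unit R (f b))"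
proof -
 define s where "s y x = (if f x = y \<and> y \<noteq> Bas L p then \<one> else \<zero>)" for y x
 let ?c = "chain_map R K q L p f"
 interpret S: module R scalars by (rule scalars_module)
 interpret C: module R "rchains K q" by (rule chains_module)
 have s: "s y x \<in> carrier scalars" for x y
  by (simp add: s_def scalars_simps)
 note ext = linear_extension[where N = scalars and s = "s y" and K = K and p = q for y, OF scalars_module s]
 have cm: "?c c y = linear_extension scalars (s y) c" if c: "c \<in> carrier (rchains K q)" for c y
 proof -
  have cc: "finite (supp c)" "c x \<in> carrier R" for x
   using c by (auto simp: reduced_chains_simps)
  have "(\<Oplus>x\<in>{x. c x \<noteq> \<zero> \<and> f x = y}. c x) = (\<Oplus>x\<in>supp c. c x \<otimes> s y x)" if "y \<noteq> Bas L p"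
   unfolding finsum_def by (rule comm_monoid.finprod_mono_neutral_cong_left[OF a_comm_monoid cc(1)]) (use cc that in \<open>auto simp: s_def\<close>)
  moreover have "(\<Oplus>x\<in>supp c. c x \<otimes> s (Bas L p) x) = \<zero>"
   using cc by (simp add: s_def)
  ultimately show ?thesis
   using c by (simp add: chain_map_def linear_extension_def scalars_simps)
 qed
 show "?c \<in> mod_hom R (rchains K q) (rchains L p)"
 proof (rule mod_homI)
  fix c assume c: "c \<in> carrier (rchains K q)"
  note cc = c[unfolded reduced_chains_simps]
  have cR: "?c c y \<in> carrier R" for y
   using mod_homD(1)[OF ext(1) c] c by (simp add: cm scalars_simps)
  have y: "y \<in> f ` supp c \<and> y \<noteq> Bas L p" if "?c c y \<noteq> \<zero>" for y
  proof (rule ccontr)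
   assume n: "\<not> ?thesis"
   have "?c c y = \<zero>"
   proof (cases "y = Bas L p")
    case False
    then have E: "{x. c x \<noteq> \<zero> \<and> f x = y} = {}"
     using n by auto
    show ?thesis
     using c by (simp add: chain_map_def E)
   qed (use c in \<open>simp add: chain_map_def\<close>)
   then show False
    using that by simp
  qed
  moreover have "finite {y. ?c c y \<noteq> \<zero>}"
   by (rule finite_subset[of _ "f ` supp c"]) (use y cc in auto)
  moreover have "{y. ?c c y \<noteq> \<zero>} \<subseteq> basis L p"
   using y cc f by blast
  ultimately show "?c c \<in> carrier (rchains L p)"
   using cR by (simp add: reduced_chains_simps)
  show "?c (r \<odot>\<^bsub>rchains K q\<^esub> c) = r \<odot>\<^bsub>rchains L p\<^esub> ?c c" if r: "r \<in> carrier R" for r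
   using mod_homD(3)[OF ext(1) r c] r c by (simp add: fun_eq_iff cm reduced_chains_simps(4)[of R L] scalars_simps)
  fix d assume d: "d \<in> carrier (rchains K q)"
  show "?c (c \<oplus>\<^bsub>rchains K q\<^esub> d) = ?c c \<oplus>\<^bsub>rchains L p\<^esub> ?c d"
   using mod_homD(2)[OF ext(1) c d] c d by (simp add: fun_eq_iff cm reduced_chains_simps(3)[of R L] scalars_simps)
 qed (simp add: chain_map_def)
 show "?c (chain_unit R b) = (if f b = Bas L p then \<zero>\<^bsub>rchains L p\<^esub> else chain_unit R (f b))" if b: "b \<in> basis K q"
  using chain_unit_in[OF b] ext(2)[OF b] by (auto simp: fun_eq_iff cm reduced_chains_simps(2) chain_unit_def[of R "f b"] s_def)
qed

end

lemma (in com_theory) op_closed_ops: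
 assumes "op_closed T A G"
 shows "a \<in> G ==> b \<in> G ==> a \<oplus>\<^bsub>U A\<^esub> b \<in> G" "r \<in> carrier R ==> a \<in> G ==> r \<odot>\<^bsub>U A\<^esub> a \<in> G" "\<zero>\<^bsub>U A\<^esub> \<in> G"
 unfolding underlying_simps ev_def zero_K
 by (rule op_closed_op[OF assms]; auto intro!: \<kappa>_in pset_intros R.pset_const simp del: lessThan_0)+

lemma (in com_theory) underlying_zero_in: "talgebra T A ==> \<zero>\<^bsub>U A\<^esub> \<in> Ob A 1"
 unfolding underlying_simps ev_def zero_K
 by (rule talgebra.op_in) (auto intro!: \<kappa>_in R.pset_const simp del: lessThan_0)

text \<open>Independence can be tested on maps to the algebras of arrows.\<close>

lemma (in com_theory) free_onI:
 assumes A: "talgebra T A" and x: "x ` J \<subseteq> Ob A 1" and gen: "Ob A 1 \<subseteq> generated T A J x"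
  and ext: "\<And>n s. (\<And>c. s c \<in> Hom T n 1) ==> \<exists>h\<in>talg_hom T A (represented T n). \<forall>c\<in>J. h 1 (x c) = s c"
 shows "free_on T A J x"
 unfolding free_on_def
proof (intro conjI allI impI x gen)
 fix js t t' assume js: "distinct js" "set js \<subseteq> J" and t: "t \<in> Hom T (length js) 1" "t' \<in> Hom T (length js) 1"
  and eq: "talg_op T A t (map x js) = talg_op T A t' (map x js)"
 let ?n = "length js"
 \<comment> \<open>The listed generators go to the projections, so the value of an operation at them
   goes to its own arrow, and equal values force equal arrows.\<close>
 define s where "s c = (if c \<in> set js then Prj T ?n (position js c) else \<zero>\<^bsub>U (represented T ?n)\<^esub>)" for c
 have "s c \<in> Hom T ?n 1" for c
  using \<kappa>.T.Prj_in[of "position js c" ?n] underlying_zero_in[OF \<kappa>.T.represented_talgebra, of ?n] position(1)[of c js] by (auto simp: s_def)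
 then obtain h where h: "h \<in> talg_hom T A (represented T ?n)" "\<And>c. c \<in> J ==> h 1 (x c) = s c"
  using ext[of s ?n] by blast
 have "map (h 1) (map x js) = map (Prj T ?n) [0..<?n]"
 proof (rule nth_equalityI)
  fix i assume "i < length (map (h 1) (map x js))"
  then have i: "i < ?n" by simp
  then have "position js (js ! i) = i"
   using position[of "js ! i" js] js(1) by (simp add: nth_eq_iff_index_eq)
  then show "map (h 1) (map x js) ! i = map (Prj T ?n) [0..<?n] ! i"
   using h(2)[OF subsetD[OF js(2) nth_mem[OF i]]] nth_mem[OF i] i by (simp add: s_def)
 qed simp
 moreover have "set (map x js) \<subseteq> Ob A 1"
  using js(2) x by auto
 ultimately have "h 1 (talg_op T A u (map x js)) = u" if "u \<in> Hom T ?n 1" for u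
  using clone_hom_op[OF talg_hom_clone[OF A \<kappa>.T.represented_talgebra h(1)], of "map x js" u] that
  by (simp add: op_represented \<kappa>.T.tuple_Prjs \<kappa>.T.Idn_right del: map_map)
 then show "t = t'"
  using t eq by metis
qed

section \<open>Freeness of the free algebra on the simplices outside the base point\<close>

locale free_chains = free_theory R T \<kappa> F \<eta>
 for R :: "('r, 'z) ring_scheme" and T :: "'t lawvere" and \<kappa>
  and F :: "('r, 'x => 'r) module => ('t, 'f) talg" and \<eta> :: "('r, 'x => 'r) module => ('x => 'r) => 'f"
begin

abbreviation FC :: "'x psset => nat => ('t, 'f) talg" where
 "FC D p \<equiv> F (R.rchains D p)"

definition gen :: "'x psset => nat => 'x => 'f" where
 "gen D p b = \<eta> (R.rchains D p) (chain_unit R b)"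

lemma FC: "talgebra T (FC D p)"
 by (rule F_algebra[OF R.chains_module])

lemma \<eta>_hom: "\<eta> (R.rchains D p) \<in> mod_hom R (R.rchains D p) (U (FC D p))"
 by (rule unit[OF R.chains_module])

lemma gen_in: "b \<in> basis D p ==> gen D p b \<in> Ob (FC D p) 1"
 unfolding gen_def using mod_homD(1)[OF \<eta>_hom R.chain_unit_in] by (simp add: underlying_simps(1))

lemma mod_hom_zero:
 assumes "talgebra T A" "module R M" "\<phi> \<in> mod_hom R M (U A)"
 shows "\<phi> \<zero>\<^bsub>M\<^esub> = \<zero>\<^bsub>U A\<^esub>"
proof -
 interpret M: module R M by fact
 interpret A: module R "U A" by (rule underlying_module[OF assms(1)])
 have "\<phi> (\<zero>\<^bsub>R\<^esub> \<odot>\<^bsub>M\<^esub> \<zero>\<^bsub>M\<^esub>) = \<zero>\<^bsub>R\<^esub> \<odot>\<^bsub>U A\<^esub> \<phi> \<zero>\<^bsub>M\<^esub>"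
  by (rule mod_homD(3)[OF assms(3)]) auto
 then show ?thesis
  using mod_homD(1)[OF assms(3), of "\<zero>\<^bsub>M\<^esub>"] by simp
qed

lemma \<eta>_zero: "\<eta> (R.rchains D p) \<zero>\<^bsub>R.rchains D p\<^esub> = \<zero>\<^bsub>U (FC D p)\<^esub>"
 by (rule mod_hom_zero[OF FC R.chains_module \<eta>_hom])

lemma \<eta>_generated:
 assumes "c \<in> carrier (R.rchains D p)"
 shows "\<eta> (R.rchains D p) c \<in> generated T (FC D p) (basis D p) (gen D p)"
 using assms
proof (induction c rule: R.chains_induct)
 let ?G = "generated T (FC D p) (basis D p) (gen D p)"
 have sub: "gen D p ` basis D p \<subseteq> Ob (FC D p) 1"
  using gen_in by auto
 have G: "op_closed T (FC D p) ?G"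
  by (rule talgebra.generated_closed[OF FC sub])
 {
  case zero
  show ?case
   using \<eta>_zero[of D p] op_closed_ops(3)[OF G] by (simp add: reduced_chains_simps)
 next
  case (step c r b)
  have "\<eta> (R.rchains D p) (chain_unit R b) \<in> ?G"
   using talgebra.generated_base[OF FC sub step(3)] by (simp add: gen_def)
  then show ?case
   using step R.chain_unit_in[OF step(3)] R.chains_smult_closed[OF step(2) R.chain_unit_in[OF step(3)]]
   by (simp add: mod_homD[OF \<eta>_hom] op_closed_ops[OF G])
 }
qed

lemma FC_generated: "Ob (FC D p) 1 \<subseteq> generated T (FC D p) (basis D p) (gen D p)"
 by (rule generated_by_unit[OF R.chains_module image_subsetI[OF gen_in] \<eta>_generated])

text \<open>A map from the basis to arrows extends linearly to the chains and then, by the universal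
  property, to \<open>F\<close>. Arrows embed into the test type as \<open>(x, [])\<close>.\<close>

lemma FC_free: "free_on T (FC D p) (basis D p) (gen D p)"
proof (rule free_onI[OF FC _ FC_generated])
 show "gen D p ` basis D p \<subseteq> Ob (FC D p) 1"
  using gen_in by auto
 fix n and s :: "'x => 't" assume s: "\<And>c. s c \<in> Hom T n 1"
 let ?B = "represented T n"
 have B: "talgebra T ?B" by (rule \<kappa>.T.represented_talgebra)
 note ext = R.linear_extension[OF underlying_module[OF B], where K = D and p = p and s = s]
 have "\<exists>!h. h \<in> talg_hom T (FC D p) ?B \<and> (\<forall>x\<in>carrier (R.rchains D p). h 1 (\<eta> (R.rchains D p) x) =
   restrict (R.linear_extension (U ?B) s) (carrier (R.rchains D p)) x)"
  by (rule universal_embedded[OF R.chains_module B, of "\<lambda>_ x. (x, [])", OF _ ext(1)]) (auto simp: inj_on_def underlying_simps(1) s)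
 then obtain h where h: "h \<in> talg_hom T (FC D p) ?B" "\<And>x. x \<in> carrier (R.rchains D p) ==> h 1 (\<eta> (R.rchains D p) x) = R.linear_extension (U ?B) s x"
  by auto
 then have "h 1 (gen D p b) = s b" if "b \<in> basis D p" for b
  using R.chain_unit_in[OF that] ext(2)[OF _ that] by (simp add: gen_def underlying_simps(1) s)
 then show "\<exists>h\<in>talg_hom T (FC D p) ?B. \<forall>c\<in>basis D p. h 1 (gen D p c) = s c"
  using h(1) by blast
qed

lemma free_map_chain:
 assumes f: "\<And>x. x \<in> basis D q ==> f x \<in> Smp E p"
 defines "h \<equiv> free_map T F \<eta> (R.rchains D q) (R.rchains E p) (chain_map R D q E p f)"
 shows "h \<in> talg_hom T (FC D q) (FC E p)"
  "b \<in> basis D q ==> h 1 (gen D q b) = (if f b = Bas E p then \<zero>\<^bsub>U (FC E p)\<^esub> else gen E p (f b))"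
proof -
 let ?inj = "\<lambda>n x. (undefined, [Inr x]) :: 't \<times> (('x => 'r) + 'f) list"
 let ?c = "chain_map R D q E p f"
 have c: "?c \<in> mod_hom R (R.rchains D q) (R.rchains E p)"
  "b \<in> basis D q ==> ?c (chain_unit R b) = (if f b = Bas E p then \<zero>\<^bsub>R.rchains E p\<^esub> else chain_unit R (f b))" for b
  by (rule R.chain_map_hom; use f in blast)+
 have "(\<lambda>x\<in>carrier (R.rchains D q). \<eta> (R.rchains E p) (?c x)) \<in> mod_hom R (R.rchains D q) (U (FC E p))"
  by (rule mod_hom_comp[OF R.chains_module c(1)]) (auto simp: mod_homD[OF \<eta>_hom])
 note lift = free_lift_props[OF R.chains_module FC, of ?inj, OF _ this]
 show "h \<in> talg_hom T (FC D q) (FC E p)"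
  unfolding h_def free_map_def by (rule lift(1)) (simp add: inj_on_def)
 show "h 1 (gen D q b) = (if f b = Bas E p then \<zero>\<^bsub>U (FC E p)\<^esub> else gen E p (f b))" if b: "b \<in> basis D q"
  unfolding h_def free_map_def gen_def
  by (subst lift(2)) (auto simp: inj_on_def R.chain_unit_in[OF b] c(2)[OF b] \<eta>_zero)
qed

end

section \<open>Simplicial algebras\<close>

lemma salg_hom_level: "h \<in> salg_hom T A B ==> h p \<in> talg_hom T (Deg A p) (Deg B p)"
 and salg_hom_Str: "h \<in> salg_hom T A B ==> \<theta> \<in> delta p q ==> x \<in> Ob (Deg A q) n ==>
  h p n (Str A p q \<theta> n x) = Str B p q \<theta> n (h q n x)"
 by (auto simp: salg_hom_def)

lemma salg_hom_in: "h \<in> salg_hom T A B ==> x \<in> Ob (Deg A p) n ==> h p n x \<in> Ob (Deg B p) n"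
 by (rule talg_hom_in[OF salg_hom_level])

lemma salg_homI:
 assumes "\<And>p. h p \<in> talg_hom T (Deg A p) (Deg B p)"
  and "\<And>p q \<theta> n x. \<theta> \<in> delta p q ==> x \<in> Ob (Deg A q) n ==> h p n (Str A p q \<theta> n x) = Str B p q \<theta> n (h q n x)"
 shows "h \<in> salg_hom T A B"
 using assms by (auto simp: salg_hom_def)

lemma salg_comp_apply: "x \<in> Ob (Deg A p) n ==> salg_comp A g h p n x = g p n (h p n x)"
 by (simp add: salg_comp_def talg_comp_apply)

lemma salg_comp_eqI:
 assumes "\<And>p n x. x \<in> Ob (Deg A p) n ==> g p n (h p n x) = g' p n (h' p n x)"
 shows "salg_comp A g h = salg_comp A g' h'"
 using assms by (auto simp: salg_comp_def talg_comp_def compose_def fun_eq_iff)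

lemma salg_comp_eq_homI:
 assumes "k \<in> salg_hom T A B" "\<And>p n x. x \<in> Ob (Deg A p) n ==> g p n (h p n x) = k p n x"
 shows "salg_comp A g h = k"
 using assms talg_hom_undef[OF salg_hom_level[OF assms(1)]]
 by (auto simp: salg_comp_def talg_comp_def compose_def fun_eq_iff)

lemma salg_comp_assoc: "h \<in> salg_hom T A B ==> salg_comp A (salg_comp B g f) h = salg_comp A g (salg_comp A f h)"
 by (rule salg_comp_eqI) (simp add: salg_comp_apply salg_hom_in)

lemma salg_comp_id: "h \<in> salg_hom T A B ==> salg_comp A (salg_id B) h = h"
 by (rule salg_comp_eq_homI) (auto simp: salg_id_def dest: salg_hom_in)

lemma salg_comp_eqD: "salg_comp A g h = k ==> x \<in> Ob (Deg A p) n ==> g p n (h p n x) = k p n x"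
 using salg_comp_apply[of x A p n g h] by simp

context salgebra
begin

lemma Str_in: "\<theta> \<in> delta p q ==> x \<in> Ob (Deg A q) n ==> Str A p q \<theta> n x \<in> Ob (Deg A p) n"
 by (rule talg_hom_in[OF Str_hom])

lemma Str_clone: "\<theta> \<in> delta p q ==> Str A p q \<theta> 1 \<in> clone_hom T (Deg A q) (Deg A p)"
 by (rule talg_hom_clone[OF Deg Deg Str_hom])

end

lemma salg_hom_clone:
 "salgebra T A ==> salgebra T B ==> h \<in> salg_hom T A B ==> h p 1 \<in> clone_hom T (Deg A p) (Deg B p)"
 by (rule talg_hom_clone[OF salgebra.Deg salgebra.Deg salg_hom_level])

lemma salg_comp_in:
 assumes "salgebra T A" "h \<in> salg_hom T A B" "g \<in> salg_hom T B C"
 shows "salg_comp A g h \<in> salg_hom T A C"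
proof (rule salg_homI)
 interpret salgebra T A by fact
 show "salg_comp A g h p \<in> talg_hom T (Deg A p) (Deg C p)" for p
  unfolding salg_comp_def by (rule talg_comp_in[OF Deg salg_hom_level[OF assms(2)] salg_hom_level[OF assms(3)]])
 show "salg_comp A g h p n (Str A p q \<theta> n x) = Str C p q \<theta> n (salg_comp A g h q n x)"
  if "\<theta> \<in> delta p q" "x \<in> Ob (Deg A q) n" for p q \<theta> n x
  using that by (simp add: salg_comp_apply Str_in salg_hom_Str[OF assms(2)] salg_hom_Str[OF assms(3)] salg_hom_in[OF assms(2)])
qed

lemma salg_id_hom: "salgebra T A ==> salg_id A \<in> salg_hom T A A"
 by (rule salg_homI) (auto simp: salg_id_def salgebra.Str_in intro!: talg_id_hom[OF salgebra.Deg])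

definition transport_salg :: "(nat => nat => 'a => 'b) => ('t, 'a) salg => ('t, 'b) salg" where
 "transport_salg j A = \<lparr> Deg = (\<lambda>p. transport_talg (j p) (Deg A p)),
   Str = (\<lambda>p q \<theta> n. \<lambda>y\<in>j q n ` Ob (Deg A q) n. j p n (Str A p q \<theta> n (inv_into (Ob (Deg A q) n) (j q n) y))) \<rparr>"

abbreviation "encode j A \<equiv> \<lambda>p n. restrict (j p n) (Ob (Deg A p) n)"
abbreviation "decode j A \<equiv> \<lambda>p n. restrict (inv_into (Ob (Deg A p) n) (j p n)) (j p n ` Ob (Deg A p) n)"

context
 fixes T :: "'t lawvere" and A :: "('t, 'a) salg" and j :: "nat => nat => 'a => 'b"
 assumes A: "salgebra T A" and inj: "\<And>p n. inj_on (j p n) (Ob (Deg A p) n)"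
begin

interpretation A: salgebra T A by (rule A)

private lemma Ob: "Ob (Deg (transport_salg j A) p) n = j p n ` Ob (Deg A p) n"
 and Act: "x \<in> Ob (Deg A p) m ==> Act (Deg (transport_salg j A) p) m n f (j p m x) = j p n (Act (Deg A p) m n f x)"
 and Str: "x \<in> Ob (Deg A q) n ==> Str (transport_salg j A) p q \<theta> n (j q n x) = j p n (Str A p q \<theta> n x)"
 using transport_talg_simps[of "j p" "Deg A p", OF inj] inj by (auto simp: transport_salg_def)

lemma transport_salg_algebra: "salgebra T (transport_salg j A)"
proof (rule salgebra.intro)
 let ?B = "transport_salg j A"
 show B: "talgebra T (Deg ?B p)" for p
  using transport_talg_algebra[OF A.Deg inj] by (simp add: transport_salg_def)
 show "Str ?B p q \<theta> \<in> talg_hom T (Deg ?B q) (Deg ?B p)" if \<theta>: "\<theta> \<in> delta p q" for \<theta> p q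
 proof (rule talg_homI)
  fix m n f y assume f: "f \<in> Hom T m n" and "y \<in> Ob (Deg ?B q) m"
  then obtain x where x: "x \<in> Ob (Deg A q) m" "y = j q m x"
   by (auto simp: Ob)
  then show "Str ?B p q \<theta> n (Act (Deg ?B q) m n f y) = Act (Deg ?B p) m n f (Str ?B p q \<theta> m y)"
   using f \<theta> talg_hom_Act[OF A.Str_hom[OF \<theta>] f x(1)] talgebra.Act_in[OF A.Deg f x(1)] A.Str_in[OF \<theta> x(1)]
   by (simp add: Act Str)
 next
  fix n y assume "y \<in> Ob (Deg ?B q) n"
  then show "Str ?B p q \<theta> n y \<in> Ob (Deg ?B p) n"
   using \<theta> by (auto simp: Ob Str A.Str_in)
 next
  fix n y assume "y \<notin> Ob (Deg ?B q) n"
  then show "Str ?B p q \<theta> n y = undefined"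
   unfolding Ob by (simp add: transport_salg_def)
 qed
 fix p n y assume "y \<in> Ob (Deg ?B p) n"
 then show "Str ?B p p (restrict id {..p}) n y = y"
  by (auto simp: Ob Str A.Str_id)
next
 let ?B = "transport_salg j A"
 fix \<theta> p q \<psi> r y n assume "\<theta> \<in> delta p q" "\<psi> \<in> delta q r" "y \<in> Ob (Deg ?B r) n"
 then show "Str ?B p r (compose {..p} \<psi> \<theta>) n y = Str ?B p q \<theta> n (Str ?B q r \<psi> n y)"
  by (auto simp: Ob Str A.Str_comp A.Str_in)
qed

lemma transport_salg_hom: "encode j A \<in> salg_hom T A (transport_salg j A)" "decode j A \<in> salg_hom T (transport_salg j A) A"
proof (safe intro!: salg_homI)
 show "encode j A p \<in> talg_hom T (Deg A p) (Deg (transport_salg j A) p)" "decode j A p \<in> talg_hom T (Deg (transport_salg j A) p) (Deg A p)" for p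
  using transport_talg_to[OF A.Deg inj] transport_talg_from[OF A.Deg inj] by (simp_all add: transport_salg_def)
 show "decode j A p n (Str (transport_salg j A) p q \<theta> n y) = Str A p q \<theta> n (decode j A q n y)"
  if "\<theta> \<in> delta p q" "y \<in> Ob (Deg (transport_salg j A) q) n" for \<theta> p q n y
 proof -
  obtain x where "x \<in> Ob (Deg A q) n" "y = j q n x"
   using \<open>y \<in> _\<close> by (auto simp: Ob)
  then show ?thesis
   using A.Str_in[OF \<open>\<theta> \<in> _\<close>, of x n] by (simp add: Str inv_into_f_f[OF inj])
 qed
qed (simp_all add: A.Str_in Str)

lemma transport_salg_inverse:
 "w \<in> salg_hom T E A ==> salg_comp E (decode j A) (salg_comp E (encode j A) w) = w"
 "v \<in> salg_hom T E (transport_salg j A) ==> salg_comp E (encode j A) (salg_comp E (decode j A) v) = v"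
 using salg_hom_in[of w T E A] salg_hom_in[of v T E "transport_salg j A"]
 by (auto intro!: salg_comp_eq_homI simp: salg_comp_apply inv_into_f_f[OF inj] f_inv_into_f inv_into_into Ob)

end

lemma pushout_homs:
 assumes "is_pushout T S D B P i a j c"
 shows "i \<in> salg_hom T S D" "a \<in> salg_hom T S B" "j \<in> salg_hom T B P" "c \<in> salg_hom T D P" "salg_comp S j a = salg_comp S c i"
 using assms unfolding is_pushout_def by blast+

lemma pushout_embedded:
 fixes B :: "('t, 'a) salg" and D :: "('t, 'f) salg" and Z :: "('t, 'b) salg" and J :: "nat => nat => 'b => 't \<times> ('a + 'f) list"
 assumes po: "is_pushout T S D B P i a j c" and alg: "salgebra T B" "salgebra T D" "salgebra T P" "salgebra T Z"
  and inj: "\<And>p n. inj_on (J p n) (Ob (Deg Z p) n)"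
  and u: "u \<in> salg_hom T B Z" and v: "v \<in> salg_hom T D Z" and uv: "salg_comp S u a = salg_comp S v i"
 shows "\<exists>!w. w \<in> salg_hom T P Z \<and> salg_comp B w j = u \<and> salg_comp D w c = v"
proof (rule ex1_retract[where f = "salg_comp P (encode J Z)" and g = "salg_comp P (decode J Z)"])
 note hom = pushout_homs[OF po] and to = transport_salg_hom[OF alg(4) inj] and inverse = transport_salg_inverse[OF alg(4) inj]
 have "salg_comp S (salg_comp B (encode J Z) u) a = salg_comp S (salg_comp D (encode J Z) v) i"
  by (simp add: salg_comp_assoc[OF hom(1)] salg_comp_assoc[OF hom(2)] uv)
 then show "\<exists>!w. w \<in> salg_hom T P (transport_salg J Z) \<and> salg_comp B w j = salg_comp B (encode J Z) u \<and> salg_comp D w c = salg_comp D (encode J Z) v"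
  using po salg_comp_in[OF alg(1) u to(1)] salg_comp_in[OF alg(2) v to(1)] transport_salg_algebra[OF alg(4) inj]
  unfolding is_pushout_def by blast
qed (auto simp: transport_salg_inverse[OF alg(4) inj] salg_comp_assoc[OF pushout_homs(3)[OF po]] salg_comp_assoc[OF pushout_homs(4)[OF po]] u v
  intro: salg_comp_in[OF alg(3)] transport_salg_hom[OF alg(4) inj])

lemma colimit_embedded:
 fixes Y :: "'i::wellorder => ('t, 'a) salg" and Z :: "('t, 'b) salg" and J :: "nat => nat => 'b => 't \<times> ('i \<times> 'a) list"
 assumes colim: "is_chain_colimit T Y e \<beta>" and Y: "\<And>\<gamma>. \<gamma> \<le> \<beta> ==> salgebra T (Y \<gamma>)"
  and e: "\<And>\<gamma> \<delta>. \<gamma> \<le> \<delta> ==> \<delta> \<le> \<beta> ==> e \<gamma> \<delta> \<in> salg_hom T (Y \<gamma>) (Y \<delta>)"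
  and Z: "salgebra T Z" and inj: "\<And>p n. inj_on (J p n) (Ob (Deg Z p) n)"
  and u: "\<And>\<gamma>. \<gamma> < \<beta> ==> u \<gamma> \<in> salg_hom T (Y \<gamma>) Z" and uu: "\<And>\<gamma> \<delta>. \<gamma> \<le> \<delta> ==> \<delta> < \<beta> ==> salg_comp (Y \<gamma>) (u \<delta>) (e \<gamma> \<delta>) = u \<gamma>"
 shows "\<exists>!w. w \<in> salg_hom T (Y \<beta>) Z \<and> (\<forall>\<gamma><\<beta>. salg_comp (Y \<gamma>) w (e \<gamma> \<beta>) = u \<gamma>)"
proof (rule ex1_retract[where f = "salg_comp (Y \<beta>) (encode J Z)" and g = "salg_comp (Y \<beta>) (decode J Z)"])
 have "salg_comp (Y \<gamma>) (encode J Z) (u \<gamma>) \<in> salg_hom T (Y \<gamma>) (transport_salg J Z)" if "\<gamma> < \<beta>" for \<gamma>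
  using that by (intro salg_comp_in[OF Y u transport_salg_hom(1)[OF Z inj]]) auto
 moreover have "salg_comp (Y \<gamma>) (salg_comp (Y \<delta>) (encode J Z) (u \<delta>)) (e \<gamma> \<delta>) = salg_comp (Y \<gamma>) (encode J Z) (u \<gamma>)" if "\<gamma> \<le> \<delta>" "\<delta> < \<beta>" for \<gamma> \<delta>
  using that by (subst salg_comp_assoc[OF e]) (auto simp: uu)
 ultimately show "\<exists>!w. w \<in> salg_hom T (Y \<beta>) (transport_salg J Z) \<and> (\<forall>\<gamma><\<beta>. salg_comp (Y \<gamma>) w (e \<gamma> \<beta>) = salg_comp (Y \<gamma>) (encode J Z) (u \<gamma>))"
  using colim transport_salg_algebra[OF Z inj] unfolding is_chain_colimit_def by simp
qed (auto simp: transport_salg_inverse[OF Z inj] salg_comp_assoc[OF e[OF less_imp_le order_refl]] u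
  intro: salg_comp_in[OF Y[OF order_refl]] transport_salg_hom[OF Z inj])

section \<open>Generation of pushouts and colimits\<close>

definition salg_closed :: "'t lawvere => ('t, 'a) salg => (nat => 'a set) => bool" where
 "salg_closed T P G \<longleftrightarrow> (\<forall>p. op_closed T (Deg P p) (G p)) \<and> (\<forall>p q. \<forall>\<theta>\<in>delta p q. Str P p q \<theta> 1 ` G q \<subseteq> G p)"

definition sub_salg :: "'t lawvere => ('t, 'a) salg => (nat => 'a set) => ('t, 'a) salg" where
 "sub_salg T P G = \<lparr> Deg = (\<lambda>p. sub_talg T (Deg P p) (G p)),
   Str = (\<lambda>p q \<theta> n. restrict (Str P p q \<theta> n) (Ob (sub_talg T (Deg P q) (G q)) n)) \<rparr>"

lemma sub_talg_Ob: "x \<in> Ob (sub_talg T A G) n \<longleftrightarrow> x \<in> Ob A n \<and> (\<forall>i<n. Act A n 1 (Prj T n i) x \<in> G)"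
 and sub_talg_Act: "Act (sub_talg T A G) = Act A"
 by (auto simp: sub_talg_def)

lemma sub_salg_algebra:
 assumes P: "salgebra T P" and G: "salg_closed T P G"
 shows "salgebra T (sub_salg T P G)"
proof (rule salgebra.intro)
 let ?S = "sub_salg T P G"
 interpret P: salgebra T P by (rule P)
 have op: "op_closed T (Deg P p) (G p)" for p
  using G by (simp add: salg_closed_def)
 have D: "Deg ?S p = sub_talg T (Deg P p) (G p)" for p
  by (simp add: sub_salg_def)
 have S: "Str ?S p q \<theta> n x = Str P p q \<theta> n x" if "x \<in> Ob (Deg ?S q) n" for p q \<theta> n x
  using that by (simp add: sub_salg_def)
 have in_P: "x \<in> Ob (Deg P q) n" if "x \<in> Ob (Deg ?S q) n" for q n x
  using that by (simp add: D sub_talg_Ob)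
 have SG: "Str P p q \<theta> n x \<in> Ob (Deg ?S p) n" if \<theta>: "\<theta> \<in> delta p q" and x: "x \<in> Ob (Deg ?S q) n" for p q \<theta> n x
 proof -
  interpret Q: talgebra T "Deg P q" by (rule P.Deg)
  have "Act (Deg P p) n 1 (Prj T n i) (Str P p q \<theta> n x) \<in> G p" if i: "i < n" for i
  proof -
   have "Act (Deg P q) n 1 (Prj T n i) x \<in> G q"
    using x i by (simp add: D sub_talg_Ob)
   moreover have "Str P p q \<theta> 1 ` G q \<subseteq> G p"
    using G \<theta> by (simp add: salg_closed_def)
   ultimately show ?thesis
    using talg_hom_Act[OF P.Str_hom[OF \<theta>] Q.Prj_in[OF i] in_P[OF x]] by auto
  qed
  then show ?thesis
   using P.Str_in[OF \<theta> in_P[OF x]] by (simp add: D sub_talg_Ob)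
 qed
 show alg: "talgebra T (Deg ?S p)" for p
  unfolding D by (rule sub_talg_algebra[OF P.Deg op])
 show "Str ?S p q \<theta> \<in> talg_hom T (Deg ?S q) (Deg ?S p)" if \<theta>: "\<theta> \<in> delta p q" for \<theta> p q
 proof (rule talg_homI)
  fix m n f x assume f: "f \<in> Hom T m n" and x: "x \<in> Ob (Deg ?S q) m"
  show "Str ?S p q \<theta> n (Act (Deg ?S q) m n f x) = Act (Deg ?S p) m n f (Str ?S p q \<theta> m x)"
   using talg_hom_Act[OF P.Str_hom[OF \<theta>] f in_P[OF x]] talgebra.Act_in[OF alg f x] x by (simp add: S D sub_talg_Act)
 qed (use SG[OF \<theta>] S in \<open>auto simp: sub_salg_def\<close>)
 show "Str ?S p p (restrict id {..p}) n x = x" if "x \<in> Ob (Deg ?S p) n" for p n x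
  using that by (simp add: S P.Str_id in_P)
 show "Str ?S p r (compose {..p} \<psi> \<theta>) n x = Str ?S p q \<theta> n (Str ?S q r \<psi> n x)"
  if "\<theta> \<in> delta p q" "\<psi> \<in> delta q r" "x \<in> Ob (Deg ?S r) n" for \<theta> p q \<psi> r x n
  using that by (simp add: S SG P.Str_comp in_P)
qed

lemma sub_salg_corestrict:
 assumes P: "salgebra T P" and B: "salgebra T B" and h: "h \<in> salg_hom T B P" and G: "\<And>p b. b \<in> Ob (Deg B p) 1 ==> h p 1 b \<in> G p"
 shows "h \<in> salg_hom T B (sub_salg T P G)"
proof (rule salg_homI)
 show hp: "h p \<in> talg_hom T (Deg B p) (Deg (sub_salg T P G) p)" for p
  unfolding sub_salg_def using sub_talg_corestrict[OF salgebra.Deg[OF P] salgebra.Deg[OF B] salg_hom_level[OF h]] G by simp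
 show "h p n (Str B p q \<theta> n x) = Str (sub_salg T P G) p q \<theta> n (h q n x)" if "\<theta> \<in> delta p q" "x \<in> Ob (Deg B q) n" for p q \<theta> n x
  using salg_hom_Str[OF h that] talg_hom_in[OF hp that(2)] by (simp add: sub_salg_def)
qed

lemma sub_salg_incl:
 assumes "h \<in> salg_hom T B (sub_salg T P G)"
 shows "h \<in> salg_hom T B P"
proof (rule salg_homI)
 show "h p \<in> talg_hom T (Deg B p) (Deg P p)" for p
  using sub_talg_incl[of "h p" T "Deg B p" "Deg P p" "G p"] salg_hom_level[OF assms, of p] by (simp add: sub_salg_def)
 show "h p n (Str B p q \<theta> n x) = Str P p q \<theta> n (h q n x)" if "\<theta> \<in> delta p q" "x \<in> Ob (Deg B q) n" for p q \<theta> n x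
  using salg_hom_Str[OF assms that] salg_hom_in[OF assms that(2)] by (simp add: sub_salg_def)
qed

lemma sub_salg_retract:
 assumes P: "salgebra T P" and G: "salg_closed T P G" and w: "w \<in> salg_hom T P (sub_salg T P G)" "w = salg_id P"
 shows "Ob (Deg P p) 1 \<subseteq> G p"
proof
 have "op_closed T (Deg P p) (G p)"
  using G by (simp add: salg_closed_def)
 moreover fix x assume "x \<in> Ob (Deg P p) 1"
 ultimately show "x \<in> G p"
  using salg_hom_in[OF w(1), of x p 1] sub_talg_1[OF salgebra.Deg[OF P], of p "G p"] by (simp add: w(2) salg_id_def sub_salg_def)
qed

text \<open>Both maps into \<open>P\<close> corestrict to the subalgebra given by \<open>G\<close>,
  which yields a morphism \<open>w\<close> from \<open>P\<close> to it. Regarded as an endomorphism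
  of \<open>P\<close>, it is the identity by uniqueness.\<close>

lemma pushout_generated:
 fixes B :: "('t, 'a) salg" and D :: "('t, 'f) salg"
 assumes po: "is_pushout T S D B P i a j c" and alg: "salgebra T B" "salgebra T D" "salgebra T P" and G: "salg_closed T P G"
  and jG: "\<And>p x. x \<in> Ob (Deg B p) 1 ==> j p 1 x \<in> G p" and cG: "\<And>p x. x \<in> Ob (Deg D p) 1 ==> c p 1 x \<in> G p"
 shows "Ob (Deg P p) 1 \<subseteq> G p"
proof -
 let ?J = "\<lambda>p n x. (undefined, [Inl x]) :: 't \<times> ('a + 'f) list"
 have J: "inj_on (?J p n) W" for p n W
  by (simp add: inj_on_def)
 note hom = pushout_homs[OF po]
 obtain w where w: "w \<in> salg_hom T P (sub_salg T P G)" "salg_comp B w j = j" "salg_comp D w c = c"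
  using pushout_embedded[OF po alg sub_salg_algebra[OF alg(3) G] J sub_salg_corestrict[OF alg(3,1) hom(3) jG] sub_salg_corestrict[OF alg(3,2) hom(4) cG] hom(5)]
  by blast
 have "w = salg_id P"
  by (rule ex1_unique[OF pushout_embedded[OF po alg alg(3) J hom(3-5)]])
   (simp_all add: w(2,3) sub_salg_incl[OF w(1)] salg_id_hom[OF alg(3)] salg_comp_id[OF hom(3)] salg_comp_id[OF hom(4)])
 then show ?thesis
  by (rule sub_salg_retract[OF alg(3) G w(1)])
qed

lemma colimit_generated:
 fixes Y :: "'i::wellorder => ('t, 'a) salg"
 assumes colim: "is_chain_colimit T Y e \<beta>" and Y: "\<And>\<gamma>. \<gamma> \<le> \<beta> ==> salgebra T (Y \<gamma>)"
  and e: "\<And>\<gamma> \<delta>. \<gamma> \<le> \<delta> ==> \<delta> \<le> \<beta> ==> e \<gamma> \<delta> \<in> salg_hom T (Y \<gamma>) (Y \<delta>)"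
  and e_comp: "\<And>\<gamma> \<delta>. \<gamma> \<le> \<delta> ==> \<delta> < \<beta> ==> salg_comp (Y \<gamma>) (e \<delta> \<beta>) (e \<gamma> \<delta>) = e \<gamma> \<beta>"
  and G: "salg_closed T (Y \<beta>) G" and eG: "\<And>\<gamma> p x. \<gamma> < \<beta> ==> x \<in> Ob (Deg (Y \<gamma>) p) 1 ==> e \<gamma> \<beta> p 1 x \<in> G p"
 shows "Ob (Deg (Y \<beta>) p) 1 \<subseteq> G p"
proof -
 let ?J = "\<lambda>p n x. (undefined, [(undefined, x)]) :: 't \<times> ('i \<times> 'a) list"
 have J: "inj_on (?J p n) W" for p n W
  by (simp add: inj_on_def)
 note P = Y[OF order_refl] and e\<beta> = e[OF less_imp_le order_refl]
 have "e \<gamma> \<beta> \<in> salg_hom T (Y \<gamma>) (sub_salg T (Y \<beta>) G)" if "\<gamma> < \<beta>" for \<gamma>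
  by (rule sub_salg_corestrict[OF P Y[OF less_imp_le[OF that]] e\<beta>[OF that] eG[OF that]])
 then obtain w where w: "w \<in> salg_hom T (Y \<beta>) (sub_salg T (Y \<beta>) G)" "\<And>\<gamma>. \<gamma> < \<beta> ==> salg_comp (Y \<gamma>) w (e \<gamma> \<beta>) = e \<gamma> \<beta>"
  using colimit_embedded[OF colim Y e sub_salg_algebra[OF P G] J, of "\<lambda>\<gamma>. e \<gamma> \<beta>"] e_comp by blast
 have "w = salg_id (Y \<beta>)"
  by (rule ex1_unique[OF colimit_embedded[OF colim Y e P J e\<beta> e_comp]])
   (simp_all add: w(2) sub_salg_incl[OF w(1)] salg_id_hom[OF P] salg_comp_id[OF e\<beta>])
 then show ?thesis
  by (rule sub_salg_retract[OF P G w(1)])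
qed

subsection \<open>Cofree simplicial algebras\<close>

text \<open>The right adjoint of evaluation in degree \<open>p\<close>; in degree \<open>q\<close> it is the power of \<open>B\<close> by \<open>delta p q\<close>.
 Testing a pushout or a colimit on it shows that these are formed degreewise.\<close>

definition power_talg :: "'d set => ('t, 'b) talg => ('t, 'd => 'b) talg" where
 "power_talg I B = \<lparr> Ob = (\<lambda>n. I \<rightarrow>\<^sub>E Ob B n), Act = (\<lambda>m n f x. \<lambda>i\<in>I. Act B m n f (x i)) \<rparr>"

definition cofree_salg :: "nat => ('t, 'b) talg => ('t, (nat => nat) => 'b) salg" where
 "cofree_salg p B = \<lparr> Deg = (\<lambda>q. power_talg (delta p q) B),
   Str = (\<lambda>q q' \<psi> n. \<lambda>x\<in>delta p q' \<rightarrow>\<^sub>E Ob B n. \<lambda>\<theta>\<in>delta p q. x (compose {..p} \<psi> \<theta>)) \<rparr>"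

lemma power_talg_algebra:
 assumes "talgebra T B"
 shows "talgebra T (power_talg I B)"
proof -
 interpret B: talgebra T B by fact
 show ?thesis
 proof
  fix n :: nat and xs assume xs: "\<And>k. k < n ==> xs k \<in> Ob (power_talg I B) 1"
  have "\<exists>!y. y \<in> Ob B n \<and> (\<forall>k<n. Act B n 1 (Prj T n k) y = xs k i)" if "i \<in> I" for i
   by (rule B.preserves_power) (use xs that in \<open>auto simp: power_talg_def\<close>)
  then obtain y where y: "\<And>i. i \<in> I ==> y i \<in> Ob B n \<and> (\<forall>k<n. Act B n 1 (Prj T n k) (y i) = xs k i)"
   by metis
  show "\<exists>!x. x \<in> Ob (power_talg I B) n \<and> (\<forall>k<n. Act (power_talg I B) n 1 (Prj T n k) x = xs k)"
  proof (intro ex1I[of _ "restrict y I"] conjI allI impI)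
   show "restrict y I \<in> Ob (power_talg I B) n"
    using y by (simp add: power_talg_def)
   show "Act (power_talg I B) n 1 (Prj T n k) (restrict y I) = xs k" if "k < n" for k
    using y that xs[OF that] by (auto simp: power_talg_def fun_eq_iff PiE_iff extensional_def)
   fix x assume x: "x \<in> Ob (power_talg I B) n \<and> (\<forall>k<n. Act (power_talg I B) n 1 (Prj T n k) x = xs k)"
   show "x = restrict y I"
   proof
    fix i
    show "x i = restrict y I i"
    proof (cases "i \<in> I")
     case True
     have "Act B n 1 (Prj T n k) (x i) = Act B n 1 (Prj T n k) (y i)" if "k < n" for k
     proof -
      have "Act (power_talg I B) n 1 (Prj T n k) x = xs k"
       using x that by blast
      moreover have "Act (power_talg I B) n 1 (Prj T n k) x i = Act B n 1 (Prj T n k) (x i)"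
       using True by (simp add: power_talg_def)
      moreover have "Act B n 1 (Prj T n k) (y i) = xs k i"
       using y[OF True] that by blast
      ultimately show ?thesis by simp
     qed
     note eq = this
     have "x i \<in> Ob B n"
      using conjunct1[OF x] True unfolding power_talg_def by (simp add: PiE_iff)
     then have "x i = y i"
      by (rule B.Ob_eqI[OF _ conjunct1[OF y[OF True]] eq])
     then show ?thesis
      using True by simp
    next
     case False
     then show ?thesis
      using conjunct1[OF x] by (auto simp: power_talg_def PiE_iff extensional_def)
    qed
   qed
  qed
 qed (auto simp: power_talg_def PiE_iff extensional_def fun_eq_iff B.Act_in B.Act_Idn B.Act_Cmp)
qed

lemma delta_id_right: "\<theta> \<in> delta p q ==> compose {..p} (restrict id {..q}) \<theta> = \<theta>"
 and delta_assoc: "\<theta> \<in> delta p q ==> compose {..p} \<chi> (compose {..p} \<psi> \<theta>) = compose {..p} (compose {..q} \<chi> \<psi>) \<theta>"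
 by (auto simp: delta_def compose_def fun_eq_iff PiE_iff extensional_def Pi_iff)

lemma cofree_salg_algebra:
 assumes "talgebra T B"
 shows "salgebra T (cofree_salg p B)"
proof (rule salgebra.intro)
 let ?Z = "cofree_salg p B"
 interpret B: talgebra T B by fact
 show "talgebra T (Deg ?Z q)" for q
  using power_talg_algebra[OF assms] by (simp add: cofree_salg_def)
 show "Str ?Z q r \<psi> \<in> talg_hom T (Deg ?Z r) (Deg ?Z q)" if "\<psi> \<in> delta q r" for \<psi> q r
 proof (rule talg_homI)
  fix m n f x assume "f \<in> Hom T m n" "x \<in> Ob (Deg ?Z r) m"
  then show "Str ?Z q r \<psi> n (Act (Deg ?Z r) m n f x) =
    Act (Deg ?Z q) m n f (Str ?Z q r \<psi> m x)"
   using that B.Act_in by (auto simp: cofree_salg_def power_talg_def fun_eq_iff PiE_iff)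
 qed (use that in \<open>auto simp: cofree_salg_def power_talg_def\<close>)
 show "Str ?Z q q (restrict id {..q}) n x = x" if "x \<in> Ob (Deg ?Z q) n" for q n x
  using that by (auto simp: cofree_salg_def power_talg_def fun_eq_iff delta_id_right PiE_iff extensional_def)
 show "Str ?Z q s (compose {..q} \<psi> \<theta>) n x = Str ?Z q r \<theta> n (Str ?Z r s \<psi> n x)"
  if "\<theta> \<in> delta q r" "\<psi> \<in> delta r s" "x \<in> Ob (Deg ?Z s) n" for \<theta> q r \<psi> s x n
  using that by (auto simp: cofree_salg_def power_talg_def fun_eq_iff delta_assoc PiE_iff)
qed

definition cotranspose :: "nat => ('t, 'a) salg => (nat => 'a => 'b) => nat => nat => 'a => (nat => nat) => 'b" where
 "cotranspose p Y h = (\<lambda>q n. \<lambda>x\<in>Ob (Deg Y q) n. \<lambda>\<theta>\<in>delta p q. h n (Str Y p q \<theta> n x))"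

lemma cotranspose_hom:
 assumes Y: "salgebra T Y" and B: "talgebra T B" and h: "h \<in> talg_hom T (Deg Y p) B"
 shows "cotranspose p Y h \<in> salg_hom T Y (cofree_salg p B)"
proof (rule salg_homI)
 interpret Y: salgebra T Y by (rule Y)
 show "cotranspose p Y h q \<in> talg_hom T (Deg Y q) (Deg (cofree_salg p B) q)" for q
 proof (rule talg_homI)
  fix m n f x assume f: "f \<in> Hom T m n" and x: "x \<in> Ob (Deg Y q) m"
  then show "cotranspose p Y h q n (Act (Deg Y q) m n f x) = Act (Deg (cofree_salg p B) q) m n f (cotranspose p Y h q m x)"
   using talgebra.Act_in[OF Y.Deg f x] by (auto simp: cotranspose_def cofree_salg_def power_talg_def fun_eq_iff
    talg_hom_Act[OF Y.Str_hom f x] talg_hom_Act[OF h f Y.Str_in])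
 qed (auto simp: cotranspose_def cofree_salg_def power_talg_def intro!: talg_hom_in[OF h] Y.Str_in)
 show "cotranspose p Y h q n (Str Y q r \<psi> n x) = Str (cofree_salg p B) q r \<psi> n (cotranspose p Y h r n x)"
  if "\<psi> \<in> delta q r" "x \<in> Ob (Deg Y r) n" for q r \<psi> n x
  using that by (auto simp: cotranspose_def cofree_salg_def fun_eq_iff Y.Str_in Y.Str_comp PiE_iff intro!: talg_hom_in[OF h] Y.Str_in)
qed

lemma cofree_eval_hom:
 assumes Y: "salgebra T Y" and B: "talgebra T B" and w: "w \<in> salg_hom T Y (cofree_salg p B)"
 shows "(\<lambda>n. \<lambda>x\<in>Ob (Deg Y p) n. w p n x (restrict id {..p})) \<in> talg_hom T (Deg Y p) B"
proof (rule talg_homI)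
 have w_in: "w p n x \<in> delta p p \<rightarrow>\<^sub>E Ob B n" if "x \<in> Ob (Deg Y p) n" for n x
  using salg_hom_in[OF w that] by (simp add: cofree_salg_def power_talg_def)
 show "(\<lambda>x\<in>Ob (Deg Y p) n. w p n x (restrict id {..p})) x \<in> Ob B n" if "x \<in> Ob (Deg Y p) n" for n x
  using w_in[OF that] that by auto
 show "(\<lambda>x\<in>Ob (Deg Y p) n. w p n x (restrict id {..p})) (Act (Deg Y p) m n f x) = Act B m n f ((\<lambda>x\<in>Ob (Deg Y p) m. w p m x (restrict id {..p})) x)"
  if f: "f \<in> Hom T m n" and x: "x \<in> Ob (Deg Y p) m" for m n f x
  using talg_hom_Act[OF salg_hom_level[OF w] f x] talgebra.Act_in[OF salgebra.Deg[OF Y] f x] x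
  by (simp add: cofree_salg_def power_talg_def)
qed simp

lemma finite_delta: "finite (delta p q)"
 by (rule finite_subset[of _ "{..p} \<rightarrow>\<^sub>E {..q}"]) (auto simp: delta_def finite_PiE)

text \<open>This encodes cofree simplicial algebras in the type \<open>'t\<close> of arrows, which is among the types over
 which the universal properties of pushouts and colimits range.\<close>

lemma (in lawvere_theory) power_embedding:
 fixes I :: "'d set"
 assumes "finite I"
 shows "\<exists>J :: ('d => 't) => 't. inj_on J (I \<rightarrow>\<^sub>E Hom T k n)"
proof -
 obtain l where l: "set l = I"
  using finite_list[OF assms] by blast
 \<comment> \<open>All components of all coordinates in one list, which is then tupled to a single
   arrow. The lengths of the pieces depend on \<open>n\<close> alone, so concatenation loses
   nothing.\<close>
 define c where "c x = concat (map (\<lambda>i. map (\<lambda>m. Cmp T (Prj T n m) (x i)) [0..<n]) l)" for x :: "'d => 't"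
 define J where "J x = tuple T (represented T k) (c x)" for x
 have c: "set (c x) \<subseteq> Hom T k 1" if "x \<in> I \<rightarrow>\<^sub>E Hom T k n" for x
  using that l Cmp_in[OF _ Prj_in] by (auto simp: c_def PiE_iff)
 have len: "length (c x) = length (c y)" for x y
  unfolding c_def length_concat map_map comp_def by simp
 have "inj_on J (I \<rightarrow>\<^sub>E Hom T k n)"
 proof (rule inj_onI)
  fix x y assume x: "x \<in> I \<rightarrow>\<^sub>E Hom T k n" and y: "y \<in> I \<rightarrow>\<^sub>E Hom T k n" and eq: "J x = J y"
  have "c x = c y"
  proof (rule nth_equalityI[OF len])
   fix m assume "m < length (c x)"
   then show "c x ! m = c y ! m"
    using Prj_tuple_arrow[OF c[OF x], of m] Prj_tuple_arrow[OF c[OF y], of m] eq len[of x y] by (simp add: J_def)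
  qed
  then have "map (\<lambda>i. map (\<lambda>m. Cmp T (Prj T n m) (x i)) [0..<n]) l = map (\<lambda>i. map (\<lambda>m. Cmp T (Prj T n m) (y i)) [0..<n]) l"
   unfolding c_def by (rule concat_injective) (auto simp: set_zip)
  then have xy: "Cmp T (Prj T n m) (x i) = Cmp T (Prj T n m) (y i)" if "i \<in> I" "m < n" for i m
   using that l by auto
  show "x = y"
  proof (rule PiE_ext[OF x y])
   fix i assume i: "i \<in> I"
   show "x i = y i"
    using talgebra.Ob_eqI[OF represented_talgebra[of k], of "x i" n "y i"] x y i xy by auto
  qed
 qed
 then show ?thesis by blast
qed

lemma (in lawvere_theory) cofree_embedding:
 "\<exists>J :: nat => nat => ((nat => nat) => 't) => 't \<times> 'l list. \<forall>q n. inj_on (J q n) (Ob (Deg (cofree_salg p (represented T k)) q) n)"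
proof -
 have "\<exists>J :: ((nat => nat) => 't) => 't. inj_on J (delta p q \<rightarrow>\<^sub>E Hom T k n)" for q n
  by (rule power_embedding[OF finite_delta])
 then obtain J :: "nat => nat => ((nat => nat) => 't) => 't" where "\<And>q n. inj_on (J q n) (delta p q \<rightarrow>\<^sub>E Hom T k n)"
  by metis
 then have "\<forall>q n. inj_on (\<lambda>x. (J q n x, [] :: 'l list)) (Ob (Deg (cofree_salg p (represented T k)) q) n)"
  by (simp add: cofree_salg_def power_talg_def inj_on_def)
 then show ?thesis
  by (intro exI[of _ "\<lambda>q n x. (J q n x, [] :: 'l list)"])
qed

text \<open>A cocone in degree \<open>p\<close> is transposed to the cofree simplicial algebra, the
  pushout property is used there, and evaluation at the identity of [p] transposes back. Represented
  targets are the ones on which \<open>free_onI\<close> tests, and their cofree simplicial algebras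
  embed into the test type, as the sets of operators are finite.\<close>

lemma (in lawvere_theory) pushout_level:
 fixes B :: "('t, 'a) salg" and D :: "('t, 'f) salg"
 assumes po: "is_pushout T S D B P i a j c" and alg: "salgebra T S" "salgebra T B" "salgebra T D" "salgebra T P"
  and h: "h \<in> talg_hom T (Deg B p) (represented T k)" and g: "g \<in> talg_hom T (Deg D p) (represented T k)"
  and hg: "\<And>n x. x \<in> Ob (Deg S p) n ==> h n (a p n x) = g n (i p n x)"
 shows "\<exists>w\<in>talg_hom T (Deg P p) (represented T k). (\<forall>n. \<forall>x\<in>Ob (Deg B p) n. w n (j p n x) = h n x) \<and>
  (\<forall>n. \<forall>x\<in>Ob (Deg D p) n. w n (c p n x) = g n x)"
proof -
 let ?R = "represented T k"
 note R = represented_talgebra[of k] and hom = pushout_homs[OF po]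
 obtain J :: "nat => nat => ((nat => nat) => 't) => 't \<times> ('a + 'f) list" where J: "\<And>q n. inj_on (J q n) (Ob (Deg (cofree_salg p ?R) q) n)"
  using cofree_embedding[of p k] by blast
 have "salg_comp S (cotranspose p B h) a = salg_comp S (cotranspose p D g) i"
 proof (rule salg_comp_eqI)
  fix q n x assume x: "x \<in> Ob (Deg S q) n"
  have "h n (Str B p q \<theta> n (a q n x)) = g n (Str D p q \<theta> n (i q n x))" if \<theta>: "\<theta> \<in> delta p q" for \<theta>
   using hg[OF salgebra.Str_in[OF alg(1) \<theta> x]] salg_hom_Str[OF hom(1) \<theta> x] salg_hom_Str[OF hom(2) \<theta> x] by simp
  then show "cotranspose p B h q n (a q n x) = cotranspose p D g q n (i q n x)"
   using salg_hom_in[OF hom(1) x] salg_hom_in[OF hom(2) x] by (auto simp: cotranspose_def fun_eq_iff)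
 qed
 then obtain w where w: "w \<in> salg_hom T P (cofree_salg p ?R)" "salg_comp B w j = cotranspose p B h" "salg_comp D w c = cotranspose p D g"
  using pushout_embedded[OF po alg(2-4) cofree_salg_algebra[OF R] J cotranspose_hom[OF alg(2) R h] cotranspose_hom[OF alg(3) R g]] by blast
 show ?thesis
  by (rule bexI[OF _ cofree_eval_hom[OF alg(4) R w(1)]])
   (use salg_hom_in[OF hom(3)] salg_hom_in[OF hom(4)] in
    \<open>auto simp: salg_comp_eqD[OF w(2)] salg_comp_eqD[OF w(3)] cotranspose_def salgebra.Str_id[OF alg(2)] salgebra.Str_id[OF alg(3)]\<close>)
qed

lemma (in lawvere_theory) colimit_level:
 fixes Y :: "'i::wellorder => ('t, 'a) salg"
 assumes colim: "is_chain_colimit T Y e \<beta>" and Y: "\<And>\<gamma>. \<gamma> \<le> \<beta> ==> salgebra T (Y \<gamma>)"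
  and e: "\<And>\<gamma> \<delta>. \<gamma> \<le> \<delta> ==> \<delta> \<le> \<beta> ==> e \<gamma> \<delta> \<in> salg_hom T (Y \<gamma>) (Y \<delta>)"
  and h: "\<And>\<gamma>. \<gamma> < \<beta> ==> h \<gamma> \<in> talg_hom T (Deg (Y \<gamma>) p) (represented T k)"
  and hh: "\<And>\<gamma> \<delta> n x. \<gamma> \<le> \<delta> ==> \<delta> < \<beta> ==> x \<in> Ob (Deg (Y \<gamma>) p) n ==> h \<delta> n (e \<gamma> \<delta> p n x) = h \<gamma> n x"
 shows "\<exists>w\<in>talg_hom T (Deg (Y \<beta>) p) (represented T k). \<forall>\<gamma><\<beta>. \<forall>n. \<forall>x\<in>Ob (Deg (Y \<gamma>) p) n. w n (e \<gamma> \<beta> p n x) = h \<gamma> n x"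
proof -
 let ?R = "represented T k" and ?u = "\<lambda>\<gamma>. cotranspose p (Y \<gamma>) (h \<gamma>)"
 note R = represented_talgebra[of k]
 obtain J :: "nat => nat => ((nat => nat) => 't) => 't \<times> ('i \<times> 'a) list" where J: "\<And>q n. inj_on (J q n) (Ob (Deg (cofree_salg p ?R) q) n)"
  using cofree_embedding[of p k] by blast
 have u: "?u \<gamma> \<in> salg_hom T (Y \<gamma>) (cofree_salg p ?R)" if "\<gamma> < \<beta>" for \<gamma>
  by (rule cotranspose_hom[OF Y[OF less_imp_le[OF that]] R h[OF that]])
 have "salg_comp (Y \<gamma>) (?u \<delta>) (e \<gamma> \<delta>) = ?u \<gamma>" if d: "\<gamma> \<le> \<delta>" "\<delta> < \<beta>" for \<gamma> \<delta>
 proof (rule salg_comp_eq_homI[OF u])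
  fix q n x assume x: "x \<in> Ob (Deg (Y \<gamma>) q) n"
  note ed = e[OF d(1) less_imp_le[OF d(2)]]
  have "\<gamma> \<le> \<beta>"
   using d by auto
  then have "h \<delta> n (Str (Y \<delta>) p q \<theta> n (e \<gamma> \<delta> q n x)) = h \<gamma> n (Str (Y \<gamma>) p q \<theta> n x)" if \<theta>: "\<theta> \<in> delta p q" for \<theta>
   using hh[OF d salgebra.Str_in[OF Y \<theta> x]] salg_hom_Str[OF ed \<theta> x] by simp
  then show "?u \<delta> q n (e \<gamma> \<delta> q n x) = ?u \<gamma> q n x"
   using salg_hom_in[OF ed x] x by (auto simp: cotranspose_def fun_eq_iff)
 qed (use d in auto)
 then obtain w where w: "w \<in> salg_hom T (Y \<beta>) (cofree_salg p ?R)" "\<And>\<gamma>. \<gamma> < \<beta> ==> salg_comp (Y \<gamma>) w (e \<gamma> \<beta>) = ?u \<gamma>"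
  using colimit_embedded[OF colim Y e cofree_salg_algebra[OF R] J u] by blast
 then show ?thesis
  using salg_hom_in[OF e[OF less_imp_le order_refl]]
  by (intro bexI[OF _ cofree_eval_hom[OF Y[OF order_refl] R w(1)]])
   (auto simp: salg_comp_eqD[OF w(2)] cotranspose_def salgebra.Str_id[OF Y])
qed

section \<open>Disks and spheres\<close>

lemma simplex_comp: "x \<in> simplex k q ==> \<theta> \<in> delta p q ==> compose {..p} x \<theta> \<in> simplex k p"
 by (auto simp: simplex_def delta_def compose_def mono_on_def PiE_iff)

lemma compose_image: "\<theta> \<in> delta p q ==> compose {..p} x \<theta> ` {..p} \<subseteq> x ` {..q}"
 by (auto simp: delta_def compose_def PiE_iff)

lemma simplex_id: "x \<in> simplex k p ==> compose {..p} x (restrict id {..p}) = x"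
 by (auto simp: simplex_def compose_def fun_eq_iff PiE_iff extensional_def)

definition disk_cells :: "nat => nat => (nat => nat) set" where
 "disk_cells k p = {x \<in> simplex (Suc k) p. {1..k} \<subseteq> x ` {..p}}"

definition sphere_cells :: "nat => nat => (nat => nat) set" where
 "sphere_cells k p = {x \<in> simplex k p. x ` {..p} = {..<k}}"

text \<open>The simplices of the disk outside the image of the sphere; these index the generators
  that a cell contributes.\<close>

definition onto_cells :: "nat => nat => (nat => nat) set" where
 "onto_cells k p = {x \<in> simplex (Suc k) p. x ` {..p} = {..k}}"

lemma disk_simps: "Smp (disk k) p = insert None (Some ` disk_cells k p)" "Bas (disk k) p = None"
 "Smp (disk k) p - {Bas (disk k) p} = Some ` disk_cells k p"
 "w \<in> simplex (Suc k) q ==> \<theta> \<in> delta p q ==>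
  Opr (disk k) p q \<theta> (Some w) = (if compose {..p} w \<theta> \<in> disk_cells k p then Some (compose {..p} w \<theta>) else None)"
 using simplex_comp[of w "Suc k" q \<theta> p] by (auto simp: disk_def simplex_quotient_def disk_cells_def)

lemma sphere_simps: "Smp (sphere k) p = insert None (Some ` sphere_cells k p)" "Bas (sphere k) p = None"
 "Smp (sphere k) p - {Bas (sphere k) p} = Some ` sphere_cells k p"
 "w \<in> simplex k q ==> \<theta> \<in> delta p q ==>
  Opr (sphere k) p q \<theta> (Some w) = (if compose {..p} w \<theta> \<in> sphere_cells k p then Some (compose {..p} w \<theta>) else None)"
 using simplex_comp[of w k q \<theta> p] by (auto simp: sphere_def simplex_quotient_def sphere_cells_def)

text \<open>A simplex outside the base point of the disk reaches all vertices except possibly 0. If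
  it misses 0, its vertices can be lowered by one.\<close>

lemma disk_cells_cases:
 assumes "w \<in> disk_cells k p" "w \<notin> onto_cells k p"
 obtains v where "v \<in> sphere_cells k p" "w = compose {..p} Suc v"
proof -
 have w: "w \<in> simplex (Suc k) p" "{1..k} \<subseteq> w ` {..p}" "w ` {..p} \<noteq> {..k}"
  using assms by (auto simp: disk_cells_def onto_cells_def)
 have le: "w i \<le> k" if "i \<le> p" for i
  using w(1) that by (force simp: simplex_def PiE_iff)
 have "w i \<noteq> 0" if "i \<le> p" for i
 proof
  assume "w i = 0"
  then have "0 \<in> w ` {..p}"
   using that by (metis atMost_iff image_eqI)
  moreover have "{..k} = insert 0 {1..k}"
   by auto
  ultimately have "w ` {..p} = {..k}"
   using w(2) le by auto
  then show False
   using w(3) by simp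
 qed
 then have pos: "Suc (w i - 1) = w i" if "i \<le> p" for i
  using that by simp
 define v where "v = (\<lambda>i\<in>{..p}. w i - 1)"
 have "v \<in> sphere_cells k p"
 proof -
  have "v i < k" if "i \<le> p" for i
   using pos[OF that] le[OF that] that by (simp add: v_def)
  moreover have "mono_on {..p} v"
   using w(1) by (auto simp: v_def simplex_def mono_on_def intro: diff_le_mono)
  moreover have "j \<in> v ` {..p}" if "j < k" for j
  proof -
   have "Suc j \<in> w ` {..p}"
    using w(2) that by auto
   then obtain i where "i \<le> p" "w i = Suc j"
    by auto
   then show ?thesis
    by (intro image_eqI[of _ _ i]) (auto simp: v_def)
  qed
  ultimately show ?thesis
   by (auto simp: sphere_cells_def simplex_def v_def)
 qed
 moreover have "w = compose {..p} Suc v"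
  using w(1) pos by (auto simp: v_def compose_def fun_eq_iff simplex_def PiE_iff extensional_def)
 ultimately show thesis
  by (rule that)
qed

lemma onto_disk: "onto_cells k p \<subseteq> disk_cells k p"
 by (auto simp: onto_cells_def disk_cells_def)

lemma sphere_disk_cell: "v \<in> sphere_cells k p ==> compose {..p} Suc v \<in> disk_cells k p"
proof -
 assume v: "v \<in> sphere_cells k p"
 have "j \<in> compose {..p} Suc v ` {..p}" if "1 \<le> j" "j \<le> k" for j
 proof -
  have "j - 1 \<in> v ` {..p}"
   using v that by (auto simp: sphere_cells_def)
  then obtain i where "i \<le> p" "v i = j - 1"
   by auto
  then show ?thesis
   using that by (intro image_eqI[of _ _ i]) (auto simp: compose_def)
 qed
 moreover have "compose {..p} Suc v \<in> simplex (Suc k) p"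
  using v by (auto simp: sphere_cells_def simplex_def compose_def mono_on_def PiE_iff)
 ultimately show ?thesis
  by (auto simp: disk_cells_def)
qed

lemma sphere_cells_not_onto:
 assumes "w \<in> simplex k q" "w \<notin> sphere_cells k q" "\<theta> \<in> delta p q"
 shows "compose {..p} w \<theta> \<notin> sphere_cells k p"
proof -
 have "w ` {..q} \<subseteq> {..<k}"
  using assms(1) by (auto simp: simplex_def PiE_iff)
 then show ?thesis
  using assms compose_image[OF assms(3), of w] by (auto simp: sphere_cells_def)
qed

lemma disk_cells_simplex: "w \<in> disk_cells k p ==> w \<in> simplex (Suc k) p"
 and sphere_cells_simplex: "w \<in> sphere_cells k p ==> w \<in> simplex k p"
 by (auto simp: disk_cells_def sphere_cells_def)

locale pointed_simplicial_set =
 fixes D :: "'x psset"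
 assumes Opr_in: "\<theta> \<in> delta p q ==> b \<in> Smp D q - {Bas D q} ==> Opr D p q \<theta> b \<in> Smp D p"
  and Opr_Bas: "\<theta> \<in> delta p q ==> Opr D p q \<theta> (Bas D q) = Bas D p"
  and Opr_id: "b \<in> Smp D p - {Bas D p} ==> Opr D p p (restrict id {..p}) b = b"
  and Opr_comp: "\<theta> \<in> delta p q ==> \<psi> \<in> delta q r ==> b \<in> Smp D r - {Bas D r} ==>
   Opr D p r (compose {..p} \<psi> \<theta>) b = Opr D p q \<theta> (Opr D q r \<psi> b)"

lemma simplex_quotient_pointed:
 assumes "\<And>p q \<theta> x. \<theta> \<in> delta p q ==> x \<in> L q ==> compose {..p} x \<theta> \<in> L p"
 shows "pointed_simplicial_set (simplex_quotient k L)"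
 by unfold_locales (auto simp: simplex_quotient_def assms simplex_comp simplex_id delta_assoc split: if_splits)

lemma disk_pointed: "pointed_simplicial_set (disk k)"
 unfolding disk_def
proof (rule simplex_quotient_pointed)
 fix p q \<theta> and x :: "nat => nat" assume "\<theta> \<in> delta p q" "x \<in> {x \<in> simplex (Suc k) q. \<not> {1..k} \<subseteq> x ` {..q}}"
 then show "compose {..p} x \<theta> \<in> {x \<in> simplex (Suc k) p. \<not> {1..k} \<subseteq> x ` {..p}}"
  using simplex_comp[of x "Suc k" q \<theta> p] compose_image[of \<theta> p q x] by blast
qed

lemma sphere_pointed: "pointed_simplicial_set (sphere k)"
 unfolding sphere_def
proof (rule simplex_quotient_pointed)
 fix p q \<theta> x assume "\<theta> \<in> delta p q" "x \<in> {x \<in> simplex k q. x ` {..q} \<noteq> {..<k}}"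
 then show "compose {..p} x \<theta> \<in> {x \<in> simplex k p. x ` {..p} \<noteq> {..<k}}"
  using sphere_cells_not_onto[of x k q \<theta> p] simplex_comp[of x k q \<theta> p] by (simp add: sphere_cells_def)
qed

context free_chains
begin

lemma free_salg_simps: "Deg (free_salg R T F \<eta> D) p = FC D p"
 "Str (free_salg R T F \<eta> D) p q \<theta> = free_map T F \<eta> (R.rchains D q) (R.rchains D p) (chain_map R D q D p (Opr D p q \<theta>))"
 by (simp_all add: free_salg_def)

lemma FC_hom_eqI:
 assumes "talgebra T B" "h \<in> talg_hom T (FC D p) B" "h' \<in> talg_hom T (FC D p) B" "\<And>b. b \<in> basis D p ==> h 1 (gen D p b) = h' 1 (gen D p b)"
 shows "h = h'"
proof (rule talg_hom_eqI[OF FC assms(1-3)])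
 fix a assume "a \<in> Ob (FC D p) 1"
 then show "h 1 a = h' 1 a"
  using clone_hom_eq_on_generated[OF talg_hom_clone[OF FC assms(1,2)] talg_hom_clone[OF FC assms(1,3)], where x = "gen D p" and J = "basis D p" and a = a]
   free_onD(1)[OF FC_free, of D p] free_onD(2)[OF FC_free, of a D p] assms(4) by blast
qed

context
 fixes D :: "'x psset"
 assumes D: "pointed_simplicial_set D"
begin

interpretation pointed_simplicial_set D by (rule D)

lemma free_salg_Str:
 assumes "\<theta> \<in> delta p q"
 shows "Str (free_salg R T F \<eta> D) p q \<theta> \<in> talg_hom T (FC D q) (FC D p)"
  "b \<in> basis D q ==> Str (free_salg R T F \<eta> D) p q \<theta> 1 (gen D q b) =
   (if Opr D p q \<theta> b = Bas D p then \<zero>\<^bsub>U (FC D p)\<^esub> else gen D p (Opr D p q \<theta> b))"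
 unfolding free_salg_simps using free_map_chain[of D q "Opr D p q \<theta>" D p, OF Opr_in[OF assms]] by blast+

lemma free_salg_algebra: "salgebra T (free_salg R T F \<eta> D)"
proof (rule salgebra.intro)
 let ?A = "free_salg R T F \<eta> D"
 show "talgebra T (Deg ?A p)" for p
  unfolding free_salg_simps by (rule FC)
 show Str: "Str ?A p q \<theta> \<in> talg_hom T (Deg ?A q) (Deg ?A p)" if "\<theta> \<in> delta p q" for \<theta> p q
  using free_salg_Str(1)[OF that] by (simp add: free_salg_simps)
 have "Str ?A p p (restrict id {..p}) = (\<lambda>n. restrict id (Ob (FC D p) n))" for p
  by (rule FC_hom_eqI[OF FC free_salg_Str(1)[OF delta_id] talg_id_hom[OF FC]])
   (use gen_in in \<open>auto simp: free_salg_Str(2)[OF delta_id] Opr_id\<close>)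
 then show "Str ?A p p (restrict id {..p}) n x = x" if "x \<in> Ob (Deg ?A p) n" for p n x
  using that by (simp add: free_salg_simps(1))
 fix \<theta> p q \<psi> r x n assume \<theta>: "\<theta> \<in> delta p q" and \<psi>: "\<psi> \<in> delta q r" and x: "x \<in> Ob (Deg ?A r) n"
 have "Str ?A p r (compose {..p} \<psi> \<theta>) = talg_comp (FC D r) (Str ?A p q \<theta>) (Str ?A q r \<psi>)"
 proof (rule FC_hom_eqI[OF FC free_salg_Str(1)[OF delta_comp[OF \<theta> \<psi>]] talg_comp_in[OF FC free_salg_Str(1)[OF \<psi>] free_salg_Str(1)[OF \<theta>]]])
  fix b assume b: "b \<in> basis D r"
  have zero: "Str ?A p q \<theta> 1 \<zero>\<^bsub>U (FC D q)\<^esub> = \<zero>\<^bsub>U (FC D p)\<^esub>"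
   by (rule clone_hom_ops(3)[OF talg_hom_clone[OF FC FC free_salg_Str(1)[OF \<theta>]]])
  show "Str ?A p r (compose {..p} \<psi> \<theta>) 1 (gen D r b) = talg_comp (FC D r) (Str ?A p q \<theta>) (Str ?A q r \<psi>) 1 (gen D r b)"
   using b gen_in[OF b] Opr_in[OF \<psi> b] Opr_Bas[OF \<theta>]
   by (auto simp: talg_comp_apply free_salg_Str(2)[OF \<psi> b] free_salg_Str(2)[OF \<theta>] free_salg_Str(2)[OF delta_comp[OF \<theta> \<psi>] b] Opr_comp[OF \<theta> \<psi> b] zero)
 qed
 then show "Str ?A p r (compose {..p} \<psi> \<theta>) n x = Str ?A p q \<theta> n (Str ?A q r \<psi> n x)"
  using x by (simp add: talg_comp_apply free_salg_simps(1))
qed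

end

end

section \<open>The generators of a cellular simplicial algebra\<close>

locale cell_algebra = fermat_theory_over R T \<iota> \<kappa> + free_chains R T \<kappa> F \<eta> + cellular_structure R T F \<eta> C
 for R :: "('r, 'z) ring_scheme" and T :: "'t lawvere" and \<iota> \<kappa>
  and F :: "('r, (nat => nat) option => 'r) module => ('t, 'f) talg"
  and \<eta> :: "('r, (nat => nat) option => 'r) module => ((nat => nat) option => 'r) => 'f"
  and C :: "('i::wellorder, 't, 'a, 'f) cells"
begin

abbreviation "FS k \<equiv> free_salg R T F \<eta> (sphere k)"
abbreviation "FD k \<equiv> free_salg R T F \<eta> (disk k)"

lemma FD: "salgebra T (FD k)"
 by (rule free_salg_algebra[OF disk_pointed])

lemma FS: "salgebra T (FS k)"
 by (rule free_salg_algebra[OF sphere_pointed])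

lemma FD_Str:
 assumes \<theta>: "\<theta> \<in> delta p q" and w: "w \<in> disk_cells k q"
 shows "Str (FD k) p q \<theta> 1 (gen (disk k) q (Some w)) =
  (if compose {..p} w \<theta> \<in> disk_cells k p then gen (disk k) p (Some (compose {..p} w \<theta>)) else \<zero>\<^bsub>U (FC (disk k) p)\<^esub>)"
proof -
 have b: "Some w \<in> basis (disk k) q"
  using w by (simp add: disk_simps(3))
 have "Str (FD k) p q \<theta> 1 (gen (disk k) q (Some w)) =
  (if Opr (disk k) p q \<theta> (Some w) = Bas (disk k) p then \<zero>\<^bsub>U (FC (disk k) p)\<^esub> else gen (disk k) p (Opr (disk k) p q \<theta> (Some w)))"
  by (rule free_salg_Str(2)[OF disk_pointed \<theta> b])
 then show ?thesis
  by (simp add: disk_simps disk_cells_simplex[OF w] \<theta>)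
qed

lemma cofibration:
 "generating_cofibration R T F \<eta> k p \<in> talg_hom T (FC (sphere k) p) (FC (disk k) p)"
 "v \<in> sphere_cells k p ==> generating_cofibration R T F \<eta> k p 1 (gen (sphere k) p (Some v)) = gen (disk k) p (Some (compose {..p} Suc v))"
proof -
 have m: "sphere_disk p b \<in> Smp (disk k) p" if "b \<in> basis (sphere k) p" for b
  using that by (auto simp: sphere_simps(3) disk_simps(1) sphere_disk_def sphere_disk_cell)
 show "generating_cofibration R T F \<eta> k p \<in> talg_hom T (FC (sphere k) p) (FC (disk k) p)"
  unfolding generating_cofibration_def by (rule free_map_chain(1)[OF m])
 show "generating_cofibration R T F \<eta> k p 1 (gen (sphere k) p (Some v)) = gen (disk k) p (Some (compose {..p} Suc v))"
  if "v \<in> sphere_cells k p"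
 proof -
  have "Some v \<in> basis (sphere k) p"
   using that by (simp add: sphere_simps(3))
  then show ?thesis
   unfolding generating_cofibration_def
   by (subst free_map_chain(2)[of "sphere k" p "sphere_disk p" "disk k" p, OF m]) (auto simp: sphere_disk_def disk_simps(2))
 qed
qed

lemma gen_disk_in: "w \<in> disk_cells k p ==> gen (disk k) p (Some w) \<in> Ob (Deg (FD k) p) 1"
 unfolding free_salg_simps by (rule gen_in) (simp add: disk_simps(3))

lemma gen_sphere_in: "v \<in> sphere_cells k p ==> gen (sphere k) p (Some v) \<in> Ob (Deg (FS k) p) 1"
 unfolding free_salg_simps by (rule gen_in) (simp add: sphere_simps(3))

lemma FD_generated: "Ob (Deg (FD k) p) 1 \<subseteq> generated T (Deg (FD k) p) (Some ` disk_cells k p) (gen (disk k) p)"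
 using FC_generated[of "disk k" p] by (simp add: free_salg_simps disk_simps(3))

definition cells_below :: "'i => nat => ('i \<times> (nat => nat)) set" where
 "cells_below \<beta> p = {(\<gamma>, w). \<gamma> < \<beta> \<and> w \<in> onto_cells (Dim C \<gamma>) p}"

text \<open>Formed for all simplices of the disk. Those that are not onto give elements that come
  through the attaching map from an earlier stage, so \<open>cells_below\<close> retains only the
  onto ones.\<close>

definition cell_gen :: "'i => nat => 'i \<times> (nat => nat) => 'a" where
 "cell_gen \<beta> p = (\<lambda>(\<gamma>, w). Trans C (next_stage \<gamma>) \<beta> p 1 (Chr C \<gamma> p 1 (gen (disk (Dim C \<gamma>)) p (Some w))))"

abbreviation "D\<^sub>p \<beta> p \<equiv> Deg (Stage C \<beta>) p"

lemma successor_homs: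
 assumes "\<gamma> < Last C"
 shows "salgebra T (Stage C (next_stage \<gamma>))" "Att C \<gamma> \<in> salg_hom T (FS (Dim C \<gamma>)) (Stage C \<gamma>)"
  "Chr C \<gamma> \<in> salg_hom T (FD (Dim C \<gamma>)) (Stage C (next_stage \<gamma>))"
  "x \<in> Ob (Deg (FS (Dim C \<gamma>)) p) n ==>
   Trans C \<gamma> (next_stage \<gamma>) p n (Att C \<gamma> p n x) = Chr C \<gamma> p n (generating_cofibration R T F \<eta> (Dim C \<gamma>) p n x)"
proof -
 show "salgebra T (Stage C (next_stage \<gamma>))"
  by (rule Stage[OF next_stage(2)[OF assms]])
 have po: "Att C \<gamma> \<in> salg_hom T (FS (Dim C \<gamma>)) (Stage C \<gamma>)" "Chr C \<gamma> \<in> salg_hom T (FD (Dim C \<gamma>)) (Stage C (next_stage \<gamma>))"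
  "salg_comp (FS (Dim C \<gamma>)) (Trans C \<gamma> (next_stage \<gamma>)) (Att C \<gamma>) = salg_comp (FS (Dim C \<gamma>)) (Chr C \<gamma>) (generating_cofibration R T F \<eta> (Dim C \<gamma>))"
  using successor[OF assms] unfolding is_pushout_def by blast+
 then show "Att C \<gamma> \<in> salg_hom T (FS (Dim C \<gamma>)) (Stage C \<gamma>)" "Chr C \<gamma> \<in> salg_hom T (FD (Dim C \<gamma>)) (Stage C (next_stage \<gamma>))"
  by blast+
 show "Trans C \<gamma> (next_stage \<gamma>) p n (Att C \<gamma> p n x) = Chr C \<gamma> p n (generating_cofibration R T F \<eta> (Dim C \<gamma>) p n x)"
  if "x \<in> Ob (Deg (FS (Dim C \<gamma>)) p) n"
  using salg_comp_eqD[OF po(3) that] that by (simp add: salg_comp_apply)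
qed

lemma Trans_Trans:
 "\<beta> \<le> \<gamma> ==> \<gamma> \<le> \<delta> ==> \<delta> \<le> Last C ==> x \<in> Ob (D\<^sub>p \<beta> p) n ==> Trans C \<gamma> \<delta> p n (Trans C \<beta> \<gamma> p n x) = Trans C \<beta> \<delta> p n x"
 using Trans_comp[of \<beta> \<gamma> \<delta>] by (simp add: salg_comp_apply)

lemma Trans_refl: "\<beta> \<le> Last C ==> x \<in> Ob (D\<^sub>p \<beta> p) n ==> Trans C \<beta> \<beta> p n x = x"
 by (simp add: Trans_id salg_id_def)

lemma Trans_in: "\<beta> \<le> \<gamma> ==> \<gamma> \<le> Last C ==> x \<in> Ob (D\<^sub>p \<beta> p) n ==> Trans C \<beta> \<gamma> p n x \<in> Ob (D\<^sub>p \<gamma> p) n"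
 by (rule salg_hom_in[OF Trans_hom])

lemma Trans_clone: "\<beta> \<le> \<gamma> ==> \<gamma> \<le> Last C ==> Trans C \<beta> \<gamma> p 1 \<in> clone_hom T (D\<^sub>p \<beta> p) (D\<^sub>p \<gamma> p)"
 by (rule salg_hom_clone[OF Stage Stage Trans_hom]) auto

context
 fixes \<gamma> \<beta> :: 'i
 assumes gb: "\<gamma> < \<beta>" "\<beta> \<le> Last C"
begin

private lemma gl: "\<gamma> < Last C" "next_stage \<gamma> \<le> \<beta>" "next_stage \<gamma> \<le> Last C"
 using gb next_stage[of \<gamma> \<beta>] by auto

lemma Chr_gen_in: "w \<in> disk_cells (Dim C \<gamma>) p ==> Chr C \<gamma> p 1 (gen (disk (Dim C \<gamma>)) p (Some w)) \<in> Ob (D\<^sub>p (next_stage \<gamma>) p) 1"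
 by (rule salg_hom_in[OF successor_homs(3)[OF gl(1)] gen_disk_in])

lemma cell_gen_in: "w \<in> disk_cells (Dim C \<gamma>) p ==> cell_gen \<beta> p (\<gamma>, w) \<in> Ob (D\<^sub>p \<beta> p) 1"
 unfolding cell_gen_def prod.case by (rule Trans_in[OF gl(2) gb(2) Chr_gen_in])

lemma Trans_cell_gen:
 "\<beta> \<le> \<delta> ==> \<delta> \<le> Last C ==> w \<in> disk_cells (Dim C \<gamma>) p ==> Trans C \<beta> \<delta> p 1 (cell_gen \<beta> p (\<gamma>, w)) = cell_gen \<delta> p (\<gamma>, w)"
 unfolding cell_gen_def prod.case by (rule Trans_Trans[OF gl(2) _ _ Chr_gen_in])

lemma Str_cell_gen:
 assumes \<theta>: "\<theta> \<in> delta p q" and w: "w \<in> disk_cells (Dim C \<gamma>) q"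
 shows "Str (Stage C \<beta>) p q \<theta> 1 (cell_gen \<beta> q (\<gamma>, w)) =
  (if compose {..p} w \<theta> \<in> disk_cells (Dim C \<gamma>) p then cell_gen \<beta> p (\<gamma>, compose {..p} w \<theta>) else \<zero>\<^bsub>U (D\<^sub>p \<beta> p)\<^esub>)"
proof -
 have "Str (Stage C \<beta>) p q \<theta> 1 (cell_gen \<beta> q (\<gamma>, w)) =
  Trans C (next_stage \<gamma>) \<beta> p 1 (Chr C \<gamma> p 1 (Str (FD (Dim C \<gamma>)) p q \<theta> 1 (gen (disk (Dim C \<gamma>)) q (Some w))))"
  unfolding cell_gen_def prod.case
  using salg_hom_Str[OF Trans_hom[OF gl(2) gb(2)] \<theta> Chr_gen_in[OF w]] salg_hom_Str[OF successor_homs(3)[OF gl(1)] \<theta> gen_disk_in[OF w]]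
  by simp
 moreover have "Chr C \<gamma> p 1 \<zero>\<^bsub>U (FC (disk (Dim C \<gamma>)) p)\<^esub> = \<zero>\<^bsub>U (D\<^sub>p (next_stage \<gamma>) p)\<^esub>"
  using clone_hom_ops(3)[OF salg_hom_clone[OF FD successor_homs(1,3)[OF gl(1)], of p]] by (simp add: free_salg_simps)
 moreover have "Trans C (next_stage \<gamma>) \<beta> p 1 \<zero>\<^bsub>U (D\<^sub>p (next_stage \<gamma>) p)\<^esub> = \<zero>\<^bsub>U (D\<^sub>p \<beta> p)\<^esub>"
  by (rule clone_hom_ops(3)[OF Trans_clone[OF gl(2) gb(2)]])
 ultimately show ?thesis
  using FD_Str[OF \<theta> w] by (simp add: cell_gen_def)
qed

lemma cell_gen_boundary:
 assumes "v \<in> sphere_cells (Dim C \<gamma>) p"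
 shows "cell_gen \<beta> p (\<gamma>, compose {..p} Suc v) = Trans C \<gamma> \<beta> p 1 (Att C \<gamma> p 1 (gen (sphere (Dim C \<gamma>)) p (Some v)))"
  "Att C \<gamma> p 1 (gen (sphere (Dim C \<gamma>)) p (Some v)) \<in> Ob (D\<^sub>p \<gamma> p) 1"
proof -
 note g = gen_sphere_in[OF assms]
 show A: "Att C \<gamma> p 1 (gen (sphere (Dim C \<gamma>)) p (Some v)) \<in> Ob (D\<^sub>p \<gamma> p) 1"
  by (rule salg_hom_in[OF successor_homs(2)[OF gl(1)] g])
 have "cell_gen \<beta> p (\<gamma>, compose {..p} Suc v) = Trans C (next_stage \<gamma>) \<beta> p 1 (Trans C \<gamma> (next_stage \<gamma>) p 1 (Att C \<gamma> p 1 (gen (sphere (Dim C \<gamma>)) p (Some v))))"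
  using successor_homs(4)[OF gl(1) g] cofibration(2)[OF assms] by (simp add: cell_gen_def)
 also have "\<dots> = Trans C \<gamma> \<beta> p 1 (Att C \<gamma> p 1 (gen (sphere (Dim C \<gamma>)) p (Some v)))"
  by (rule Trans_Trans[OF less_imp_le[OF next_stage(1)[OF gb(1)]] gl(2) gb(2) A])
 finally show "cell_gen \<beta> p (\<gamma>, compose {..p} Suc v) = Trans C \<gamma> \<beta> p 1 (Att C \<gamma> p 1 (gen (sphere (Dim C \<gamma>)) p (Some v)))" .
qed

end

lemma cells_below_in: "\<beta> \<le> Last C ==> cell_gen \<beta> p ` cells_below \<beta> p \<subseteq> Ob (D\<^sub>p \<beta> p) 1"
 using cell_gen_in onto_disk by (fastforce simp: cells_below_def)

lemma cells_below_mono: "\<gamma> \<le> \<beta> ==> cells_below \<gamma> p \<subseteq> cells_below \<beta> p"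
 by (auto simp: cells_below_def)

lemma generated_cong: "(\<And>i. i \<in> J ==> x i = y i) ==> generated T A J x = generated T A J y"
proof -
 assume "\<And>i. i \<in> J ==> x i = y i"
 then have "map x js = map y js" if "set js \<subseteq> J" for js
  using that by auto
 then show ?thesis
  unfolding generated_def by (metis (no_types, lifting))
qed

lemma Trans_generated:
 assumes "\<gamma> \<le> \<beta>" "\<beta> \<le> Last C" "a \<in> generated T (D\<^sub>p \<gamma> p) (cells_below \<gamma> p) (cell_gen \<gamma> p)"
 shows "Trans C \<gamma> \<beta> p 1 a \<in> generated T (D\<^sub>p \<beta> p) (cells_below \<gamma> p) (cell_gen \<beta> p)"
proof -
 have "Trans C \<gamma> \<beta> p 1 a \<in> generated T (D\<^sub>p \<beta> p) (cells_below \<gamma> p) (\<lambda>i. Trans C \<gamma> \<beta> p 1 (cell_gen \<gamma> p i))"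
  by (rule clone_hom_generated[OF Trans_clone[OF assms(1,2)] cells_below_in assms(3)]) (use assms in auto)
 also have "\<dots> = generated T (D\<^sub>p \<beta> p) (cells_below \<gamma> p) (cell_gen \<beta> p)"
  by (rule generated_cong) (use assms onto_disk in \<open>auto simp: cells_below_def intro!: Trans_cell_gen\<close>)
 finally show ?thesis .
qed

text \<open>An operator sends a generator to 0, to another generator or into the boundary of its
  cell. The boundary comes through the attaching map from an earlier stage, which is generated by
  induction. So the generated sets are closed under operators, and they contain everything that
  generates the pushout or colimit.\<close>

lemma stage_generated:
 assumes "\<beta> \<le> Last C"
 shows "Ob (D\<^sub>p \<beta> p) 1 \<subseteq> generated T (D\<^sub>p \<beta> p) (cells_below \<beta> p) (cell_gen \<beta> p)"
 using assms
proof (induction \<beta> arbitrary: p rule: less_induct)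
 case (less \<beta>)
 note \<beta> = less.prems
 interpret A: salgebra T "Stage C \<beta>" by (rule Stage[OF \<beta>])
 let ?G = "\<lambda>p. generated T (D\<^sub>p \<beta> p) (cells_below \<beta> p) (cell_gen \<beta> p)"
 have op: "op_closed T (D\<^sub>p \<beta> p) (?G p)" for p
  by (rule talgebra.generated_closed[OF A.Deg cells_below_in[OF \<beta>]])
 have below: "Trans C \<gamma> \<beta> p 1 a \<in> ?G p" if "\<gamma> < \<beta>" "a \<in> Ob (D\<^sub>p \<gamma> p) 1" for \<gamma> p a
 proof -
  have "a \<in> generated T (D\<^sub>p \<gamma> p) (cells_below \<gamma> p) (cell_gen \<gamma> p)"
   by (rule subsetD[OF less.IH[OF that(1) order_trans[OF less_imp_le[OF that(1)] \<beta>]] that(2)])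
  then have "Trans C \<gamma> \<beta> p 1 a \<in> generated T (D\<^sub>p \<beta> p) (cells_below \<gamma> p) (cell_gen \<beta> p)"
   using that(1) \<beta> by (intro Trans_generated) auto
  then show ?thesis
   by (rule subsetD[OF generated_mono[OF cells_below_mono[OF less_imp_le[OF that(1)]]]])
 qed
 have cell: "cell_gen \<beta> p (\<gamma>, w) \<in> ?G p" if "\<gamma> < \<beta>" "w \<in> disk_cells (Dim C \<gamma>) p" for \<gamma> w p
 proof (cases "w \<in> onto_cells (Dim C \<gamma>) p")
  case True
  then have "(\<gamma>, w) \<in> cells_below \<beta> p"
   using that(1) by (simp add: cells_below_def)
  then show ?thesis
   by (rule talgebra.generated_base[OF A.Deg cells_below_in[OF \<beta>]])
 next
  case False
  then obtain v where "v \<in> sphere_cells (Dim C \<gamma>) p" "w = compose {..p} Suc v"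
   using disk_cells_cases[OF \<open>w \<in> disk_cells (Dim C \<gamma>) p\<close>] by blast
  then show ?thesis
   using cell_gen_boundary[OF \<open>\<gamma> < \<beta>\<close> \<beta>] below[OF \<open>\<gamma> < \<beta>\<close>] by simp
 qed
 have closed: "salg_closed T (Stage C \<beta>) ?G"
  unfolding salg_closed_def
 proof (intro conjI allI ballI op image_subsetI)
  fix p q \<theta> a assume \<theta>: "\<theta> \<in> delta p q" and a: "a \<in> ?G q"
  have "Str (Stage C \<beta>) p q \<theta> 1 a \<in> generated T (D\<^sub>p \<beta> p) (cells_below \<beta> q) (\<lambda>i. Str (Stage C \<beta>) p q \<theta> 1 (cell_gen \<beta> q i))"
   by (rule clone_hom_generated[OF A.Str_clone[OF \<theta>] cells_below_in[OF \<beta>] a])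
  also have "\<dots> \<subseteq> ?G p"
  proof (rule generated_least[OF op image_subsetI])
   fix i assume "i \<in> cells_below \<beta> q"
   then obtain \<gamma> w where i: "i = (\<gamma>, w)" "\<gamma> < \<beta>" "w \<in> disk_cells (Dim C \<gamma>) q"
    by (auto simp: cells_below_def intro: subsetD[OF onto_disk])
   show "Str (Stage C \<beta>) p q \<theta> 1 (cell_gen \<beta> q i) \<in> ?G p"
    unfolding i(1) Str_cell_gen[OF i(2) \<beta> \<theta> i(3)] using cell[OF i(2)] op_closed_ops(3)[OF op] by simp
  qed
  finally show "Str (Stage C \<beta>) p q \<theta> 1 a \<in> ?G p" .
 qed
 show ?case
 proof (cases "\<exists>\<gamma>. \<gamma> < \<beta> \<and> \<beta> = next_stage \<gamma>")
  case True
  then obtain \<gamma> where \<gamma>: "\<gamma> < \<beta>" "\<beta> = next_stage \<gamma>" by blast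
  then have gl: "\<gamma> < Last C"
   using \<beta> by auto
  let ?k = "Dim C \<gamma>"
  show ?thesis
  proof (rule pushout_generated[OF successor[OF gl, folded \<gamma>(2)] Stage FD A.salgebra_axioms closed])
   show "Trans C \<gamma> \<beta> p 1 x \<in> ?G p" if "x \<in> Ob (D\<^sub>p \<gamma> p) 1" for p x
    by (rule below[OF \<gamma>(1) that])
   show "Chr C \<gamma> p 1 x \<in> ?G p" if x: "x \<in> Ob (Deg (FD ?k) p) 1" for p x
   proof -
    have "Chr C \<gamma> p 1 x \<in> generated T (D\<^sub>p \<beta> p) (Some ` disk_cells ?k p) (\<lambda>b. Chr C \<gamma> p 1 (gen (disk ?k) p b))"
    proof (rule clone_hom_generated[OF _ _ subsetD[OF FD_generated x]])
     show "Chr C \<gamma> p 1 \<in> clone_hom T (Deg (FD ?k) p) (D\<^sub>p \<beta> p)"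
      unfolding \<gamma>(2) by (rule salg_hom_clone[OF FD successor_homs(1,3)[OF gl]])
     show "gen (disk ?k) p ` Some ` disk_cells ?k p \<subseteq> Ob (Deg (FD ?k) p) 1"
      using gen_disk_in by blast
    qed
    also have "\<dots> \<subseteq> ?G p"
    proof (rule generated_least[OF op image_subsetI])
     fix b assume "b \<in> Some ` disk_cells ?k p"
     then obtain w where w: "b = Some w" "w \<in> disk_cells ?k p" by auto
     have "Chr C \<gamma> p 1 (gen (disk ?k) p b) = cell_gen \<beta> p (\<gamma>, w)"
      using Trans_refl[OF \<beta> Chr_gen_in[OF \<gamma>(1) \<beta> w(2), folded \<gamma>(2)]] by (simp add: cell_gen_def w(1) flip: \<gamma>(2))
     then show "Chr C \<gamma> p 1 (gen (disk ?k) p b) \<in> ?G p"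
      using cell[OF \<gamma>(1) w(2)] by simp
    qed
    finally show ?thesis .
   qed
  qed (use gl in auto)
 next
  case False
  show ?thesis
  proof (rule colimit_generated[OF limit[OF \<beta> False] Stage Trans_hom Trans_comp[OF _ less_imp_le \<beta>, symmetric] closed])
   show "Trans C \<gamma> \<beta> p 1 x \<in> ?G p" if "\<gamma> < \<beta>" "x \<in> Ob (D\<^sub>p \<gamma> p) 1" for \<gamma> p x
    by (rule below[OF that])
  qed (use \<beta> in auto)
 qed
qed

lemma stage_hom_eqI:
 assumes "\<beta> \<le> Last C" "talgebra T B" "h \<in> talg_hom T (D\<^sub>p \<beta> p) B" "h' \<in> talg_hom T (D\<^sub>p \<beta> p) B"
  and "\<And>c. c \<in> cells_below \<beta> p ==> h 1 (cell_gen \<beta> p c) = h' 1 (cell_gen \<beta> p c)"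
 shows "h = h'"
proof (rule talg_hom_eqI[OF _ assms(2-4)])
 show D: "talgebra T (D\<^sub>p \<beta> p)"
  by (rule salgebra.Deg[OF Stage[OF assms(1)]])
 fix a assume "a \<in> Ob (D\<^sub>p \<beta> p) 1"
 then have a: "a \<in> generated T (D\<^sub>p \<beta> p) (cells_below \<beta> p) (cell_gen \<beta> p)"
  using stage_generated[OF assms(1)] by blast
 show "h 1 a = h' 1 a"
  by (rule clone_hom_eq_on_generated[OF talg_hom_clone[OF D assms(2,3)] talg_hom_clone[OF D assms(2,4)] cells_below_in[OF assms(1)] assms(5) a])
qed

text \<open>At a successor, the map on the disk is prescribed by \<open>s\<close> on the onto
  simplices and by the attaching map followed by \<open>h \<gamma>\<close> on the boundary;
  \<open>pushout_level\<close> glues it to \<open>h \<gamma>\<close>. At a limit, the maps on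
  earlier stages are compatible because they agree on generators.\<close>

lemma stage_extension:
 assumes "\<beta> \<le> Last C" and s: "\<And>c. s c \<in> Hom T n 1"
 shows "\<exists>h\<in>talg_hom T (D\<^sub>p \<beta> p) (represented T n). \<forall>c\<in>cells_below \<beta> p. h 1 (cell_gen \<beta> p c) = s c"
 using assms(1)
proof (induction \<beta> rule: less_induct)
 case (less \<beta>)
 note \<beta> = less.prems
 let ?R = "represented T n"
 have R: "talgebra T ?R" by (rule T.represented_talgebra)
 have "\<forall>\<gamma>. \<exists>h. \<gamma> < \<beta> \<longrightarrow> h \<in> talg_hom T (D\<^sub>p \<gamma> p) ?R \<and> (\<forall>c\<in>cells_below \<gamma> p. h 1 (cell_gen \<gamma> p c) = s c)"
  using less.IH \<beta> by (meson less_imp_le order_trans)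
 then obtain h where h: "\<And>\<gamma>. \<gamma> < \<beta> ==> h \<gamma> \<in> talg_hom T (D\<^sub>p \<gamma> p) ?R"
  "\<And>\<gamma> c. \<gamma> < \<beta> ==> c \<in> cells_below \<gamma> p ==> h \<gamma> 1 (cell_gen \<gamma> p c) = s c"
  by metis
 show ?case
 proof (cases "\<exists>\<gamma>. \<gamma> < \<beta> \<and> \<beta> = next_stage \<gamma>")
  case True
  then obtain \<gamma> where \<gamma>: "\<gamma> < \<beta>" "\<beta> = next_stage \<gamma>" by blast
  then have gl: "\<gamma> < Last C"
   using \<beta> by auto
  let ?k = "Dim C \<gamma>"
  let ?i = "generating_cofibration R T F \<eta> ?k p"
  \<comment> \<open>Recovers a simplex of the sphere from its image in the disk.\<close>
  define b where "b w = (SOME v. v \<in> sphere_cells ?k p \<and> w = compose {..p} Suc v)" for w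
  have b: "b (compose {..p} Suc v) = v" if "v \<in> sphere_cells ?k p" for v
   unfolding b_def
  proof (rule some_equality)
   fix v' assume v': "v' \<in> sphere_cells ?k p \<and> compose {..p} Suc v = compose {..p} Suc v'"
   have "v i = v' i" for i
   proof (cases "i \<le> p")
    case True
    then show ?thesis using fun_cong[of _ _ i, OF conjunct2[OF v']] by (simp add: compose_def)
   next
    case False
    then show ?thesis
     using sphere_cells_simplex[OF that] sphere_cells_simplex[OF conjunct1[OF v']] by (auto simp: simplex_def PiE_def extensional_def)
   qed
   then show "v' = v" by auto
  qed (use that in simp)
  have att: "Att C \<gamma> p 1 (gen (sphere ?k) p (Some v)) \<in> Ob (D\<^sub>p \<gamma> p) 1" if "v \<in> sphere_cells ?k p" for v
   by (rule cell_gen_boundary(2)[OF \<gamma>(1) \<beta> that])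
  let ?s = "\<lambda>y. if the y \<in> onto_cells ?k p then s (\<gamma>, the y) else h \<gamma> 1 (Att C \<gamma> p 1 (gen (sphere ?k) p (Some (b (the y)))))"
  have s_in: "?s ` basis (disk ?k) p \<subseteq> Ob ?R 1"
  proof (rule image_subsetI)
   fix y assume "y \<in> basis (disk ?k) p"
   then obtain w where w: "y = Some w" "w \<in> disk_cells ?k p" by (auto simp: disk_simps(3))
   show "?s y \<in> Ob ?R 1"
   proof (cases "w \<in> onto_cells ?k p")
    case False
    then obtain v where "v \<in> sphere_cells ?k p" "w = compose {..p} Suc v"
     using disk_cells_cases[OF w(2)] by blast
    then show ?thesis
     using False w(1) b talg_hom_in[OF h(1)[OF \<gamma>(1)] att] by simp
   qed (use s w(1) in simp)
  qed
  obtain \<phi> where \<phi>: "\<phi> \<in> clone_hom T (FC (disk ?k) p) ?R" "\<And>y. y \<in> basis (disk ?k) p ==> \<phi> (gen (disk ?k) p y) = ?s y"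
   using free_on_extend[OF FC R FC_free s_in] by blast
  define g where "g = clone_lift T (FC (disk ?k) p) ?R \<phi>"
  have g: "g \<in> talg_hom T (FC (disk ?k) p) ?R"
   unfolding g_def by (rule clone_lift_hom[OF FC R \<phi>(1)])
  have g1: "g 1 (gen (disk ?k) p (Some w)) = ?s (Some w)" if "w \<in> disk_cells ?k p" for w
  proof -
   have "Some w \<in> basis (disk ?k) p"
    using that by (simp add: disk_simps(3))
   then show ?thesis
    unfolding g_def by (subst clone_lift_1[OF FC R \<phi>(1) gen_in]) (auto simp: \<phi>(2))
  qed
  have a: "Att C \<gamma> p \<in> talg_hom T (FC (sphere ?k) p) (D\<^sub>p \<gamma> p)"
   using salg_hom_level[OF successor_homs(2)[OF gl], of p] by (simp add: free_salg_simps)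
  have eq: "talg_comp (FC (sphere ?k) p) (h \<gamma>) (Att C \<gamma> p) = talg_comp (FC (sphere ?k) p) g ?i"
  proof (rule FC_hom_eqI[OF R
     talg_comp_in[OF FC a h(1)[OF \<gamma>(1)]] talg_comp_in[OF FC cofibration(1) g]])
   fix y assume "y \<in> basis (sphere ?k) p"
   then obtain v where v: "y = Some v" "v \<in> sphere_cells ?k p" by (auto simp: sphere_simps(3))
   have "compose {..p} Suc v \<notin> onto_cells ?k p"
   proof
    assume "compose {..p} Suc v \<in> onto_cells ?k p"
    then have "0 \<in> compose {..p} Suc v ` {..p}" by (simp add: onto_cells_def)
    then show False by (auto simp: compose_def)
   qed
   moreover have "gen (sphere ?k) p y \<in> Ob (FC (sphere ?k) p) 1"
    by (rule gen_in) fact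
   ultimately show "talg_comp (FC (sphere ?k) p) (h \<gamma>) (Att C \<gamma> p) 1 (gen (sphere ?k) p y) = talg_comp (FC (sphere ?k) p) g ?i 1 (gen (sphere ?k) p y)"
    using g1[OF sphere_disk_cell[OF v(2)]] b[OF v(2)] cofibration(2)[OF v(2)] by (simp add: v(1) talg_comp_apply)
  qed
  obtain w where w: "w \<in> talg_hom T (D\<^sub>p \<beta> p) ?R" "\<And>m x. x \<in> Ob (D\<^sub>p \<gamma> p) m ==> w m (Trans C \<gamma> \<beta> p m x) = h \<gamma> m x"
   "\<And>m x. x \<in> Ob (FC (disk ?k) p) m ==> w m (Chr C \<gamma> p m x) = g m x"
  proof -
   have "\<exists>w\<in>talg_hom T (D\<^sub>p \<beta> p) ?R. (\<forall>m. \<forall>x\<in>Ob (D\<^sub>p \<gamma> p) m. w m (Trans C \<gamma> \<beta> p m x) = h \<gamma> m x) \<and>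
     (\<forall>m. \<forall>x\<in>Ob (Deg (FD ?k) p) m. w m (Chr C \<gamma> p m x) = g m x)"
   proof (rule T.pushout_level[OF successor[OF gl, folded \<gamma>(2)] FS Stage FD Stage h(1)[OF \<gamma>(1)]])
    show "g \<in> talg_hom T (Deg (FD ?k) p) ?R"
     using g by (simp add: free_salg_simps)
    show "h \<gamma> m (Att C \<gamma> p m x) = g m (?i m x)" if "x \<in> Ob (Deg (FS ?k) p) m" for m x
     using fun_cong[OF fun_cong[OF eq, of m], of x] that by (simp add: talg_comp_apply free_salg_simps)
   qed (use gl \<beta> in auto)
   then show ?thesis
    using that by (auto simp: free_salg_simps)
  qed
  have "w 1 (cell_gen \<beta> p c) = s c" if cb: "c \<in> cells_below \<beta> p" for c
  proof -
   obtain \<delta> v where c: "c = (\<delta>, v)" "\<delta> < \<beta>" "v \<in> onto_cells (Dim C \<delta>) p"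
    using cb by (auto simp: cells_below_def)
   note vd = subsetD[OF onto_disk c(3)]
   show ?thesis
   proof (cases "\<delta> = \<gamma>")
    case True
    have "Some v \<in> basis (disk ?k) p"
     using vd True by (simp add: disk_simps(3))
    moreover have "cell_gen \<beta> p c = Chr C \<gamma> p 1 (gen (disk ?k) p (Some v))"
     using Trans_refl[OF \<beta> Chr_gen_in[OF \<gamma>(1) \<beta> vd[unfolded True], folded \<gamma>(2)]] by (simp add: cell_gen_def c(1) True flip: \<gamma>(2))
    ultimately show ?thesis
     using w(3)[OF gen_in] g1[OF vd[unfolded True]] c True by simp
   next
    case False
    then have d: "\<delta> < \<gamma>"
     using c(2) next_stage(3)[OF \<gamma>(1), of \<delta>] \<gamma>(2) by auto
    have cc: "cell_gen \<gamma> p c \<in> Ob (D\<^sub>p \<gamma> p) 1"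
     unfolding c(1) by (rule cell_gen_in[OF d less_imp_le[OF gl] vd])
    have "cell_gen \<beta> p c = Trans C \<gamma> \<beta> p 1 (cell_gen \<gamma> p c)"
     unfolding c(1) by (rule Trans_cell_gen[OF d less_imp_le[OF gl] less_imp_le[OF \<gamma>(1)] \<beta> vd, symmetric])
    then show ?thesis
     using w(2)[OF cc] h(2)[OF \<gamma>(1), of c] d c by (simp add: cells_below_def)
   qed
  qed
  then show ?thesis using w(1) by blast
 next
  case False
  have "\<exists>w\<in>talg_hom T (D\<^sub>p \<beta> p) ?R. \<forall>\<gamma><\<beta>. \<forall>m. \<forall>x\<in>Ob (D\<^sub>p \<gamma> p) m. w m (Trans C \<gamma> \<beta> p m x) = h \<gamma> m x"
  proof (rule T.colimit_level[OF limit[OF \<beta> False] Stage Trans_hom h(1)])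
   fix \<gamma> \<delta> m x assume gd: "\<gamma> \<le> \<delta>" "\<delta> < \<beta>" and x: "x \<in> Ob (D\<^sub>p \<gamma> p) m"
   have l: "\<gamma> \<le> Last C" "\<delta> \<le> Last C" "\<gamma> < \<beta>"
    using gd \<beta> by auto
   have D: "talgebra T (D\<^sub>p \<gamma> p)"
    by (rule salgebra.Deg[OF Stage[OF l(1)]])
   have "talg_comp (D\<^sub>p \<gamma> p) (h \<delta>) (Trans C \<gamma> \<delta> p) = h \<gamma>"
   proof (rule stage_hom_eqI[OF l(1) R talg_comp_in[OF D salg_hom_level[OF Trans_hom[OF gd(1) l(2)]] h(1)[OF gd(2)]] h(1)[OF l(3)]])
    fix c assume c: "c \<in> cells_below \<gamma> p"
    then obtain \<delta>' v where v: "c = (\<delta>', v)" "\<delta>' < \<gamma>" "v \<in> disk_cells (Dim C \<delta>') p"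
     by (auto simp: cells_below_def intro: subsetD[OF onto_disk])
    have "Trans C \<gamma> \<delta> p 1 (cell_gen \<gamma> p c) = cell_gen \<delta> p c"
     unfolding v(1) by (rule Trans_cell_gen[OF v(2) l(1) gd(1) l(2) v(3)])
    then show "talg_comp (D\<^sub>p \<gamma> p) (h \<delta>) (Trans C \<gamma> \<delta> p) 1 (cell_gen \<gamma> p c) = h \<gamma> 1 (cell_gen \<gamma> p c)"
     using h(2)[OF gd(2) subsetD[OF cells_below_mono[OF gd(1)] c]] h(2)[OF l(3) c] subsetD[OF cells_below_in[OF l(1)] imageI[OF c]]
     by (simp add: talg_comp_apply)
   qed
   then show "h \<delta> m (Trans C \<gamma> \<delta> p m x) = h \<gamma> m x"
    using x by (metis talg_comp_apply)
  qed (use \<beta> in auto)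
  then obtain w where w: "w \<in> talg_hom T (D\<^sub>p \<beta> p) ?R" "\<And>\<gamma> m x. \<gamma> < \<beta> ==> x \<in> Ob (D\<^sub>p \<gamma> p) m ==> w m (Trans C \<gamma> \<beta> p m x) = h \<gamma> m x"
   by blast
  have "w 1 (cell_gen \<beta> p c) = s c" if cb: "c \<in> cells_below \<beta> p" for c
  proof -
   obtain \<delta> v where c: "c = (\<delta>, v)" "\<delta> < \<beta>" "v \<in> onto_cells (Dim C \<delta>) p"
    using cb by (auto simp: cells_below_def)
   note vd = subsetD[OF onto_disk c(3)]
   let ?\<gamma> = "next_stage \<delta>"
   have g: "\<delta> < ?\<gamma>" "?\<gamma> < \<beta>"
    using next_stage[OF c(2)] False c(2) by (auto simp: less_le)
   have l: "?\<gamma> \<le> Last C"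
    using g \<beta> by auto
   have cc: "cell_gen ?\<gamma> p c \<in> Ob (D\<^sub>p ?\<gamma> p) 1"
    unfolding c(1) by (rule cell_gen_in[OF g(1) l vd])
   have "cell_gen \<beta> p c = Trans C ?\<gamma> \<beta> p 1 (cell_gen ?\<gamma> p c)"
    unfolding c(1) by (rule Trans_cell_gen[OF g(1) l less_imp_le[OF g(2)] \<beta> vd, symmetric])
   then show ?thesis
    using w(2)[OF g(2) cc] h(2)[OF g(2), of c] g(1) c by (simp add: cells_below_def)
  qed
  then show ?thesis using w(1) by blast
 qed
qed

theorem stage_free:
 assumes "\<beta> \<le> Last C"
 shows "free_on T (D\<^sub>p \<beta> p) (cells_below \<beta> p) (cell_gen \<beta> p)"
 by (rule free_onI[OF salgebra.Deg[OF Stage[OF assms]] cells_below_in[OF assms] stage_generated[OF assms] stage_extension[OF assms]])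

end

section \<open>Onto simplices one degree higher: degenerate or shifted\<close>

lemma shift_1 [simp]: "shift p w 1 = Suc (w 0)"
 by (simp add: shift_def One_nat_def del: One_nat_def[symmetric])

lemma shift_image: "shift p w ` {..Suc p} = insert 0 (Suc ` w ` {..p})"
 by (simp add: atMost_Suc_eq_insert_0 shift_def image_image)

lemma shift_onto: "w \<in> sphere_cells k p ==> shift p w \<in> onto_cells k (Suc p)"
 unfolding onto_cells_def sphere_cells_def mem_Collect_eq shift_image
 by (auto simp: simplex_def shift_def mono_on_def PiE_iff lessThan_Suc_eq_insert_0 lessThan_Suc_atMost[symmetric] split: nat.split)

lemma shift_disk: "w \<in> simplex k p ==> shift p w \<in> disk_cells k (Suc p) ==> w \<in> sphere_cells k p"
 unfolding disk_cells_def sphere_cells_def mem_Collect_eq shift_image image_Suc_lessThan[symmetric]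
 by (auto simp: simplex_def)

lemma shift_inj:
 assumes "w \<in> simplex k p" "w' \<in> simplex l p" "shift p w = shift p w'"
 shows "w = w'"
proof (rule extensionalityI)
 show "w \<in> extensional {..p}" "w' \<in> extensional {..p}"
  using assms(1,2) by (auto simp: simplex_def PiE_def)
 fix i assume "i \<in> {..p}"
 then show "w i = w' i"
  using fun_cong[OF assms(3), of "Suc i"] by (simp add: shift_def)
qed

lemma shift_coface_0: "compose {..p} (shift p w) (coface p 0) = compose {..p} Suc w"
 by (auto simp: shift_def coface_def compose_def)

abbreviation "degenerate p v \<equiv> compose {..Suc p} v (codegeneracy p 0)"

lemma onto_codegeneracy:
 assumes "v \<in> onto_cells k p"
 shows "degenerate p v \<in> onto_cells k (Suc p)" "degenerate p v 1 = 0"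
proof -
 have v: "v \<in> simplex (Suc k) p" "v ` {..p} = {..k}"
  using assms by (auto simp: onto_cells_def)
 have "codegeneracy p 0 ` {..Suc p} = {..p}"
 proof (intro equalityI image_subsetI subsetI)
  show "i \<in> codegeneracy p 0 ` {..Suc p}" if "i \<in> {..p}" for i
   by (rule image_eqI[of _ _ "Suc i"]) (use that in \<open>simp_all add: codegeneracy_def\<close>)
 qed (auto simp: codegeneracy_def)
 then have "degenerate p v ` {..Suc p} = {..k}"
  using v(2) by (simp add: compose_def image_image[symmetric])
 then show "degenerate p v \<in> onto_cells k (Suc p)"
  using simplex_comp[OF v(1) codegeneracy_in[of 0 p]] by (simp add: onto_cells_def)
 have "0 \<in> v ` {..p}"
  unfolding v(2) by simp
 then obtain i where "i \<le> p" "v i = 0" by auto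
 moreover have "mono_on {..p} v"
  using v(1) by (simp add: simplex_def)
 ultimately have "v 0 = 0"
  using mono_onD[of "{..p}" v 0 i] by simp
 then show "degenerate p v 1 = 0"
  by (simp add: compose_def codegeneracy_def)
qed

text \<open>An onto simplex starts at vertex 0. If its next vertex is 0 too, it is degenerate under
  s_0. Otherwise all later vertices are positive, and lowering them gives a simplex of the sphere.
  So the generators of degree \<open>Suc p\<close> that are not degenerate under s_0 form the sphere
  in degree \<open>p\<close>.\<close>

lemma onto_cells_cases:
 assumes "c \<in> onto_cells k (Suc p)"
 obtains w where "w \<in> sphere_cells k p" "c = shift p w"
 | v where "v \<in> onto_cells k p" "c = degenerate p v" "c 1 = 0"
proof -
 have c: "c \<in> simplex (Suc k) (Suc p)" "c ` {..Suc p} = {..k}"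
  using assms by (auto simp: onto_cells_def)
 have mono: "mono_on {..Suc p} c" and le: "\<And>i. i \<le> Suc p ==> c i \<le> k" and ext: "c \<in> extensional {..Suc p}"
  using c by (auto simp: simplex_def PiE_def less_Suc_eq_le)
 have "0 \<in> c ` {..Suc p}"
  unfolding c(2) by simp
 then obtain i where "i \<le> Suc p" "c i = 0" by auto
 then have c0: "c 0 = 0"
  using mono_onD[OF mono, of 0 i] by simp
 show thesis
 proof (cases "c 1 = 0")
  case True
  define v where "v = compose {..p} c (coface p 0)"
  have cv: "c = degenerate p v"
  proof
   fix i show "c i = degenerate p v i"
    using ext c0 True by (cases i) (auto simp: v_def compose_def coface_def codegeneracy_def extensional_def)
  qed
  have "v \<in> simplex (Suc k) p"
   unfolding v_def by (rule simplex_comp[OF c(1)]) simp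
  moreover have "v ` {..p} = {..k}"
  proof (intro equalityI subsetI)
   fix j assume "j \<in> {..k}"
   then have "j \<in> c ` {..Suc p}"
    unfolding c(2) .
   then obtain i where i: "i \<le> Suc p" "j = c i" by auto
   show "j \<in> v ` {..p}"
   proof (cases i)
    case 0
    then show ?thesis
     using i c0 True by (intro image_eqI[of _ _ 0]) (auto simp: v_def compose_def coface_def)
   next
    case (Suc l)
    then show ?thesis
     using i by (intro image_eqI[of _ _ l]) (auto simp: v_def compose_def coface_def)
   qed
  qed (use le in \<open>auto simp: v_def compose_def coface_def\<close>)
  ultimately show thesis
   using that(2)[OF _ cv True] by (simp add: onto_cells_def)
 next
  case False
  define w where "w = (\<lambda>i\<in>{..p}. c (Suc i) - 1)"
  have pos: "0 < c (Suc i)" if "i \<le> p" for i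
   using mono_onD[OF mono, of 1 "Suc i"] False that by simp
  have cw: "c = shift p w"
  proof
   fix i show "c i = shift p w i"
    using ext c0 pos by (cases i) (auto simp: w_def shift_def extensional_def)
  qed
  have "w i < k" "i \<le> j ==> j \<le> p ==> w i \<le> w j" if "i \<le> p" for i j
   using pos[OF that] le[of "Suc i"] mono_onD[OF mono, of "Suc i" "Suc j"] that by (auto simp: w_def)
  then have "w \<in> simplex k p"
   by (auto simp: simplex_def w_def mono_on_def)
  then show thesis
   using that(1)[OF shift_disk cw] subsetD[OF onto_disk assms] cw by simp
 qed
qed

locale augmented_cell_algebra = cell_algebra R T \<iota> \<kappa> F \<eta> C + canonical_augmentation R T F \<eta> C \<kappa> \<epsilon>
 for R :: "('r, 'z) ring_scheme" and T :: "'t lawvere" and \<iota> \<kappa>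
  and F :: "('r, (nat => nat) option => 'r) module => ('t, 'f) talg"
  and \<eta> :: "('r, (nat => nat) option => 'r) module => ((nat => nat) option => 'r) => 'f"
  and C :: "('i::wellorder, 't, 'a, 'f) cells" and \<epsilon>
begin

text \<open>The augmentation passes through the free algebra on the zero module, where a generator
  becomes the image of 0 under the unit, which is 0 by linearity.\<close>

lemma free_augmentation_gen:
 assumes "b \<in> basis D p"
 shows "free_augmentation R T \<kappa> F \<eta> (R.rchains D p) 1 (gen D p b) = \<zero>\<^bsub>U (represented T 0)\<^esub>"
proof -
 let ?M = "R.rchains D p" and ?T0 = "represented T 0"
 define Z where "Z = ?M\<lparr>carrier := {\<zero>\<^bsub>?M\<^esub>}\<rparr>"
 interpret M: module R ?M by (rule R.chains_module)
 have Z: "carrier Z = {\<zero>\<^bsub>?M\<^esub>}" "\<zero>\<^bsub>Z\<^esub> = \<zero>\<^bsub>?M\<^esub>" "add Z = add ?M" "smult Z = smult ?M"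
  by (simp_all add: Z_def)
 have ZM: "module R Z"
 proof (rule module.intro)
  show "abelian_group Z"
   by (rule abelian_groupI) (auto simp: Z M.r_zero)
 qed (unfold_locales, auto simp: Z M.r_zero M.smult_r_null)
 note T0 = T.represented_talgebra[of 0] and FZ = F_algebra[OF ZM]
 have \<eta>Z: "\<eta> Z \<zero>\<^bsub>?M\<^esub> = \<zero>\<^bsub>U (F Z)\<^esub>"
  using mod_hom_zero[OF FZ ZM unit[OF ZM]] by (simp add: Z)
 interpret FZ: module R "U (F Z)" by (rule underlying_module[OF FZ])
 interpret T0: module R "U ?T0" by (rule underlying_module[OF T0])
 define m where "m = free_map T F \<eta> ?M Z (\<lambda>_. \<zero>\<^bsub>?M\<^esub>)"
 define l where "l = free_lift T F \<eta> Z ?T0 (\<lambda>_. \<zero>\<^bsub>U ?T0\<^esub>)"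
 have c: "chain_unit R b \<in> carrier ?M"
  by (rule R.chain_unit_in[OF assms])
 have "restrict (\<lambda>_. \<eta> Z \<zero>\<^bsub>?M\<^esub>) (carrier ?M) \<in> mod_hom R ?M (U (F Z))"
  by (rule mod_homI) (use FZ.zero_closed in \<open>auto simp: \<eta>Z\<close>)
 from free_lift_props[OF M.module_axioms FZ, of "\<lambda>_ x. (undefined, [Inr x])", OF _ this]
 have m: "m 1 (gen D p b) = \<zero>\<^bsub>U (F Z)\<^esub>"
  using c by (simp add: m_def free_map_def gen_def \<eta>Z inj_on_def)
 have "restrict (\<lambda>_. \<zero>\<^bsub>U ?T0\<^esub>) (carrier Z) \<in> mod_hom R Z (U ?T0)"
  by (rule mod_homI) (use T0.zero_closed in \<open>auto simp: Z\<close>)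
 from free_lift_props(1)[OF ZM T0, of "\<lambda>_ x. (x, [])", OF _ this]
 have "l \<in> talg_hom T (F Z) ?T0"
  by (simp add: l_def inj_on_def)
 then have "l 1 \<zero>\<^bsub>U (F Z)\<^esub> = \<zero>\<^bsub>U ?T0\<^esub>"
  by (rule clone_hom_ops(3)[OF talg_hom_clone[OF FZ T0]])
 then show ?thesis
  using gen_in[OF assms] m by (simp add: free_augmentation_def talg_comp_apply Let_def flip: Z_def m_def l_def)
qed

lemma \<epsilon>_clone: "\<beta> \<le> Last C ==> \<epsilon> \<beta> p 1 \<in> clone_hom T (D\<^sub>p \<beta> p) (represented T 0)"
 using talg_hom_clone[OF salgebra.Deg[OF Stage] T.represented_talgebra, of \<beta> "\<epsilon> \<beta> p" p 0] salg_hom_level[OF aug_hom, of \<beta> p]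
 by (simp add: const_salg_def)

lemma \<epsilon>_Str:
 "\<beta> \<le> Last C ==> \<theta> \<in> delta p q ==> a \<in> Ob (D\<^sub>p \<beta> q) 1 ==> \<epsilon> \<beta> p 1 (Str (Stage C \<beta>) p q \<theta> 1 a) = \<epsilon> \<beta> q 1 a"
 using salg_hom_Str[OF aug_hom, of \<beta> \<theta> p q a 1] salg_hom_in[OF aug_hom, of \<beta> a q 1] by (simp add: const_salg_def)

lemma \<epsilon>_cell_gen:
 assumes \<beta>: "\<beta> \<le> Last C" and c: "c \<in> cells_below \<beta> p"
 shows "\<epsilon> \<beta> p 1 (cell_gen \<beta> p c) = \<zero>\<^bsub>U (represented T 0)\<^esub>"
proof -
 obtain \<gamma> w where w: "c = (\<gamma>, w)" "\<gamma> < \<beta>" "w \<in> disk_cells (Dim C \<gamma>) p"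
  using c by (auto simp: cells_below_def intro: subsetD[OF onto_disk])
 let ?k = "Dim C \<gamma>" and ?\<gamma> = "next_stage \<gamma>"
 have l: "?\<gamma> \<le> \<beta>" "\<gamma> < Last C"
  using next_stage(2)[OF w(2)] w(2) \<beta> by auto
 have b: "Some w \<in> basis (disk ?k) p"
  using w(3) by (simp add: disk_simps(3))
 note g = gen_disk_in[OF w(3)] and Ch = Chr_gen_in[OF w(2) \<beta> w(3)]
 have "\<epsilon> \<beta> p 1 (cell_gen \<beta> p c) = \<epsilon> ?\<gamma> p 1 (Chr C \<gamma> p 1 (gen (disk ?k) p (Some w)))"
  unfolding w(1) cell_gen_def prod.case by (rule salg_comp_eqD[OF aug_Trans[OF l(1) \<beta>] Ch])
 also have "\<dots> = free_augmentation R T \<kappa> F \<eta> (R.rchains (disk ?k) p) 1 (gen (disk ?k) p (Some w))"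
  by (rule salg_comp_eqD[OF aug_Chr[OF l(2)] g])
 finally show ?thesis
  by (simp add: free_augmentation_gen[OF b])
qed

abbreviation "X\<^sub>p p \<equiv> D\<^sub>p (Last C) p"
abbreviation "St p q \<theta> \<equiv> Str (Stage C (Last C)) p q \<theta> 1"
abbreviation "x p \<equiv> cell_gen (Last C) p"
abbreviation "J p \<equiv> cells_below (Last C) p"
abbreviation "s\<^sub>0 p \<equiv> St (Suc p) p (codegeneracy p 0)"
abbreviation "d\<^sub>0 p \<equiv> St p (Suc p) (coface p 0)"
abbreviation "PX p \<equiv> X\<^sub>p (Suc p)"
abbreviation "sd p a \<equiv> s\<^sub>0 p (d\<^sub>0 p a)"

sublocale A: salgebra T "Stage C (Last C)"
 by (rule Stage) simp

lemma U_cring: "cring (U (X\<^sub>p p))"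
 by (rule underlying_cring[OF A.Deg])

sublocale UA: cring "U (X\<^sub>p p)" for p
 by (rule U_cring)

lemma U_carrier: "carrier (U (X\<^sub>p p)) = Ob (X\<^sub>p p) 1"
 by (rule underlying_simps(1))

lemma x_in: "c \<in> J p ==> x p c \<in> Ob (X\<^sub>p p) 1"
 using cells_below_in[of "Last C" p] by auto

lemmas s_in = A.Str_in[OF codegeneracy_in[OF le0], where n = 1] and d_in = A.Str_in[OF coface_in[OF le0], where n = 1]
lemmas s_clone = A.Str_clone[OF codegeneracy_in[OF le0]]
 and d_clone = A.Str_clone[OF coface_in[OF le0]]

lemma sd_clone: "(\<lambda>a. sd p a) \<in> clone_hom T (PX p) (PX p)"
 by (rule clone_hom_comp[OF d_clone s_clone])

lemma d_s: "a \<in> Ob (X\<^sub>p p) 1 ==> d\<^sub>0 p (s\<^sub>0 p a) = a"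
proof -
 assume a: "a \<in> Ob (X\<^sub>p p) 1"
 have "compose {..p} (codegeneracy p 0) (coface p 0) = restrict id {..p}"
  by (auto simp: compose_def coface_def codegeneracy_def fun_eq_iff)
 then show "d\<^sub>0 p (s\<^sub>0 p a) = a"
  using A.Str_comp[OF coface_in[OF le0] codegeneracy_in[OF le0] a] A.Str_id[OF a] by simp
qed

lemma d_shift:
 assumes "\<theta> \<in> delta p q" "a \<in> Ob (PX q) 1"
 shows "d\<^sub>0 p (St (Suc p) (Suc q) (shift p \<theta>) a) = St p q \<theta> (d\<^sub>0 q a)"
 using A.Str_comp[OF assms(1) coface_in[OF le0] assms(2)] A.Str_comp[OF coface_in[OF le0] shift_in[OF assms(1)] assms(2)] coface_0_natural[OF assms(1)]
 by simp

text \<open>The generators \<open>(\<gamma>, \<eta>)\<close> of degree \<open>p + 1\<close> with \<open>\<eta> 1 = 0\<close> are the degeneracies \<open>s\<^sub>0\<close> of the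
 generators of degree \<open>p\<close>. The other ones are corrected, so that their face \<open>d\<^sub>0\<close> vanishes.\<close>

definition z :: "nat => 'i \<times> (nat => nat) => 'a" where
 "z p c = (if snd c 1 = 0 then x (Suc p) c else x (Suc p) c \<ominus>\<^bsub>U (PX p)\<^esub> sd p (x (Suc p) c))"

lemma degenerate_cell:
 assumes "(\<gamma>, v) \<in> J p"
 shows "(\<gamma>, degenerate p v) \<in> J (Suc p)"
  "x (Suc p) (\<gamma>, degenerate p v) = s\<^sub>0 p (x p (\<gamma>, v))"
proof -
 have v: "\<gamma> < Last C" "v \<in> onto_cells (Dim C \<gamma>) p"
  using assms by (auto simp: cells_below_def)
 note o = onto_codegeneracy(1)[OF v(2)]
 show "(\<gamma>, degenerate p v) \<in> J (Suc p)"
  using o v(1) by (simp add: cells_below_def)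
 show "x (Suc p) (\<gamma>, degenerate p v) = s\<^sub>0 p (x p (\<gamma>, v))"
  using Str_cell_gen[OF v(1) order_refl codegeneracy_in[of 0 p, OF le0] subsetD[OF onto_disk v(2)]] subsetD[OF onto_disk o] by simp
qed

text \<open>The image of s_0 is generated by the s_0 of generators, which are again generators
  \<open>c\<close>, with \<open>snd c 1 = 0\<close>.\<close>

lemma fixes_degenerate:
 assumes \<phi>: "\<phi> \<in> clone_hom T (PX p) (PX p)" "\<And>c. c \<in> J (Suc p) ==> snd c 1 = 0 ==> \<phi> (x (Suc p) c) = x (Suc p) c"
  and a: "a \<in> Ob (X\<^sub>p p) 1"
 shows "\<phi> (s\<^sub>0 p a) = s\<^sub>0 p a"
proof (rule clone_hom_eq_on_generated[OF clone_hom_comp[OF s_clone \<phi>(1)] s_clone cells_below_in[OF order_refl]])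
 show "a \<in> generated T (X\<^sub>p p) (J p) (x p)"
  using stage_generated[OF order_refl] a by blast
 fix c assume c: "c \<in> J p"
 obtain \<gamma> v where v: "c = (\<gamma>, v)" by (cases c)
 have "\<phi> (x (Suc p) (\<gamma>, degenerate p v)) = x (Suc p) (\<gamma>, degenerate p v)"
  using c onto_codegeneracy(2)[of v "Dim C \<gamma>" p] by (intro \<phi>(2) degenerate_cell(1)) (auto simp: v cells_below_def)
 then show "\<phi> (s\<^sub>0 p (x p c)) = s\<^sub>0 p (x p c)"
  using degenerate_cell(2)[of \<gamma> v p] c v by simp
qed

lemma sd_degenerate:
 assumes "c \<in> J (Suc p)" "snd c 1 = 0"
 shows "sd p (x (Suc p) c) = x (Suc p) c"
proof -
 obtain \<gamma> u where u: "c = (\<gamma>, u)" "\<gamma> < Last C" "u \<in> onto_cells (Dim C \<gamma>) (Suc p)"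
  using assms(1) by (auto simp: cells_below_def)
 from u(3) show ?thesis
 proof (cases rule: onto_cells_cases)
  case (1 w)
  then show ?thesis
   using assms(2) u by simp
 next
  case (2 v)
  have "(\<gamma>, v) \<in> J p"
   using u(2) 2 by (simp add: cells_below_def)
  then show ?thesis
   using degenerate_cell[of \<gamma> v p] d_s[OF x_in] u(1) 2 by simp
 qed
qed

lemma sd_x_in: "c \<in> J (Suc p) ==> sd p (x (Suc p) c) \<in> Ob (PX p) 1"
 by (rule s_in[OF d_in[OF x_in]])

text \<open>The change of generators subtracts s_0 d_0 x from some of the x. As s_0 d_0 x is an
  expression in degenerate generators, which the change fixes, adding it back is an inverse, and
  automorphisms preserve freeness.\<close>

lemma z_free: "free_on T (PX p) (J (Suc p)) (z p)"
proof -
 let ?B = "U (PX p)" and ?J = "J (Suc p)" and ?x = "x (Suc p)"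
 note free = stage_free[OF order_refl, of "Suc p"]
 have z: "z p ` ?J \<subseteq> Ob (PX p) 1"
  using x_in sd_x_in UA.minus_closed[of _ "Suc p"] by (auto simp: z_def U_carrier)
 define z' where "z' c = (if snd c 1 = 0 then ?x c else ?x c \<oplus>\<^bsub>?B\<^esub> sd p (?x c))" for c
 have z': "z' ` ?J \<subseteq> Ob (PX p) 1"
  using x_in sd_x_in UA.add.m_closed[of _ "Suc p"] by (auto simp: z'_def U_carrier)
 obtain \<alpha> where \<alpha>: "\<alpha> \<in> clone_hom T (PX p) (PX p)" "\<And>c. c \<in> ?J ==> \<alpha> (?x c) = z p c"
  using free_on_extend[OF A.Deg A.Deg free z] by blast
 obtain \<beta> where \<beta>: "\<beta> \<in> clone_hom T (PX p) (PX p)" "\<And>c. c \<in> ?J ==> \<beta> (?x c) = z' c"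
  using free_on_extend[OF A.Deg A.Deg free z'] by blast
 have \<alpha>s: "\<alpha> (s\<^sub>0 p a) = s\<^sub>0 p a" and \<beta>s: "\<beta> (s\<^sub>0 p a) = s\<^sub>0 p a" if "a \<in> Ob (X\<^sub>p p) 1" for a
  using fixes_degenerate[OF \<alpha>(1) _ that] fixes_degenerate[OF \<beta>(1) _ that] \<alpha>(2) \<beta>(2) by (simp_all add: z_def z'_def)
 have c: "\<beta> (\<alpha> (?x c)) = ?x c" "\<alpha> (\<beta> (?x c)) = ?x c" if "c \<in> ?J" for c
 proof -
  note i = x_in[OF that] sd_x_in[OF that] d_in[OF x_in[OF that]]
  have "\<beta> (\<alpha> (?x c)) = ?x c \<and> \<alpha> (\<beta> (?x c)) = ?x c" if "snd c 1 \<noteq> 0"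
  proof -
   have "\<beta> (\<alpha> (?x c)) = (?x c \<oplus>\<^bsub>?B\<^esub> sd p (?x c)) \<ominus>\<^bsub>?B\<^esub> sd p (?x c)"
    using \<alpha>(2)[OF \<open>c \<in> ?J\<close>] \<beta>(2)[OF \<open>c \<in> ?J\<close>] that clone_hom_minus(2)[OF A.Deg A.Deg \<beta>(1) i(1,2)] \<beta>s[OF i(3)] by (simp add: z_def z'_def)
   moreover have "\<alpha> (\<beta> (?x c)) = (?x c \<ominus>\<^bsub>?B\<^esub> sd p (?x c)) \<oplus>\<^bsub>?B\<^esub> sd p (?x c)"
    using \<alpha>(2)[OF \<open>c \<in> ?J\<close>] \<beta>(2)[OF \<open>c \<in> ?J\<close>] that clone_hom_ops(1)[OF \<alpha>(1) i(1,2)] \<alpha>s[OF i(3)] by (simp add: z_def z'_def)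
   ultimately show ?thesis
    using i(1,2)[folded U_carrier] by (simp add: a_minus_def UA.a_assoc UA.r_neg UA.l_neg)
  qed
  then show "\<beta> (\<alpha> (?x c)) = ?x c" "\<alpha> (\<beta> (?x c)) = ?x c"
   using \<alpha>(2)[OF that] \<beta>(2)[OF that] by (cases "snd c 1 = 0"; simp add: z_def z'_def)+
 qed
 show ?thesis
 proof (rule free_on_automorphism[OF A.Deg free \<alpha> \<beta>(1)])
  fix a assume "a \<in> Ob (PX p) 1"
  then have a: "a \<in> generated T (PX p) ?J ?x"
   using stage_generated[OF order_refl] by blast
  show "\<beta> (\<alpha> a) = a" "\<alpha> (\<beta> a) = a"
   by (rule clone_hom_eq_on_generated[OF clone_hom_comp[OF \<alpha>(1) \<beta>(1)] clone_hom_id cells_below_in[OF order_refl] c(1) a],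
     assumption)
    (rule clone_hom_eq_on_generated[OF clone_hom_comp[OF \<beta>(1) \<alpha>(1)] clone_hom_id cells_below_in[OF order_refl] c(2) a])
 qed
qed

text \<open>The variables in degree \<open>p\<close> of the decalage are indexed by sphere simplices
  of degree \<open>p\<close>; \<open>sh\<close> turns these into indices of generators in degree
  \<open>Suc p\<close>.\<close>

definition bdry :: "nat => 'i => ('i \<times> (nat => nat)) set" where
 "bdry p \<beta> = {(\<gamma>, w). \<gamma> < \<beta> \<and> w \<in> sphere_cells (Dim C \<gamma>) p}"

definition sh :: "nat => 'i \<times> (nat => nat) => 'i \<times> (nat => nat)" where
 "sh p = (\<lambda>(\<gamma>, w). (\<gamma>, shift p w))"

text \<open>The choice is harmless, because a homomorphism is determined on the algebra by its
  values at the free generators \<open>z p\<close>. Degenerate generators are never in the image of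
  \<open>sh\<close>, so they are fixed for every \<open>S\<close>.\<close>

definition e :: "nat => ('i \<times> (nat => nat)) set => 'a => 'a" where
 "e p S = (SOME \<phi>. \<phi> \<in> clone_hom T (PX p) (PX p) \<and>
   (\<forall>c\<in>J (Suc p). \<phi> (z p c) = (if c \<in> sh p ` S then \<zero>\<^bsub>U (PX p)\<^esub> else z p c)))"

lemma e: "e p S \<in> clone_hom T (PX p) (PX p)"
 and e_z: "c \<in> J (Suc p) ==> e p S (z p c) = (if c \<in> sh p ` S then \<zero>\<^bsub>U (PX p)\<^esub> else z p c)"
proof -
 have "(\<lambda>c. if c \<in> sh p ` S then \<zero>\<^bsub>U (PX p)\<^esub> else z p c) ` J (Suc p) \<subseteq> Ob (PX p) 1"
  using free_onD(3)[OF z_free] underlying_zero_in[OF A.Deg] by auto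
 then have "\<exists>\<phi>. \<phi> \<in> clone_hom T (PX p) (PX p) \<and>
   (\<forall>c\<in>J (Suc p). \<phi> (z p c) = (if c \<in> sh p ` S then \<zero>\<^bsub>U (PX p)\<^esub> else z p c))"
  using free_on_extend[OF A.Deg A.Deg z_free] by blast
 note * = someI_ex[OF this, folded e_def]
 show "e p S \<in> clone_hom T (PX p) (PX p)"
  "c \<in> J (Suc p) ==> e p S (z p c) = (if c \<in> sh p ` S then \<zero>\<^bsub>U (PX p)\<^esub> else z p c)"
  using * by blast+
qed

lemma e_eqI:
 assumes "\<phi> \<in> clone_hom T (PX p) B" "\<psi> \<in> clone_hom T (PX p) B"
  and "\<And>c. c \<in> J (Suc p) ==> \<phi> (z p c) = \<psi> (z p c)" "f \<in> Ob (PX p) 1"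
 shows "\<phi> f = \<psi> f"
 by (rule clone_hom_eq_on_generated[OF assms(1,2) free_onD(1)[OF z_free] assms(3) free_onD(2)[OF z_free assms(4)]])

lemma sh_J: "c \<in> bdry p \<beta> ==> \<beta> \<le> Last C ==> sh p c \<in> J (Suc p)"
 by (auto simp: bdry_def sh_def cells_below_def shift_onto)

lemma sh_inj: "c \<in> bdry p \<beta> ==> c' \<in> bdry p \<gamma> ==> sh p c = sh p c' ==> c = c'"
 using shift_inj sphere_cells_simplex by (fastforce simp: bdry_def sh_def)

lemma sh_1: "snd (sh p c) 1 \<noteq> 0"
 by (cases c) (simp add: sh_def)

lemma sh_degenerate: "snd c 1 = 0 ==> c \<notin> sh p ` S"
 using sh_1 by (metis imageE)

lemma sh_image: "c \<in> bdry p (Last C) ==> S \<subseteq> bdry p (Last C) ==> sh p c \<in> sh p ` S \<longleftrightarrow> c \<in> S"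
 using sh_inj by blast

lemma e_s: "a \<in> Ob (X\<^sub>p p) 1 ==> e p S (s\<^sub>0 p a) = s\<^sub>0 p a"
proof (rule fixes_degenerate[OF e])
 fix c assume c: "c \<in> J (Suc p)" "snd c 1 = 0"
 then show "e p S (x (Suc p) c) = x (Suc p) c"
  using e_z[OF c(1), of S] sh_degenerate by (simp add: z_def)
qed

lemma x_z:
 assumes "c \<in> J (Suc p)" "snd c 1 \<noteq> 0"
 shows "x (Suc p) c = z p c \<oplus>\<^bsub>U (PX p)\<^esub> sd p (x (Suc p) c)"
 using x_in[OF assms(1), folded U_carrier] sd_x_in[OF assms(1), folded U_carrier] assms(2)
 by (simp add: z_def a_minus_def UA.a_assoc UA.l_neg)

lemma e_x:
 assumes "c \<in> J (Suc p)"
 shows "e p S (x (Suc p) c) = (if c \<in> sh p ` S then sd p (x (Suc p) c) else x (Suc p) c)"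
proof (cases "snd c 1 = 0")
 case True
 then show ?thesis
  using e_z[OF assms, of S] sh_degenerate by (simp add: z_def)
next
 case False
 note zi = free_onD(3)[OF z_free assms]
 have "e p S (x (Suc p) c) = e p S (z p c) \<oplus>\<^bsub>U (PX p)\<^esub> sd p (x (Suc p) c)"
  by (subst x_z[OF assms False]) (simp add: clone_hom_ops(1)[OF e zi sd_x_in[OF assms]] e_s d_in x_in assms)
 then show ?thesis
  using e_z[OF assms, of S] x_z[OF assms False, symmetric] UA.l_zero[OF sd_x_in[OF assms, folded U_carrier]] by auto
qed

text \<open>On the generators of cells before \<open>\<beta>\<close> both maps fix the degenerate
  ones, and killing the corrected part of a shifted one leaves s_0 d_0 of it. For the last stage
  this becomes the axiom \<open>e_all\<close>; for the stage at which a cell is attached it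
  evaluates the killing of earlier variables on the boundary.\<close>

lemma e_stage:
 assumes \<beta>: "\<beta> \<le> Last C" and f: "f \<in> generated T (PX p) (cells_below \<beta> (Suc p)) (x (Suc p))"
 shows "e p (bdry p \<beta>) f = sd p f"
proof (rule clone_hom_eq_on_generated[OF e sd_clone _ _ f])
 show "x (Suc p) ` cells_below \<beta> (Suc p) \<subseteq> Ob (PX p) 1"
  using cells_below_mono[OF \<beta>] x_in by blast
 fix c assume c: "c \<in> cells_below \<beta> (Suc p)"
 then have cJ: "c \<in> J (Suc p)"
  using cells_below_mono[OF \<beta>] by blast
 obtain \<gamma> u where u: "c = (\<gamma>, u)" "\<gamma> < \<beta>" "u \<in> onto_cells (Dim C \<gamma>) (Suc p)"
  using c by (auto simp: cells_below_def)
 from u(3) show "e p (bdry p \<beta>) (x (Suc p) c) = sd p (x (Suc p) c)"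
 proof (cases rule: onto_cells_cases)
  case (1 w)
  then have "c \<in> sh p ` bdry p \<beta>"
   using u by (intro image_eqI[of _ _ "(\<gamma>, w)"]) (simp_all add: sh_def bdry_def)
  then show ?thesis
   by (simp add: e_x[OF cJ])
 next
  case (2 v)
  then have "snd c 1 = 0"
   using u(1) by simp
  then show ?thesis
   by (simp add: e_x[OF cJ] sd_degenerate[OF cJ])
 qed
qed

abbreviation "I p \<equiv> augmentation_ideal R T \<kappa> (Stage C (Last C)) (\<epsilon> (Last C)) p"

lemma I_iff: "f \<in> I p \<longleftrightarrow> f \<in> Ob (X\<^sub>p p) 1 \<and> \<epsilon> (Last C) p 1 f = \<zero>\<^bsub>U (represented T 0)\<^esub>"
 by (auto simp: augmentation_ideal_def a_kernel_def' U_carrier)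

lemma \<epsilon>_z: "c \<in> J (Suc p) ==> \<epsilon> (Last C) (Suc p) 1 (z p c) = \<zero>\<^bsub>U (represented T 0)\<^esub>"
proof -
 assume c: "c \<in> J (Suc p)"
 interpret U0: cring "U (represented T 0)"
  by (rule underlying_cring[OF T.represented_talgebra])
 note i = x_in[OF c] sd_x_in[OF c]
 have "\<epsilon> (Last C) (Suc p) 1 (sd p (x (Suc p) c)) = \<zero>\<^bsub>U (represented T 0)\<^esub>"
  using \<epsilon>_Str[OF order_refl codegeneracy_in[OF le0] d_in[OF i(1)]] \<epsilon>_Str[OF order_refl coface_in[OF le0] i(1)] \<epsilon>_cell_gen[OF order_refl c]
  by simp
 then show ?thesis
  using \<epsilon>_cell_gen[OF order_refl c] clone_hom_minus(2)[OF A.Deg T.represented_talgebra \<epsilon>_clone[OF order_refl] i]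
  by (simp add: z_def a_minus_def)
qed

definition \<xi> :: "nat => 'i \<times> (nat => nat) => 'a" where
 "\<xi> p c = z p (sh p c)"

definition bdry_op :: "'i => nat => nat => (nat => nat) => (nat => nat) => (nat => nat) option" where
 "bdry_op \<gamma> p q \<theta> w = (if compose {..p} w \<theta> \<in> sphere_cells (Dim C \<gamma>) p then Some (compose {..p} w \<theta>) else None)"

lemma pointed_bdry: "pointed_family (\<lambda>p. sphere_cells (Dim C \<gamma>) p) (bdry_op \<gamma>)"
proof
 have "sphere_cells (Dim C \<gamma>) p \<subseteq> {..p} \<rightarrow>\<^sub>E {..<Dim C \<gamma>}" for p
  by (auto simp: sphere_cells_def simplex_def)
 then show "finite (sphere_cells (Dim C \<gamma>) p)" for p
  by (rule finite_subset) (simp add: finite_PiE)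
 show "bdry_op \<gamma> p p (restrict id {..p}) w = Some w" if "w \<in> sphere_cells (Dim C \<gamma>) p" for p w
  using that simplex_id[OF sphere_cells_simplex[OF that]] by (simp add: bdry_op_def)
 fix \<theta> p q \<psi> r w assume \<theta>: "\<theta> \<in> delta p q" and \<psi>: "\<psi> \<in> delta q r" and w: "w \<in> sphere_cells (Dim C \<gamma>) r"
 show "bdry_op \<gamma> p r (compose {..p} \<psi> \<theta>) w = Option.bind (bdry_op \<gamma> q r \<psi> w) (bdry_op \<gamma> p q \<theta>)"
  using sphere_cells_not_onto[OF simplex_comp[OF sphere_cells_simplex[OF w] \<psi>] _ \<theta>] by (auto simp: bdry_op_def delta_assoc[OF \<theta>])
qed (auto simp: bdry_op_def split: if_splits)

text \<open>The variable is y - s_0 d_0 y, and d_0 y is a boundary value that comes from the stage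
  \<open>\<gamma>\<close> through the attaching map. The operator keeps s_0 d_0 y within that stage,
  where killing the earlier variables acts as s_0 d_0. With \<open>b\<close> the image of y, what
  remains is b - s_0 d_0 b, and \<open>b\<close> is either the generator of the image simplex,
  untouched by the killing, or 0.\<close>

lemma e_opr_\<xi>:
 assumes \<gamma>: "\<gamma> < Last C" and w: "w \<in> sphere_cells (Dim C \<gamma>) q" and \<theta>: "\<theta> \<in> delta p q"
 shows "e p (bdry p \<gamma>) (St (Suc p) (Suc q) (shift p \<theta>) (\<xi> q (\<gamma>, w))) =
  (case bdry_op \<gamma> p q \<theta> w of None => \<zero>\<^bsub>U (PX p)\<^esub> | Some v => \<xi> p (\<gamma>, v))"
proof -
 let ?B = "U (PX p)" and ?k = "Dim C \<gamma>" and ?\<theta> = "St (Suc p) (Suc q) (shift p \<theta>)" and ?y = "x (Suc q) (\<gamma>, shift q w)"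
 note gl = less_imp_le[OF \<gamma>]
 note o = shift_onto[OF w] and ws = sphere_cells_simplex[OF w]
 have cJ: "(\<gamma>, shift q w) \<in> J (Suc q)"
  using o \<gamma> by (simp add: cells_below_def)
 note y = x_in[OF cJ] and sdy = sd_x_in[OF cJ] and dy = d_in[OF x_in[OF cJ]]
 note \<theta>c = A.Str_clone[OF shift_in[OF \<theta>]]
 define b where "b = ?\<theta> ?y"
 have b: "b \<in> Ob (PX p) 1" "sd p b \<in> Ob (PX p) 1"
  unfolding b_def using A.Str_in[OF shift_in[OF \<theta>] y] by (simp_all add: s_in d_in)
 have "d\<^sub>0 q ?y = x q (\<gamma>, compose {..q} Suc w)"
  using Str_cell_gen[OF \<gamma> order_refl coface_in[of 0 q, OF le0] subsetD[OF onto_disk o]] sphere_disk_cell[OF w] by (simp add: shift_coface_0)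
 also have "\<dots> = Trans C \<gamma> (Last C) q 1 (Att C \<gamma> q 1 (gen (sphere ?k) q (Some w)))"
  by (rule cell_gen_boundary(1)[OF \<gamma> order_refl w])
 finally obtain a where a: "a \<in> Ob (D\<^sub>p \<gamma> q) 1" "d\<^sub>0 q ?y = Trans C \<gamma> (Last C) q 1 a"
  using cell_gen_boundary(2)[OF \<gamma> order_refl w] by blast
 let ?St = "\<lambda>p q \<theta>. Str (Stage C \<gamma>) p q \<theta> 1"
 interpret D: salgebra T "Stage C \<gamma>" by (rule Stage[OF gl])
 note sa = D.Str_in[OF codegeneracy_in[of 0 q, OF le0] a(1)]
 define a' where "a' = ?St (Suc p) (Suc q) (shift p \<theta>) (?St (Suc q) q (codegeneracy q 0) a)"
 have a': "a' \<in> Ob (D\<^sub>p \<gamma> (Suc p)) 1"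
  unfolding a'_def by (rule D.Str_in[OF shift_in[OF \<theta>] sa])
 have eq: "?\<theta> (sd q ?y) = Trans C \<gamma> (Last C) (Suc p) 1 a'"
  unfolding a(2) a'_def salg_hom_Str[OF Trans_hom[OF gl order_refl] shift_in[OF \<theta>] sa]
   salg_hom_Str[OF Trans_hom[OF gl order_refl] codegeneracy_in[of 0 q, OF le0] a(1)] ..
 have "e p (bdry p \<gamma>) (?\<theta> (sd q ?y)) = sd p (?\<theta> (s\<^sub>0 q (d\<^sub>0 q ?y)))"
  unfolding eq by (rule e_stage[OF gl Trans_generated[OF gl order_refl subsetD[OF stage_generated[OF gl] a']]])
 also have "\<dots> = sd p b"
  using d_shift[OF \<theta> sdy] d_shift[OF \<theta> y] d_s[OF dy] by (simp add: b_def)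
 finally have e1: "e p (bdry p \<gamma>) (?\<theta> (sd q ?y)) = sd p b" .
 have "\<xi> q (\<gamma>, w) = ?y \<ominus>\<^bsub>U (PX q)\<^esub> sd q ?y"
  by (simp add: \<xi>_def sh_def z_def)
 then have e2: "e p (bdry p \<gamma>) (?\<theta> (\<xi> q (\<gamma>, w))) = e p (bdry p \<gamma>) b \<ominus>\<^bsub>?B\<^esub> sd p b"
  using clone_hom_minus(2)[OF A.Deg A.Deg \<theta>c y sdy] e1
   clone_hom_minus(2)[OF A.Deg A.Deg e b(1)[unfolded b_def] A.Str_in[OF shift_in[OF \<theta>] sdy]] by (simp add: b_def)
 have b_eq: "b = (if shift p (compose {..p} w \<theta>) \<in> disk_cells ?k (Suc p) then x (Suc p) (\<gamma>, shift p (compose {..p} w \<theta>)) else \<zero>\<^bsub>?B\<^esub>)"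
  unfolding b_def Str_cell_gen[OF \<gamma> order_refl shift_in[OF \<theta>] subsetD[OF onto_disk o]] shift_comp[OF \<theta>] ..
 show ?thesis
 proof (cases "compose {..p} w \<theta> \<in> sphere_cells ?k p")
  case True
  let ?v = "compose {..p} w \<theta>"
  have vY: "(\<gamma>, ?v) \<in> bdry p (Last C)"
   using True \<gamma> by (simp add: bdry_def)
  have "(\<gamma>, ?v) \<notin> bdry p \<gamma>" "bdry p \<gamma> \<subseteq> bdry p (Last C)"
   using \<gamma> by (auto simp: bdry_def)
  then have "sh p (\<gamma>, ?v) \<notin> sh p ` bdry p \<gamma>"
   using sh_image[OF vY] by blast
  moreover have bx: "b = x (Suc p) (sh p (\<gamma>, ?v))"
   using b_eq subsetD[OF onto_disk shift_onto[OF True]] by (simp add: sh_def)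
  ultimately have "e p (bdry p \<gamma>) b = b"
   using e_x[OF sh_J[OF vY order_refl]] by simp
  moreover have "\<xi> p (\<gamma>, ?v) = b \<ominus>\<^bsub>?B\<^esub> sd p b"
   unfolding bx \<xi>_def z_def using sh_1[of p "(\<gamma>, ?v)"] by (rule if_not_P)
  ultimately show ?thesis
   using True by (simp add: e2 bdry_op_def)
 next
  case False
  then have "b = \<zero>\<^bsub>?B\<^esub>"
   using b_eq shift_disk[OF simplex_comp[OF ws \<theta>]] by auto
  then show ?thesis
   using False clone_hom_ops(3)[OF e, of p "bdry p \<gamma>"] clone_hom_ops(3)[OF sd_clone, of p] by (simp add: e2 bdry_op_def a_minus_def UA.r_neg)
 qed
qed

theorem cell_ring:
 assumes "reduced R T \<kappa> (Stage C (Last C)) (\<epsilon> (Last C))"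
 shows "cell_ring (\<lambda>p. U (X\<^sub>p p)) St I (Last C) (\<lambda>\<gamma>. sphere_cells (Dim C \<gamma>)) bdry_op \<xi> e"
proof (rule cell_ring.intro, unfold bdry_def[symmetric])
 let ?L = "Last C"
 have eB: "e p S f \<in> Ob (PX p) 1" if "f \<in> Ob (PX p) 1" for p S f
  by (rule clone_hom_in[OF e that])
 show "ideal (I p) (U (X\<^sub>p p))" for p
 proof -
  interpret U0: cring "U (represented T 0)"
   by (rule underlying_cring[OF T.represented_talgebra])
  interpret h: ring_hom_ring "U (X\<^sub>p p)" "U (represented T 0)" "\<epsilon> (Last C) p 1"
   by (rule ring_hom_ringI2[OF UA.ring_axioms U0.ring_axioms clone_hom_ring_hom[OF \<epsilon>_clone[OF order_refl]]])
  show ?thesis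
   unfolding augmentation_ideal_def by (rule h.kernel_is_ideal)
 qed
 show "I 0 = {\<zero>\<^bsub>U (X\<^sub>p 0)\<^esub>}"
  using assms by (simp add: reduced_def)
 show "St p q \<theta> \<in> ring_hom (U (X\<^sub>p q)) (U (X\<^sub>p p))" if "\<theta> \<in> delta p q" for \<theta> p q
  by (rule clone_hom_ring_hom[OF A.Str_clone[OF that]])
 show "St p q \<theta> f \<in> I p" if "\<theta> \<in> delta p q" "f \<in> I q" for \<theta> p q f
  using that A.Str_in[OF that(1)] \<epsilon>_Str[OF order_refl that(1)] by (simp add: I_iff)
 show "pointed_family (sphere_cells (Dim C \<gamma>)) (bdry_op \<gamma>)" for \<gamma>
  using pointed_bdry .
 show "e p S \<in> ring_hom (U (PX p)) (U (PX p))" for p S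
  by (rule clone_hom_ring_hom[OF e])
 show "e p {} f = f" if "f \<in> carrier (U (PX p))" for p f
  by (rule e_eqI[OF e clone_hom_id]) (use that in \<open>auto simp: e_z U_carrier\<close>)
 show "e p S (e p S' f) = e p (S \<union> S') f" if "f \<in> carrier (U (PX p))" for p S S' f
  by (rule e_eqI[OF clone_hom_comp[OF e e] e]) (use that in \<open>auto simp: e_z U_carrier clone_hom_ops(3)[OF e]\<close>)
 show "e p S f \<in> I (Suc p)" if "f \<in> I (Suc p)" for p S f
 proof -
  have "\<epsilon> ?L (Suc p) 1 (e p S f) = \<epsilon> ?L (Suc p) 1 f"
   by (rule e_eqI[OF clone_hom_comp[OF e \<epsilon>_clone] \<epsilon>_clone])
    (use that in \<open>auto simp: I_iff e_z \<epsilon>_z clone_hom_ops(3)[OF \<epsilon>_clone[OF order_refl]]\<close>)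
  then show ?thesis
   using that eB by (simp add: I_iff)
 qed
 show "\<exists>D. finite D \<and> (\<forall>S. S \<subseteq> bdry p ?L \<longrightarrow> e p S f = e p (S \<inter> D) f)" if "f \<in> carrier (U (PX p))" for p f
 proof -
  have "f \<in> generated T (PX p) (J (Suc p)) (z p)"
   using free_onD(2)[OF z_free] that by (simp add: U_carrier)
  then obtain t js where js: "set js \<subseteq> J (Suc p)" and t: "t \<in> Hom T (length js) 1" "f = talg_op T (PX p) t (map (z p) js)"
   by (rule generatedE)
  have f: "f \<in> generated T (PX p) (set js) (z p)"
   unfolding t(2) by (rule generatedI[OF order_refl t(1)])
  \<comment> \<open>The variables that occur in one presentation of \<open>f\<close>; killing any
    others has no effect on it.\<close>
  define D where "D = {c \<in> bdry p ?L. sh p c \<in> set js}"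
  have "inj_on (sh p) D"
   using sh_inj by (fastforce simp: D_def intro!: inj_onI)
  then have "finite D"
   by (rule finite_imageD[rotated]) (rule finite_subset[of _ "set js"], auto simp: D_def)
  moreover have "e p S f = e p (S \<inter> D) f" if S: "S \<subseteq> bdry p ?L" for S
  proof (rule clone_hom_eq_on_generated[OF e e _ _ f])
   show "z p ` set js \<subseteq> Ob (PX p) 1"
    using js free_onD(1)[OF z_free] by blast
   fix c assume c: "c \<in> set js"
   then have "c \<in> sh p ` S \<longleftrightarrow> c \<in> sh p ` (S \<inter> D)"
    using S by (auto simp: D_def)
   then show "e p S (z p c) = e p (S \<inter> D) (z p c)"
    by (simp add: e_z[OF subsetD[OF js c]])
  qed
  ultimately show ?thesis by blast
 qed
 fix p c
 assume c: "c \<in> bdry p ?L"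
 note cJ = sh_J[OF c order_refl]
 show "\<xi> p c \<in> I (Suc p)"
  using free_onD(3)[OF z_free cJ] \<epsilon>_z[OF cJ] by (simp add: I_iff \<xi>_def)
 show "e p S (\<xi> p c) = (if c \<in> S then \<zero>\<^bsub>U (PX p)\<^esub> else \<xi> p c)" if "S \<subseteq> bdry p ?L" for S
  using e_z[OF cJ, of S] sh_image[OF c that] by (simp add: \<xi>_def)
 show "\<exists>g\<in>carrier (U (PX p)). f = e p {c} f \<oplus>\<^bsub>U (PX p)\<^esub> \<xi> p c \<otimes>\<^bsub>U (PX p)\<^esub> g"
  if "f \<in> carrier (U (PX p))" for f
  unfolding \<xi>_def U_carrier by (rule free_factor[OF A.Deg z_free cJ e]) (use that in \<open>simp_all add: e_z cJ U_carrier\<close>)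
 show "g = \<zero>\<^bsub>U (PX p)\<^esub>" if "g \<in> carrier (U (PX p))" "\<xi> p c \<otimes>\<^bsub>U (PX p)\<^esub> g = \<zero>\<^bsub>U (PX p)\<^esub>" for g
  by (rule free_regular[OF A.Deg z_free cJ]) (use that in \<open>simp_all add: \<xi>_def U_carrier\<close>)
next
 fix \<gamma> w q \<theta> p assume "\<gamma> < Last C" "w \<in> sphere_cells (Dim C \<gamma>) q" "\<theta> \<in> delta p q"
 then show "e p (bdry p \<gamma>) (St (Suc p) (Suc q) (shift p \<theta>) (\<xi> q (\<gamma>, w))) =
  (case bdry_op \<gamma> p q \<theta> w of None => \<zero>\<^bsub>U (PX p)\<^esub> | Some v => \<xi> p (\<gamma>, v))"
  by (rule e_opr_\<xi>)
next
 fix f p assume "f \<in> carrier (U (PX p))"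
 then show "e p (bdry p (Last C)) f = sd p f"
  using e_stage[OF order_refl] stage_generated[OF order_refl] by (simp add: U_carrier subset_iff)
qed (auto simp: U_carrier A.Str_id A.Str_comp UA.is_cring)

end

theorem theorem3p5:
  fixes R :: "('r, 'z) ring_scheme"
    and T :: "'t lawvere"
    and \<iota> :: "nat \<Rightarrow> nat \<Rightarrow> (nat multiset \<Rightarrow> int) list \<Rightarrow> 't"
    and \<kappa> :: "nat \<Rightarrow> nat \<Rightarrow> (nat multiset \<Rightarrow> 'r) list \<Rightarrow> 't"
    and F :: "('r, (nat \<Rightarrow> nat) option \<Rightarrow> 'r) module \<Rightarrow> ('t, 'f) talg"
    and \<eta> :: "('r, (nat \<Rightarrow> nat) option \<Rightarrow> 'r) module \<Rightarrow> ((nat \<Rightarrow> nat) option \<Rightarrow> 'r) \<Rightarrow> 'f"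
    and C :: "('i::wellorder, 't, 'a, 'f) cells"
    and \<epsilon> :: "'i \<Rightarrow> nat \<Rightarrow> nat \<Rightarrow> 'a \<Rightarrow> 't"
    and A :: "('t, 'a) salg"
    and r :: nat
  assumes "cring R"
    and "fermat_theory_over R T \<iota> \<kappa>"
    and "free_functor R T \<kappa> F \<eta>"
    and "cellular_structure R T F \<eta> C"
    and "A = cellular_object C"
    and "canonical_augmentation R T F \<eta> C \<kappa> \<epsilon>"
    and "reduced R T \<kappa> A (\<epsilon> (Last C))"
    and "r \<ge> 1"
  shows "connected_simplicial_abelian_group (r - 1)
           (augmentation_power R T \<kappa> A (\<epsilon> (Last C)) r)"
proof -
  interpret fermat_theory_over R T \<iota> \<kappa> by fact
  interpret free_chains R T \<kappa> F \<eta>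
    using assms(3) by (intro free_chains.intro free_theory.intro com_theory_axioms)
  interpret augmented_cell_algebra R T \<iota> \<kappa> F \<eta> C \<epsilon>
    using assms(4,6) by (intro augmented_cell_algebra.intro cell_algebra.intro fermat_theory_over_axioms free_chains_axioms)
  interpret P: cell_ring "\<lambda>p. U (X\<^sub>p p)" St I "Last C" "\<lambda>\<gamma>. sphere_cells (Dim C \<gamma>)" bdry_op \<xi> e bdry
    using assms(5,7) by (intro cell_ring) (simp, intro eq_reflection ext, simp add: bdry_def)
  have "augmentation_power R T \<kappa> A (\<epsilon> (Last C)) r = P.PI r"
    by (simp add: augmentation_power_def additive_sgroup_def assms(5) Let_def)
  \<comment> \<open>As \<open>r\<close> is positive it is the successor of \<open>r - 1\<close>,
    which matches the strict bound in \<open>acyclic_below\<close>.\<close>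
  moreover have "connected_simplicial_abelian_group (r - 1) (P.PI r)"
    using P.PI_acyclic[of r] assms(8) by (intro simplicial_abelian_group.connected_if_acyclic_below P.PI_simplicial) simp
  ultimately show ?thesis by simp
qed

end
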